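(* Let $\Gamma\curvearrowright(B\subseteq A,\tau)$ be a trace-preserving mixing extension. Let $\Lambda\curvearrowright^{\alpha}(D\subseteq C,\tau)$ be a trace-preserving extension for which there exists a $\ast$-isomorphism $\theta:A\rtimes\Gamma\to C\rtimes\Lambda$ satisfying $\theta(B\rtimes\Gamma)=D\rtimes\Lambda$ and $\theta(L(\Gamma))=L(\Lambda)$. Then $\Lambda\curvearrowright(D\subseteq C,\tau)$ is a mixing extension.
   Context: An extension $\Gamma\curvearrowright(B\subseteq A)$ is an inclusion $B\subseteq A$ of von Neumann algebras together with an action $\Gamma\curvearrowright^{\sigma}A$ of a countable discrete group leaving $B$ invariant. It is trace-preserving, denoted $\Gamma\curvearrowright(B\subseteq A,\tau)$, if $A$ is a finite von Neumann algebra and $\tau$ is a faithful normal trace on $A$ preserved by $\sigma$. A trace-preserving extension is mixing if for every $t,z\in A\ominus B$ one has $\lim_{\gamma\to\infty}\|E_B(t\sigma_\gamma(z))\|_2=0$, where $E_B:A\to B$ is the trace-preserving conditional expectation and $A\ominus B=\{a\in A: E_B(a)=0\}$. $L(\Gamma)\subseteq A\rtimes\Gamma$ is the von Neumann subalgebra generated by the canonical group unitaries. *)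

theory Defs
  imports "HOL-Analysis.Analysis"
begin

section \<open>Complex Hilbert spaces\<close>

text \<open>The inner product is linear in the first argument.\<close>

class complex_hilbert_space = banach +
  fixes scaleC :: "complex \<Rightarrow> 'a \<Rightarrow> 'a"  (infixr \<open>*\<^sub>C\<close> 75)
    and cinner :: "'a \<Rightarrow> 'a \<Rightarrow> complex"
  assumes scaleC_add_right: "c *\<^sub>C (x + y) = c *\<^sub>C x + c *\<^sub>C y"
    and scaleC_add_left: "(c + d) *\<^sub>C x = c *\<^sub>C x + d *\<^sub>C x"
    and scaleC_scaleC: "c *\<^sub>C d *\<^sub>C x = (c * d) *\<^sub>C x"
    and scaleC_of_real: "complex_of_real r *\<^sub>C x = r *\<^sub>R x"
    and cinner_commute: "cinner x y = cnj (cinner y x)"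
    and cinner_add_left: "cinner (x + y) z = cinner x z + cinner y z"
    and cinner_scaleC_left: "cinner (c *\<^sub>C x) y = c * cinner x y"
    and cinner_self: "cinner x x = complex_of_real ((norm x)\<^sup>2)"

instantiation complex :: complex_hilbert_space
begin

definition scaleC_complex :: "complex \<Rightarrow> complex \<Rightarrow> complex" where
  "scaleC_complex c x = c * x"

definition cinner_complex :: "complex \<Rightarrow> complex \<Rightarrow> complex" where
  "cinner_complex x y = x * cnj y"

instance
proof
  show "cinner x x = complex_of_real ((norm x)\<^sup>2)" for x :: complex
    by (simp only: cinner_complex_def complex_norm_square)
qed (simp_all add: scaleC_complex_def cinner_complex_def algebra_simps scaleR_conv_of_real)

end

lemma scaleC_one [simp]: "1 *\<^sub>C (x::'a::complex_hilbert_space) = x"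
  using scaleC_of_real[of 1 x] by simp

lemma cinner_add_right: "cinner x (y + z) = cinner x y + cinner (x::'a::complex_hilbert_space) z"
  by (metis cinner_add_left cinner_commute complex_cnj_add)

lemma cinner_scaleC_right: "cinner x (c *\<^sub>C y) = cnj c * cinner (x::'a::complex_hilbert_space) y"
  by (metis cinner_commute cinner_scaleC_left complex_cnj_mult)

lemma norm_scaleC: "norm (c *\<^sub>C (x::'a::complex_hilbert_space)) = cmod c * norm x"
proof -
  have "complex_of_real ((norm (c *\<^sub>C x))\<^sup>2) = c * cnj c * cinner x x"
    by (metis cinner_scaleC_left cinner_scaleC_right cinner_self mult.assoc)
  also have "\<dots> = complex_of_real ((cmod c * norm x)\<^sup>2)"
    by (simp add: cinner_self power_mult_distrib complex_norm_square[symmetric])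
  finally have "(norm (c *\<^sub>C x))\<^sup>2 = (cmod c * norm x)\<^sup>2"
    by (simp only: of_real_eq_iff)
  then show ?thesis
    by (simp add: power2_eq_iff_nonneg)
qed

lemma cinner_bound: "cmod (cinner x y) \<le> (norm (x::'a::complex_hilbert_space))\<^sup>2 + (norm y)\<^sup>2"
proof -
  define c where "c = (if cinner x y = 0 then 1 else cnj (cinner x y) / cmod (cinner x y))"
  have c1: "cmod c = 1"
    by (simp add: c_def norm_divide)
  have cc: "c * cinner x y = cmod (cinner x y)"
    using complex_norm_square[of "cinner x y"]
    by (auto simp: c_def power2_eq_square field_simps)
  let ?u = "c *\<^sub>C x" and ?v = "(-1) *\<^sub>C y"
  have "complex_of_real ((norm (?u + ?v))\<^sup>2)
      = cinner ?u ?u + cinner ?v ?v + cinner ?u ?v + cinner ?v ?u"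
    by (simp only: cinner_self[symmetric] cinner_add_left cinner_add_right ac_simps)
  moreover have "cinner ?u ?v = - cmod (cinner x y)"
    by (simp only: cinner_scaleC_left cinner_scaleC_right) (simp add: cc)
  moreover have "cinner ?v ?u = - cmod (cinner x y)"
    by (metis calculation(2) cinner_commute complex_cnj_complex_of_real)
  moreover have "cinner ?u ?u = (norm x)\<^sup>2" "cinner ?v ?v = (norm y)\<^sup>2"
    by (simp_all add: cinner_self norm_scaleC c1)
  ultimately have "complex_of_real ((norm (?u + ?v))\<^sup>2)
      = complex_of_real ((norm x)\<^sup>2 + (norm y)\<^sup>2 - 2 * cmod (cinner x y))"
    by simp
  then have "(norm (?u + ?v))\<^sup>2 = (norm x)\<^sup>2 + (norm y)\<^sup>2 - 2 * cmod (cinner x y)"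
    by (simp only: of_real_eq_iff)
  then have "2 * cmod (cinner x y) \<le> (norm x)\<^sup>2 + (norm y)\<^sup>2"
    by (smt (verit) zero_le_power2)
  then show ?thesis
    using norm_ge_zero[of "cinner x y"] by linarith
qed

section \<open>The Hilbert space of square-summable functions from \<open>\<Gamma>\<close> to \<open>H\<close>\<close>

text \<open>This is the Hilbert space tensor product of \<open>H\<close> with \<open>\<ell>\<^sup>2(\<Gamma>)\<close>.\<close>

typedef (overloaded) ('g, 'h::complex_hilbert_space) ell2 =
  "{f :: 'g \<Rightarrow> 'h. (\<lambda>g. (norm (f g))\<^sup>2) summable_on UNIV}"
  by (rule exI[of _ "\<lambda>_. 0"]) simp

setup_lifting type_definition_ell2

lemma ell2_iff_bound:
  fixes f :: "'g \<Rightarrow> 'h::complex_hilbert_space"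
  shows "(\<lambda>g. (norm (f g))\<^sup>2) summable_on UNIV
    \<longleftrightarrow> (\<exists>b. \<forall>F. finite F \<longrightarrow> L2_set (\<lambda>g. norm (f g)) F \<le> b)"
proof
  assume s: "(\<lambda>g. (norm (f g))\<^sup>2) summable_on UNIV"
  have "L2_set (\<lambda>g. norm (f g)) F \<le> sqrt (\<Sum>\<^sub>\<infinity>g. (norm (f g))\<^sup>2)" if "finite F" for F
    unfolding L2_set_def using that by (intro real_sqrt_le_mono finite_sum_le_infsum s) auto
  then show "\<exists>b. \<forall>F. finite F \<longrightarrow> L2_set (\<lambda>g. norm (f g)) F \<le> b" by blast
next
  assume "\<exists>b. \<forall>F. finite F \<longrightarrow> L2_set (\<lambda>g. norm (f g)) F \<le> b"
  then obtain b where b: "\<And>F. finite F \<Longrightarrow> L2_set (\<lambda>g. norm (f g)) F \<le> b" by blast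
  have "(\<Sum>g\<in>F. (norm (f g))\<^sup>2) \<le> b\<^sup>2" if "finite F" for F
    using b[OF that] unfolding L2_set_def by (simp add: sqrt_le_D)
  then show "(\<lambda>g. (norm (f g))\<^sup>2) summable_on UNIV"
    by (intro nonneg_bdd_above_summable_on) (auto intro!: bdd_aboveI[of _ "b\<^sup>2"])
qed

lemma L2_set_norm_add:
  fixes f h :: "'g \<Rightarrow> 'h::real_normed_vector"
  shows "L2_set (\<lambda>g. norm (f g + h g)) F \<le> L2_set (\<lambda>g. norm (f g)) F + L2_set (\<lambda>g. norm (h g)) F"
proof -
  have "L2_set (\<lambda>g. norm (f g + h g)) F \<le> L2_set (\<lambda>g. norm (f g) + norm (h g)) F"
    by (intro L2_set_mono norm_triangle_ineq) auto
  also have "\<dots> \<le> L2_set (\<lambda>g. norm (f g)) F + L2_set (\<lambda>g. norm (h g)) F"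
    by (rule L2_set_triangle_ineq)
  finally show ?thesis .
qed

lemma ell2_add:
  fixes f h :: "'g \<Rightarrow> 'h::complex_hilbert_space"
  assumes "(\<lambda>g. (norm (f g))\<^sup>2) summable_on UNIV" "(\<lambda>g. (norm (h g))\<^sup>2) summable_on UNIV"
  shows "(\<lambda>g. (norm (f g + h g))\<^sup>2) summable_on UNIV"
proof -
  obtain a b where "\<And>F. finite F \<Longrightarrow> L2_set (\<lambda>g. norm (f g)) F \<le> a"
    and "\<And>F. finite F \<Longrightarrow> L2_set (\<lambda>g. norm (h g)) F \<le> b"
    using assms unfolding ell2_iff_bound by metis
  then have "L2_set (\<lambda>g. norm (f g + h g)) F \<le> a + b" if "finite F" for F
    using L2_set_norm_add[of f h F] that by (smt (verit))
  then show ?thesis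
    unfolding ell2_iff_bound by blast
qed

lemma ell2_scaleC:
  fixes f :: "'g \<Rightarrow> 'h::complex_hilbert_space"
  assumes "(\<lambda>g. (norm (f g))\<^sup>2) summable_on UNIV"
  shows "(\<lambda>g. (norm (c *\<^sub>C f g))\<^sup>2) summable_on UNIV"
  using summable_on_cmult_right[OF assms, of "(cmod c)\<^sup>2"]
  by (simp add: norm_scaleC power_mult_distrib)

instantiation ell2 :: (type, complex_hilbert_space) real_normed_vector
begin

lift_definition zero_ell2 :: "('a, 'b) ell2" is "\<lambda>_. 0" by simp

lift_definition plus_ell2 :: "('a, 'b) ell2 \<Rightarrow> ('a, 'b) ell2 \<Rightarrow> ('a, 'b) ell2"
  is "\<lambda>f h g. f g + h g" by (rule ell2_add)

lift_definition uminus_ell2 :: "('a, 'b) ell2 \<Rightarrow> ('a, 'b) ell2"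
  is "\<lambda>f g. - f g" by simp

lift_definition minus_ell2 :: "('a, 'b) ell2 \<Rightarrow> ('a, 'b) ell2 \<Rightarrow> ('a, 'b) ell2"
  is "\<lambda>f h g. f g - h g"
proof -
  fix f h :: "'a \<Rightarrow> 'b"
  assume "(\<lambda>g. (norm (f g))\<^sup>2) summable_on UNIV" "(\<lambda>g. (norm (h g))\<^sup>2) summable_on UNIV"
  then show "(\<lambda>g. (norm (f g - h g))\<^sup>2) summable_on UNIV"
    using ell2_add[of f "\<lambda>g. - h g"] by simp
qed

lift_definition scaleR_ell2 :: "real \<Rightarrow> ('a, 'b) ell2 \<Rightarrow> ('a, 'b) ell2"
  is "\<lambda>r f g. r *\<^sub>R f g"
  by (subst scaleC_of_real[symmetric]) (rule ell2_scaleC)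

lift_definition norm_ell2 :: "('a, 'b) ell2 \<Rightarrow> real"
  is "\<lambda>f. sqrt (\<Sum>\<^sub>\<infinity>g. (norm (f g))\<^sup>2)" .

definition sgn_ell2 :: "('a, 'b) ell2 \<Rightarrow> ('a, 'b) ell2" where
  "sgn_ell2 x = inverse (norm x) *\<^sub>R x"

definition dist_ell2 :: "('a, 'b) ell2 \<Rightarrow> ('a, 'b) ell2 \<Rightarrow> real" where
  "dist_ell2 x y = norm (x - y)"

definition uniformity_ell2 :: "(('a, 'b) ell2 \<times> ('a, 'b) ell2) filter" where
  "uniformity_ell2 = (INF e\<in>{0<..}. principal {(x, y). dist x y < e})"

definition open_ell2 :: "('a, 'b) ell2 set \<Rightarrow> bool" where
  "open_ell2 U \<longleftrightarrow> (\<forall>x\<in>U. \<forall>\<^sub>F (x', y) in uniformity. x' = x \<longrightarrow> y \<in> U)"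

lemma L2_set_le_norm_ell2:
  "finite F \<Longrightarrow> L2_set (\<lambda>g. norm (Rep_ell2 x g)) F \<le> norm (x :: ('a, 'b) ell2)"
  unfolding L2_set_def norm_ell2.rep_eq
  by (intro real_sqrt_le_mono finite_sum_le_infsum) (use Rep_ell2[of x] in auto)

lemma norm_ell2_le:
  assumes "\<And>F. finite F \<Longrightarrow> L2_set (\<lambda>g. norm (Rep_ell2 (x :: ('a, 'b) ell2) g)) F \<le> b"
  shows "norm x \<le> b"
proof -
  have b0: "0 \<le> b" using assms[of "{}"] by simp
  have "(\<Sum>\<^sub>\<infinity>g. (norm (Rep_ell2 x g))\<^sup>2) \<le> b\<^sup>2"
    using assms unfolding L2_set_def
    by (intro infsum_le_finite_sums) (use Rep_ell2[of x] in \<open>auto simp: sqrt_le_D\<close>)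
  then show ?thesis
    unfolding norm_ell2.rep_eq using b0 by (simp add: real_le_lsqrt infsum_nonneg)
qed

instance
proof
  fix x y z :: "('a, 'b) ell2" and r s :: real
  show "x + y + z = x + (y + z)" by transfer (simp add: add.assoc)
  show "x + y = y + x" by transfer (simp add: add.commute)
  show "0 + x = x" by transfer simp
  show "- x + x = 0" by transfer simp
  show "x - y = x + - y" by transfer simp
  show "r *\<^sub>R (x + y) = r *\<^sub>R x + r *\<^sub>R y" by transfer (simp add: scaleR_add_right)
  show "(r + s) *\<^sub>R x = r *\<^sub>R x + s *\<^sub>R x" by transfer (simp add: scaleR_add_left)
  show "r *\<^sub>R s *\<^sub>R x = (r * s) *\<^sub>R x" by transfer simp
  show "1 *\<^sub>R x = x" by transfer simp
  show "dist x y = norm (x - y)" by (rule dist_ell2_def)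
  show "sgn x = inverse (norm x) *\<^sub>R x" by (rule sgn_ell2_def)
  show "uniformity = (INF e\<in>{0<..}. principal {(x :: ('a, 'b) ell2, y). dist x y < e})"
    by (rule uniformity_ell2_def)
  show "open U \<longleftrightarrow> (\<forall>x\<in>U. \<forall>\<^sub>F (x', y) in uniformity. x' = x \<longrightarrow> y \<in> U)" for U :: "('a, 'b) ell2 set"
    by (rule open_ell2_def)
  show "norm x = 0 \<longleftrightarrow> x = 0"
  proof
    assume "norm x = 0"
    then have "(\<Sum>\<^sub>\<infinity>g. (norm (Rep_ell2 x g))\<^sup>2) = 0"
      by (simp add: norm_ell2.rep_eq)
    then have "(norm (Rep_ell2 x g))\<^sup>2 = 0" for g
      by (intro nonneg_infsum_le_0D[of "\<lambda>g. (norm (Rep_ell2 x g))\<^sup>2" UNIV])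
        (use Rep_ell2[of x] in auto)
    then show "x = 0"
      by (intro Rep_ell2_inject[THEN iffD1]) (simp add: zero_ell2.rep_eq fun_eq_iff)
  qed (simp add: norm_ell2.rep_eq zero_ell2.rep_eq)
  show "norm (x + y) \<le> norm x + norm y"
  proof (rule norm_ell2_le)
    fix F :: "'a set" assume "finite F"
    then show "L2_set (\<lambda>g. norm (Rep_ell2 (x + y) g)) F \<le> norm x + norm y"
      using L2_set_norm_add[of "Rep_ell2 x" "Rep_ell2 y" F]
        L2_set_le_norm_ell2[of F x] L2_set_le_norm_ell2[of F y]
      by (simp add: plus_ell2.rep_eq)
  qed
  show "norm (r *\<^sub>R x) = \<bar>r\<bar> * norm x"
    by transfer (simp add: power_mult_distrib infsum_cmult_right' real_sqrt_mult)
qed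

end

instantiation ell2 :: (type, complex_hilbert_space) complex_hilbert_space
begin

lift_definition scaleC_ell2 :: "complex \<Rightarrow> ('a, 'b) ell2 \<Rightarrow> ('a, 'b) ell2"
  is "\<lambda>c f g. c *\<^sub>C f g" by (rule ell2_scaleC)

lift_definition cinner_ell2 :: "('a, 'b) ell2 \<Rightarrow> ('a, 'b) ell2 \<Rightarrow> complex"
  is "\<lambda>f h. \<Sum>\<^sub>\<infinity>g. cinner (f g) (h g)" .

lemma summable_cinner_ell2:
  "(\<lambda>g. cinner (Rep_ell2 (x :: ('a, 'b) ell2) g) (Rep_ell2 y g)) summable_on UNIV"
proof -
  have "(\<lambda>g. (norm (Rep_ell2 x g))\<^sup>2 + (norm (Rep_ell2 y g))\<^sup>2) summable_on UNIV"
    using Rep_ell2[of x] Rep_ell2[of y] by (auto intro: summable_on_add)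
  then have "(\<lambda>g. cmod (cinner (Rep_ell2 x g) (Rep_ell2 y g))) summable_on UNIV"
    by (rule Infinite_Sum.abs_summable_on_comparison_test') (rule cinner_bound)
  then show ?thesis
    by (rule Infinite_Sum.abs_summable_summable)
qed

instance
proof
  fix x y z :: "('a, 'b) ell2" and r :: real and c d :: complex
  show "c *\<^sub>C (x + y) = c *\<^sub>C x + c *\<^sub>C y" by transfer (simp add: scaleC_add_right)
  show "(c + d) *\<^sub>C x = c *\<^sub>C x + d *\<^sub>C x" by transfer (simp add: scaleC_add_left)
  show "c *\<^sub>C d *\<^sub>C x = (c * d) *\<^sub>C x" by transfer (simp add: scaleC_scaleC)
  show "complex_of_real r *\<^sub>C x = r *\<^sub>R x" by transfer (simp add: scaleC_of_real)
  show "cinner x y = cnj (cinner y x)"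
    by transfer (subst infsum_cnj[symmetric], rule infsum_cong, rule cinner_commute)
  show "cinner (x + y) z = cinner x z + cinner y z"
    using summable_cinner_ell2[of x z] summable_cinner_ell2[of y z]
    by (simp add: cinner_ell2.rep_eq plus_ell2.rep_eq cinner_add_left infsum_add)
  show "cinner (c *\<^sub>C x) y = c * cinner x y"
    by transfer (simp add: cinner_scaleC_left infsum_cmult_right')
  show "cinner x x = complex_of_real ((norm x)\<^sup>2)"
  proof -
    have "((\<lambda>g. complex_of_real ((norm (Rep_ell2 x g))\<^sup>2)) has_sum
        complex_of_real (\<Sum>\<^sub>\<infinity>g. (norm (Rep_ell2 x g))\<^sup>2)) UNIV"
      using Rep_ell2[of x] by (intro has_sum_of_real has_sum_infsum) simp
    then show ?thesis
      by (simp add: cinner_ell2.rep_eq norm_ell2.rep_eq cinner_self infsum_nonneg infsumI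
          del: of_real_power)
  qed
next
  fix X :: "nat \<Rightarrow> ('a, 'b) ell2" assume X: "Cauchy X"
  have le: "norm (Rep_ell2 x g) \<le> norm x" for x :: "('a, 'b) ell2" and g
    using L2_set_le_norm_ell2[of "{g}" x] by simp
  have "Cauchy (\<lambda>n. Rep_ell2 (X n) g)" for g
  proof (rule CauchyI)
    fix e :: real assume "0 < e"
    then obtain N where N: "\<And>m n. m \<ge> N \<Longrightarrow> n \<ge> N \<Longrightarrow> dist (X m) (X n) < e"
      using X unfolding Cauchy_def by blast
    then show "\<exists>N. \<forall>m\<ge>N. \<forall>n\<ge>N. norm (Rep_ell2 (X m) g - Rep_ell2 (X n) g) < e"
      using le[of "X _ - X _" g]
      by (metis dist_ell2_def minus_ell2.rep_eq order_le_less_trans)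
  qed
  then have "\<exists>l. (\<lambda>n. Rep_ell2 (X n) g) \<longlonglongrightarrow> l" for g
    by (simp add: Cauchy_convergent_iff convergent_def)
  then obtain l where l: "\<And>g. (\<lambda>n. Rep_ell2 (X n) g) \<longlonglongrightarrow> l g" by metis
  have close: "\<exists>N. \<forall>m\<ge>N. \<forall>F. finite F \<longrightarrow> L2_set (\<lambda>g. norm (l g - Rep_ell2 (X m) g)) F \<le> e"
    if e: "0 < e" for e
  proof -
    obtain N where N: "\<And>m n. m \<ge> N \<Longrightarrow> n \<ge> N \<Longrightarrow> dist (X m) (X n) < e"
      using X e unfolding Cauchy_def by blast
    have "L2_set (\<lambda>g. norm (l g - Rep_ell2 (X m) g)) F \<le> e" if m: "m \<ge> N" and F: "finite F" for m F
    proof (rule tendsto_upperbound)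
      show "(\<lambda>n. L2_set (\<lambda>g. norm (Rep_ell2 (X n) g - Rep_ell2 (X m) g)) F)
          \<longlonglongrightarrow> L2_set (\<lambda>g. norm (l g - Rep_ell2 (X m) g)) F"
        unfolding L2_set_def by (intro tendsto_intros l)
      show "\<forall>\<^sub>F n in sequentially. L2_set (\<lambda>g. norm (Rep_ell2 (X n) g - Rep_ell2 (X m) g)) F \<le> e"
      proof (rule eventually_sequentiallyI[of N])
        fix n assume "N \<le> n"
        then have "norm (X n - X m) < e" using N m by (simp add: dist_ell2_def)
        then show "L2_set (\<lambda>g. norm (Rep_ell2 (X n) g - Rep_ell2 (X m) g)) F \<le> e"
          using L2_set_le_norm_ell2[OF F, of "X n - X m"] by (simp add: minus_ell2.rep_eq)
      qed
    qed simp
    then show ?thesis by blast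
  qed
  obtain N1 where N1: "\<And>F. finite F \<Longrightarrow> L2_set (\<lambda>g. norm (l g - Rep_ell2 (X N1) g)) F \<le> 1"
    using close[of 1] by auto
  then have "(\<lambda>g. (norm (l g - Rep_ell2 (X N1) g))\<^sup>2) summable_on UNIV"
    unfolding ell2_iff_bound by blast
  from ell2_add[OF this, of "Rep_ell2 (X N1)"] Rep_ell2[of "X N1"]
  have ls: "(\<lambda>g. (norm (l g))\<^sup>2) summable_on UNIV" by simp
  define L where "L = Abs_ell2 l"
  have L: "Rep_ell2 L = l" unfolding L_def using ls by (simp add: Abs_ell2_inverse)
  have "X \<longlonglongrightarrow> L"
    unfolding lim_sequentially
  proof (intro allI impI)
    fix e :: real assume "0 < e"
    then obtain N where N: "\<And>m F. m \<ge> N \<Longrightarrow> finite F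
        \<Longrightarrow> L2_set (\<lambda>g. norm (l g - Rep_ell2 (X m) g)) F \<le> e / 2"
      using close[of "e / 2"] by auto
    have "dist (X m) L < e" if "m \<ge> N" for m
    proof -
      have "L2_set (\<lambda>g. norm (Rep_ell2 (X m - L) g)) F \<le> e / 2" if "finite F" for F
        using N[OF \<open>m \<ge> N\<close> that] by (simp add: minus_ell2.rep_eq L norm_minus_commute)
      then have "norm (X m - L) \<le> e / 2" by (rule norm_ell2_le)
      then show ?thesis using \<open>0 < e\<close> by (simp add: dist_ell2_def)
    qed
    then show "\<exists>N. \<forall>m\<ge>N. dist (X m) L < e" by blast
  qed
  then show "convergent X" unfolding convergent_def by blast
qed

end

section \<open>Bounded operators and von Neumann algebras\<close>

text \<open>
  The library type of bounded linear maps consists of the real-linear ones; operators on \<open>H\<close> are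
  the elements of \<open>bounded_ops\<close>, and operator algebras are subsets of \<open>bounded_ops\<close>.
\<close>

type_synonym 'h op = "'h \<Rightarrow>\<^sub>L 'h"

definition bounded_ops :: "'h::complex_hilbert_space op set" where
  "bounded_ops = {T. \<forall>c x. blinfun_apply T (c *\<^sub>C x) = c *\<^sub>C blinfun_apply T x}"

lemma bounded_linear_scaleC: "bounded_linear (\<lambda>x::'h::complex_hilbert_space. c *\<^sub>C x)"
proof (rule bounded_linear_intro[of _ "cmod c"])
  show "c *\<^sub>C r *\<^sub>R x = r *\<^sub>R c *\<^sub>C x" for r and x :: 'h
    by (simp only: scaleC_of_real[symmetric] scaleC_scaleC mult.commute)
qed (simp_all add: scaleC_add_right norm_scaleC mult.commute)

lift_definition scale_op :: "complex \<Rightarrow> 'h op \<Rightarrow> 'h::complex_hilbert_space op"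
  is "\<lambda>c T x. c *\<^sub>C T x"
  by (rule bounded_linear_compose[OF bounded_linear_scaleC])

definition adj :: "'h::complex_hilbert_space op \<Rightarrow> 'h op" where
  "adj T = (THE S. S \<in> bounded_ops
     \<and> (\<forall>x y. cinner (blinfun_apply T x) y = cinner x (blinfun_apply S y)))"

definition positive_op :: "'h::complex_hilbert_space op \<Rightarrow> bool" where
  "positive_op T \<longleftrightarrow> T \<in> bounded_ops \<and> (\<forall>x. cinner (blinfun_apply T x) x \<in> \<real>\<^sub>\<ge>\<^sub>0)"

definition op_le :: "'h::complex_hilbert_space op \<Rightarrow> 'h op \<Rightarrow> bool" where
  "op_le S T \<longleftrightarrow> positive_op (T - S)"

definition commutant :: "'h::complex_hilbert_space op set \<Rightarrow> 'h op set" where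
  "commutant M = {T \<in> bounded_ops. \<forall>S\<in>M. T o\<^sub>L S = S o\<^sub>L T}"

definition von_neumann_algebra :: "'h::complex_hilbert_space op set \<Rightarrow> bool" where
  "von_neumann_algebra A \<longleftrightarrow>
     A \<subseteq> bounded_ops \<and> (\<forall>a\<in>A. adj a \<in> A) \<and> commutant (commutant A) = A"

definition finite_von_neumann_algebra :: "'h::complex_hilbert_space op set \<Rightarrow> bool" where
  "finite_von_neumann_algebra A \<longleftrightarrow> von_neumann_algebra A \<and>
     (\<forall>v\<in>A. adj v o\<^sub>L v = id_blinfun \<longrightarrow> v o\<^sub>L adj v = id_blinfun)"

definition star_isomorphism ::
  "'h::complex_hilbert_space op set \<Rightarrow> 'k::complex_hilbert_space op set \<Rightarrow> ('h op \<Rightarrow> 'k op) \<Rightarrow> bool"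
where
  "star_isomorphism M N \<theta> \<longleftrightarrow> bij_betw \<theta> M N
     \<and> (\<forall>x\<in>M. \<forall>y\<in>M. \<theta> (x + y) = \<theta> x + \<theta> y \<and> \<theta> (x o\<^sub>L y) = \<theta> x o\<^sub>L \<theta> y)
     \<and> (\<forall>c. \<forall>x\<in>M. \<theta> (scale_op c x) = scale_op c (\<theta> x))
     \<and> (\<forall>x\<in>M. \<theta> (adj x) = adj (\<theta> x))"

section \<open>Traces and conditional expectations\<close>

definition linear_functional_on ::
  "'h::complex_hilbert_space op set \<Rightarrow> ('h op \<Rightarrow> complex) \<Rightarrow> bool" where
  "linear_functional_on A \<phi> \<longleftrightarrow>
     (\<forall>x\<in>A. \<forall>y\<in>A. \<phi> (x + y) = \<phi> x + \<phi> y) \<and> (\<forall>c. \<forall>x\<in>A. \<phi> (scale_op c x) = c * \<phi> x)"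

text \<open>A positive functional on \<open>A\<close> is normal if it preserves the suprema of bounded upward directed
  families of positive elements.\<close>

definition normal_on :: "'h::complex_hilbert_space op set \<Rightarrow> ('h op \<Rightarrow> complex) \<Rightarrow> bool" where
  "normal_on A \<phi> \<longleftrightarrow>
     (\<forall>S s. S \<noteq> {} \<and> (\<forall>x\<in>S. x \<in> A \<and> positive_op x)
        \<and> (\<forall>x\<in>S. \<forall>y\<in>S. \<exists>z\<in>S. op_le x z \<and> op_le y z)
        \<and> s \<in> A \<and> (\<forall>x\<in>S. op_le x s) \<and> (\<forall>u\<in>A. (\<forall>x\<in>S. op_le x u) \<longrightarrow> op_le s u)
      \<longrightarrow> Re (\<phi> s) = (SUP x\<in>S. Re (\<phi> x)))"

text \<open>Traces are finite, but need not be normalised.\<close>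

definition faithful_normal_trace ::
  "'h::complex_hilbert_space op set \<Rightarrow> ('h op \<Rightarrow> complex) \<Rightarrow> bool" where
  "faithful_normal_trace A \<tau> \<longleftrightarrow> linear_functional_on A \<tau>
     \<and> (\<forall>x\<in>A. positive_op x \<longrightarrow> \<tau> x \<in> \<real>\<^sub>\<ge>\<^sub>0)
     \<and> (\<forall>x\<in>A. \<forall>y\<in>A. \<tau> (x o\<^sub>L y) = \<tau> (y o\<^sub>L x))
     \<and> (\<forall>x\<in>A. \<tau> (adj x o\<^sub>L x) = 0 \<longrightarrow> x = 0)
     \<and> normal_on A \<tau>"

definition norm2 :: "('h::complex_hilbert_space op \<Rightarrow> complex) \<Rightarrow> 'h op \<Rightarrow> real" where
  "norm2 \<tau> x = sqrt (Re (\<tau> (adj x o\<^sub>L x)))"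

definition trace_preserving_expectation ::
  "('h::complex_hilbert_space op \<Rightarrow> complex) \<Rightarrow> 'h op set \<Rightarrow> 'h op set \<Rightarrow> ('h op \<Rightarrow> 'h op) \<Rightarrow> bool"
where
  "trace_preserving_expectation \<tau> B A E \<longleftrightarrow>
     (\<forall>a\<in>A. E a \<in> B) \<and> (\<forall>b\<in>B. E b = b)
     \<and> (\<forall>x\<in>A. \<forall>y\<in>A. E (x + y) = E x + E y) \<and> (\<forall>c. \<forall>x\<in>A. E (scale_op c x) = scale_op c (E x))
     \<and> (\<forall>x\<in>A. positive_op x \<longrightarrow> positive_op (E x))
     \<and> (\<forall>x\<in>A. \<forall>b\<in>B. \<forall>b'\<in>B. E (b o\<^sub>L x o\<^sub>L b') = b o\<^sub>L E x o\<^sub>L b')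
     \<and> (\<forall>x\<in>A. \<tau> (E x) = \<tau> x)"

text \<open>For a faithful normal trace on \<open>A\<close> the expectation onto a von Neumann subalgebra \<open>B\<close> exists
  and is unique on \<open>A\<close>, so the choice only affects values outside \<open>A\<close>.\<close>

definition cond_exp_onto ::
  "('h::complex_hilbert_space op \<Rightarrow> complex) \<Rightarrow> 'h op set \<Rightarrow> 'h op set \<Rightarrow> 'h op \<Rightarrow> 'h op" where
  "cond_exp_onto \<tau> B A = (SOME E. trace_preserving_expectation \<tau> B A E)"

section \<open>Extensions\<close>

text \<open>A countable discrete group is a type of class \<open>{group_add, countable}\<close>; the group operation
  is written additively but is not assumed commutative.\<close>

definition group_action ::
  "('g::group_add \<Rightarrow> 'h::complex_hilbert_space op \<Rightarrow> 'h op) \<Rightarrow> 'h op set \<Rightarrow> bool" where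
  "group_action \<sigma> A \<longleftrightarrow> (\<forall>g. star_isomorphism A A (\<sigma> g))
     \<and> (\<forall>a\<in>A. \<sigma> 0 a = a) \<and> (\<forall>g h. \<forall>a\<in>A. \<sigma> (g + h) a = \<sigma> g (\<sigma> h a))"

definition extension ::
  "('g::{group_add,countable} \<Rightarrow> 'h::complex_hilbert_space op \<Rightarrow> 'h op) \<Rightarrow> 'h op set \<Rightarrow> 'h op set \<Rightarrow> bool"
where
  "extension \<sigma> B A \<longleftrightarrow> von_neumann_algebra A \<and> von_neumann_algebra B \<and> B \<subseteq> A
     \<and> group_action \<sigma> A \<and> (\<forall>g. \<sigma> g ` B = B)"

definition trace_preserving_extension ::
  "('g::{group_add,countable} \<Rightarrow> 'h::complex_hilbert_space op \<Rightarrow> 'h op) \<Rightarrow> 'h op set \<Rightarrow> 'h op set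
     \<Rightarrow> ('h op \<Rightarrow> complex) \<Rightarrow> bool"
where
  "trace_preserving_extension \<sigma> B A \<tau> \<longleftrightarrow> extension \<sigma> B A \<and> finite_von_neumann_algebra A
     \<and> faithful_normal_trace A \<tau> \<and> (\<forall>g. \<forall>a\<in>A. \<tau> (\<sigma> g a) = \<tau> a)"

definition orthocomplement_in ::
  "('h::complex_hilbert_space op \<Rightarrow> complex) \<Rightarrow> 'h op set \<Rightarrow> 'h op set \<Rightarrow> 'h op set" where
  "orthocomplement_in \<tau> A B = {a \<in> A. cond_exp_onto \<tau> B A a = 0}"

definition mixing_extension ::
  "('g::{group_add,countable} \<Rightarrow> 'h::complex_hilbert_space op \<Rightarrow> 'h op) \<Rightarrow> 'h op set \<Rightarrow> 'h op set
     \<Rightarrow> ('h op \<Rightarrow> complex) \<Rightarrow> bool"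
where
  "mixing_extension \<sigma> B A \<tau> \<longleftrightarrow> trace_preserving_extension \<sigma> B A \<tau>
     \<and> (\<forall>t \<in> orthocomplement_in \<tau> A B. \<forall>z \<in> orthocomplement_in \<tau> A B.
          ((\<lambda>g. norm2 \<tau> (cond_exp_onto \<tau> B A (t o\<^sub>L \<sigma> g z))) \<longlongrightarrow> 0) cofinite)"

section \<open>Crossed products\<close>

text \<open>On square-summable functions \<open>\<xi>\<close> from \<open>\<Gamma>\<close> to \<open>H\<close>, an element \<open>a\<close> of \<open>A\<close> acts by
  \<open>(\<pi>(a) \<xi>)(s) = \<sigma>\<^bsub>-s\<^esub>(a) \<xi>(s)\<close> and a group element \<open>g\<close> acts by
  \<open>(u\<^bsub>g\<^esub> \<xi>)(s) = \<xi>(-g + s)\<close>, so that \<open>u\<^bsub>g\<^esub> \<pi>(a) u\<^bsub>g\<^esub>\<^sup>* = \<pi>(\<sigma>\<^bsub>g\<^esub>(a))\<close>.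
  Both maps are bounded (the first one whenever \<open>\<sigma>\<close> acts by *-automorphisms of \<open>A\<close>), so the
  conversions into the types of operators and of square-summable functions are legitimate.\<close>

definition crossed_embed ::
  "('g::group_add \<Rightarrow> 'h::complex_hilbert_space op \<Rightarrow> 'h op) \<Rightarrow> 'h op \<Rightarrow> ('g, 'h) ell2 op" where
  "crossed_embed \<sigma> a =
     Blinfun (\<lambda>\<xi>. Abs_ell2 (\<lambda>s. blinfun_apply (\<sigma> (- s) a) (Rep_ell2 \<xi> s)))"

definition group_unitary :: "'g::group_add \<Rightarrow> ('g, 'h::complex_hilbert_space) ell2 op" where
  "group_unitary g = Blinfun (\<lambda>\<xi>. Abs_ell2 (\<lambda>s. Rep_ell2 \<xi> (- g + s)))"

text \<open>For an invariant \<open>B \<subseteq> A\<close>, \<open>crossed_product \<sigma> B\<close> is realised inside \<open>crossed_product \<sigma> A\<close>,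
  and so is \<open>group_vna\<close>.\<close>

definition crossed_product ::
  "('g::group_add \<Rightarrow> 'h::complex_hilbert_space op \<Rightarrow> 'h op) \<Rightarrow> 'h op set \<Rightarrow> ('g, 'h) ell2 op set"
where
  "crossed_product \<sigma> A = von_neumann_algebra hull (crossed_embed \<sigma> ` A \<union> range group_unitary)"

definition group_vna :: "('g::group_add, 'h::complex_hilbert_space) ell2 op set" where
  "group_vna = von_neumann_algebra hull (range group_unitary)"

end

theory Submission
  imports Defs
begin

text \<open>
  On \<open>M = A \<rtimes> \<Gamma>\<close> with the trace \<open>tr(x) = \<tau>(x\<^bsub>00\<^esub>)\<close> and \<open>N = B \<rtimes> \<Gamma>\<close>, the extension is mixing iff
  \<open>\<parallel>E\<^sub>N(x w\<^sub>i y)\<parallel>\<^sub>2 \<longlonglongrightarrow> 0\<close> for all \<open>x, y \<in> M\<close> with \<open>E\<^sub>N(x) = E\<^sub>N(y) = 0\<close> and all bounded weakly null families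
  \<open>w\<^sub>i \<in> L(\<Gamma>)\<close>; one direction is a computation with Fourier coefficients. This is applied to the images
  under \<open>\<theta>\<^sup>-\<^sup>1\<close> of the group unitaries of \<open>\<Lambda>\<close>.

  The isomorphism is not assumed to preserve the traces, and the condition \<open>E\<^sub>N(x) = 0\<close> depends on the trace. Let
  \<open>\<tau>\<^sub>1\<close> be the pullback to \<open>M\<close> of the trace of \<open>C \<rtimes> \<Lambda>\<close>. Both traces are faithful and normal, so they
  have the same bounded weakly null families. If \<open>\<tau>\<^sub>1(n x) = 0\<close> for \<open>n \<in> N\<close> and \<open>b\<^sub>i \<in> N\<close> is bounded, then
  \<open>\<tau>\<^sub>1(b\<^sub>i x w\<^sub>i y) = \<tau>\<^sub>1(b\<^sub>i x w\<^sub>i (y - E\<^sub>N(y))) = \<tau>\<^sub>1(x w\<^sub>i (y - E\<^sub>N(y)) b\<^sub>i)\<close>, and the family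
  \<open>x w\<^sub>i (y - E\<^sub>N(y)) b\<^sub>i\<close> is weakly null for \<open>tr\<close> by mixing, hence for \<open>\<tau>\<^sub>1\<close>.
\<close>

section \<open>Hilbert space preliminaries\<close>

text \<open>The Hilbert spaces are arbitrary: they need not be separable, and \<sigma> need not be
  implemented by unitaries. Traciality of \<open>tr\<close> rests on the relation
  \<sigma>_r(x_{s+r,t+r}) = x_{s,t} between matrix entries; it is tested against all operators V
  with V a = \<sigma>_r(a) V, which are shown to separate A. In place of separability there is the
  trace: it forces a separating sequence of vectors to exist, and on bounded sequences convergence
  in the trace norm then amounts to strong convergence.

  \<theta> is merely algebraic, but positive elements are squares, so \<theta> preserves order,
  hence suprema of directed families and normality.

  The two traces have different conditional expectations. The argument avoids an expectation for
  \<tau>_1 and works with scalars, whose smallness can be moved from one trace to the other: for t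
  with E_D(t) = 0 and d_l = E_D(t \<alpha>_l(z)), the elements b_l = \<theta>^{-1}(u_{-l} adj(d_l))
  satisfy \<tau>_1(b_l x w_l y) = ||d_l||_2^2, where x, y, w_l are the preimages of t, z,
  u_l.\<close>

lemma nonneg_quadratic_imp_cauchy_schwarz:
  fixes b :: complex and a d :: real
  assumes q: "\<And>c. 0 \<le> a + 2 * Re (c * b) + (cmod c)\<^sup>2 * d" and d: "0 \<le> d"
  shows "(cmod b)\<^sup>2 \<le> a * d"
proof -
  have bb: "Re (of_real t * cnj b * b) = t * (cmod b)\<^sup>2" for t
    unfolding cmod_power2 by (simp add: power2_eq_square algebra_simps)
  \<comment> \<open>Substituting c = - t * cnj b leaves a real quadratic in t. It is evaluated at
    its minimum t = 1/d or, when d = 0, at a value where the linear term exceeds a. The lemma speaks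
    of scalars because it serves vectors, positive forms and traces, and also turns minimal distance
    into orthogonality.\<close>
  have q': "0 \<le> a - 2 * t * (cmod b)\<^sup>2 + t\<^sup>2 * (cmod b)\<^sup>2 * d" for t
    using q[of "of_real (-t) * cnj b"] bb[of "-t"]
    by (simp add: norm_mult power_mult_distrib algebra_simps)
  show ?thesis
  proof (cases "d = 0")
    case True
    have "cmod b = 0"
    proof (rule ccontr)
      assume "cmod b \<noteq> 0"
      then show False
        using q'[of "(a + 1) / (2 * (cmod b)\<^sup>2)"] True by simp
    qed
    then show ?thesis using True by simp
  next
    case False
    then have "0 < d" using d by simp
    then show ?thesis
      using q'[of "1 / d"] by (simp add: field_simps power2_eq_square)
  qed
qed

lemma cinner_zero_left [simp]: "cinner 0 (y::'h::complex_hilbert_space) = 0"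
  using cinner_add_left[of 0 0 y] by simp

lemma cinner_zero_right [simp]: "cinner (y::'h::complex_hilbert_space) 0 = 0"
  using cinner_add_right[of y 0 0] by simp

lemma cinner_scaleR_left: "cinner (r *\<^sub>R (x::'h::complex_hilbert_space)) y = r *\<^sub>R cinner x y"
  using cinner_scaleC_left[of "of_real r" x y] by (simp add: scaleC_of_real scaleR_conv_of_real)

lemma cinner_scaleR_right: "cinner x (r *\<^sub>R (y::'h::complex_hilbert_space)) = r *\<^sub>R cinner x y"
  using cinner_scaleC_right[of x "of_real r" y] by (simp add: scaleC_of_real scaleR_conv_of_real)

lemma norm_add_sq:
  "(norm (x + (y::'h::complex_hilbert_space)))\<^sup>2 = (norm x)\<^sup>2 + (norm y)\<^sup>2 + 2 * Re (cinner x y)"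
proof -
  have "complex_of_real ((norm (x + y))\<^sup>2)
      = cinner x x + cinner y y + cinner x y + cnj (cinner x y)"
    by (simp only: cinner_self[symmetric] cinner_add_left cinner_add_right
        cinner_commute[of y x] ac_simps)
  then have "Re (complex_of_real ((norm (x + y))\<^sup>2)) = (norm x)\<^sup>2 + (norm y)\<^sup>2 + 2 * Re (cinner x y)"
    by (simp add: cinner_self)
  then show ?thesis by simp
qed

lemma cinner_cauchy_schwarz: "cmod (cinner x y) \<le> norm x * norm (y::'h::complex_hilbert_space)"
proof -
  have "(cmod (cinner x y))\<^sup>2 \<le> (norm y)\<^sup>2 * (norm x)\<^sup>2"
  proof (rule nonneg_quadratic_imp_cauchy_schwarz)
    fix c
    have "0 \<le> (norm (c *\<^sub>C x + y))\<^sup>2" by simp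
    then show "0 \<le> (norm y)\<^sup>2 + 2 * Re (c * cinner x y) + (cmod c)\<^sup>2 * (norm x)\<^sup>2"
      by (simp add: norm_add_sq norm_scaleC power_mult_distrib cinner_scaleC_left)
  qed simp
  then have "(cmod (cinner x y))\<^sup>2 \<le> (norm x * norm y)\<^sup>2"
    by (simp add: power_mult_distrib mult.commute)
  then show ?thesis by (simp add: power2_le_iff_abs_le)
qed

lemma bounded_bilinear_cinner:
  "bounded_bilinear (cinner :: 'h::complex_hilbert_space \<Rightarrow> 'h \<Rightarrow> complex)"
proof
  show "\<exists>K. \<forall>a b. norm (cinner a (b::'h)) \<le> norm a * norm b * K"
    by (intro exI[of _ 1]) (simp add: cinner_cauchy_schwarz)
qed (simp_all add: cinner_add_left cinner_add_right cinner_scaleR_left cinner_scaleR_right)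

interpretation cinner: bounded_bilinear "cinner :: 'h::complex_hilbert_space \<Rightarrow> 'h \<Rightarrow> complex"
  by (rule bounded_bilinear_cinner)

lemma scaleC_scaleR_commute: "c *\<^sub>C r *\<^sub>R (x::'h::complex_hilbert_space) = r *\<^sub>R c *\<^sub>C x"
  by (simp only: scaleC_of_real[symmetric] scaleC_scaleC mult.commute)

lemma bounded_bilinear_scaleC:
  "bounded_bilinear (scaleC :: complex \<Rightarrow> 'h::complex_hilbert_space \<Rightarrow> 'h)"
proof
  show "\<exists>K. \<forall>a b. norm (a *\<^sub>C (b::'h)) \<le> norm a * norm b * K"
    by (intro exI[of _ 1]) (simp add: norm_scaleC)
  show "(r *\<^sub>R a) *\<^sub>C b = r *\<^sub>R (a *\<^sub>C b)" for r a and b :: 'h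
    by (simp add: scaleR_conv_of_real scaleC_scaleC[symmetric] scaleC_of_real)
qed (simp_all add: scaleC_add_left scaleC_add_right scaleC_scaleR_commute)

interpretation scaleC: bounded_bilinear "scaleC :: complex \<Rightarrow> 'h::complex_hilbert_space \<Rightarrow> 'h"
  by (rule bounded_bilinear_scaleC)

lemma cinner_ext: "(\<And>z. cinner x z = cinner y z) \<Longrightarrow> x = (y::'h::complex_hilbert_space)"
proof -
  assume "\<And>z. cinner x z = cinner y z"
  then have "cinner (x - y) (x - y) = 0" by (simp add: cinner.diff_left)
  then show ?thesis by (simp add: cinner_self)
qed

lemma Re_cinner_self: "Re (cinner x x) = (norm (x::'h::complex_hilbert_space))\<^sup>2"
  by (simp add: cinner_self)

lemma parallelogram:
  "(norm (x + y))\<^sup>2 + (norm (x - y))\<^sup>2 = 2 * (norm x)\<^sup>2 + 2 * (norm (y::'h::complex_hilbert_space))\<^sup>2"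
  using norm_add_sq[of x y] norm_add_sq[of x "-y"] by (simp add: cinner.minus_right)

section \<open>Orthogonal decomposition and the Riesz representation\<close>

definition csubspace :: "'h::complex_hilbert_space set \<Rightarrow> bool" where
  "csubspace S \<longleftrightarrow> 0 \<in> S \<and> (\<forall>x\<in>S. \<forall>y\<in>S. x + y \<in> S) \<and> (\<forall>c. \<forall>x\<in>S. c *\<^sub>C x \<in> S)"

text \<open>Midpoints of nearly minimising points are nearly minimising, so the parallelogram law makes
  minimising sequences Cauchy.\<close>

lemma minimising_sequence:
  fixes q :: "'v::real_vector \<Rightarrow> real"
  assumes S: "S \<noteq> {}" and mid: "\<And>x y. x \<in> S \<Longrightarrow> y \<in> S \<Longrightarrow> (1/2) *\<^sub>R (x + y) \<in> S"
    and q0: "\<And>x. 0 \<le> q x"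
    and par: "\<And>x y. x \<in> S \<Longrightarrow> y \<in> S \<Longrightarrow> 4 * q (a - (1/2) *\<^sub>R (x + y)) + q (x - y) = 2 * q (a - x) + 2 * q (a - y)"
  obtains X where "\<And>n. X n \<in> S" "\<And>n y. y \<in> S \<Longrightarrow> q (a - X n) \<le> q (a - y) + 1 / real (Suc n)"
    "\<And>m n. q (X m - X n) \<le> 2 / real (Suc m) + 2 / real (Suc n)"
proof -
  define d where "d = (INF x\<in>S. q (a - x))"
  have bdd: "bdd_below ((\<lambda>x. q (a - x)) ` S)" using q0 by (auto intro!: bdd_belowI[of _ 0])
  have le: "d \<le> q (a - x)" if "x \<in> S" for x
    unfolding d_def using bdd that by (rule cINF_lower)
  have "\<exists>x\<in>S. q (a - x) < d + 1 / real (Suc n)" for n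
  proof -
    have "d < d + 1 / real (Suc n)" by simp
    then show ?thesis unfolding d_def using cINF_less_iff[OF S bdd] by blast
  qed
  then obtain X where X: "\<And>n. X n \<in> S" "\<And>n. q (a - X n) < d + 1 / real (Suc n)" by metis
  show thesis
  proof
    show "X n \<in> S" for n by (rule X)
    show "q (a - X n) \<le> q (a - y) + 1 / real (Suc n)" if "y \<in> S" for n y
      using X(2)[of n] le[OF that] by linarith
    show "q (X m - X n) \<le> 2 / real (Suc m) + 2 / real (Suc n)" for m n
      using par[OF X(1)[of m] X(1)[of n]] X(2)[of m] X(2)[of n] le[OF mid[OF X(1)[of m] X(1)[of n]]]
      by simp
  qed
qed

text \<open>For the nearest point y of S, the distance from x to y - c z is minimal at c = 0 for
  every z in S; a quadratic in c with vanishing constant term that stays nonnegative has no linear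
  term.\<close>

lemma orthogonal_decomposition:
  assumes S: "csubspace S" and cl: "closed S"
  shows "\<exists>y\<in>S. \<forall>z\<in>S. cinner (x - y) z = 0"
proof -
  have mid: "(1/2) *\<^sub>R (y + z) \<in> S" if "y \<in> S" "z \<in> S" for y z
    using S that unfolding csubspace_def by (metis scaleC_of_real)
  have par: "4 * (norm (x - (1/2) *\<^sub>R (y + z)))\<^sup>2 + (norm (y - z))\<^sup>2
      = 2 * (norm (x - y))\<^sup>2 + 2 * (norm (x - z))\<^sup>2" for y z
  proof -
    have "(x - y) + (x - z) = 2 *\<^sub>R (x - (1/2) *\<^sub>R (y + z))"
      by (simp add: algebra_simps scaleR_2)
    then have "(norm ((x - y) + (x - z)))\<^sup>2 = 4 * (norm (x - (1/2) *\<^sub>R (y + z)))\<^sup>2"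
      by (simp add: power_mult_distrib)
    then show ?thesis using parallelogram[of "x - y" "x - z"]
      by (simp add: norm_minus_commute)
  qed
  obtain X where X: "\<And>n. X n \<in> S"
      "\<And>n y. y \<in> S \<Longrightarrow> (norm (x - X n))\<^sup>2 \<le> (norm (x - y))\<^sup>2 + 1 / real (Suc n)"
      "\<And>m n. (norm (X m - X n))\<^sup>2 \<le> 2 / real (Suc m) + 2 / real (Suc n)"
    by (rule minimising_sequence[of S "\<lambda>v. (norm v)\<^sup>2" x])
      (use S mid par in \<open>auto simp: csubspace_def\<close>)
  have "Cauchy X"
  proof (rule CauchyI)
    fix e :: real assume e: "0 < e"
    obtain N where N: "4 / e\<^sup>2 < real N" using reals_Archimedean2 by blast
    have "norm (X m - X n) < e" if "N \<le> m" "N \<le> n" for m n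
    proof -
      have p: "0 < real N" using N e by (smt (verit) divide_pos_pos zero_less_power)
      have "2 / real (Suc m) \<le> 2 / real N" "2 / real (Suc n) \<le> 2 / real N"
        using that p by (auto intro!: divide_left_mono)
      then have "(norm (X m - X n))\<^sup>2 \<le> 4 / real N" using X(3)[of m n] by simp
      also have "\<dots> < e\<^sup>2" using N e p by (simp add: field_simps)
      finally show ?thesis using e by (simp add: power2_less_imp_less)
    qed
    then show "\<exists>M. \<forall>m\<ge>M. \<forall>n\<ge>M. norm (X m - X n) < e" by blast
  qed
  then obtain y where y: "X \<longlonglongrightarrow> y" using Cauchy_convergent convergent_def by blast
  have yS: "y \<in> S" using cl y X(1) closed_sequentially by blast
  have min: "(norm (x - y))\<^sup>2 \<le> (norm (x - z))\<^sup>2" if "z \<in> S" for z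
  proof (rule tendsto_le)
    show "(\<lambda>n. (norm (x - X n))\<^sup>2) \<longlonglongrightarrow> (norm (x - y))\<^sup>2" by (intro tendsto_intros y)
    have "(\<lambda>n. (norm (x - z))\<^sup>2 + 1 / real (Suc n)) \<longlonglongrightarrow> (norm (x - z))\<^sup>2 + 0"
      by (intro tendsto_intros LIMSEQ_Suc lim_const_over_n)
    then show "(\<lambda>n. (norm (x - z))\<^sup>2 + 1 / real (Suc n)) \<longlonglongrightarrow> (norm (x - z))\<^sup>2" by simp
  qed (use X(2)[OF that] in auto)
  have "cinner (x - y) z = 0" if z: "z \<in> S" for z
  proof -
    have "(cmod (cinner z (x - y)))\<^sup>2 \<le> 0 * (norm z)\<^sup>2"
    proof (rule nonneg_quadratic_imp_cauchy_schwarz)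
      fix c
      have "y + (- c) *\<^sub>C z \<in> S" using S yS z unfolding csubspace_def by blast
      then have "(norm (x - y))\<^sup>2 \<le> (norm (c *\<^sub>C z + (x - y)))\<^sup>2"
        using min[of "y + (- c) *\<^sub>C z"] by (simp add: scaleC.minus_left algebra_simps)
      then show "0 \<le> 0 + 2 * Re (c * cinner z (x - y)) + (cmod c)\<^sup>2 * (norm z)\<^sup>2"
        by (simp only: norm_add_sq norm_scaleC power_mult_distrib cinner_scaleC_left)
    qed simp
    then have "cinner z (x - y) = 0" by simp
    then show ?thesis using cinner_commute[of "x - y" z] by simp
  qed
  then show ?thesis using yS by blast
qed

text \<open>Apart from the zero functional, a vector w orthogonal to the kernel determines f,
  because x - (f x / f w) w always lies in the kernel.\<close>

lemma riesz_representation: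
  fixes f :: "'h::complex_hilbert_space \<Rightarrow> complex"
  assumes add: "\<And>x y. f (x + y) = f x + f y" and sc: "\<And>c x. f (c *\<^sub>C x) = c * f x"
    and bd: "\<And>x. cmod (f x) \<le> norm x * K"
  shows "\<exists>z. \<forall>x. f x = cinner x z"
proof (cases "\<forall>x. f x = 0")
  case True
  then show ?thesis by (intro exI[of _ 0]) simp
next
  case False
  then obtain x0 where x0: "f x0 \<noteq> 0" by blast
  have f0: "f 0 = 0" using add[of 0 0] by simp
  have fdiff: "f (x - y) = f x - f y" for x y using add[of "x - y" y] by simp
  have "f (r *\<^sub>R x) = r *\<^sub>R f x" for r x
    using sc[of "of_real r" x] by (simp add: scaleC_of_real scaleR_conv_of_real)
  then have "bounded_linear f"
    by (intro bounded_linear_intro[of _ K]) (auto simp: add bd)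
  then have cont: "continuous_on UNIV f" by (rule linear_continuous_on)
  define S where "S = {x. f x = 0}"
  have "csubspace S" unfolding csubspace_def S_def by (simp add: add sc f0)
  moreover have "closed S"
    unfolding S_def by (rule closed_Collect_eq[OF cont continuous_on_const])
  ultimately obtain y where y: "y \<in> S" "\<And>z. z \<in> S \<Longrightarrow> cinner (x0 - y) z = 0"
    using orthogonal_decomposition by blast
  define w where "w = x0 - y"
  have fw: "f w = f x0" using y(1) by (simp add: w_def fdiff S_def)
  have w0: "w \<noteq> 0" using fw x0 f0 by auto
  define z where "z = (cnj (f w) / of_real ((norm w)\<^sup>2)) *\<^sub>C w"
  have "f x = cinner x z" for x
  proof -
    have "(x - (f x / f w) *\<^sub>C w) \<in> S" using fw x0 by (simp add: S_def fdiff sc)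
    from y(2)[OF this] have "cinner (x - (f x / f w) *\<^sub>C w) w = 0"
      using cinner_commute w_def by (metis complex_cnj_zero)
    then have "cinner x w = (f x / f w) * of_real ((norm w)\<^sup>2)"
      by (simp add: cinner.diff_left cinner_scaleC_left cinner_self)
    then show ?thesis
      unfolding z_def using w0 fw x0 by (simp add: cinner_scaleC_right)
  qed
  then show ?thesis by blast
qed

section \<open>Bounded operators\<close>

lemma norm_blinfun_le: "norm T \<le> K \<Longrightarrow> norm (blinfun_apply T x) \<le> K * norm x"
  using norm_blinfun[of T x] by (meson mult_right_mono norm_ge_zero order_trans)

lemma bounded_ops_scaleC: "T \<in> bounded_ops \<Longrightarrow> T (c *\<^sub>C x) = c *\<^sub>C T x"
  by (simp add: bounded_ops_def)

lemma bounded_ops_of_linear: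
  fixes f :: "'h::complex_hilbert_space \<Rightarrow> 'h"
  assumes "\<And>x y. f (x + y) = f x + f y" "\<And>c x. f (c *\<^sub>C x) = c *\<^sub>C f x"
    and "\<And>x. norm (f x) \<le> norm x * K"
  shows "Blinfun f \<in> bounded_ops" "blinfun_apply (Blinfun f) = f"
proof -
  have "f (r *\<^sub>R x) = r *\<^sub>R f x" for r x
    using assms(2)[of "of_real r" x] by (simp add: scaleC_of_real)
  then have "bounded_linear f"
    by (intro bounded_linear_intro[of _ K]) (auto simp: assms)
  then show "blinfun_apply (Blinfun f) = f" by (rule bounded_linear_Blinfun_apply)
  then show "Blinfun f \<in> bounded_ops" by (simp add: bounded_ops_def assms)
qed

lemma scale_op_apply [simp]: "scale_op c T x = c *\<^sub>C T x"
  by transfer simp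

lemma scale_op_of_real: "scale_op (of_real r) T = r *\<^sub>R T"
  by (rule blinfun_eqI) (simp add: scaleC_of_real scaleR_blinfun.rep_eq)

lemma bounded_ops_intros [intro, simp]:
  "id_blinfun \<in> bounded_ops" "0 \<in> bounded_ops"
  "S \<in> bounded_ops \<Longrightarrow> T \<in> bounded_ops \<Longrightarrow> S + T \<in> bounded_ops"
  "S \<in> bounded_ops \<Longrightarrow> T \<in> bounded_ops \<Longrightarrow> S - T \<in> bounded_ops"
  "S \<in> bounded_ops \<Longrightarrow> - S \<in> bounded_ops"
  "S \<in> bounded_ops \<Longrightarrow> T \<in> bounded_ops \<Longrightarrow> S o\<^sub>L T \<in> bounded_ops"
  "S \<in> bounded_ops \<Longrightarrow> scale_op c S \<in> bounded_ops"
  "S \<in> bounded_ops \<Longrightarrow> r *\<^sub>R S \<in> bounded_ops"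
  by (simp_all add: bounded_ops_def scaleC_add_right blinfun.bilinear_simps scaleC.diff_right
      scaleC.minus_right scaleC_scaleR_commute scaleC_scaleC mult.commute)

lemma op_eqI:
  assumes "\<And>x y. cinner (blinfun_apply S x) y = cinner (blinfun_apply T x) y"
  shows "S = (T::'h::complex_hilbert_space op)"
  by (rule blinfun_eqI) (rule cinner_ext, rule assms)

text \<open>The Riesz representation applied to the conjugate of B x, for each x. Adjoints and weak
  limits of operators are both obtained from it.\<close>

lemma sesquilinear_form_op:
  fixes B :: "'h::complex_hilbert_space \<Rightarrow> 'h \<Rightarrow> complex"
  assumes "\<And>x x' y. B (x + x') y = B x y + B x' y" "\<And>c x y. B (c *\<^sub>C x) y = c * B x y"
    and "\<And>x y y'. B x (y + y') = B x y + B x y'" "\<And>c x y. B x (c *\<^sub>C y) = cnj c * B x y"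
    and bd: "\<And>x y. cmod (B x y) \<le> norm x * norm y * K"
  shows "\<exists>T\<in>bounded_ops. \<forall>x y. cinner (blinfun_apply T x) y = B x y"
proof -
  have "\<exists>z. \<forall>y. cnj (B x y) = cinner y z" for x
    by (rule riesz_representation[of _ "norm x * K"])
      (use bd[of x] in \<open>simp_all add: assms mult.assoc mult.left_commute\<close>)
  then obtain f where "\<And>x y. cnj (B x y) = cinner y (f x)" by metis
  then have f: "cinner (f x) y = B x y" for x y
    by (metis cinner_commute complex_cnj_cnj)
  have add: "f (x + y) = f x + f y" for x y
    by (rule cinner_ext) (simp add: f assms cinner_add_left)
  have sc: "f (c *\<^sub>C x) = c *\<^sub>C f x" for c x
    by (rule cinner_ext) (simp add: f assms cinner_scaleC_left)
  have nm: "norm (f x) \<le> norm x * K" for x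
  proof (cases "f x = 0")
    case True
    \<comment> \<open>K is not assumed nonnegative: the bound at the pair (x, x) yields this unless
      x = 0.\<close>
    have "0 \<le> norm x * K"
    proof (cases "x = 0")
      case False
      then have "0 < norm x * norm x" by simp
      moreover have "0 \<le> (norm x * norm x) * K" using bd[of x x] by (meson norm_ge_zero order_trans)
      ultimately have "0 \<le> K" using zero_le_mult_iff[of "norm x * norm x" K] by linarith
      then show ?thesis by simp
    qed simp
    then show ?thesis using True by simp
  next
    case False
    have "norm (f x) * norm (f x) = cmod (cinner (f x) (f x))"
      by (simp add: cinner_self power2_eq_square norm_mult)
    also have "\<dots> \<le> norm (f x) * (norm x * K)"
      using bd[of x "f x"] by (simp add: f ac_simps)
    finally show ?thesis using False by simp
  qed
  show ?thesis
    using bounded_ops_of_linear[of f K] add sc nm f by metis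
qed

text \<open>The description in \<open>adj\<close> determines an operator: the form (x, y) -> <x, T
  y> is represented by a bounded operator, and inner products separate operators.\<close>

lemma adj_props:
  assumes T: "T \<in> bounded_ops"
  shows adj_bounded_ops [simp]: "adj T \<in> bounded_ops"
    and cinner_adj_right: "cinner (blinfun_apply T x) y = cinner x (blinfun_apply (adj T) y)"
proof -
  have "\<exists>S\<in>bounded_ops. \<forall>x y. cinner (blinfun_apply S x) y = cinner x (T y)"
  proof (rule sesquilinear_form_op[of "\<lambda>x y. cinner x (T y)" "norm T"])
    show "cmod (cinner x (T y)) \<le> norm x * norm y * norm T" for x y
      using cinner_cauchy_schwarz[of x "T y"] norm_blinfun[of T y]
      by (smt (verit) mult.assoc mult.commute mult_left_mono norm_ge_zero)
  qed (simp_all add: cinner_add_left cinner_add_right cinner_scaleC_left cinner_scaleC_right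
      bounded_ops_scaleC[OF T] blinfun.bilinear_simps)
  then obtain S where S: "S \<in> bounded_ops" "\<And>x y. cinner (blinfun_apply S x) y = cinner x (T y)"
    by blast
  then have S': "cinner (T x) y = cinner x (S y)" for x y
    by (metis cinner_commute)
  have "adj T = S" unfolding adj_def
  proof (rule the_equality)
    show "S \<in> bounded_ops \<and> (\<forall>x y. cinner (T x) y = cinner x (S y))" using S(1) S' by blast
    fix R assume "R \<in> bounded_ops \<and> (\<forall>x y. cinner (T x) y = cinner x (blinfun_apply R y))"
    then show "R = S"
      by (intro op_eqI) (metis S(2) cinner_commute)
  qed
  then show "adj T \<in> bounded_ops" "cinner (T x) y = cinner x (adj T y)" using S(1) S' by auto
qed

lemma cinner_adj_left:
  "T \<in> bounded_ops \<Longrightarrow> cinner (blinfun_apply (adj T) x) y = cinner x (blinfun_apply T y)"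
  by (metis cinner_adj_right cinner_commute)

lemma adj_eqI:
  assumes "T \<in> bounded_ops" "\<And>x y. cinner (blinfun_apply T x) y = cinner x (blinfun_apply S y)"
  shows "adj T = S"
  by (rule op_eqI) (metis assms cinner_adj_left cinner_commute)

lemma adj_adj [simp]: "T \<in> bounded_ops \<Longrightarrow> adj (adj T) = T"
  by (rule adj_eqI) (simp_all add: cinner_adj_left)

lemma adj_compose [simp]:
  "S \<in> bounded_ops \<Longrightarrow> T \<in> bounded_ops \<Longrightarrow> adj (S o\<^sub>L T) = adj T o\<^sub>L adj S"
  by (rule adj_eqI) (simp_all add: cinner_adj_right)

lemma adj_add [simp]: "S \<in> bounded_ops \<Longrightarrow> T \<in> bounded_ops \<Longrightarrow> adj (S + T) = adj S + adj T"
  by (rule adj_eqI) (simp_all add: cinner_adj_right blinfun.bilinear_simps cinner_add_left cinner_add_right)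

lemma adj_diff [simp]: "S \<in> bounded_ops \<Longrightarrow> T \<in> bounded_ops \<Longrightarrow> adj (S - T) = adj S - adj T"
  by (rule adj_eqI) (simp_all add: cinner_adj_right blinfun.bilinear_simps cinner.diff_left cinner.diff_right)

lemma adj_scale_op [simp]: "T \<in> bounded_ops \<Longrightarrow> adj (scale_op c T) = scale_op (cnj c) (adj T)"
  by (rule adj_eqI) (simp_all add: cinner_adj_right cinner_scaleC_left cinner_scaleC_right)

lemma adj_scaleR [simp]: "T \<in> bounded_ops \<Longrightarrow> adj (r *\<^sub>R T) = r *\<^sub>R adj T"
  using adj_scale_op[of T "of_real r"] by (simp add: scale_op_of_real)

lemma adj_id [simp]: "adj id_blinfun = (id_blinfun :: 'h::complex_hilbert_space op)"
  by (rule adj_eqI) simp_all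

lemma adj_zero [simp]: "adj 0 = (0 :: 'h::complex_hilbert_space op)"
  by (rule adj_eqI) simp_all

lemma norm_adj_compose_self:
  assumes T: "T \<in> bounded_ops"
  shows "cinner (blinfun_apply (adj T o\<^sub>L T) x) x = of_real ((norm (blinfun_apply T x))\<^sup>2)"
  by (simp add: cinner_adj_left T cinner_self)

lemma norm_adj_le: assumes T: "T \<in> bounded_ops" shows "norm (adj T) \<le> norm (T::'h::complex_hilbert_space op)"
proof (rule norm_blinfun_bound)
  fix x
  have "norm (adj T x) * norm (adj T x) = cmod (cinner (adj T x) (adj T x))"
    by (simp add: cinner_self power2_eq_square norm_mult)
  also have "\<dots> = cmod (cinner x (T (adj T x)))" by (simp add: cinner_adj_left T)
  also have "\<dots> \<le> norm x * norm (T (adj T x))" by (rule cinner_cauchy_schwarz)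
  also have "\<dots> \<le> norm x * (norm T * norm (adj T x))"
    by (intro mult_left_mono norm_blinfun) simp
  finally show "norm (adj T x) \<le> norm T * norm x"
    by (cases "adj T x = 0") (simp_all add: ac_simps)
qed simp

lemma norm_adj: "T \<in> bounded_ops \<Longrightarrow> norm (adj T) = norm (T::'h::complex_hilbert_space op)"
  using norm_adj_le[of T] norm_adj_le[of "adj T"] by simp

lemma blinfun_compose_simps:
  "(S + T) o\<^sub>L R = (S o\<^sub>L R) + (T o\<^sub>L R)" "R o\<^sub>L (S + T) = (R o\<^sub>L S) + (R o\<^sub>L T)"
  "(S - T) o\<^sub>L R = (S o\<^sub>L R) - (T o\<^sub>L R)" "R o\<^sub>L (S - T) = (R o\<^sub>L S) - (R o\<^sub>L T)"
  "(r *\<^sub>R S) o\<^sub>L R = r *\<^sub>R (S o\<^sub>L R)" "R o\<^sub>L (r *\<^sub>R S) = r *\<^sub>R (R o\<^sub>L S)"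
  "id_blinfun o\<^sub>L R = R" "R o\<^sub>L id_blinfun = R" "0 o\<^sub>L R = 0" "R o\<^sub>L 0 = 0"
  for R S T :: "'h::complex_hilbert_space op"
  by (auto intro!: blinfun_eqI simp: blinfun.bilinear_simps)

lemma blinfun_compose_assoc: "(R o\<^sub>L S) o\<^sub>L T = R o\<^sub>L (S o\<^sub>L T)"
  by (rule blinfun_eqI) simp

lemma scale_op_compose:
  "scale_op c S o\<^sub>L T = scale_op c (S o\<^sub>L T)"
  "S \<in> bounded_ops \<Longrightarrow> S o\<^sub>L scale_op c T = scale_op c (S o\<^sub>L T)"
  by (auto intro!: blinfun_eqI simp: bounded_ops_scaleC)

subsection \<open>Positive operators\<close>

lemma positive_op_iff:
  "positive_op T \<longleftrightarrow> T \<in> bounded_ops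
     \<and> (\<forall>x. 0 \<le> Re (cinner (blinfun_apply T x) x) \<and> Im (cinner (blinfun_apply T x) x) = 0)"
  by (auto simp: positive_op_def complex_nonneg_Reals_iff)

lemma positive_op_bounded_ops [simp]: "positive_op T \<Longrightarrow> T \<in> bounded_ops"
  by (simp add: positive_op_def)

lemma positive_op_Re: "positive_op T \<Longrightarrow> 0 \<le> Re (cinner (blinfun_apply T x) x)"
  by (simp add: positive_op_iff)

lemma polarization_op:
  assumes T: "T \<in> bounded_ops"
  shows "4 * cinner (blinfun_apply T x) y = cinner (blinfun_apply T (x + y)) (x + y) - cinner (blinfun_apply T (x - y)) (x - y)
     + \<i> * cinner (blinfun_apply T (x + \<i> *\<^sub>C y)) (x + \<i> *\<^sub>C y) - \<i> * cinner (blinfun_apply T (x - \<i> *\<^sub>C y)) (x - \<i> *\<^sub>C y)"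
  by (simp add: blinfun.bilinear_simps bounded_ops_scaleC[OF T] cinner_add_left cinner_add_right
      cinner.diff_left cinner.diff_right cinner_scaleC_left cinner_scaleC_right algebra_simps)

lemma quadratic_form_eqI:
  assumes "S \<in> bounded_ops" "T \<in> bounded_ops"
    and "\<And>x. cinner (blinfun_apply S x) x = cinner (blinfun_apply T x) x"
  shows "S = T"
proof (rule op_eqI)
  fix x y
  have "4 * cinner (S x) y = 4 * cinner (T x) y"
    unfolding polarization_op[OF assms(1)] polarization_op[OF assms(2)] assms(3) ..
  then show "cinner (S x) y = cinner (T x) y" by simp
qed

lemma self_adjointI:
  assumes "T \<in> bounded_ops" "\<And>x. Im (cinner (blinfun_apply T x) x) = 0"
  shows "adj T = T"
proof (rule quadratic_form_eqI)
  fix x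
  have "cinner (adj T x) x = cnj (cinner (T x) x)"
    by (metis assms(1) cinner_adj_left cinner_commute)
  also have "\<dots> = cinner (T x) x" using assms(2) by (simp add: complex_eq_iff)
  finally show "cinner (adj T x) x = cinner (T x) x" .
qed (use assms in auto)

lemma positive_op_adj: "positive_op T \<Longrightarrow> adj T = T"
  by (rule self_adjointI) (auto simp: positive_op_iff)

lemma self_adjoint_Im:
  assumes "T \<in> bounded_ops" "adj T = T"
  shows "Im (cinner (blinfun_apply T x) x) = 0"
proof -
  have "cinner (T x) x = cnj (cinner (T x) x)"
    by (metis assms cinner_adj_left cinner_commute)
  then show ?thesis by (simp add: complex_eq_iff)
qed

lemma positive_op_basic [simp]:
  "positive_op 0" "positive_op id_blinfun"
  by (auto simp: positive_op_iff cinner_self)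

lemma positive_op_add [simp]: "positive_op S \<Longrightarrow> positive_op T \<Longrightarrow> positive_op (S + T)"
  by (auto simp: positive_op_iff blinfun.bilinear_simps cinner_add_left)

lemma positive_op_scaleR [simp]: "positive_op S \<Longrightarrow> 0 \<le> r \<Longrightarrow> positive_op (r *\<^sub>R S)"
  by (auto simp: positive_op_iff blinfun.bilinear_simps cinner_scaleR_left)

lemma positive_op_sum: "(\<And>i. i \<in> I \<Longrightarrow> positive_op (f i)) \<Longrightarrow> positive_op (sum f I)"
  by (induction I rule: infinite_finite_induct) auto

lemma positive_op_conj:
  "positive_op T \<Longrightarrow> S \<in> bounded_ops \<Longrightarrow> positive_op (adj S o\<^sub>L T o\<^sub>L S)"
  by (auto simp: positive_op_iff cinner_adj_left)

lemma positive_op_adj_self [simp]: "S \<in> bounded_ops \<Longrightarrow> positive_op (adj S o\<^sub>L S)"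
  using positive_op_conj[of id_blinfun S] by (simp add: blinfun_compose_simps)

lemma positive_opI:
  assumes "T \<in> bounded_ops" "adj T = T" "\<And>x. 0 \<le> Re (cinner (blinfun_apply T x) x)"
  shows "positive_op T"
  using assms self_adjoint_Im by (auto simp: positive_op_iff)

lemma op_le_Re: "op_le S T \<Longrightarrow> Re (cinner (blinfun_apply S x) x) \<le> Re (cinner (blinfun_apply T x) x)"
  using positive_op_Re[of "T - S" x]
  by (simp add: op_le_def blinfun.bilinear_simps cinner.diff_left)

lemma op_leI:
  assumes "S \<in> bounded_ops" "adj S = S" "T \<in> bounded_ops" "adj T = T"
    and "\<And>x. Re (cinner (blinfun_apply S x) x) \<le> Re (cinner (blinfun_apply T x) x)"
  shows "op_le S T"
  unfolding op_le_def
  by (rule positive_opI) (use assms in \<open>auto simp: blinfun.bilinear_simps cinner.diff_left\<close>)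

lemma op_le_refl [simp]: "op_le T T"
  by (simp add: op_le_def)

lemma op_le_trans: "op_le R S \<Longrightarrow> op_le S T \<Longrightarrow> op_le R T"
  unfolding op_le_def using positive_op_add[of "S - R" "T - S"] by simp

lemma op_le_antisym:
  assumes "op_le S T" "op_le T S" shows "S = T"
proof -
  have "T - S = 0"
  proof (rule quadratic_form_eqI)
    show "T - S \<in> bounded_ops" using assms by (simp add: op_le_def)
    fix x
    have "Re (cinner ((T - S) x) x) = 0"
      using op_le_Re[OF assms(1), of x] op_le_Re[OF assms(2), of x]
      by (simp add: blinfun.bilinear_simps cinner.diff_left)
    then show "cinner ((T - S) x) x = cinner (blinfun_apply 0 x) x"
      using assms(1) by (auto simp: op_le_def positive_op_iff complex_eq_iff)
  qed simp
  then show ?thesis by simp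
qed

lemma op_le_0_iff [simp]: "op_le 0 T \<longleftrightarrow> positive_op T"
  by (simp add: op_le_def)

lemma positive_op_diff: "op_le S T \<Longrightarrow> positive_op (T - S)"
  by (simp add: op_le_def)

lemma op_le_scaleR: "op_le S T \<Longrightarrow> 0 \<le> r \<Longrightarrow> op_le (r *\<^sub>R S) (r *\<^sub>R T)"
  unfolding op_le_def using positive_op_scaleR[of "T - S" r] by (simp add: scaleR_diff_right)

lemma positive_op_mono: "positive_op S \<Longrightarrow> op_le S T \<Longrightarrow> positive_op T"
  using op_le_trans[of 0 S T] by simp

lemma positive_form_cauchy_schwarz:
  assumes T: "positive_op T"
  shows "(cmod (cinner (blinfun_apply T x) y))\<^sup>2
    \<le> Re (cinner (blinfun_apply T x) x) * Re (cinner (blinfun_apply T y) y)"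
proof -
  have "(cmod (cinner (T x) y))\<^sup>2 \<le> Re (cinner (T y) y) * Re (cinner (T x) x)"
  proof (rule nonneg_quadratic_imp_cauchy_schwarz)
    fix c
    have yx: "cinner (T y) x = cnj (cinner (T x) y)"
      by (metis T cinner_adj_left cinner_commute positive_op_adj positive_op_bounded_ops)
    have "0 \<le> Re (cinner (T (c *\<^sub>C x + y)) (c *\<^sub>C x + y))" by (rule positive_op_Re[OF T])
    also have "cinner (T (c *\<^sub>C x + y)) (c *\<^sub>C x + y)
      = cinner (T y) y + (c * cinner (T x) y + cnj (c * cinner (T x) y)) + (c * cnj c) * cinner (T x) x"
      by (simp add: blinfun.bilinear_simps bounded_ops_scaleC T cinner_add_left cinner_add_right
          cinner_scaleC_left cinner_scaleC_right yx algebra_simps)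
    also have "Re \<dots> = Re (cinner (T y) y) + 2 * Re (c * cinner (T x) y) + (cmod c)\<^sup>2 * Re (cinner (T x) x)"
      using T by (simp add: complex_norm_square[symmetric] positive_op_iff del: of_real_power)
    finally show "0 \<le> Re (cinner (T y) y) + 2 * Re (c * cinner (T x) y) + (cmod c)\<^sup>2 * Re (cinner (T x) x)" .
  qed (rule positive_op_Re[OF T])
  then show ?thesis by (simp add: mult.commute)
qed

text \<open>Cauchy-Schwarz for the form <T x, y> at y = T x. It is the device that upgrades
  convergence of quadratic forms of bounded positive operators to strong convergence.\<close>

lemma norm_apply_positive_op:
  assumes T: "positive_op T" "op_le T (c *\<^sub>R id_blinfun)"
  shows "(norm (blinfun_apply T x))\<^sup>2 \<le> c * Re (cinner (blinfun_apply T x) x)"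
proof (cases "T x = 0")
  case True
  then show ?thesis by simp
next
  case False
  let ?n = "(norm (T x))\<^sup>2"
  have "?n * ?n = (cmod (cinner (T x) (T x)))\<^sup>2"
    by (simp add: cinner_self power2_eq_square norm_mult)
  also have "\<dots> \<le> Re (cinner (T x) x) * Re (cinner (T (T x)) (T x))"
    by (rule positive_form_cauchy_schwarz[OF T(1)])
  also have "\<dots> \<le> Re (cinner (T x) x) * (c * ?n)"
    using op_le_Re[OF T(2), of "T x"] positive_op_Re[OF T(1), of x]
    by (intro mult_left_mono) (simp_all add: blinfun.bilinear_simps cinner_scaleR_left Re_cinner_self)
  finally have "?n * ?n \<le> (c * Re (cinner (T x) x)) * ?n" by (simp only: ac_simps)
  moreover have "0 < ?n" using False by simp
  ultimately show ?thesis by (rule mult_right_le_imp_le)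
qed

lemma norm_le_of_op_le:
  assumes T: "positive_op T" "op_le T (c *\<^sub>R id_blinfun)" "0 \<le> c"
  shows "norm (T::'h::complex_hilbert_space op) \<le> c"
proof (rule norm_blinfun_bound)
  fix x
  have "(norm (T x))\<^sup>2 \<le> c * Re (cinner (T x) x)" by (rule norm_apply_positive_op[OF T(1,2)])
  also have "\<dots> \<le> c * (c * (norm x)\<^sup>2)"
    using op_le_Re[OF T(2), of x] T(3)
    by (intro mult_left_mono) (simp_all add: blinfun.bilinear_simps cinner_scaleR_left Re_cinner_self)
  finally have "(norm (T x))\<^sup>2 \<le> (c * norm x)\<^sup>2" by (simp add: power2_eq_square ac_simps)
  then show "norm (T x) \<le> c * norm x" using T(3) by (simp add: power2_le_iff_abs_le)
qed (rule T(3))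

lemma self_adjoint_le_norm:
  fixes T :: "'h::complex_hilbert_space op"
  assumes T: "T \<in> bounded_ops" "adj T = T" and c: "norm T \<le> c"
  shows "op_le T (c *\<^sub>R id_blinfun)" "op_le (- (c *\<^sub>R id_blinfun)) T"
proof -
  have nm: "norm (T x) \<le> c * norm x" for x
    using c by (rule norm_blinfun_le)
  have "\<bar>Re (cinner (T x) x)\<bar> \<le> c * (norm x)\<^sup>2" for x
  proof -
    have "\<bar>Re (cinner (T x) x)\<bar> \<le> cmod (cinner (T x) x)" by (rule abs_Re_le_cmod)
    also have "\<dots> \<le> norm (T x) * norm x" by (rule cinner_cauchy_schwarz)
    also have "\<dots> \<le> (c * norm x) * norm x"
      using nm by (intro mult_right_mono) auto
    finally show ?thesis by (simp add: power2_eq_square ac_simps)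
  qed
  then have b: "Re (cinner (T x) x) \<le> c * (norm x)\<^sup>2" "- (c * (norm x)\<^sup>2) \<le> Re (cinner (T x) x)" for x
    by (auto simp: abs_le_iff minus_le_iff)
  have m: "adj (- (c *\<^sub>R id_blinfun)) = - (c *\<^sub>R id_blinfun :: 'h op)"
    using adj_scaleR[of "id_blinfun::'h op" "-c"] by simp
  show "op_le T (c *\<^sub>R id_blinfun)" "op_le (- (c *\<^sub>R id_blinfun)) T"
    by (rule op_leI; use T b m in \<open>simp add: blinfun.bilinear_simps cinner_scaleR_left cinner_self cinner.minus_left\<close>)+
qed

lemma adj_self_le:
  fixes S :: "'h::complex_hilbert_space op"
  assumes S: "S \<in> bounded_ops" "norm S \<le> c"
  shows "op_le (adj S o\<^sub>L S) (c\<^sup>2 *\<^sub>R id_blinfun)"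
proof (rule op_leI)
  fix x
  have "norm (S x) \<le> c * norm x"
    using S(2) by (rule norm_blinfun_le)
  then have "(norm (S x))\<^sup>2 \<le> (c * norm x)\<^sup>2" by (simp add: power_mono)
  then show "Re (cinner ((adj S o\<^sub>L S) x) x) \<le> Re (cinner ((c\<^sup>2 *\<^sub>R id_blinfun :: 'h op) x) x)"
    using norm_adj_compose_self[OF S(1), of x]
    by (simp add: blinfun.bilinear_simps cinner_scaleR_left cinner_self power_mult_distrib)
qed (use S in auto)

lemma norm_le_of_adj_self_le:
  fixes S :: "'h::complex_hilbert_space op"
  assumes S: "S \<in> bounded_ops" and le: "op_le (adj S o\<^sub>L S) (c\<^sup>2 *\<^sub>R id_blinfun)" and c: "0 \<le> c"
  shows "norm S \<le> c"
proof (rule norm_blinfun_bound)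
  fix x
  have "(norm (S x))\<^sup>2 \<le> (c * norm x)\<^sup>2"
    using op_le_Re[OF le, of x] norm_adj_compose_self[OF S(1), of x]
    by (simp add: blinfun.bilinear_simps cinner_scaleR_left cinner_self power_mult_distrib)
  then show "norm (S x) \<le> c * norm x" using c by (simp add: power2_le_iff_abs_le)
qed (rule c)

subsection \<open>Weak limits\<close>

text \<open>A pointwise limit of uniformly bounded sesquilinear forms is again one. An arbitrary
  filter is allowed because suprema of directed families are limits along their filter of sections,
  not along a sequence.\<close>

lemma weak_limit_op:
  fixes X :: "'i \<Rightarrow> 'h::complex_hilbert_space op"
  assumes F: "F \<noteq> bot"
    and X: "\<forall>\<^sub>F i in F. X i \<in> bounded_ops \<and> norm (X i) \<le> K"
    and lim: "\<And>x y. \<exists>l. ((\<lambda>i. cinner (X i x) y) \<longlongrightarrow> l) F"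
  shows "\<exists>T\<in>bounded_ops. \<forall>x y. ((\<lambda>i. cinner (X i x) y) \<longlongrightarrow> cinner (blinfun_apply T x) y) F"
proof -
  obtain B where B: "\<And>x y. ((\<lambda>i. cinner (X i x) y) \<longlongrightarrow> B x y) F" using lim by metis
  note uniq = tendsto_unique[OF F]
  have "\<exists>T\<in>bounded_ops. \<forall>x y. cinner (blinfun_apply T x) y = B x y"
  proof (rule sesquilinear_form_op[where K = K])
    fix x x' y y' c
    show "B (x + x') y = B x y + B x' y"
      using tendsto_add[OF B[of x y] B[of x' y]]
      by (intro uniq[OF B]) (simp add: blinfun.bilinear_simps cinner_add_left)
    show "B x (y + y') = B x y + B x y'"
      using tendsto_add[OF B[of x y] B[of x y']] by (intro uniq[OF B]) (simp add: cinner_add_right)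
    have "\<forall>\<^sub>F i in F. c * cinner (X i x) y = cinner (X i (c *\<^sub>C x)) y"
      using X by eventually_elim (simp add: bounded_ops_scaleC cinner_scaleC_left)
    from Lim_transform_eventually[OF tendsto_mult_left[OF B] this]
    show "B (c *\<^sub>C x) y = c * B x y" by (intro uniq[OF B])
    show "B x (c *\<^sub>C y) = cnj c * B x y"
      using tendsto_mult_left[OF B[of x y], of "cnj c"]
      by (intro uniq[OF B]) (simp add: cinner_scaleC_right)
    show "cmod (B x y) \<le> norm x * norm y * K"
    proof (rule tendsto_upperbound[OF tendsto_norm[OF B] _ F])
      show "\<forall>\<^sub>F i in F. cmod (cinner (X i x) y) \<le> norm x * norm y * K"
        using X
      proof eventually_elim
        case (elim i)
        have "cmod (cinner (X i x) y) \<le> norm (X i x) * norm y" by (rule cinner_cauchy_schwarz)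
        also have "\<dots> \<le> (K * norm x) * norm y"
          using norm_blinfun_le[of "X i" K x] elim by (intro mult_right_mono) auto
        finally show ?case by (simp add: ac_simps)
      qed
    qed
  qed
  then show ?thesis using B by metis
qed

lemma quadratic_limit_imp_weak_limit:
  fixes X :: "'i \<Rightarrow> 'h::complex_hilbert_space op"
  assumes X: "\<forall>\<^sub>F i in F. X i \<in> bounded_ops"
    and lim: "\<And>x. ((\<lambda>i. cinner (X i x) x) \<longlongrightarrow> q x) F"
  shows "((\<lambda>i. cinner (X i x) y) \<longlongrightarrow>
    (q (x + y) - q (x - y) + \<i> * q (x + \<i> *\<^sub>C y) - \<i> * q (x - \<i> *\<^sub>C y)) / 4) F"
proof (rule Lim_transform_eventually)
  show "((\<lambda>i. (cinner (X i (x + y)) (x + y) - cinner (X i (x - y)) (x - y)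
     + \<i> * cinner (X i (x + \<i> *\<^sub>C y)) (x + \<i> *\<^sub>C y) - \<i> * cinner (X i (x - \<i> *\<^sub>C y)) (x - \<i> *\<^sub>C y)) / 4)
     \<longlongrightarrow> (q (x + y) - q (x - y) + \<i> * q (x + \<i> *\<^sub>C y) - \<i> * q (x - \<i> *\<^sub>C y)) / 4) F"
    by (intro tendsto_intros lim) simp
  show "\<forall>\<^sub>F i in F. (cinner (X i (x + y)) (x + y) - cinner (X i (x - y)) (x - y)
     + \<i> * cinner (X i (x + \<i> *\<^sub>C y)) (x + \<i> *\<^sub>C y) - \<i> * cinner (X i (x - \<i> *\<^sub>C y)) (x - \<i> *\<^sub>C y)) / 4
     = cinner (X i x) y"
    using X by eventually_elim (simp only: polarization_op[symmetric], simp)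
qed

subsection \<open>The resolvent at \<open>-1\<close>\<close>

text \<open>The inverse of 1 + T. It replaces functional calculus: 1 - (1 + T)^{-1} is the bounded
  cut-off t/(1 + t) of T, which is operator monotone and stays in every von Neumann algebra that
  contains T.\<close>

definition resolv :: "'h::complex_hilbert_space op \<Rightarrow> 'h op" where
  "resolv T = (SOME R. R \<in> bounded_ops \<and> R o\<^sub>L (id_blinfun + T) = id_blinfun
     \<and> (id_blinfun + T) o\<^sub>L R = id_blinfun)"

text \<open>With n = ||T||, the equation x + T x = y is the fixed point equation x = c (y + (n - T)
  x) for c = 1/(1 + n). As ||n - T|| <= n, the right side contracts by the factor c n < 1.
  Positivity of T makes 1 + T bounded below by 1, which gives uniqueness and the norm bound of the
  inverse.\<close>

lemma resolv_exists:
  assumes T: "positive_op T"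
  shows "\<exists>R. R \<in> bounded_ops \<and> R o\<^sub>L (id_blinfun + T) = id_blinfun
     \<and> (id_blinfun + T) o\<^sub>L R = (id_blinfun :: 'h::complex_hilbert_space op)"
proof -
  let ?n = "norm T"
  define c where "c = 1 / (1 + ?n)"
  have Tb: "T \<in> bounded_ops" using T by simp
  have c: "0 < c" "c * ?n < 1" "c * (1 + ?n) = 1"
    unfolding c_def by (simp_all add: add_pos_nonneg field_simps add_nonneg_eq_0_iff)
  let ?K = "?n *\<^sub>R id_blinfun - T"
  have "op_le T (?n *\<^sub>R id_blinfun)" by (rule self_adjoint_le_norm) (use T positive_op_adj in auto)
  then have K: "norm ?K \<le> ?n"
    by (intro norm_le_of_op_le) (use T in \<open>auto simp: op_le_def\<close>)
  have inj: "norm x \<le> norm (x + T x)" for x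
  proof (cases "x = 0")
    case False
    have "norm x * norm x \<le> Re (cinner (x + T x) x)"
      using positive_op_Re[OF T, of x] by (simp add: cinner_add_left cinner_self power2_eq_square)
    also have "\<dots> \<le> norm (x + T x) * norm x"
      by (rule order_trans[OF complex_Re_le_cmod cinner_cauchy_schwarz])
    finally show ?thesis using False by simp
  qed simp
  have "\<exists>x. x + T x = y" for y
  proof -
    have "\<exists>!x. c *\<^sub>R (y + ?K x) = x"
    proof (rule banach_fix_type[of "c * ?n"])
      have "dist (c *\<^sub>R (y + ?K x)) (c *\<^sub>R (y + ?K x')) \<le> c * ?n * dist x x'" for x x'
      proof -
        have "dist (c *\<^sub>R (y + ?K x)) (c *\<^sub>R (y + ?K x')) = norm (c *\<^sub>R (?K (x - x')))"
          by (simp add: dist_norm scaleR_diff_right[symmetric] blinfun.diff_right)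
        also have "\<dots> = c * norm (?K (x - x'))" using c by simp
        also have "\<dots> \<le> c * (?n * norm (x - x'))"
          using norm_blinfun_le[OF K, of "x - x'"] c by (intro mult_left_mono) auto
        finally show ?thesis by (simp add: dist_norm ac_simps)
      qed
      then show "\<forall>x x'. dist (c *\<^sub>R (y + ?K x)) (c *\<^sub>R (y + ?K x')) \<le> c * ?n * dist x x'" by blast
    qed (use c in auto)
    then obtain x where "c *\<^sub>R (y + ?K x) = x" by blast
    then have "(1 + ?n) *\<^sub>R x = ((1 + ?n) * c) *\<^sub>R (y + ?K x)" by (metis scaleR_scaleR)
    also have "(1 + ?n) * c = 1" using c(3) by (simp only: mult.commute)
    finally have "x + T x = y" by (simp add: blinfun.bilinear_simps scaleR_add_left algebra_simps)
    then show ?thesis by blast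
  qed
  then obtain r where r: "\<And>y. r y + T (r y) = y" by metis
  have uniq: "x = x'" if "x + T x = x' + T x'" for x x'
    using inj[of "x - x'"] that by (simp add: blinfun.diff_right algebra_simps)
  have r1: "r (x + y) = r x + r y" for x y
    by (rule uniq) (metis (no_types, lifting) r add.assoc add.left_commute blinfun.add_right)
  have r2: "r (a *\<^sub>C x) = a *\<^sub>C r x" for a x
    by (rule uniq) (metis r bounded_ops_scaleC[OF Tb] scaleC_add_right)
  have "norm (r x) \<le> norm x * 1" for x using inj[of "r x"] r[of x] by simp
  from bounded_ops_of_linear[OF r1 r2 this]
  have "Blinfun r \<in> bounded_ops" "blinfun_apply (Blinfun r) = r" by auto
  moreover have "r (x + T x) = x" for x using uniq r by blast
  ultimately show ?thesis
    using r by (intro exI[of _ "Blinfun r"]) (auto intro!: blinfun_eqI simp: blinfun.bilinear_simps)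
qed

lemma
  assumes T: "positive_op T"
  shows resolv_bounded_ops [simp]: "resolv T \<in> bounded_ops"
    and resolv_left: "resolv T o\<^sub>L (id_blinfun + T) = id_blinfun"
    and resolv_right: "(id_blinfun + T) o\<^sub>L resolv T = id_blinfun"
  using someI_ex[OF resolv_exists[OF T]] unfolding resolv_def by auto

lemma resolv_right_apply: "positive_op T \<Longrightarrow> resolv T x + T (resolv T x) = x"
  using arg_cong[OF resolv_right, of T "\<lambda>S. blinfun_apply S x"] by (simp add: blinfun.bilinear_simps)

lemma resolv_commute:
  assumes T: "positive_op T" and S: "S o\<^sub>L T = T o\<^sub>L S"
  shows "S o\<^sub>L resolv T = resolv T o\<^sub>L S"
proof -
  let ?R = "id_blinfun + T"
  have c: "?R o\<^sub>L S = S o\<^sub>L ?R" by (simp add: blinfun_compose_simps S)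
  have "S o\<^sub>L resolv T = (resolv T o\<^sub>L ?R) o\<^sub>L S o\<^sub>L resolv T"
    by (simp only: resolv_left[OF T] blinfun_compose_simps(7))
  also have "\<dots> = resolv T o\<^sub>L (?R o\<^sub>L S) o\<^sub>L resolv T" by (simp only: blinfun_compose_assoc)
  also have "\<dots> = (resolv T o\<^sub>L S) o\<^sub>L (?R o\<^sub>L resolv T)" unfolding c by (simp only: blinfun_compose_assoc)
  also have "\<dots> = resolv T o\<^sub>L S" by (simp only: resolv_right[OF T] blinfun_compose_simps(8))
  finally show ?thesis .
qed

lemma resolv_positive [simp]:
  assumes T: "positive_op T" shows "positive_op (resolv T)"
proof -
  have "cinner (resolv T x) x = cinner (resolv T x) (resolv T x) + cinner (T (resolv T x)) (resolv T x)" for x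
    by (metis T cinner_add_right resolv_right_apply cinner_adj_left positive_op_adj positive_op_bounded_ops)
  then show ?thesis
    using T by (auto simp: positive_op_iff cinner_self)
qed

lemma resolv_compl:
  assumes T: "positive_op T"
  shows "id_blinfun - resolv T = T o\<^sub>L resolv T" "id_blinfun - resolv T = resolv T o\<^sub>L T"
  using resolv_right[OF T] resolv_left[OF T] by (simp_all add: blinfun_compose_simps diff_eq_eq add.commute)

text \<open>Expand 0 <= <(1 + S)(u - v), u - v> for u = (1 + S)^{-1} x and v = (1 + T)^{-1} x, and
  use <(1 + S) v, v> <= <(1 + T) v, v> = <x, v>.\<close>

lemma resolv_antimono:
  assumes S: "positive_op S" and T: "positive_op T" and le: "op_le S T"
  shows "op_le (resolv T) (resolv S)"
proof (rule op_leI)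
  fix x
  let ?u = "resolv S x" and ?v = "resolv T x"
  have u: "?u + S ?u = x" and v: "?v + T ?v = x" using S T by (simp_all add: resolv_right_apply)
  let ?R = "id_blinfun + S"
  have R: "positive_op ?R" using S by simp
  have sa: "cinner (?R x) y = cinner x (?R y)" for x y
    by (metis R cinner_adj_left positive_op_adj positive_op_bounded_ops)
  have Ru: "?R ?u = x" using u by (simp add: blinfun.bilinear_simps)
  have "0 \<le> Re (cinner (?R (?u - ?v)) (?u - ?v))" by (rule positive_op_Re[OF R])
  also have "cinner (?R (?u - ?v)) (?u - ?v) = cinner x ?u - cinner x ?v - cinner ?v x + cinner (?R ?v) ?v"
    by (simp only: blinfun.diff_right cinner.diff_left cinner.diff_right Ru sa[of ?v ?u]) simp
  also have "Re \<dots> = Re (cinner x ?u) - 2 * Re (cinner ?v x) + Re (cinner (?R ?v) ?v)"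
    using cinner_commute[of x ?v] by simp
  also have "Re (cinner (?R ?v) ?v) \<le> Re (cinner (?v + T ?v) ?v)"
    using op_le_Re[OF le, of ?v] by (simp add: blinfun.bilinear_simps cinner_add_left)
  also have "\<dots> = Re (cinner ?v x)" unfolding v by (subst cinner_commute) simp
  finally show "Re (cinner (resolv T x) x) \<le> Re (cinner (resolv S x) x)"
    using cinner_commute[of x ?u] by simp
qed (use S T in \<open>auto simp: positive_op_adj\<close>)

lemma resolv_zero [simp]: "resolv 0 = id_blinfun"
  using resolv_left[of 0] by (simp add: blinfun_compose_simps)

lemma resolv_le_id [simp]: "positive_op T \<Longrightarrow> op_le (resolv T) id_blinfun"
  using resolv_antimono[of 0 T] by simp

subsection \<open>Products and square roots\<close>

text \<open>Riesz's argument: with \<open>A\<^sub>0 = S\<close> and \<open>A\<^bsub>k+1\<^esub> = A\<^sub>k - A\<^sub>k\<^sup>2\<close>, the operator \<open>S\<close> is the strong sum of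
  the squares \<open>A\<^sub>k\<^sup>2\<close>.\<close>

lemma positive_op_compose:
  fixes S T :: "'h::complex_hilbert_space op"
  assumes S: "positive_op S" and T: "positive_op T" and ST: "S o\<^sub>L T = T o\<^sub>L S"
  shows "positive_op (S o\<^sub>L T)"
proof -
  have main: "positive_op (S o\<^sub>L T)"
    if S: "positive_op S" "op_le S id_blinfun" and ST: "S o\<^sub>L T = T o\<^sub>L S" for S :: "'h op"
  proof -
    define a where "a = rec_nat S (\<lambda>_ X. X - (X o\<^sub>L X))"
    have a0: "a 0 = S" and aS: "a (Suc n) = a n - (a n o\<^sub>L a n)" for n
      unfolding a_def by simp_all
    have a: "positive_op (a n) \<and> op_le (a n) id_blinfun \<and> a n o\<^sub>L T = T o\<^sub>L a n" for n
    proof (induction n)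
      case 0
      then show ?case using S ST by (simp add: a0)
    next
      case (Suc n)
      let ?A = "a n" and ?B = "id_blinfun - a n"
      have A: "positive_op ?A" "adj ?A = ?A" "?A \<in> bounded_ops"
        and B: "positive_op ?B" "adj ?B = ?B" "?B \<in> bounded_ops"
        and c: "?A o\<^sub>L T = T o\<^sub>L ?A"
        using Suc positive_op_adj by (auto simp: op_le_def)
      \<comment> \<open>A - A^2 = A (1 - A) A + (1 - A) A (1 - A) gives positivity, and 1 - (A -
        A^2) = (1 - A) + A^2 the upper bound.\<close>
      have "positive_op ((?A o\<^sub>L ?B o\<^sub>L ?A) + (?B o\<^sub>L ?A o\<^sub>L ?B))"
        using positive_op_conj[of ?B ?A] positive_op_conj[of ?A ?B] A B by (intro positive_op_add) simp_all
      also have "(?A o\<^sub>L ?B o\<^sub>L ?A) + (?B o\<^sub>L ?A o\<^sub>L ?B) = a (Suc n)"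
        unfolding aS by (simp add: blinfun_compose_simps blinfun_compose_assoc algebra_simps)
      finally have 1: "positive_op (a (Suc n))" .
      have "positive_op (?B + (adj ?A o\<^sub>L ?A))"
        by (intro positive_op_add positive_op_adj_self A B)
      then have 2: "op_le (a (Suc n)) id_blinfun"
        using A by (simp add: op_le_def aS algebra_simps)
      have "?A o\<^sub>L ?A o\<^sub>L T = T o\<^sub>L (?A o\<^sub>L ?A)"
        by (metis blinfun_compose_assoc c)
      then have "a (Suc n) o\<^sub>L T = T o\<^sub>L a (Suc n)" by (simp add: aS blinfun_compose_simps c)
      then show ?case using 1 2 by blast
    qed
    have asa: "adj (a n) = a n" and ab: "a n \<in> bounded_ops" for n using a positive_op_adj by auto
    have sq: "cinner (a n x) y = cinner x (a n y)" for n x y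
      by (metis asa ab cinner_adj_left)
    have sum: "(\<Sum>k<n. a k (a k x)) = S x - a n x" for n x
      by (induction n) (simp_all add: a0 aS blinfun.bilinear_simps)
    have sumn: "(\<Sum>k<n. (norm (a k x))\<^sup>2) \<le> (norm x)\<^sup>2" for n x
    proof -
      have "(\<Sum>k<n. (norm (a k x))\<^sup>2) = Re (cinner (\<Sum>k<n. a k (a k x)) x)"
        by (simp add: cinner.sum_left sq[of _ "a _ _"] cinner_self)
      also have "\<dots> = Re (cinner (S x) x) - Re (cinner (a n x) x)"
        unfolding sum by (simp add: cinner.diff_left)
      also have "\<dots> \<le> (norm x)\<^sup>2"
        using op_le_Re[OF S(2), of x] positive_op_Re[of "a n" x] a by (simp add: cinner_self)
      finally show ?thesis .
    qed
    have "summable (\<lambda>k. (norm (a k x))\<^sup>2)" for x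
      by (rule summableI_nonneg_bounded[where x = "(norm x)\<^sup>2"]) (use sumn in auto)
    then have "(\<lambda>k. (norm (a k x))\<^sup>2) \<longlonglongrightarrow> 0" for x by (rule summable_LIMSEQ_zero)
    then have "(\<lambda>k. sqrt ((norm (a k x))\<^sup>2)) \<longlonglongrightarrow> sqrt 0" for x by (intro tendsto_intros)
    then have lim: "(\<lambda>k. a k x) \<longlonglongrightarrow> 0" for x by (simp add: tendsto_norm_zero_iff)
    have pos: "0 \<le> Re (cinner (S (T x)) x)" for x
    proof (rule tendsto_lowerbound)
      have "(\<lambda>n. Re (cinner (S (T x) - a n (T x)) x)) \<longlonglongrightarrow> Re (cinner (S (T x) - 0) x)"
        by (intro tendsto_intros cinner.tendsto lim)
      then show "(\<lambda>n. Re (cinner (S (T x) - a n (T x)) x)) \<longlonglongrightarrow> Re (cinner (S (T x)) x)" by simp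
      have "Re (cinner (S (T x) - a n (T x)) x) = (\<Sum>k<n. Re (cinner (T (a k x)) (a k x)))" for n
      proof -
        have "a k (T x) = T (a k x)" for k
          using a[of k] by (metis blinfun_apply_blinfun_compose)
        then show ?thesis
          unfolding sum[symmetric] by (simp add: cinner.sum_left sq[of _ "T _"])
      qed
      then show "\<forall>\<^sub>F n in sequentially. 0 \<le> Re (cinner (S (T x) - a n (T x)) x)"
        using positive_op_Re[OF T] by (simp add: sum_nonneg)
    qed simp
    have "adj (S o\<^sub>L T) = S o\<^sub>L T" 
      using positive_op_adj[OF S(1)] positive_op_adj[OF T] S T ST by simp
    then show ?thesis
      by (intro positive_opI) (use S T pos in simp_all)
  qed
  \<comment> \<open>The summand 1 keeps the scaling defined when S = 0.\<close>
  define c where "c = 1 / (1 + norm S)"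
  have c: "0 < c" "c * norm S \<le> 1"
    unfolding c_def by (simp_all add: add_pos_nonneg field_simps)
  have "op_le (c *\<^sub>R S) id_blinfun"
    using self_adjoint_le_norm(1)[of "c *\<^sub>R S" 1] S c positive_op_adj[of S] by simp
  then have "positive_op ((c *\<^sub>R S) o\<^sub>L T)"
    using S c ST by (intro main) (simp_all add: blinfun_compose_simps)
  then have "positive_op ((1 / c) *\<^sub>R ((c *\<^sub>R S) o\<^sub>L T))" using c by (intro positive_op_scaleR) auto
  then show ?thesis using c by (simp add: blinfun_compose_simps)
qed

section \<open>Von Neumann algebras\<close>

lemma commutantD: "T \<in> commutant M \<Longrightarrow> S \<in> M \<Longrightarrow> T o\<^sub>L S = S o\<^sub>L T"
  by (simp add: commutant_def)

lemma commutant_bounded_ops: "T \<in> commutant M \<Longrightarrow> T \<in> bounded_ops"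
  by (simp add: commutant_def)

lemma commutant_antimono: "M \<subseteq> N \<Longrightarrow> commutant N \<subseteq> commutant M"
  by (auto simp: commutant_def)

lemma subset_bicommutant: "M \<subseteq> bounded_ops \<Longrightarrow> M \<subseteq> commutant (commutant M)"
  by (auto simp: commutant_def)

lemma adj_commutant:
  assumes M: "M \<subseteq> bounded_ops" "\<And>x. x \<in> M \<Longrightarrow> adj x \<in> M" and T: "T \<in> commutant M"
  shows "adj T \<in> commutant M"
proof -
  have "adj T o\<^sub>L S = S o\<^sub>L adj T" if S: "S \<in> M" for S
  proof -
    have Sb: "S \<in> bounded_ops" and Tb: "T \<in> bounded_ops" using S M T by (auto simp: commutant_def)
    have "adj (adj S o\<^sub>L T) = adj (T o\<^sub>L adj S)"
      using commutantD[OF T M(2)[OF S]] by simp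
    then show ?thesis using Sb Tb by simp
  qed
  then show ?thesis using T by (simp add: commutant_def)
qed

lemma von_neumann_algebra_commutant:
  assumes M: "M \<subseteq> bounded_ops" "\<And>x. x \<in> M \<Longrightarrow> adj x \<in> M"
  shows "von_neumann_algebra (commutant M)"
  unfolding von_neumann_algebra_def
proof (intro conjI ballI)
  show b: "commutant M \<subseteq> bounded_ops" by (auto simp: commutant_def)
  show "adj a \<in> commutant M" if "a \<in> commutant M" for a using adj_commutant M that by blast
  show "commutant (commutant (commutant M)) = commutant M"
    by (rule equalityI) (rule commutant_antimono[OF subset_bicommutant[OF M(1)]], rule subset_bicommutant[OF b])
qed

lemma von_neumann_algebra_bicommutant:
  assumes M: "M \<subseteq> bounded_ops" "\<And>x. x \<in> M \<Longrightarrow> adj x \<in> M"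
  shows "von_neumann_algebra (commutant (commutant M))"
  using von_neumann_algebra_commutant adj_commutant M by (metis commutant_bounded_ops subsetI)

lemma von_neumann_algebra_bounded_ops: "von_neumann_algebra (bounded_ops :: 'h::complex_hilbert_space op set)"
proof -
  have "commutant {} = (bounded_ops :: 'h op set)" by (simp add: commutant_def)
  then show ?thesis using von_neumann_algebra_commutant[of "{} :: 'h op set"] by simp
qed

lemma von_neumann_algebra_Inter:
  assumes "\<T> \<noteq> {}" and T: "\<And>A. A \<in> \<T> \<Longrightarrow> von_neumann_algebra A"
  shows "von_neumann_algebra (\<Inter>\<T>)"
proof -
  have b: "\<Inter>\<T> \<subseteq> bounded_ops" using assms unfolding von_neumann_algebra_def by fast
  have "commutant (commutant (\<Inter>\<T>)) \<subseteq> A" if A: "A \<in> \<T>" for A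
  proof -
    have "commutant (commutant (\<Inter>\<T>)) \<subseteq> commutant (commutant A)"
      using A by (intro commutant_antimono) auto
    then show ?thesis using T[OF A] by (simp add: von_neumann_algebra_def)
  qed
  then have "commutant (commutant (\<Inter>\<T>)) \<subseteq> \<Inter>\<T>" by blast
  then show ?thesis
    using b subset_bicommutant[OF b] T by (auto simp: von_neumann_algebra_def)
qed

text \<open>An intersection of von Neumann algebras is one provided the family is nonempty, and here
  it contains \<open>bounded_ops\<close>.\<close>

lemma von_neumann_algebra_hull:
  "M \<subseteq> bounded_ops \<Longrightarrow> von_neumann_algebra (von_neumann_algebra hull M)"
  unfolding hull_def using von_neumann_algebra_bounded_ops
  by (intro von_neumann_algebra_Inter) auto

text \<open>The form in which generation is used: an element of a generated algebra commutes with
  every operator that commutes with the generators, and suitable operators of this kind reveal its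
  matrix entries.\<close>

lemma hull_subset_bicommutant:
  assumes "M \<subseteq> bounded_ops" "\<And>x. x \<in> M \<Longrightarrow> adj x \<in> M"
  shows "von_neumann_algebra hull M \<subseteq> commutant (commutant M)"
  using assms by (intro hull_minimal subset_bicommutant von_neumann_algebra_bicommutant)

locale vn_algebra =
  fixes A :: "'h::complex_hilbert_space op set"
  assumes vna: "von_neumann_algebra A"
begin

lemma bounded [simp]: "a \<in> A \<Longrightarrow> a \<in> bounded_ops"
  using vna by (auto simp: von_neumann_algebra_def)

lemma adj_closed [simp]: "a \<in> A \<Longrightarrow> adj a \<in> A"
  using vna by (auto simp: von_neumann_algebra_def)

lemma mem_iff: "a \<in> A \<longleftrightarrow> a \<in> bounded_ops \<and> (\<forall>S\<in>commutant A. a o\<^sub>L S = S o\<^sub>L a)"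
proof -
  have "commutant (commutant A) = A" using vna unfolding von_neumann_algebra_def by blast
  then show ?thesis unfolding commutant_def[of "commutant A"] by blast
qed

lemma commute_commutant: "a \<in> A \<Longrightarrow> S \<in> commutant A \<Longrightarrow> a o\<^sub>L S = S o\<^sub>L a"
  by (simp add: mem_iff)

lemma closed_simps [simp, intro]:
  "id_blinfun \<in> A" "0 \<in> A"
  "a \<in> A \<Longrightarrow> b \<in> A \<Longrightarrow> a + b \<in> A" "a \<in> A \<Longrightarrow> b \<in> A \<Longrightarrow> a - b \<in> A"
  "a \<in> A \<Longrightarrow> - a \<in> A" "a \<in> A \<Longrightarrow> r *\<^sub>R a \<in> A" "a \<in> A \<Longrightarrow> scale_op c a \<in> A"
  "a \<in> A \<Longrightarrow> b \<in> A \<Longrightarrow> a o\<^sub>L b \<in> A"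
proof -
  show scale: "scale_op c a \<in> A" if "a \<in> A" for c a
    using that by (auto simp: mem_iff scale_op_compose(1) scale_op_compose(2)[OF commutant_bounded_ops])
  show scaleR: "r *\<^sub>R a \<in> A" if "a \<in> A" for r a
    using scale[OF that, of "of_real r"] by (simp add: scale_op_of_real)
  show "- a \<in> A" if "a \<in> A" using scaleR[OF that, of "-1"] by simp
  show "a o\<^sub>L b \<in> A" if "a \<in> A" "b \<in> A"
    using that by (auto simp: mem_iff) (metis blinfun_compose_assoc)
qed (auto simp: mem_iff blinfun_compose_simps)

lemma sum_closed: "(\<And>i. i \<in> I \<Longrightarrow> f i \<in> A) \<Longrightarrow> sum f I \<in> A"
  by (induction I rule: infinite_finite_induct) auto

text \<open>Commutation with a fixed element of the commutant is preserved by weak limits, and such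
  commutations characterise A.\<close>

lemma weak_limit_closed:
  assumes F: "F \<noteq> bot" and X: "\<forall>\<^sub>F i in F. X i \<in> A" and T: "T \<in> bounded_ops"
    and lim: "\<And>x y. ((\<lambda>i. cinner (blinfun_apply (X i) x) y) \<longlongrightarrow> cinner (blinfun_apply T x) y) F"
  shows "T \<in> A"
proof -
  have "T o\<^sub>L S = S o\<^sub>L T" if S: "S \<in> commutant A" for S
  proof (rule op_eqI)
    fix x y
    have "\<forall>\<^sub>F i in F. cinner (X i x) (adj S y) = cinner (X i (S x)) y"
      using X
    proof eventually_elim
      case (elim i)
      have "X i (S x) = S (X i x)"
        using commute_commutant[OF elim S] by (metis blinfun_apply_blinfun_compose)
      then show ?case using commutant_bounded_ops[OF S] by (simp add: cinner_adj_right)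
    qed
    from Lim_transform_eventually[OF lim this]
    have "cinner (T x) (adj S y) = cinner (T (S x)) y" using lim F tendsto_unique by blast
    then show "cinner ((T o\<^sub>L S) x) y = cinner ((S o\<^sub>L T) x) y"
      using commutant_bounded_ops[OF S] by (simp add: cinner_adj_right)
  qed
  then show ?thesis using T by (simp add: mem_iff)
qed

lemma strong_limit_closed:
  assumes X: "\<And>n. X n \<in> A" and T: "T \<in> bounded_ops"
    and lim: "\<And>x. (\<lambda>n. blinfun_apply (X n) x) \<longlonglongrightarrow> blinfun_apply T x"
  shows "T \<in> A"
  by (rule weak_limit_closed[of sequentially X]) (use X T in \<open>auto intro: cinner.tendsto lim\<close>)

lemma resolv_closed [simp]: "a \<in> A \<Longrightarrow> positive_op a \<Longrightarrow> resolv a \<in> A"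
  using resolv_commute[of a] commute_commutant[of a] by (simp add: mem_iff)

text \<open>Along the filter F of sections {y in S. x <= y}, the quadratic forms increase to their
  pointwise suprema; polarization and the uniform bound turn this into a weak limit, which stays in
  A. The explicit quadratic form of s is recorded because it can be restricted to subspaces, in
  contrast to leastness within A.\<close>

lemma directed_supremum:
  assumes S: "S \<noteq> {}" "\<And>x. x \<in> S \<Longrightarrow> x \<in> A \<and> positive_op x"
    and dir: "\<And>x y. x \<in> S \<Longrightarrow> y \<in> S \<Longrightarrow> \<exists>z\<in>S. op_le x z \<and> op_le y z"
    and bound: "\<And>x. x \<in> S \<Longrightarrow> op_le x u"
  shows "\<exists>s\<in>A. positive_op s \<and> (\<forall>x\<in>S. op_le x s)
    \<and> (\<forall>\<xi>. Re (cinner (blinfun_apply s \<xi>) \<xi>) = (SUP x\<in>S. Re (cinner (blinfun_apply x \<xi>) \<xi>)))"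
proof -
  obtain x0 where x0: "x0 \<in> S" using S by blast
  have u: "positive_op u" using S(2)[OF x0] bound[OF x0] positive_op_mono by blast
  define F where "F = (INF x\<in>S. principal {y\<in>S. op_le x y})"
  have base: "\<exists>z\<in>S. principal {w\<in>S. op_le z w}
      \<le> inf (principal {w\<in>S. op_le x w}) (principal {w\<in>S. op_le y w})"
    if "x \<in> S" "y \<in> S" for x y
  proof -
    obtain z where z: "z \<in> S" "op_le x z" "op_le y z" using dir \<open>x \<in> S\<close> \<open>y \<in> S\<close> by blast
    then have "{w\<in>S. op_le z w} \<subseteq> {w\<in>S. op_le x w} \<inter> {w\<in>S. op_le y w}"
      using op_le_trans by blast
    then show ?thesis using z(1) by auto
  qed
  have ev: "eventually P F \<longleftrightarrow> (\<exists>x\<in>S. \<forall>y\<in>S. op_le x y \<longrightarrow> P y)" for P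
    unfolding F_def by (subst eventually_INF_base[OF S(1) base]) (auto simp: eventually_principal)
  have F: "F \<noteq> bot"
  proof
    assume "F = bot"
    then have "\<exists>x\<in>S. \<forall>y\<in>S. op_le x y \<longrightarrow> False" unfolding ev[symmetric] by simp
    then show False using op_le_refl by blast
  qed
  have evS: "\<forall>\<^sub>F x in F. x \<in> S" using x0 by (auto simp: ev)
  have nm: "norm x \<le> norm u" if x: "x \<in> S" for x
    using norm_le_of_op_le[of x "norm u"] S(2)[OF x] bound[OF x]
      self_adjoint_le_norm(1)[of u "norm u"] u positive_op_adj[OF u]
    by (meson norm_ge_zero op_le_trans order_refl positive_op_bounded_ops)
  let ?q = "\<lambda>\<xi>. SUP x\<in>S. Re (cinner (blinfun_apply x \<xi>) \<xi>)"
  have bdd: "bdd_above ((\<lambda>x. Re (cinner (blinfun_apply x \<xi>) \<xi>)) ` S)" for \<xi>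
    using bound op_le_Re by (auto intro!: bdd_aboveI[of _ "Re (cinner (u \<xi>) \<xi>)"])
  have limR: "((\<lambda>x. Re (cinner (blinfun_apply x \<xi>) \<xi>)) \<longlongrightarrow> ?q \<xi>) F" for \<xi>
  proof (rule order_tendstoI)
    fix c assume "c < ?q \<xi>"
    then obtain x where x: "x \<in> S" "c < Re (cinner (blinfun_apply x \<xi>) \<xi>)"
      using less_cSUP_iff[OF S(1) bdd] by blast
    show "\<forall>\<^sub>F x in F. c < Re (cinner (blinfun_apply x \<xi>) \<xi>)"
      unfolding ev using x op_le_Re by (meson less_le_trans)
  next
    fix c assume "?q \<xi> < c"
    moreover have "Re (cinner (blinfun_apply x \<xi>) \<xi>) \<le> ?q \<xi>" if "x \<in> S" for x
      using that by (intro cSUP_upper bdd)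
    ultimately show "\<forall>\<^sub>F x in F. Re (cinner (blinfun_apply x \<xi>) \<xi>) < c"
      unfolding ev using x0 le_less_trans by blast
  qed
  have lim: "((\<lambda>x. cinner (blinfun_apply x \<xi>) \<xi>) \<longlongrightarrow> complex_of_real (?q \<xi>)) F" for \<xi>
  proof (rule Lim_transform_eventually[OF tendsto_of_real[OF limR]])
    show "\<forall>\<^sub>F x in F. complex_of_real (Re (cinner (blinfun_apply x \<xi>) \<xi>)) = cinner (blinfun_apply x \<xi>) \<xi>"
      using evS by eventually_elim (use S(2) in \<open>auto simp: positive_op_iff complex_eq_iff\<close>)
  qed
  have "\<forall>\<^sub>F x in F. x \<in> bounded_ops" using evS by eventually_elim (use S(2) in auto)
  note wl = quadratic_limit_imp_weak_limit[OF this lim]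
  have "\<exists>s\<in>bounded_ops. \<forall>x y. ((\<lambda>i. cinner (blinfun_apply i x) y) \<longlongrightarrow> cinner (blinfun_apply s x) y) F"
  proof (rule weak_limit_op[OF F])
    show "\<forall>\<^sub>F x in F. x \<in> bounded_ops \<and> norm x \<le> norm u"
      using evS by eventually_elim (use S(2) nm in auto)
    show "\<exists>l. ((\<lambda>i. cinner (blinfun_apply i x) y) \<longlongrightarrow> l) F" for x y using wl by blast
  qed
  then obtain s where s: "s \<in> bounded_ops"
    "\<And>x y. ((\<lambda>i. cinner (blinfun_apply i x) y) \<longlongrightarrow> cinner (blinfun_apply s x) y) F" by blast
  have sA: "s \<in> A"
    by (rule weak_limit_closed[OF F _ s]) (use evS S(2) in \<open>auto elim: eventually_mono\<close>)
  have sq: "cinner (s \<xi>) \<xi> = complex_of_real (?q \<xi>)" for \<xi>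
    using tendsto_unique[OF F s(2) lim] .
  have ub: "Re (cinner (blinfun_apply x \<xi>) \<xi>) \<le> ?q \<xi>" if "x \<in> S" for x \<xi>
    using that by (intro cSUP_upper bdd)
  have pos: "positive_op s" unfolding positive_op_iff
    using s(1) sq S(2)[OF x0] ub[OF x0] positive_op_Re[of x0] by (auto intro: order_trans)
  have "op_le x s" if "x \<in> S" for x
    by (rule op_leI) (use S(2)[OF that] ub[OF that] sq pos positive_op_adj in auto)
  then show ?thesis using sA pos sq by (intro bexI[of _ s]) auto
qed

text \<open>Weak convergence to the supremum y becomes strong because ||(y - Y n) \<xi>||^2 <= ||y||
  <(y - Y n) \<xi>, \<xi>> by \<open>norm_apply_positive_op\<close>.\<close>

lemma monotone_sequence_limit:
  assumes Y: "\<And>n. Y n \<in> A" "\<And>n. positive_op (Y n)" "\<And>n. op_le (Y n) (Y (Suc n))"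
    and u: "\<And>n. op_le (Y n) u"
  shows "\<exists>y\<in>A. positive_op y \<and> (\<forall>n. op_le (Y n) y) \<and> op_le y u
    \<and> (\<forall>\<xi>. (\<lambda>n. blinfun_apply (Y n) \<xi>) \<longlonglongrightarrow> blinfun_apply y \<xi>)"
proof -
  have mono: "m \<le> n \<Longrightarrow> op_le (Y m) (Y n)" for m n
    by (induction rule: dec_induct) (auto intro: op_le_trans Y)
  have up: "positive_op u" using Y(2)[of 0] u[of 0] positive_op_mono by blast
  obtain y where y: "y \<in> A" "positive_op y" "\<And>n. op_le (Y n) y"
      "\<And>\<xi>. Re (cinner (blinfun_apply y \<xi>) \<xi>) = (SUP x\<in>range Y. Re (cinner (blinfun_apply x \<xi>) \<xi>))"
  proof -
    have "\<exists>z\<in>range Y. op_le x z \<and> op_le y z" if "x \<in> range Y" "y \<in> range Y" for x y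
    proof -
      obtain m n where "x = Y m" "y = Y n" using \<open>x \<in> range Y\<close> \<open>y \<in> range Y\<close> by blast
      then show ?thesis using mono[of m "max m n"] mono[of n "max m n"] by auto
    qed
    from directed_supremum[OF _ _ this, of u] show thesis using Y u that by blast
  qed
  have le: "Re (cinner (y \<xi>) \<xi>) \<le> Re (cinner (u \<xi>) \<xi>)" for \<xi>
    unfolding y(4) by (rule cSUP_least) (use u op_le_Re in auto)
  have 1: "op_le y u" by (rule op_leI) (use y up positive_op_adj le in auto)
  have lim: "(\<lambda>n. Re (cinner ((y - Y n) \<xi>) \<xi>)) \<longlonglongrightarrow> 0" for \<xi>
  proof -
    have "bdd_above (range (\<lambda>n. Re (cinner (Y n \<xi>) \<xi>)))"
      using u op_le_Re by (auto intro!: bdd_aboveI[of _ "Re (cinner (u \<xi>) \<xi>)"])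
    moreover have "incseq (\<lambda>n. Re (cinner (Y n \<xi>) \<xi>))"
      unfolding incseq_def by (intro allI impI op_le_Re mono)
    ultimately have "(\<lambda>n. Re (cinner (Y n \<xi>) \<xi>)) \<longlonglongrightarrow> (SUP n. Re (cinner (Y n \<xi>) \<xi>))"
      by (rule LIMSEQ_incseq_SUP)
    then have "(\<lambda>n. Re (cinner (Y n \<xi>) \<xi>)) \<longlonglongrightarrow> Re (cinner (y \<xi>) \<xi>)"
      unfolding y(4) by (simp add: image_image)
    from tendsto_diff[OF tendsto_const this, of "Re (cinner (y \<xi>) \<xi>)"]
    show ?thesis by (simp add: blinfun.bilinear_simps cinner.diff_left)
  qed
  have "(\<lambda>n. Y n \<xi>) \<longlonglongrightarrow> y \<xi>" for \<xi>
  proof -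
    have "(norm ((y - Y n) \<xi>))\<^sup>2 \<le> norm y * Re (cinner ((y - Y n) \<xi>) \<xi>)" for n
    proof (rule norm_apply_positive_op)
      show "positive_op (y - Y n)" using y(3) by (simp add: op_le_def)
      have "op_le (y - Y n) y" using Y(2)[of n] by (simp add: op_le_def)
      then show "op_le (y - Y n) (norm y *\<^sub>R id_blinfun)"
        using self_adjoint_le_norm(1)[of y "norm y"] y(2) positive_op_adj op_le_trans by auto
    qed
    moreover have "(\<lambda>n. norm y * Re (cinner ((y - Y n) \<xi>) \<xi>)) \<longlonglongrightarrow> norm y * 0"
      by (intro tendsto_intros lim)
    ultimately have "(\<lambda>n. (norm ((y - Y n) \<xi>))\<^sup>2) \<longlonglongrightarrow> 0"
      by (intro tendsto_sandwich[of "\<lambda>_. 0" "\<lambda>n. (norm ((y - Y n) \<xi>))\<^sup>2"]) auto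
    then have "(\<lambda>n. sqrt ((norm ((y - Y n) \<xi>))\<^sup>2)) \<longlonglongrightarrow> sqrt 0" by (intro tendsto_intros)
    then have "(\<lambda>n. (y - Y n) \<xi>) \<longlonglongrightarrow> 0" by (simp add: tendsto_norm_zero_iff)
    from tendsto_diff[OF tendsto_const this, of "y \<xi>"]
    show ?thesis by (simp add: blinfun.bilinear_simps)
  qed
  then show ?thesis using y 1 by blast
qed

end

text \<open>Split off \<open>Y n (Y n \<xi> - y \<xi>)\<close>, which tends to 0 because the
  operators are uniformly bounded.\<close>

lemma strong_square_limit:
  fixes y :: "'h::complex_hilbert_space op"
  assumes "\<And>n. norm (Y n :: 'h op) \<le> 1" and lim: "\<And>\<xi>. (\<lambda>n. Y n \<xi>) \<longlonglongrightarrow> y \<xi>"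
  shows "(\<lambda>n. Y n (Y n \<xi>)) \<longlonglongrightarrow> y (y \<xi>)"
proof -
  have "(\<lambda>n. Y n (Y n \<xi> - y \<xi>)) \<longlonglongrightarrow> 0"
  proof (rule Lim_null_comparison)
    show "\<forall>\<^sub>F n in sequentially. norm (Y n (Y n \<xi> - y \<xi>)) \<le> norm (Y n \<xi> - y \<xi>)"
      using norm_blinfun_le[OF assms(1)] by auto
    show "(\<lambda>n. norm (Y n \<xi> - y \<xi>)) \<longlonglongrightarrow> 0"
      using tendsto_norm_zero[OF LIM_zero[OF lim]] .
  qed
  from tendsto_add[OF this lim[of "y \<xi>"]] show ?thesis by (simp add: blinfun.bilinear_simps)
qed

text \<open>T commutes with itself, so its bicommutant is contained in its commutant.\<close>

lemma bicommutant_singleton_commute: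
  assumes T: "T \<in> bounded_ops" and x: "x \<in> commutant (commutant {T})" and y: "y \<in> commutant (commutant {T})"
  shows "x o\<^sub>L y = y o\<^sub>L x"
proof -
  have "T \<in> commutant {T}" using T by (simp add: commutant_def)
  then have "y \<in> commutant {T}" using y by (auto simp: commutant_def)
  then show ?thesis using x by (auto simp: commutant_def)
qed

text \<open>The iteration Y' = Y + (T - Y^2)/2 started at 0 increases and stays below 1, and its
  strong limit satisfies T = y^2. All iterates lie in the commutative bicommutant of T, so products
  of positive ones are positive.\<close>

lemma sqrt_exists_contraction:
  fixes T :: "'h::complex_hilbert_space op"
  assumes T: "positive_op T" "op_le T id_blinfun"
  shows "\<exists>S\<in>commutant (commutant {T}). positive_op S \<and> S o\<^sub>L S = T"
proof -
  let ?C = "commutant (commutant {T})"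
  have Tb: "T \<in> bounded_ops" and Ts: "adj T = T" using T positive_op_adj by auto
  interpret C: vn_algebra ?C
    by unfold_locales (rule von_neumann_algebra_bicommutant; use Tb Ts in simp)
  have TC: "T \<in> ?C" using subset_bicommutant[of "{T}"] Tb by auto
  define Y where "Y = rec_nat 0 (\<lambda>_ X. X + (1/2) *\<^sub>R (T - (X o\<^sub>L X)))"
  have Y0: "Y 0 = 0" and YS: "Y (Suc n) = Y n + (1/2) *\<^sub>R (T - (Y n o\<^sub>L Y n))" for n
    unfolding Y_def by simp_all
  have inv: "Y n \<in> ?C \<and> positive_op (Y n) \<and> op_le (Y n) id_blinfun \<and> positive_op (T - (Y n o\<^sub>L Y n))" for n
  proof (induction n)
    case 0
    then show ?case using T TC by (simp add: Y0 blinfun_compose_simps op_le_def)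
  next
    case (Suc n)
    let ?Y = "Y n" and ?D = "T - (Y n o\<^sub>L Y n)"
    have Y: "?Y \<in> ?C" "positive_op ?Y" "positive_op (id_blinfun - ?Y)" and D: "positive_op ?D" "?D \<in> ?C"
      using Suc TC by (auto simp: op_le_def)
    have B: "adj (id_blinfun - ?Y) = id_blinfun - ?Y" "id_blinfun - ?Y \<in> bounded_ops"
      using Y positive_op_adj by auto
    \<comment> \<open>The upper bound is kept because 1 - Y' = (1 - Y)^2 / 2 + (1 - T) / 2.\<close>
    have "positive_op ((1/2) *\<^sub>R (adj (id_blinfun - ?Y) o\<^sub>L (id_blinfun - ?Y)) + (1/2) *\<^sub>R (id_blinfun - T))"
      by (intro positive_op_add positive_op_scaleR positive_op_adj_self B) (use T in \<open>auto simp: op_le_def\<close>)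
    also have "(1/2) *\<^sub>R (adj (id_blinfun - ?Y) o\<^sub>L (id_blinfun - ?Y)) + (1/2) *\<^sub>R (id_blinfun - T)
        = id_blinfun - Y (Suc n)"
      unfolding B(1) YS by (rule blinfun_eqI) (simp add: blinfun.bilinear_simps algebra_simps scaleR_2[symmetric])
    finally have 1: "positive_op (id_blinfun - Y (Suc n))" .
    have 2: "Y (Suc n) \<in> ?C" "positive_op (Y (Suc n))"
      unfolding YS using Y D by auto
    \<comment> \<open>With D = T - Y^2 and Y' = Y + D/2 one has T - Y'^2 = D (1 - Y' + D/4), a
      product of commuting positive operators.\<close>
    let ?E = "(id_blinfun - Y (Suc n)) + (1/4) *\<^sub>R ?D"
    have E: "positive_op ?E" "?E \<in> ?C" using 1 2 D by auto
    have comm: "?Y o\<^sub>L ?D = ?D o\<^sub>L ?Y"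
      by (rule bicommutant_singleton_commute[OF Tb Y(1) D(2)])
    have "positive_op (?D o\<^sub>L ?E)"
      by (rule positive_op_compose[OF D(1) E(1) bicommutant_singleton_commute[OF Tb D(2) E(2)]])
    also have "?D o\<^sub>L ?E = T - (Y (Suc n) o\<^sub>L Y (Suc n))"
    proof -
      define D where "D = ?D"
      have T: "T = D + (?Y o\<^sub>L ?Y)" by (simp add: D_def)
      have c: "?Y (D x) = D (?Y x)" for x using comm unfolding D_def by (metis blinfun_apply_blinfun_compose)
      have "(D o\<^sub>L (id_blinfun - (?Y + (1/2) *\<^sub>R D) + (1/4) *\<^sub>R D))
        = D + (?Y o\<^sub>L ?Y) - ((?Y + (1/2) *\<^sub>R D) o\<^sub>L (?Y + (1/2) *\<^sub>R D))"
      proof (rule blinfun_eqI)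
        fix x
        define e f where "e = (1/4) *\<^sub>R D (D x)" and "f = (1/2) *\<^sub>R D (?Y x)"
        have e: "(1/2) *\<^sub>R D (D x) = e + e" and f: "D (?Y x) = f + f"
          unfolding e_def f_def scaleR_add_left[symmetric] by simp_all
        show "(D o\<^sub>L (id_blinfun - (?Y + (1/2) *\<^sub>R D) + (1/4) *\<^sub>R D)) x
          = (D + (?Y o\<^sub>L ?Y) - ((?Y + (1/2) *\<^sub>R D) o\<^sub>L (?Y + (1/2) *\<^sub>R D))) x"
          by (simp add: blinfun.bilinear_simps c scaleR_add_right e_def[symmetric] f_def[symmetric])
            (simp add: e f)
      qed
      then show ?thesis unfolding YS D_def[symmetric] T[symmetric] by simp
    qed
    finally show ?case using 1 2 by (simp add: op_le_def)
  qed
  have "op_le (Y n) (Y (Suc n))" for n using inv[of n] by (simp add: op_le_def YS)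
  then obtain y where y: "y \<in> ?C" "positive_op y" "\<And>\<xi>. (\<lambda>n. Y n \<xi>) \<longlonglongrightarrow> y \<xi>"
    using C.monotone_sequence_limit[of Y id_blinfun] inv by blast
  have n1: "norm (Y n) \<le> 1" for n using inv[of n] norm_le_of_op_le[of "Y n" 1] by simp
  have "T = y o\<^sub>L y"
  proof (rule blinfun_eqI)
    fix \<xi>
    have "(\<lambda>n. 2 *\<^sub>R (Y (Suc n) \<xi> - Y n \<xi>)) \<longlonglongrightarrow> 2 *\<^sub>R (y \<xi> - y \<xi>)"
      by (intro tendsto_scaleR tendsto_diff tendsto_const LIMSEQ_Suc[OF y(3)] y(3))
    moreover have "2 *\<^sub>R (Y (Suc n) \<xi> - Y n \<xi>) = T \<xi> - Y n (Y n \<xi>)" for n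
      by (simp add: YS blinfun.bilinear_simps)
    ultimately have "(\<lambda>n. T \<xi> - Y n (Y n \<xi>)) \<longlonglongrightarrow> 0" by simp
    moreover have "(\<lambda>n. T \<xi> - Y n (Y n \<xi>)) \<longlonglongrightarrow> T \<xi> - y (y \<xi>)"
      by (intro tendsto_diff tendsto_const strong_square_limit n1 y(3))
    ultimately have "0 = T \<xi> - y (y \<xi>)" by (rule LIMSEQ_unique)
    then show "T \<xi> = (y o\<^sub>L y) \<xi>" by simp
  qed
  then show ?thesis using y by blast
qed

lemma commutant_scaleR: "r \<noteq> 0 \<Longrightarrow> commutant {r *\<^sub>R T} = commutant {T}"
  by (auto simp: commutant_def blinfun_compose_simps)

lemma sqrt_exists:
  fixes T :: "'h::complex_hilbert_space op"
  assumes T: "positive_op T"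
  shows "\<exists>S\<in>commutant (commutant {T}). positive_op S \<and> S o\<^sub>L S = T"
proof -
  define c where "c = 1 / (1 + norm T)"
  have c: "0 < c" "c * norm T \<le> 1"
    unfolding c_def by (simp_all add: add_pos_nonneg field_simps)
  have "op_le (c *\<^sub>R T) id_blinfun"
    using self_adjoint_le_norm(1)[of "c *\<^sub>R T" 1] T c positive_op_adj[of T] by simp
  then obtain S where S: "S \<in> commutant (commutant {c *\<^sub>R T})" "positive_op S" "S o\<^sub>L S = c *\<^sub>R T"
    using sqrt_exists_contraction[of "c *\<^sub>R T"] T c by auto
  have Tb: "T \<in> bounded_ops" "adj T = T" using T positive_op_adj by auto
  interpret C: vn_algebra "commutant (commutant {T})"
    by unfold_locales (rule von_neumann_algebra_bicommutant; use Tb in simp)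
  let ?S = "(1 / sqrt c) *\<^sub>R S"
  have "?S \<in> commutant (commutant {T})" using S(1) c by (simp add: commutant_scaleR)
  moreover have "positive_op ?S" using S c by simp
  moreover have "?S o\<^sub>L ?S = T"
    using c by (simp add: blinfun_compose_simps S(3) real_sqrt_mult_self flip: power2_eq_square)
  ultimately show ?thesis by blast
qed

text \<open>The bicommutant of {T} is contained in A. The commutation clause makes the absolute
  value of a self-adjoint b, the root of b^2, commute with b.\<close>

lemma (in vn_algebra) sqrt_closed:
  assumes "T \<in> A" "positive_op T"
  shows "\<exists>S\<in>A. positive_op S \<and> S o\<^sub>L S = T \<and> (\<forall>R\<in>bounded_ops. R o\<^sub>L T = T o\<^sub>L R \<longrightarrow> R o\<^sub>L S = S o\<^sub>L R)"
proof -
  obtain S where S: "S \<in> commutant (commutant {T})" "positive_op S" "S o\<^sub>L S = T"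
    using sqrt_exists assms by blast
  have "commutant (commutant {T}) \<subseteq> commutant (commutant A)"
    by (intro commutant_antimono) (use assms in blast)
  also have "\<dots> = A" using vna unfolding von_neumann_algebra_def by blast
  finally have "S \<in> A" using S(1) by blast
  moreover have "R o\<^sub>L S = S o\<^sub>L R" if "R \<in> bounded_ops" "R o\<^sub>L T = T o\<^sub>L R" for R
  proof -
    have "R \<in> commutant {T}" unfolding commutant_def using that by blast
    then show ?thesis using commutantD[OF S(1)] by metis
  qed
  ultimately show ?thesis using S by blast
qed

section \<open>Normal positive functionals\<close>

lemma op_le_limit:
  assumes lim: "\<And>\<xi>. (\<lambda>n. blinfun_apply (Y n) \<xi>) \<longlonglongrightarrow> blinfun_apply y \<xi>"
    and Y: "\<And>n. positive_op (Y n)" "\<And>n. op_le (Y n) u" and y: "y \<in> bounded_ops"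
  shows "positive_op y" "op_le y u"
proof -
  have lim': "(\<lambda>n. cinner (Y n \<xi>) \<xi>) \<longlonglongrightarrow> cinner (y \<xi>) \<xi>" for \<xi>
    by (intro cinner.tendsto lim tendsto_const)
  have r: "0 \<le> Re (cinner (y \<xi>) \<xi>)" for \<xi>
    by (rule tendsto_lowerbound[OF tendsto_Re[OF lim']]) (auto intro!: always_eventually positive_op_Re Y)
  have i: "Im (cinner (y \<xi>) \<xi>) = 0" for \<xi>
  proof -
    have "(\<lambda>n. Im (cinner (Y n \<xi>) \<xi>)) = (\<lambda>n. 0)" using Y(1) by (simp add: positive_op_iff)
    then show ?thesis using tendsto_Im[OF lim'[of \<xi>]] LIMSEQ_unique[OF _ tendsto_const] by metis
  qed
  show 1: "positive_op y" using r i y by (simp add: positive_op_iff)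
  have u: "positive_op u" using Y positive_op_mono by blast
  have le: "Re (cinner (y \<xi>) \<xi>) \<le> Re (cinner (u \<xi>) \<xi>)" for \<xi>
    by (rule tendsto_upperbound[OF tendsto_Re[OF lim']]) (auto intro!: always_eventually op_le_Re Y)
  show "op_le y u"
    by (rule op_leI[OF y positive_op_adj[OF 1] positive_op_bounded_ops[OF u] positive_op_adj[OF u] le])
qed

lemma op_le_limit_upper:
  assumes lim: "\<And>\<xi>. (\<lambda>n. blinfun_apply (Y n) \<xi>) \<longlonglongrightarrow> blinfun_apply y \<xi>"
    and Y: "\<And>n. positive_op (Y n)" "\<And>n. op_le (Y n) (Y (Suc n))" and y: "y \<in> bounded_ops"
  shows "positive_op y" "op_le (Y n) y"
proof -
  have mono: "m \<le> n \<Longrightarrow> op_le (Y m) (Y n)" for m n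
    by (induction rule: dec_induct) (auto intro: op_le_trans Y)
  have lim': "(\<lambda>n. cinner (Y n \<xi>) \<xi>) \<longlonglongrightarrow> cinner (y \<xi>) \<xi>" for \<xi>
    by (intro cinner.tendsto lim tendsto_const)
  have i: "Im (cinner (y \<xi>) \<xi>) = 0" for \<xi>
  proof -
    have "(\<lambda>n. Im (cinner (Y n \<xi>) \<xi>)) = (\<lambda>n. 0)" using Y(1) by (simp add: positive_op_iff)
    then show ?thesis using tendsto_Im[OF lim'[of \<xi>]] LIMSEQ_unique[OF _ tendsto_const] by metis
  qed
  have le: "Re (cinner (Y n \<xi>) \<xi>) \<le> Re (cinner (y \<xi>) \<xi>)" for n \<xi>
    by (rule tendsto_lowerbound[OF tendsto_Re[OF lim']])
      (auto intro!: eventually_sequentiallyI[of n] op_le_Re mono)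
  then show 1: "positive_op y"
    using i y order_trans[OF positive_op_Re[OF Y(1)] le] by (auto simp: positive_op_iff)
  show "op_le (Y n) y"
    by (rule op_leI[OF positive_op_bounded_ops[OF Y(1)] positive_op_adj[OF Y(1)] y positive_op_adj[OF 1] le])
qed

text \<open>Only monotone sequences are needed below, so normality is required for sequences only.\<close>

definition normal_positive :: "'h::complex_hilbert_space op set \<Rightarrow> ('h op \<Rightarrow> real) \<Rightarrow> bool" where
  "normal_positive A \<phi> \<longleftrightarrow> (\<forall>x\<in>A. \<forall>y\<in>A. \<phi> (x + y) = \<phi> x + \<phi> y)
     \<and> (\<forall>r. \<forall>x\<in>A. \<phi> (r *\<^sub>R x) = r * \<phi> x)
     \<and> (\<forall>x\<in>A. positive_op x \<longrightarrow> 0 \<le> \<phi> x)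
     \<and> (\<forall>Y y. (\<forall>n. Y n \<in> A \<and> positive_op (Y n) \<and> op_le (Y n) (Y (Suc n))) \<longrightarrow> y \<in> A
          \<longrightarrow> (\<forall>\<xi>. (\<lambda>n. blinfun_apply (Y n) \<xi>) \<longlonglongrightarrow> blinfun_apply y \<xi>) \<longrightarrow> (\<lambda>n. \<phi> (Y n)) \<longlonglongrightarrow> \<phi> y)"

text \<open>This is t/(1 + t) <= t: the difference is T (1 + T)^{-1} T.\<close>

lemma compl_resolv_le:
  assumes T: "positive_op T" shows "op_le (id_blinfun - resolv T) T"
proof -
  have "T - (id_blinfun - resolv T) = T - (T o\<^sub>L resolv T)" using resolv_compl(1)[OF T] by simp
  also have "\<dots> = T o\<^sub>L (id_blinfun - resolv T)" by (simp add: blinfun_compose_simps)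
  also have "\<dots> = adj T o\<^sub>L resolv T o\<^sub>L T"
    unfolding resolv_compl(2)[OF T] positive_op_adj[OF T] by (simp add: blinfun_compose_assoc)
  finally show ?thesis
    using positive_op_conj[of "resolv T" T] T by (simp add: op_le_def)
qed

text \<open>This is t/2 <= t/(1 + t) on [0, 1]: the difference is the product of T with (1 + T)^{-1}
  - 1/2, which is positive since (1 + T)^{-1} decreases in T.\<close>

lemma half_le_compl_resolv:
  assumes T: "positive_op T" "op_le T id_blinfun"
  shows "op_le ((1/2) *\<^sub>R T) (id_blinfun - resolv (T :: 'h::complex_hilbert_space op))"
proof -
  have id2: "resolv id_blinfun = (1/2) *\<^sub>R (id_blinfun :: 'h op)"
  proof (rule blinfun_eqI)
    fix x :: 'h
    have "resolv id_blinfun x + resolv id_blinfun x = x"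
      using resolv_right_apply[of id_blinfun x] by simp
    then have "(1/2) *\<^sub>R (2 *\<^sub>R resolv id_blinfun x) = (1/2) *\<^sub>R x" by (simp add: scaleR_2)
    then show "resolv id_blinfun x = ((1/2) *\<^sub>R (id_blinfun :: 'h op)) x"
      by (simp add: blinfun.bilinear_simps)
  qed
  have p: "positive_op (resolv T - (1/2) *\<^sub>R id_blinfun)"
    using resolv_antimono[OF T(1) _ T(2)] by (simp add: id2 op_le_def)
  have c: "T o\<^sub>L resolv T = resolv T o\<^sub>L T" by (rule resolv_commute[OF T(1)]) simp
  have "positive_op (T o\<^sub>L (resolv T - (1/2) *\<^sub>R id_blinfun))"
    by (rule positive_op_compose[OF T(1) p]) (simp add: blinfun_compose_simps c)
  then show ?thesis
    unfolding op_le_def resolv_compl(1)[OF T(1)] by (simp add: blinfun_compose_simps)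
qed

context vn_algebra
begin

lemma normal_positiveD:
  assumes "normal_positive A \<phi>"
  shows "x \<in> A \<Longrightarrow> y \<in> A \<Longrightarrow> \<phi> (x + y) = \<phi> x + \<phi> y"
    and "x \<in> A \<Longrightarrow> \<phi> (r *\<^sub>R x) = r * \<phi> x"
    and "x \<in> A \<Longrightarrow> positive_op x \<Longrightarrow> 0 \<le> \<phi> x"
    and "\<phi> 0 = 0"
    and "x \<in> A \<Longrightarrow> y \<in> A \<Longrightarrow> \<phi> (x - y) = \<phi> x - \<phi> y"
    and "x \<in> A \<Longrightarrow> y \<in> A \<Longrightarrow> op_le x y \<Longrightarrow> \<phi> x \<le> \<phi> y"
    and "(\<And>n. Y n \<in> A) \<Longrightarrow> (\<And>n. positive_op (Y n)) \<Longrightarrow> (\<And>n. op_le (Y n) (Y (Suc n))) \<Longrightarrow> y \<in> A \<Longrightarrow>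
      (\<And>\<xi>. (\<lambda>n. blinfun_apply (Y n) \<xi>) \<longlonglongrightarrow> blinfun_apply y \<xi>) \<Longrightarrow> (\<lambda>n. \<phi> (Y n)) \<longlonglongrightarrow> \<phi> y"
proof -
  show add: "\<phi> (x + y) = \<phi> x + \<phi> y" if "x \<in> A" "y \<in> A" for x y
    using assms that unfolding normal_positive_def by blast
  show sc: "\<phi> (r *\<^sub>R x) = r * \<phi> x" if "x \<in> A" for r x
    using assms that unfolding normal_positive_def by blast
  show pos: "x \<in> A \<Longrightarrow> positive_op x \<Longrightarrow> 0 \<le> \<phi> x" for x
    using assms unfolding normal_positive_def by blast
  show "\<phi> 0 = 0" using sc[of 0 0] by simp
  show diff: "\<phi> (x - y) = \<phi> x - \<phi> y" if "x \<in> A" "y \<in> A" for x y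
    using add[of "x - y" y] that by simp
  show "x \<in> A \<Longrightarrow> y \<in> A \<Longrightarrow> op_le x y \<Longrightarrow> \<phi> x \<le> \<phi> y"
    using pos[of "y - x"] diff[of y x] by (simp add: op_le_def)
  show "(\<And>n. Y n \<in> A) \<Longrightarrow> (\<And>n. positive_op (Y n)) \<Longrightarrow> (\<And>n. op_le (Y n) (Y (Suc n))) \<Longrightarrow> y \<in> A \<Longrightarrow>
      (\<And>\<xi>. (\<lambda>n. blinfun_apply (Y n) \<xi>) \<longlonglongrightarrow> blinfun_apply y \<xi>) \<Longrightarrow> (\<lambda>n. \<phi> (Y n)) \<longlonglongrightarrow> \<phi> y"
    using assms unfolding normal_positive_def by blast
qed

lemma normal_positive_sum:
  assumes "normal_positive A \<phi>" "\<And>i. i \<in> I \<Longrightarrow> f i \<in> A"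
  shows "\<phi> (sum f I) = (\<Sum>i\<in>I. \<phi> (f i))"
  using assms(2)
proof (induction I rule: infinite_finite_induct)
  case (insert i I)
  then show ?case using normal_positiveD(1)[OF assms(1)] sum_closed[of I f] by simp
qed (use normal_positiveD(4)[OF assms(1)] in simp_all)

text \<open>If \<open>\<omega>(x\<^sub>n) < 2\<^sup>-\<^sup>n\<close> but \<open>\<phi>(x\<^sub>n) \<ge> e\<close>, then the operators
  \<open>1 - (1 + x\<^sub>m + \<dots> + x\<^bsub>m+n\<^esub>)\<inverse>\<close> increase with \<open>n\<close> to some \<open>y\<^sub>m\<close>, and the \<open>y\<^sub>m\<close> decrease to an operator
  on which \<open>\<omega>\<close> vanishes, hence to \<open>0\<close>, although \<open>\<phi>(y\<^sub>m) \<ge> e/2\<close>.\<close>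

lemma normal_positive_absolutely_continuous:
  assumes \<omega>: "normal_positive A \<omega>" and faithful: "\<And>x. x \<in> A \<Longrightarrow> positive_op x \<Longrightarrow> \<omega> x = 0 \<Longrightarrow> x = 0"
    and \<phi>: "normal_positive A \<phi>" and e: "0 < e"
  shows "\<exists>d>0. \<forall>x\<in>A. positive_op x \<and> op_le x id_blinfun \<and> \<omega> x < d \<longrightarrow> \<phi> x < e"
proof (rule ccontr)
  assume neg: "\<not> ?thesis"
  have "\<exists>x\<in>A. positive_op x \<and> op_le x id_blinfun \<and> \<omega> x < (1/2) ^ n \<and> e \<le> \<phi> x" for n
  proof -
    have "(0::real) < (1/2) ^ n" by simp
    then show ?thesis using neg by (meson not_le)
  qed
  then obtain X where X: "X n \<in> A" "positive_op (X n)" "op_le (X n) id_blinfun"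
    "\<omega> (X n) < (1/2) ^ n" "e \<le> \<phi> (X n)" for n
    by metis
  define s where "s m n = (\<Sum>i\<in>{m..<m+n}. X i)" for m n
  have s: "s m n \<in> A" "positive_op (s m n)" for m n
    unfolding s_def using X by (auto intro: sum_closed positive_op_sum)
  have s_Suc: "s m (Suc n) = s m n + X (m + n)" for m n by (simp add: s_def)
  have s_shift: "s m (Suc n) = X m + s (Suc m) n" for m n
    unfolding s_def by (simp add: sum.atLeast_Suc_lessThan)
  have \<omega>s: "\<omega> (s m n) \<le> 2 * (1/2) ^ m" for m n
  proof -
    \<comment> \<open>The subtracted geometric term is what makes the induction on n close.\<close>
    have "\<omega> (s m n) \<le> 2 * (1/2) ^ m - 2 * (1/2) ^ (m + n)"
    proof (induction n)
      case 0
      then show ?case using normal_positiveD(4)[OF \<omega>] by (simp add: s_def)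
    next
      case (Suc n)
      then show ?case
        using X(4)[of "m + n"] normal_positiveD(1)[OF \<omega> s(1) X(1)] by (simp add: s_Suc)
    qed
    then show ?thesis by (smt (verit) zero_le_power divide_nonneg_nonneg)
  qed
  define Y where "Y m n = id_blinfun - resolv (s m n)" for m n
  have Y: "Y m n \<in> A" "positive_op (Y m n)" "op_le (Y m n) id_blinfun" for m n
    unfolding Y_def using s[of m n] resolv_le_id[of "s m n"] by (auto simp: op_le_def)
  have Ymono: "op_le (Y m n) (Y m' n')" if "op_le (s m n) (s m' n')" for m n m' n'
    using resolv_antimono[OF s(2) s(2) that] by (simp add: Y_def op_le_def)
  have Yinc: "op_le (Y m n) (Y m (Suc n))" for m n
    by (rule Ymono) (use X(2) in \<open>simp add: s_Suc op_le_def\<close>)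
  have "\<exists>y\<in>A. positive_op y \<and> (\<forall>n. op_le (Y m n) y) \<and> op_le y id_blinfun
    \<and> (\<forall>\<xi>. (\<lambda>n. blinfun_apply (Y m n) \<xi>) \<longlonglongrightarrow> blinfun_apply y \<xi>)" for m
    by (rule monotone_sequence_limit) (use Y Yinc in auto)
  then obtain y where y: "y m \<in> A" "positive_op (y m)" "op_le (Y m n) (y m)" "op_le (y m) id_blinfun"
    "(\<lambda>n. blinfun_apply (Y m n) \<xi>) \<longlonglongrightarrow> blinfun_apply (y m) \<xi>" for m n \<xi>
    by metis
  have \<omega>y: "\<omega> (y m) \<le> 2 * (1/2) ^ m" for m
  proof (rule tendsto_upperbound)
    show "(\<lambda>n. \<omega> (Y m n)) \<longlonglongrightarrow> \<omega> (y m)"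
      by (rule normal_positiveD(7)[OF \<omega>]) (use Y Yinc y in auto)
    have "\<omega> (Y m n) \<le> \<omega> (s m n)" for n
      using normal_positiveD(6)[OF \<omega> Y(1) s(1)] compl_resolv_le[OF s(2)] by (simp add: Y_def)
    then show "\<forall>\<^sub>F n in sequentially. \<omega> (Y m n) \<le> 2 * (1/2) ^ m"
      using \<omega>s order_trans by (intro always_eventually) blast
  qed simp
  have \<phi>y: "e / 2 \<le> \<phi> (y m)" for m
  proof -
    \<comment> \<open>The sum of n terms starting at m is X m for n = 1, so \<open>Y m 1\<close>
      already dominates half of X m.\<close>
    have "s m 1 = X m" by (simp add: s_def)
    then have "op_le ((1/2) *\<^sub>R X m) (Y m 1)"
      using half_le_compl_resolv[OF X(2,3), of m] by (simp add: Y_def)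
    then have "op_le ((1/2) *\<^sub>R X m) (y m)" using y(3) op_le_trans by blast
    then have "\<phi> ((1/2) *\<^sub>R X m) \<le> \<phi> (y m)"
      using normal_positiveD(6)[OF \<phi>] X(1) y(1) by auto
    then show ?thesis using normal_positiveD(2)[OF \<phi> X(1), of "1/2" m] X(5)[of m] by simp
  qed
  have ydec: "op_le (y (Suc m)) (y m)" for m
  proof (rule op_le_limit(2)[of "Y (Suc m)"])
    fix n
    have "op_le (Y (Suc m) n) (Y m (Suc n))"
      by (rule Ymono) (use X(2) in \<open>simp add: s_shift op_le_def\<close>)
    then show "op_le (Y (Suc m) n) (y m)" using y(3) op_le_trans by blast
  qed (use Y y in auto)
  \<comment> \<open>Normality is formulated for increasing sequences, so the decreasing y m are
    replaced by 1 - y m; their limit z turns out to be 1.\<close>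
  obtain z where z: "z \<in> A" "positive_op z" "\<And>m. op_le (id_blinfun - y m) z" "op_le z id_blinfun"
    "\<And>\<xi>. (\<lambda>m. blinfun_apply (id_blinfun - y m) \<xi>) \<longlonglongrightarrow> blinfun_apply z \<xi>"
    using monotone_sequence_limit[of "\<lambda>m. id_blinfun - y m" id_blinfun] y(1,2,4) ydec
    by (auto simp: op_le_def)
  have "\<omega> (id_blinfun - z) \<le> 2 * (1/2) ^ m" for m
  proof -
    have "op_le (id_blinfun - z) (y m)" using z(3)[of m] by (simp add: op_le_def algebra_simps)
    then have "\<omega> (id_blinfun - z) \<le> \<omega> (y m)" using normal_positiveD(6)[OF \<omega>] z y by auto
    then show ?thesis using \<omega>y order_trans by blast
  qed
  moreover have "(\<lambda>m. 2 * (1/2) ^ m :: real) \<longlonglongrightarrow> 2 * 0"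
    by (intro tendsto_intros LIMSEQ_power_zero) simp
  ultimately have "\<omega> (id_blinfun - z) \<le> 0"
    by (intro tendsto_lowerbound[of "\<lambda>m. 2 * (1/2) ^ m :: real" _ sequentially]) auto
  moreover have "positive_op (id_blinfun - z)" using z(4) by (simp add: op_le_def)
  ultimately have "id_blinfun - z = 0"
    using faithful[of "id_blinfun - z"] normal_positiveD(3)[OF \<omega>, of "id_blinfun - z"] z(1) by auto
  then have zid: "z = id_blinfun" by simp
  have lim: "(\<lambda>m. \<phi> (id_blinfun - y m)) \<longlonglongrightarrow> \<phi> z"
    by (rule normal_positiveD(7)[OF \<phi>]) (use y z ydec in \<open>auto simp: op_le_def\<close>)
  have "\<phi> z \<le> \<phi> id_blinfun - e / 2"
  proof (rule tendsto_upperbound[OF lim])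
    show "\<forall>\<^sub>F m in sequentially. \<phi> (id_blinfun - y m) \<le> \<phi> id_blinfun - e / 2"
      using \<phi>y normal_positiveD(5)[OF \<phi> _ y(1)] by (intro always_eventually) auto
  qed simp
  then show False using e zid by simp
qed

text \<open>Each vector functional is strongly continuous, and Tannery's theorem exchanges limit and
  sum with the majorant ||y|| ||\<xi>_i||^2. Over separating vectors this is a concrete normal
  functional to compare the trace with.\<close>

lemma normal_positive_vector_series:
  assumes s: "summable (\<lambda>i. (norm (\<xi> i))\<^sup>2)"
  shows "normal_positive A (\<lambda>x. \<Sum>i. Re (cinner (blinfun_apply x (\<xi> i)) (\<xi> i)))"
proof -
  have bd: "norm (Re (cinner (blinfun_apply x (\<xi> i)) (\<xi> i))) \<le> norm x * (norm (\<xi> i))\<^sup>2" for x i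
  proof -
    have "norm (Re (cinner (x (\<xi> i)) (\<xi> i))) \<le> norm (x (\<xi> i)) * norm (\<xi> i)"
      using abs_Re_le_cmod cinner_cauchy_schwarz order_trans by (metis real_norm_def)
    also have "\<dots> \<le> (norm x * norm (\<xi> i)) * norm (\<xi> i)"
      by (intro mult_right_mono norm_blinfun) simp
    finally show ?thesis by (simp add: power2_eq_square ac_simps)
  qed
  have sm: "summable (\<lambda>i. Re (cinner (blinfun_apply x (\<xi> i)) (\<xi> i)))" for x
    by (rule summable_comparison_test'[OF summable_mult[OF s, of "norm x"]]) (rule bd)
  show ?thesis unfolding normal_positive_def
  proof (intro conjI ballI allI impI)
    fix x y r
    show "(\<Sum>i. Re (cinner (blinfun_apply (x + y) (\<xi> i)) (\<xi> i))) =
      (\<Sum>i. Re (cinner (blinfun_apply x (\<xi> i)) (\<xi> i))) + (\<Sum>i. Re (cinner (blinfun_apply y (\<xi> i)) (\<xi> i)))"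
      by (simp add: suminf_add[OF sm sm] blinfun.bilinear_simps cinner_add_left)
    show "(\<Sum>i. Re (cinner (blinfun_apply (r *\<^sub>R x) (\<xi> i)) (\<xi> i))) = r * (\<Sum>i. Re (cinner (blinfun_apply x (\<xi> i)) (\<xi> i)))"
      by (simp add: suminf_mult[OF sm] blinfun.bilinear_simps cinner_scaleR_left)
    show "0 \<le> (\<Sum>i. Re (cinner (blinfun_apply x (\<xi> i)) (\<xi> i)))" if "positive_op x"
      using suminf_nonneg[OF sm] positive_op_Re[OF that] by blast
  next
    fix Y y
    assume Y: "\<forall>n. Y n \<in> A \<and> positive_op (Y n) \<and> op_le (Y n) (Y (Suc n))" and y: "y \<in> A"
      and lim: "\<forall>\<xi>. (\<lambda>n. blinfun_apply (Y n) \<xi>) \<longlonglongrightarrow> blinfun_apply y \<xi>"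
    have y': "positive_op y" "\<And>n. op_le (Y n) y"
      using op_le_limit_upper[of Y y] Y y lim by auto
    have nm: "norm (Y n) \<le> norm y" for n
    proof (rule norm_le_of_op_le)
      show "op_le (Y n) (norm y *\<^sub>R id_blinfun)"
        using self_adjoint_le_norm(1)[of y "norm y"] y'(1) positive_op_adj[OF y'(1)] op_le_trans[OF y'(2)] by simp
    qed (use Y in auto)
    show "(\<lambda>n. \<Sum>i. Re (cinner (blinfun_apply (Y n) (\<xi> i)) (\<xi> i))) \<longlonglongrightarrow> (\<Sum>i. Re (cinner (blinfun_apply y (\<xi> i)) (\<xi> i)))"
    proof (rule tannerys_theorem[THEN conjunct2, THEN conjunct2])
      show "(\<lambda>n. Re (cinner (blinfun_apply (Y n) (\<xi> i)) (\<xi> i))) \<longlonglongrightarrow> Re (cinner (blinfun_apply y (\<xi> i)) (\<xi> i))" for i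
        using lim by (intro tendsto_Re cinner.tendsto tendsto_const) blast
      have "norm (Re (cinner (blinfun_apply (Y n) (\<xi> i)) (\<xi> i))) \<le> norm y * (norm (\<xi> i))\<^sup>2" for i n
        using bd[of "Y n" i] nm[of n] by (meson mult_right_mono order_trans zero_le_power2)
      then show "\<forall>\<^sub>F (i, n) in at_top \<times>\<^sub>F sequentially. norm (Re (cinner (blinfun_apply (Y n) (\<xi> i)) (\<xi> i))) \<le> norm y * (norm (\<xi> i))\<^sup>2"
        by (intro always_eventually) auto
      show "summable (\<lambda>i. norm y * (norm (\<xi> i))\<^sup>2)" by (rule summable_mult[OF s])
    qed simp
  qed
qed

lemma normal_positive_vector: "normal_positive A (\<lambda>x. Re (cinner (blinfun_apply x \<xi>) \<xi>))"
proof -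
  let ?\<xi> = "\<lambda>i. if i = (0::nat) then \<xi> else 0"
  have "(\<lambda>x. \<Sum>i. Re (cinner (blinfun_apply x (?\<xi> i)) (?\<xi> i))) = (\<lambda>x. Re (cinner (blinfun_apply x \<xi>) \<xi>))"
    by (rule ext, subst suminf_finite[of "{0}"]) auto
  moreover have "summable (\<lambda>i. (norm (?\<xi> i))\<^sup>2)" by (rule summable_finite[of "{0}"]) auto
  ultimately show ?thesis using normal_positive_vector_series[of ?\<xi>] by simp
qed

end

subsection \<open>Isomorphisms\<close>

locale vn_isomorphism = dom: vn_algebra A + cod: vn_algebra A'
  for A :: "'h::complex_hilbert_space op set" and A' :: "'k::complex_hilbert_space op set" +
  fixes \<theta> :: "'h op \<Rightarrow> 'k op"
  assumes iso: "star_isomorphism A A' \<theta>"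
begin

lemma bij: "bij_betw \<theta> A A'"
  and add [simp]: "x \<in> A \<Longrightarrow> y \<in> A \<Longrightarrow> \<theta> (x + y) = \<theta> x + \<theta> y"
  and mult [simp]: "x \<in> A \<Longrightarrow> y \<in> A \<Longrightarrow> \<theta> (x o\<^sub>L y) = \<theta> x o\<^sub>L \<theta> y"
  and scale [simp]: "x \<in> A \<Longrightarrow> \<theta> (scale_op c x) = scale_op c (\<theta> x)"
  and adjoint [simp]: "x \<in> A \<Longrightarrow> \<theta> (adj x) = adj (\<theta> x)"
  using iso by (auto simp: star_isomorphism_def)

lemma closed [simp]: "x \<in> A \<Longrightarrow> \<theta> x \<in> A'"
  using bij by (auto simp: bij_betw_def)

lemma inject: "x \<in> A \<Longrightarrow> y \<in> A \<Longrightarrow> \<theta> x = \<theta> y \<longleftrightarrow> x = y"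
  using bij by (auto simp: bij_betw_def inj_on_def)

lemma surjE: "y \<in> A' \<Longrightarrow> (\<And>x. x \<in> A \<Longrightarrow> y = \<theta> x \<Longrightarrow> P) \<Longrightarrow> P"
  using bij by (auto simp: bij_betw_def)

lemma scaleR [simp]: "x \<in> A \<Longrightarrow> \<theta> (r *\<^sub>R x) = r *\<^sub>R \<theta> x"
  using scale[of x "of_real r"] by (simp add: scale_op_of_real)

lemma zero [simp]: "\<theta> 0 = 0"
  using scaleR[of 0 0] by simp

lemma diff [simp]: "x \<in> A \<Longrightarrow> y \<in> A \<Longrightarrow> \<theta> (x - y) = \<theta> x - \<theta> y"
  using add[of x "(-1) *\<^sub>R y"] scaleR[of y "-1"] by simp

lemma one [simp]: "\<theta> id_blinfun = id_blinfun"
proof -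
  obtain x where x: "x \<in> A" "id_blinfun = \<theta> x" by (rule surjE[of id_blinfun]) auto
  have "\<theta> id_blinfun = \<theta> id_blinfun o\<^sub>L \<theta> x" by (simp add: x(2)[symmetric] blinfun_compose_simps)
  also have "\<dots> = \<theta> (id_blinfun o\<^sub>L x)" using x(1) by simp
  also have "\<dots> = id_blinfun" by (simp add: x(2) blinfun_compose_simps)
  finally show ?thesis .
qed

text \<open>Positivity is algebraic inside A: a positive element is the square of a self-adjoint
  element of A, and so is its image.\<close>

lemma positive:
  assumes x: "x \<in> A" "positive_op x" shows "positive_op (\<theta> x)"
proof -
  obtain s where s: "s \<in> A" "positive_op s" "s o\<^sub>L s = x"
    using dom.sqrt_closed[OF x] by blast
  then have "\<theta> x = adj (\<theta> s) o\<^sub>L \<theta> s"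
    using positive_op_adj[OF s(2)] adjoint[OF s(1)] mult[OF s(1) s(1)] by simp
  then show ?thesis using s(1) by simp
qed

lemma inv_iso: "vn_isomorphism A' A (inv_into A \<theta>)"
proof
  let ?i = "inv_into A \<theta>"
  have b: "bij_betw ?i A' A" using bij by (rule bij_betw_inv_into)
  have iA: "?i y \<in> A" "\<theta> (?i y) = y" if "y \<in> A'" for y
    using b bij that by (auto simp: bij_betw_def f_inv_into_f)
  have eq: "?i y = x" if "x \<in> A" "\<theta> x = y" for x y
    using that bij by (auto simp: bij_betw_def)
  show "star_isomorphism A' A ?i"
    unfolding star_isomorphism_def using b by (auto intro!: eq simp: iA)
qed

lemma inv_simps [simp]:
  "y \<in> A' \<Longrightarrow> inv_into A \<theta> y \<in> A" "y \<in> A' \<Longrightarrow> \<theta> (inv_into A \<theta> y) = y"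
  "x \<in> A \<Longrightarrow> inv_into A \<theta> (\<theta> x) = x"
  using bij by (auto simp: bij_betw_def f_inv_into_f inv_into_into)

lemma positive_iff: "x \<in> A \<Longrightarrow> positive_op (\<theta> x) \<longleftrightarrow> positive_op x"
  using positive[of x] vn_isomorphism.positive[OF inv_iso, of "\<theta> x"] by auto

lemma op_le_iff: "x \<in> A \<Longrightarrow> y \<in> A \<Longrightarrow> op_le (\<theta> x) (\<theta> y) \<longleftrightarrow> op_le x y"
  using positive_iff[of "y - x"] by (simp add: op_le_def)

text \<open>Continuity is automatic: adj(x) x <= ||x||^2 is an order relation between elements of A
  and survives \<theta>.\<close>

lemma norm_le: assumes x: "x \<in> A" shows "norm (\<theta> x) \<le> norm x"
proof (rule norm_le_of_adj_self_le)
  have "op_le (adj x o\<^sub>L x) ((norm x)\<^sup>2 *\<^sub>R id_blinfun)" by (rule adj_self_le) (use x in auto)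
  then have "op_le (\<theta> (adj x o\<^sub>L x)) (\<theta> ((norm x)\<^sup>2 *\<^sub>R id_blinfun))"
    using x by (subst op_le_iff) auto
  then show "op_le (adj (\<theta> x) o\<^sub>L \<theta> x) ((norm x)\<^sup>2 *\<^sub>R id_blinfun)" using x by simp
qed (use x in auto)

text \<open>Normality is automatic as well: the strong limit w of the images lies in A', hence w =
  \<theta>(x), and x dominates every Y n and so their limit y. Thus w is at least \<theta>(y), and
  it is at most \<theta>(y) because all images are.\<close>

lemma strong_monotone_limit:
  assumes Y: "\<And>n. Y n \<in> A" "\<And>n. positive_op (Y n)" "\<And>n. op_le (Y n) (Y (Suc n))" and y: "y \<in> A"
    and lim: "\<And>\<xi>. (\<lambda>n. blinfun_apply (Y n) \<xi>) \<longlonglongrightarrow> blinfun_apply y \<xi>"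
  shows "(\<lambda>n. blinfun_apply (\<theta> (Y n)) \<xi>) \<longlonglongrightarrow> blinfun_apply (\<theta> y) \<xi>"
proof -
  have y': "positive_op y" "\<And>n. op_le (Y n) y"
    using op_le_limit_upper[OF lim Y(2,3)] y by auto
  obtain w where w: "w \<in> A'" "positive_op w" "\<And>n. op_le (\<theta> (Y n)) w" "op_le w (\<theta> y)"
    "\<And>\<xi>. (\<lambda>n. blinfun_apply (\<theta> (Y n)) \<xi>) \<longlonglongrightarrow> blinfun_apply w \<xi>"
    using cod.monotone_sequence_limit[of "\<lambda>n. \<theta> (Y n)" "\<theta> y"] Y y y'
    by (auto simp: positive_iff op_le_iff)
  obtain x where x: "x \<in> A" "w = \<theta> x" using surjE[OF w(1)] by blast
  have "op_le y x"
    by (rule op_le_limit(2)[OF lim Y(2)]) (use w(3) x Y y in \<open>auto simp: op_le_iff\<close>)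
  then have "op_le (\<theta> y) w" using x y by (simp add: op_le_iff)
  then have "w = \<theta> y" using w(4) op_le_antisym by blast
  then show ?thesis using w(5) by simp
qed

lemma normal_positive_compose:
  assumes "normal_positive A' \<phi>"
  shows "normal_positive A (\<lambda>x. \<phi> (\<theta> x))"
  unfolding normal_positive_def
proof (intro conjI ballI allI impI)
  fix Y y assume Y: "\<forall>n. Y n \<in> A \<and> positive_op (Y n) \<and> op_le (Y n) (Y (Suc n))" and y: "y \<in> A"
      and lim: "\<forall>\<xi>. (\<lambda>n. blinfun_apply (Y n) \<xi>) \<longlonglongrightarrow> blinfun_apply y \<xi>"
  show "(\<lambda>n. \<phi> (\<theta> (Y n))) \<longlonglongrightarrow> \<phi> (\<theta> y)"
    by (rule cod.normal_positiveD(7)[OF assms])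
      (use Y y lim strong_monotone_limit[of Y y] in \<open>auto simp: positive_iff op_le_iff\<close>)
qed (use cod.normal_positiveD[OF assms] positive_iff in auto)

end

subsection \<open>Orthogonal projections\<close>

text \<open>Uniqueness of the orthogonal decomposition makes the nearest-point map linear.\<close>

lemma projection_exists:
  assumes V: "csubspace V" "closed V"
  shows "\<exists>P\<in>bounded_ops. positive_op P \<and> P o\<^sub>L P = P \<and> (\<forall>x. blinfun_apply P x \<in> V)
    \<and> (\<forall>v\<in>V. blinfun_apply P v = (v::'h::complex_hilbert_space))"
proof -
  obtain f where f: "f x \<in> V" "\<And>z. z \<in> V \<Longrightarrow> cinner (x - f x) z = 0" for x
    using orthogonal_decomposition[OF V] by metis
  have uniq: "f x = y" if y: "y \<in> V" "\<And>z. z \<in> V \<Longrightarrow> cinner (x - y) z = 0" for x y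
  proof -
    have z: "y + (-1) *\<^sub>C f x \<in> V" using V(1) y(1) f(1) unfolding csubspace_def by blast
    have "cinner (y - f x) (y + (-1) *\<^sub>C f x) = 0"
      using f(2)[OF z] y(2)[OF z] by (simp add: cinner.diff_left)
    then have "cinner (y - f x) (y - f x) = 0" by (simp add: scaleC.minus_left)
    then show ?thesis by (simp add: cinner_self)
  qed
  have add: "f (x + y) = f x + f y" for x y
  proof (rule uniq)
    show "f x + f y \<in> V" using V(1) f(1) unfolding csubspace_def by blast
    show "cinner (x + y - (f x + f y)) z = 0" if "z \<in> V" for z
      using f(2)[OF that, of x] f(2)[OF that, of y] by (simp add: cinner.diff_left cinner_add_left)
  qed
  have sc: "f (c *\<^sub>C x) = c *\<^sub>C f x" for c x
  proof (rule uniq)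
    show "c *\<^sub>C f x \<in> V" using V(1) f(1) unfolding csubspace_def by blast
    show "cinner (c *\<^sub>C x - c *\<^sub>C f x) z = 0" if "z \<in> V" for z
      using f(2)[OF that, of x] by (simp add: cinner_scaleC_left flip: scaleC.diff_right)
  qed
  have id: "f v = v" if "v \<in> V" for v using that by (intro uniq) auto
  have self: "cinner (f x) x = of_real ((norm (f x))\<^sup>2)" for x
  proof -
    have "cinner (x - f x) (f x) = 0" using f by blast
    then have "cinner x (f x) = of_real ((norm (f x))\<^sup>2)" by (simp add: cinner.diff_left cinner_self)
    then show ?thesis by (metis cinner_commute complex_cnj_complex_of_real)
  qed
  have nm: "norm (f x) \<le> norm x * 1" for x
  proof -
    have "norm (f x) * norm (f x) = cmod (cinner (f x) x)"
      by (simp add: self power2_eq_square norm_mult)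
    also have "\<dots> \<le> norm (f x) * norm x" by (rule cinner_cauchy_schwarz)
    finally show ?thesis by (cases "f x = 0") auto
  qed
  note P = bounded_ops_of_linear[of f, OF add sc nm]
  have "positive_op (Blinfun f)" using P self by (simp add: positive_op_iff)
  moreover have "Blinfun f o\<^sub>L Blinfun f = Blinfun f"
    by (rule blinfun_eqI) (simp add: P(2) id f)
  ultimately show ?thesis using P id f by (intro bexI[of _ "Blinfun f"]) auto
qed

text \<open>Invariance under w gives P w P = w P; invariance under its adjoint gives P w P = P w
  after taking adjoints.\<close>

lemma projection_commute:
  assumes P: "positive_op P" "\<And>x. blinfun_apply P x \<in> V" "\<And>v. v \<in> V \<Longrightarrow> blinfun_apply P v = v"
    and w: "w \<in> bounded_ops" "\<And>v. v \<in> V \<Longrightarrow> blinfun_apply w v \<in> V" "\<And>v. v \<in> V \<Longrightarrow> blinfun_apply (adj w) v \<in> V"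
  shows "P o\<^sub>L w = w o\<^sub>L P"
proof -
  have 1: "P o\<^sub>L w o\<^sub>L P = w o\<^sub>L P" by (rule blinfun_eqI) (simp add: P w)
  have "P o\<^sub>L adj w o\<^sub>L P = adj w o\<^sub>L P" by (rule blinfun_eqI) (simp add: P w)
  then have "adj (P o\<^sub>L adj w o\<^sub>L P) = adj (adj w o\<^sub>L P)" by simp
  then have "P o\<^sub>L (w o\<^sub>L P) = P o\<^sub>L w" using P(1) w(1) positive_op_adj[OF P(1)] by simp
  then show ?thesis using 1 by (simp add: blinfun_compose_assoc)
qed

definition closed_cspan :: "'h::complex_hilbert_space set \<Rightarrow> 'h set" where
  "closed_cspan G = \<Inter>{V. csubspace V \<and> closed V \<and> G \<subseteq> V}"

lemma closed_cspan_props: "csubspace (closed_cspan G)" "closed (closed_cspan G)" "G \<subseteq> closed_cspan G"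
proof -
  show "csubspace (closed_cspan G)" unfolding closed_cspan_def csubspace_def by blast
  show "closed (closed_cspan G)" unfolding closed_cspan_def by (rule closed_Inter) blast
qed (auto simp: closed_cspan_def)

lemma closed_cspan_minimal: "csubspace V \<Longrightarrow> closed V \<Longrightarrow> G \<subseteq> V \<Longrightarrow> closed_cspan G \<subseteq> V"
  by (auto simp: closed_cspan_def)

lemma closed_csubspace_vimage:
  assumes w: "w \<in> bounded_ops" and V: "csubspace V" "closed V"
  shows "csubspace {v. blinfun_apply w v \<in> V}" "closed {v. blinfun_apply w v \<in> V}"
proof -
  show "csubspace {v. blinfun_apply w v \<in> V}"
    using V(1) by (auto simp: csubspace_def blinfun.bilinear_simps bounded_ops_scaleC[OF w])
  have "closed (blinfun_apply w -` V)"
    by (intro closed_vimage V linear_continuous_on blinfun.bounded_linear_right)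
  then show "closed {v. blinfun_apply w v \<in> V}" by (simp add: vimage_def)
qed

lemma closed_cspan_invariant:
  assumes w: "w \<in> bounded_ops" and G: "\<And>g. g \<in> G \<Longrightarrow> blinfun_apply w g \<in> closed_cspan G"
    and v: "v \<in> closed_cspan G"
  shows "blinfun_apply w v \<in> closed_cspan G"
proof -
  have "closed_cspan G \<subseteq> {v. blinfun_apply w v \<in> closed_cspan G}"
    by (rule closed_cspan_minimal)
      (use closed_csubspace_vimage[OF w closed_cspan_props(1,2), of G] G in auto)
  then show ?thesis using v by blast
qed

lemma closed_cspan_kernel:
  assumes x: "x \<in> bounded_ops" and G: "\<And>g. g \<in> G \<Longrightarrow> blinfun_apply x g = 0"
    and v: "v \<in> closed_cspan G"
  shows "blinfun_apply x v = 0"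
proof -
  have "csubspace {0 :: 'a}" by (simp add: csubspace_def scaleC.zero_right)
  then have "closed_cspan G \<subseteq> {v. blinfun_apply x v \<in> {0}}"
    by (intro closed_cspan_minimal closed_csubspace_vimage[OF x]) (use G in auto)
  then show ?thesis using v by blast
qed

section \<open>Faithful normal traces\<close>

context vn_algebra
begin

text \<open>Absolute continuity speaks of contractions; dividing by |K| + 1, which is positive
  whatever K is, extends it to uniformly bounded positive families along any filter.\<close>

lemma normal_positive_tendsto:
  assumes \<omega>: "normal_positive A \<omega>" and faithful: "\<And>x. x \<in> A \<Longrightarrow> positive_op x \<Longrightarrow> \<omega> x = 0 \<Longrightarrow> x = 0"
    and \<phi>: "normal_positive A \<phi>"
    and X: "\<forall>\<^sub>F i in F. X i \<in> A \<and> positive_op (X i) \<and> op_le (X i) (K *\<^sub>R id_blinfun)"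
    and lim: "((\<lambda>i. \<omega> (X i)) \<longlongrightarrow> 0) F"
  shows "((\<lambda>i. \<phi> (X i)) \<longlongrightarrow> 0) F"
proof (rule tendstoI)
  fix e :: real assume e: "0 < e"
  define K' where "K' = \<bar>K\<bar> + 1"
  have K': "0 < K'" "K \<le> K'" by (auto simp: K'_def)
  obtain d where d: "0 < d" "\<And>x. x \<in> A \<Longrightarrow> positive_op x \<Longrightarrow> op_le x id_blinfun \<Longrightarrow> \<omega> x < d \<Longrightarrow> \<phi> x < e / K'"
  proof -
    have "0 < e / K'" using e K' by simp
    from normal_positive_absolutely_continuous[OF \<omega> _ \<phi> this] faithful
    obtain d where "0 < d" "\<forall>x\<in>A. positive_op x \<and> op_le x id_blinfun \<and> \<omega> x < d \<longrightarrow> \<phi> x < e / K'"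
      by blast
    then show thesis using that by blast
  qed
  have "\<forall>\<^sub>F i in F. dist (\<omega> (X i)) 0 < d * K'" by (rule tendstoD[OF lim]) (use d K' in simp)
  then show "\<forall>\<^sub>F i in F. dist (\<phi> (X i)) 0 < e"
    using X
  proof eventually_elim
    case (elim i)
    let ?x = "(1 / K') *\<^sub>R X i"
    have x: "?x \<in> A" "positive_op ?x" using elim K' by auto
    have "op_le (K *\<^sub>R id_blinfun) (K' *\<^sub>R id_blinfun)"
      using K' by (simp add: op_le_def flip: scaleR_diff_left)
    then have "op_le (X i) (K' *\<^sub>R id_blinfun)" using elim op_le_trans by blast
    from op_le_scaleR[OF this, of "1 / K'"] have "op_le ?x id_blinfun" using K' by simp
    moreover have "\<omega> ?x < d"
    proof -
      have "\<omega> ?x = \<omega> (X i) / K'" using normal_positiveD(2)[OF \<omega>, of "X i" "1 / K'"] elim by simp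
      then show ?thesis using elim K' by (simp add: divide_less_eq)
    qed
    ultimately have "\<phi> ?x < e / K'" using d x by blast
    moreover have "\<phi> ?x = \<phi> (X i) / K'" using normal_positiveD(2)[OF \<phi>, of "X i" "1 / K'"] elim by simp
    ultimately have "\<phi> (X i) < e" using K' by (simp add: divide_less_cancel)
    then show ?case using normal_positiveD(3)[OF \<phi>, of "X i"] elim by simp
  qed
qed

end

locale tracial_algebra = vn_algebra A for A :: "'a::complex_hilbert_space op set" +
  fixes \<tau> :: "'a op \<Rightarrow> complex"
  assumes trace: "faithful_normal_trace A \<tau>"
begin

lemma tr_add [simp]: "x \<in> A \<Longrightarrow> y \<in> A \<Longrightarrow> \<tau> (x + y) = \<tau> x + \<tau> y"
  and tr_scale [simp]: "x \<in> A \<Longrightarrow> \<tau> (scale_op c x) = c * \<tau> x"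
  using trace by (auto simp: faithful_normal_trace_def linear_functional_on_def)

lemma tr_comm: "x \<in> A \<Longrightarrow> y \<in> A \<Longrightarrow> \<tau> (x o\<^sub>L y) = \<tau> (y o\<^sub>L x)"
  using trace by (auto simp: faithful_normal_trace_def)

lemma tr_faithful: "x \<in> A \<Longrightarrow> \<tau> (adj x o\<^sub>L x) = 0 \<Longrightarrow> x = 0"
  using trace by (auto simp: faithful_normal_trace_def)

lemma tr_scaleR [simp]: "x \<in> A \<Longrightarrow> \<tau> (r *\<^sub>R x) = of_real r * \<tau> x"
  using tr_scale[of x "of_real r"] by (simp add: scale_op_of_real)

lemma tr_zero [simp]: "\<tau> 0 = 0"
  using tr_scaleR[of 0 0] by simp

lemma tr_uminus [simp]: "x \<in> A \<Longrightarrow> \<tau> (- x) = - \<tau> x"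
  using tr_scaleR[of x "-1"] by simp

lemma tr_diff [simp]: "x \<in> A \<Longrightarrow> y \<in> A \<Longrightarrow> \<tau> (x - y) = \<tau> x - \<tau> y"
  using tr_add[of x "- y"] by simp

lemma tr_positive: "x \<in> A \<Longrightarrow> positive_op x \<Longrightarrow> 0 \<le> Re (\<tau> x)"
  "x \<in> A \<Longrightarrow> positive_op x \<Longrightarrow> Im (\<tau> x) = 0"
  using trace by (auto simp: faithful_normal_trace_def complex_nonneg_Reals_iff)

lemma tr_adj_self: "x \<in> A \<Longrightarrow> 0 \<le> Re (\<tau> (adj x o\<^sub>L x))" "x \<in> A \<Longrightarrow> Im (\<tau> (adj x o\<^sub>L x)) = 0"
  by (rule tr_positive; simp)+

lemma tr_form_expand:
  assumes "x \<in> A" "y \<in> A"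
  shows "\<tau> (adj (scale_op c x + y) o\<^sub>L (scale_op c x + y))
    = \<tau> (adj y o\<^sub>L y) + (c * \<tau> (adj y o\<^sub>L x) + cnj c * \<tau> (adj x o\<^sub>L y)) + of_real ((cmod c)\<^sup>2) * \<tau> (adj x o\<^sub>L x)"
proof -
  have "adj (scale_op c x + y) o\<^sub>L (scale_op c x + y)
    = scale_op (cnj c * c) (adj x o\<^sub>L x) + scale_op (cnj c) (adj x o\<^sub>L y) + scale_op c (adj y o\<^sub>L x) + (adj y o\<^sub>L y)"
    using assms by (intro blinfun_eqI)
      (simp add: blinfun.bilinear_simps bounded_ops_scaleC[OF adj_bounded_ops[OF bounded]] scaleC_add_right scaleC_scaleC ac_simps)
  moreover have "cnj c * c = of_real ((cmod c)\<^sup>2)" by (metis complex_norm_square mult.commute)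
  ultimately show ?thesis using assms by simp
qed

text \<open>The expansion of the square of c x + y has real trace for every c; c = 1 and c = \<i>
  determine the imaginary and the real part.\<close>

lemma tr_form_hermitian:
  assumes "x \<in> A" "y \<in> A"
  shows "\<tau> (adj x o\<^sub>L y) = cnj (\<tau> (adj y o\<^sub>L x))"
proof -
  have im: "Im (c * \<tau> (adj y o\<^sub>L x) + cnj c * \<tau> (adj x o\<^sub>L y)) = 0" for c
    using arg_cong[OF tr_form_expand[OF assms, of c], of Im] tr_adj_self(2)[of "scale_op c x + y"]
      tr_adj_self(2)[of x] tr_adj_self(2)[of y] assms by simp
  show ?thesis using im[of 1] im[of "\<i>"] by (simp add: complex_eq_iff)
qed

lemma tr_adj: "x \<in> A \<Longrightarrow> \<tau> (adj x) = cnj (\<tau> x)"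
  using tr_form_hermitian[of x id_blinfun] by (simp add: blinfun_compose_simps)

lemma tr_cauchy_schwarz_sq:
  assumes "x \<in> A" "y \<in> A"
  shows "(cmod (\<tau> (adj y o\<^sub>L x)))\<^sup>2 \<le> Re (\<tau> (adj y o\<^sub>L y)) * Re (\<tau> (adj x o\<^sub>L x))"
proof (rule nonneg_quadratic_imp_cauchy_schwarz)
  fix c
  show "0 \<le> Re (\<tau> (adj y o\<^sub>L y)) + 2 * Re (c * \<tau> (adj y o\<^sub>L x)) + (cmod c)\<^sup>2 * Re (\<tau> (adj x o\<^sub>L x))"
    using tr_adj_self(1)[of "scale_op c x + y"] assms
    unfolding tr_form_expand[OF assms] tr_form_hermitian[OF assms] by simp
qed (use tr_adj_self assms in auto)

lemma norm2_nonneg [simp]: "x \<in> A \<Longrightarrow> 0 \<le> norm2 \<tau> x"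
  by (simp add: norm2_def tr_adj_self)

lemma norm2_sq: "x \<in> A \<Longrightarrow> (norm2 \<tau> x)\<^sup>2 = Re (\<tau> (adj x o\<^sub>L x))"
  by (simp add: norm2_def tr_adj_self)

lemma tr_adj_self_eq: "x \<in> A \<Longrightarrow> \<tau> (adj x o\<^sub>L x) = of_real ((norm2 \<tau> x)\<^sup>2)"
  using tr_adj_self(2) by (simp add: norm2_sq complex_eq_iff del: of_real_power)

lemma norm2_zero [simp]: "norm2 \<tau> 0 = 0"
  by (simp add: norm2_def blinfun_compose_simps)

lemma norm2_eq_0: "x \<in> A \<Longrightarrow> norm2 \<tau> x = 0 \<longleftrightarrow> x = 0"
  using tr_faithful[of x] tr_adj_self_eq[of x] by auto

lemma norm2_adj: "x \<in> A \<Longrightarrow> norm2 \<tau> (adj x) = norm2 \<tau> x"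
  using tr_comm[of x "adj x"] by (simp add: norm2_def)

lemma tr_cauchy_schwarz:
  assumes "x \<in> A" "y \<in> A"
  shows "cmod (\<tau> (x o\<^sub>L y)) \<le> norm2 \<tau> x * norm2 \<tau> y"
proof -
  have "(cmod (\<tau> (adj (adj x) o\<^sub>L y)))\<^sup>2 \<le> Re (\<tau> (adj (adj x) o\<^sub>L adj x)) * Re (\<tau> (adj y o\<^sub>L y))"
    by (rule tr_cauchy_schwarz_sq) (use assms in auto)
  then have "(cmod (\<tau> (x o\<^sub>L y)))\<^sup>2 \<le> (norm2 \<tau> x * norm2 \<tau> y)\<^sup>2"
    using assms norm2_sq[of "adj x"] norm2_sq[of y] by (simp add: power_mult_distrib norm2_adj)
  then show ?thesis using assms by (simp add: power2_le_iff_abs_le)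
qed

lemma tr_le_norm2: "x \<in> A \<Longrightarrow> cmod (\<tau> x) \<le> norm2 \<tau> x * norm2 \<tau> id_blinfun"
  using tr_cauchy_schwarz[of x id_blinfun] by (simp add: blinfun_compose_simps)

lemma norm2_scale: "x \<in> A \<Longrightarrow> norm2 \<tau> (scale_op c x) = cmod c * norm2 \<tau> x"
  using tr_form_expand[of x 0 c]
  by (simp add: norm2_def blinfun_compose_simps real_sqrt_mult)

lemma norm2_scaleR: "x \<in> A \<Longrightarrow> norm2 \<tau> (r *\<^sub>R x) = \<bar>r\<bar> * norm2 \<tau> x"
  using norm2_scale[of x "of_real r"] by (simp add: scale_op_of_real)

lemma norm2_triangle:
  assumes "x \<in> A" "y \<in> A" shows "norm2 \<tau> (x + y) \<le> norm2 \<tau> x + norm2 \<tau> y"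
proof -
  have s1: "scale_op 1 x = x" by (rule blinfun_eqI) simp
  have "Re (\<tau> (adj y o\<^sub>L x)) \<le> norm2 \<tau> y * norm2 \<tau> x"
    using tr_cauchy_schwarz[of "adj y" x] complex_Re_le_cmod assms norm2_adj
    by (metis adj_closed order_trans)
  moreover have "(norm2 \<tau> (x + y))\<^sup>2 = (norm2 \<tau> y)\<^sup>2 + 2 * Re (\<tau> (adj y o\<^sub>L x)) + (norm2 \<tau> x)\<^sup>2"
    using arg_cong[OF tr_form_expand[OF assms, of 1], of Re] assms
    unfolding s1 tr_form_hermitian[OF assms] by (simp add: norm2_sq)
  ultimately have "(norm2 \<tau> (x + y))\<^sup>2 \<le> (norm2 \<tau> x + norm2 \<tau> y)\<^sup>2"
    by (simp add: power2_sum ac_simps)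
  then show ?thesis using assms by (simp add: power2_le_iff_abs_le)
qed

lemma norm2_compose_left:
  assumes "x \<in> A" "y \<in> A" shows "norm2 \<tau> (x o\<^sub>L y) \<le> norm x * norm2 \<tau> y"
proof -
  have "op_le (adj x o\<^sub>L x) ((norm x)\<^sup>2 *\<^sub>R id_blinfun)" by (rule adj_self_le) (use assms in auto)
  from positive_op_conj[OF positive_op_diff[OF this], of y]
  have "positive_op (((norm x)\<^sup>2 *\<^sub>R (adj y o\<^sub>L y)) - (adj (x o\<^sub>L y) o\<^sub>L (x o\<^sub>L y)))"
    using assms by (simp add: blinfun_compose_simps blinfun_compose_assoc)
  then have "0 \<le> Re (\<tau> (((norm x)\<^sup>2 *\<^sub>R (adj y o\<^sub>L y)) - (adj (x o\<^sub>L y) o\<^sub>L (x o\<^sub>L y))))"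
    using assms by (intro tr_positive) auto
  also have "\<dots> = (norm x)\<^sup>2 * Re (\<tau> (adj y o\<^sub>L y)) - Re (\<tau> (adj (x o\<^sub>L y) o\<^sub>L (x o\<^sub>L y)))"
    using assms by (subst tr_diff) (auto simp del: adj_compose)
  finally have "(norm2 \<tau> (x o\<^sub>L y))\<^sup>2 \<le> (norm x * norm2 \<tau> y)\<^sup>2"
    using assms by (simp add: norm2_sq power_mult_distrib)
  then show ?thesis using assms by (simp add: power2_le_iff_abs_le)
qed

lemma norm2_compose_right:
  assumes "x \<in> A" "y \<in> A" shows "norm2 \<tau> (x o\<^sub>L y) \<le> norm2 \<tau> x * norm y"
  using norm2_compose_left[of "adj y" "adj x"] norm2_adj[of "x o\<^sub>L y"] norm2_adj[of x] assms
    norm_adj[of y] by (simp add: mult.commute)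

lemma norm2_le_norm: "x \<in> A \<Longrightarrow> norm2 \<tau> x \<le> norm x * norm2 \<tau> id_blinfun"
  using norm2_compose_left[of x id_blinfun] by (simp add: blinfun_compose_simps)

text \<open>The product need not be positive, but with s the root of x its trace equals that of s y
  s.\<close>

lemma tr_product_positive:
  assumes "x \<in> A" "positive_op x" "y \<in> A" "positive_op y"
  shows "0 \<le> Re (\<tau> (x o\<^sub>L y))"
proof -
  obtain s where s: "s \<in> A" "positive_op s" "s o\<^sub>L s = x"
    using sqrt_closed assms by blast
  have "\<tau> (x o\<^sub>L y) = \<tau> (s o\<^sub>L (y o\<^sub>L s))"
    using tr_comm[of s "s o\<^sub>L y"] s assms by (simp add: s(3)[symmetric] blinfun_compose_assoc)
  also have "s o\<^sub>L (y o\<^sub>L s) = adj s o\<^sub>L y o\<^sub>L s" using positive_op_adj[OF s(2)] by (simp add: blinfun_compose_assoc)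
  finally show ?thesis using s assms positive_op_conj[of y s] by (simp add: tr_positive)
qed

text \<open>The range of an increasing sequence is directed and its strong limit is its least upper
  bound, so normality in terms of suprema applies.\<close>

lemma normal_positive_trace: "normal_positive A (\<lambda>x. Re (\<tau> x))"
  unfolding normal_positive_def
proof (intro conjI ballI allI impI)
  fix Y y assume Y: "\<forall>n. Y n \<in> A \<and> positive_op (Y n) \<and> op_le (Y n) (Y (Suc n))" and y: "y \<in> A"
      and lim: "\<forall>\<xi>. (\<lambda>n. blinfun_apply (Y n) \<xi>) \<longlonglongrightarrow> blinfun_apply y \<xi>"
  have y': "positive_op y" "\<And>n. op_le (Y n) y"
    using op_le_limit_upper[of Y y] Y y lim by auto
  have mono: "m \<le> n \<Longrightarrow> op_le (Y m) (Y n)" for m n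
    by (induction rule: dec_induct) (use Y op_le_trans in auto)
  have le: "Re (\<tau> (Y m)) \<le> Re (\<tau> x)" if "x \<in> A" "op_le (Y m) x" for m x
    using tr_positive(1)[of "x - Y m"] that Y by (simp add: op_le_def)
  have "Re (\<tau> y) = (SUP x\<in>range Y. Re (\<tau> x))"
  proof -
    have 1: "\<exists>z\<in>range Y. op_le x z \<and> op_le x' z" if "x \<in> range Y" "x' \<in> range Y" for x x'
    proof -
      obtain m n where "x = Y m" "x' = Y n" using \<open>x \<in> range Y\<close> \<open>x' \<in> range Y\<close> by blast
      then show ?thesis using mono[of m "max m n"] mono[of n "max m n"] by auto
    qed
    have 2: "op_le y u" if "\<forall>x\<in>range Y. op_le x u" for u
      by (rule op_le_limit(2)[of Y]) (use lim Y y that in auto)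
    have 3: "range Y \<noteq> {}" "\<forall>x\<in>range Y. x \<in> A \<and> positive_op x" "\<forall>x\<in>range Y. op_le x y"
      using Y y'(2) by auto
    have "normal_on A \<tau>" using trace unfolding faithful_normal_trace_def by blast
    then show ?thesis
      by (intro mp[OF spec[OF spec[OF iffD1[OF normal_on_def]]]] conjI ballI impI)
        (use 1 2 3 y in auto)
  qed
  moreover have "(\<lambda>n. Re (\<tau> (Y n))) \<longlonglongrightarrow> (SUP n. Re (\<tau> (Y n)))"
  proof (rule LIMSEQ_incseq_SUP)
    show "bdd_above (range (\<lambda>n. Re (\<tau> (Y n))))"
      using le[OF y y'(2)] by (auto intro!: bdd_aboveI[of _ "Re (\<tau> y)"])
    show "incseq (\<lambda>n. Re (\<tau> (Y n)))" unfolding incseq_def using le mono Y by blast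
  qed
  ultimately show "(\<lambda>n. Re (\<tau> (Y n))) \<longlonglongrightarrow> Re (\<tau> y)" by (simp add: image_image)
qed (use tr_positive in auto)

lemma trace_faithful_positive:
  assumes "x \<in> A" "positive_op x" "Re (\<tau> x) = 0" shows "x = 0"
proof -
  obtain s where s: "s \<in> A" "positive_op s" "s o\<^sub>L s = x"
    using sqrt_closed assms by blast
  then have "\<tau> (adj s o\<^sub>L s) = 0"
    using positive_op_adj[OF s(2)] assms tr_positive(2)[of x] by (simp add: complex_eq_iff)
  then have "s = 0" using s(1) tr_faithful by blast
  then show ?thesis using s(3) by (simp add: blinfun_compose_simps)
qed

lemma tr_mono: "x \<in> A \<Longrightarrow> y \<in> A \<Longrightarrow> op_le x y \<Longrightarrow> Re (\<tau> x) \<le> Re (\<tau> y)"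
  using normal_positiveD(6)[OF normal_positive_trace] .

lemma norm2_tendsto_normal_positive:
  assumes X: "\<forall>\<^sub>F i in F. X i \<in> A \<and> norm (X i) \<le> K" and lim: "((\<lambda>i. norm2 \<tau> (X i)) \<longlongrightarrow> 0) F"
    and \<phi>: "normal_positive A \<phi>"
  shows "((\<lambda>i. \<phi> (adj (X i) o\<^sub>L X i)) \<longlongrightarrow> 0) F"
proof (rule normal_positive_tendsto[OF normal_positive_trace trace_faithful_positive \<phi>])
  show "\<forall>\<^sub>F i in F. adj (X i) o\<^sub>L X i \<in> A \<and> positive_op (adj (X i) o\<^sub>L X i)
      \<and> op_le (adj (X i) o\<^sub>L X i) (K\<^sup>2 *\<^sub>R id_blinfun)"
    using X by eventually_elim (auto intro: adj_self_le)
  show "((\<lambda>i. Re (\<tau> (adj (X i) o\<^sub>L X i))) \<longlongrightarrow> 0) F"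
  proof (rule Lim_transform_eventually)
    show "((\<lambda>i. (norm2 \<tau> (X i))\<^sup>2) \<longlongrightarrow> 0) F" using tendsto_power[OF lim, of 2] by simp
    show "\<forall>\<^sub>F i in F. (norm2 \<tau> (X i))\<^sup>2 = Re (\<tau> (adj (X i) o\<^sub>L X i))"
      using X by eventually_elim (simp add: norm2_sq)
  qed
qed

text \<open>Vector functionals are normal, hence absolutely continuous with respect to the faithful
  trace on bounded sets.\<close>

lemma norm2_tendsto_strong:
  assumes X: "\<forall>\<^sub>F i in F. X i \<in> A \<and> norm (X i) \<le> K" and lim: "((\<lambda>i. norm2 \<tau> (X i)) \<longlongrightarrow> 0) F"
  shows "((\<lambda>i. blinfun_apply (X i) \<xi>) \<longlongrightarrow> 0) F"
proof -
  have "((\<lambda>i. Re (cinner ((adj (X i) o\<^sub>L X i) \<xi>) \<xi>)) \<longlongrightarrow> 0) F"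
    by (rule norm2_tendsto_normal_positive[OF X lim normal_positive_vector])
  moreover have "\<forall>\<^sub>F i in F. Re (cinner ((adj (X i) o\<^sub>L X i) \<xi>) \<xi>) = (norm (X i \<xi>))\<^sup>2"
    using X by eventually_elim (simp only: norm_adj_compose_self[OF bounded] Re_complex_of_real)
  ultimately have "((\<lambda>i. (norm (X i \<xi>))\<^sup>2) \<longlongrightarrow> 0) F" by (rule Lim_transform_eventually)
  then have "((\<lambda>i. sqrt ((norm (X i \<xi>))\<^sup>2)) \<longlongrightarrow> sqrt 0) F" by (intro tendsto_intros)
  then show ?thesis by (simp add: tendsto_norm_zero_iff)
qed

subsection \<open>A separating sequence of vectors\<close>

text \<open>For a sequence S, the projection p S onto the closed span of the commutant applied to S
  lies in A. Merging countably many sequences of nearly maximal trace gives one of maximal trace M.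
  Prepending any further vector \<eta> cannot raise the trace, hence by faithfulness not the
  projection either, so \<eta> was already in its range. A sequence that is cyclic for the commutant
  separates A.\<close>

lemma separating_sequence:
  "\<exists>\<xi> :: nat \<Rightarrow> 'a. \<forall>x\<in>A. (\<forall>i. blinfun_apply x (\<xi> i) = 0) \<longrightarrow> x = 0"
proof -
  define G where "G S = {blinfun_apply w (S i) | w i. w \<in> commutant A}" for S :: "nat \<Rightarrow> 'a"
  define V where "V S = closed_cspan (G S)" for S
  have idc: "id_blinfun \<in> commutant A" by (simp add: commutant_def blinfun_compose_simps)
  have V: "csubspace (V S)" "closed (V S)" for S unfolding V_def by (rule closed_cspan_props)+
  have VS: "w \<in> commutant A \<Longrightarrow> blinfun_apply w (S i) \<in> V S" for w S i
    using closed_cspan_props(3)[of "G S"] unfolding V_def G_def by blast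
  have Vmono: "V S \<subseteq> V S'" if "\<And>i. \<exists>j. S i = S' j" for S S'
    unfolding V_def
  proof (rule closed_cspan_minimal[OF closed_cspan_props(1,2)])
    have "G S \<subseteq> G S'"
    proof
      fix g assume "g \<in> G S"
      then obtain w i where g: "w \<in> commutant A" "g = blinfun_apply w (S i)" by (auto simp: G_def)
      obtain j where "S i = S' j" using \<open>\<And>i. \<exists>j. S i = S' j\<close> by blast
      then show "g \<in> G S'" using g unfolding G_def by auto
    qed
    then show "G S \<subseteq> closed_cspan (G S')" using closed_cspan_props(3) by blast
  qed
  have Vinv: "blinfun_apply w v \<in> V S" if w: "w \<in> commutant A" and v: "v \<in> V S" for w v S
    unfolding V_def
  proof (rule closed_cspan_invariant[OF commutant_bounded_ops[OF w]])
    fix g assume "g \<in> G S"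
    then obtain w' i where "w' \<in> commutant A" "g = blinfun_apply w' (S i)" by (auto simp: G_def)
    moreover have "w o\<^sub>L w' \<in> commutant A" if "w' \<in> commutant A" for w'
      using w that unfolding commutant_def
      by (auto intro!: bounded_ops_intros) (metis blinfun_compose_assoc)
    ultimately show "blinfun_apply w g \<in> closed_cspan (G S)"
      using VS[of "w o\<^sub>L w'" S i] by (simp add: V_def)
  qed (use v in \<open>simp add: V_def\<close>)
  have "\<exists>P. positive_op P \<and> P o\<^sub>L P = P \<and> (\<forall>x. blinfun_apply P x \<in> V S) \<and> (\<forall>v\<in>V S. blinfun_apply P v = v)" for S
    using projection_exists[OF V] by blast
  then obtain p where p: "positive_op (p S)" "p S o\<^sub>L p S = p S" "blinfun_apply (p S) x \<in> V S"
    "v \<in> V S \<Longrightarrow> blinfun_apply (p S) v = v" for S x v by metis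
  have pA: "p S \<in> A" for S
    unfolding mem_iff
  proof (intro conjI ballI)
    fix w assume w: "w \<in> commutant A"
    show "p S o\<^sub>L w = w o\<^sub>L p S"
    proof (rule projection_commute[OF p(1) p(3) p(4) commutant_bounded_ops[OF w] Vinv[OF w]])
      have "adj w \<in> commutant A" by (rule adj_commutant[OF _ _ w]) auto
      then show "blinfun_apply (adj w) v \<in> V S" if "v \<in> V S" for v using Vinv that by blast
    qed
  qed (use p in simp)
  have psub: "p S' o\<^sub>L p S = p S" "p S o\<^sub>L p S' = p S" if "V S \<subseteq> V S'" for S S'
  proof -
    have "p S x \<in> V S'" for x using p(3)[of S x] that by blast
    then show 1: "p S' o\<^sub>L p S = p S" by (intro blinfun_eqI) (simp add: p(4))
    have "adj (p S' o\<^sub>L p S) = adj (p S)" by (simp add: 1)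
    then show "p S o\<^sub>L p S' = p S" using positive_op_bounded_ops[OF p(1)] positive_op_adj[OF p(1)] by simp
  qed
  have pdiff: "adj (p S' - p S) o\<^sub>L (p S' - p S) = p S' - p S" if "V S \<subseteq> V S'" for S S'
    using positive_op_bounded_ops[OF p(1)] positive_op_adj[OF p(1)] p(2) psub[OF that]
    by (simp add: blinfun_compose_simps)
  define m where "m S = Re (\<tau> (p S))" for S
  have mmono: "m S \<le> m S'" if "V S \<subseteq> V S'" for S S'
  proof -
    have "0 \<le> Re (\<tau> (p S' - p S))" using tr_adj_self(1)[of "p S' - p S"] pdiff[OF that] pA by simp
    then show ?thesis using pA by (simp add: m_def)
  qed
  have mle: "m S \<le> Re (\<tau> id_blinfun)" for S
  proof -
    have "adj (id_blinfun - p S) o\<^sub>L (id_blinfun - p S) = id_blinfun - p S"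
      using positive_op_bounded_ops[OF p(1)] positive_op_adj[OF p(1)] p(2)
      by (simp add: blinfun_compose_simps)
    then have "0 \<le> Re (\<tau> (id_blinfun - p S))" using tr_adj_self(1)[of "id_blinfun - p S"] pA by simp
    then show ?thesis using pA by (simp add: m_def)
  qed
  define M where "M = (SUP S. m S)"
  have bdd: "bdd_above (range m)" using mle by (auto intro!: bdd_aboveI[of _ "Re (\<tau> id_blinfun)"])
  have leM: "m S \<le> M" for S unfolding M_def by (rule cSUP_upper[OF _ bdd]) simp
  have "\<exists>S. M - 1 / real (Suc n) < m S" for n
  proof -
    have "M - 1 / real (Suc n) < M" by simp
    then show ?thesis unfolding M_def using less_cSUP_iff[OF _ bdd] by blast
  qed
  then obtain Q where Q: "\<And>n. M - 1 / real (Suc n) < m (Q n)" by metis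
  define S where "S k = (case prod_decode k of (n, i) \<Rightarrow> Q n i)" for k
  have QS: "V (Q n) \<subseteq> V S" for n
  proof (rule Vmono)
    show "\<exists>j. Q n i = S j" for i by (rule exI[of _ "prod_encode (n, i)"]) (simp add: S_def)
  qed
  have mS: "M \<le> m S"
  proof (rule tendsto_upperbound)
    have "(\<lambda>n. M - 1 / real (Suc n)) \<longlonglongrightarrow> M - 0"
      by (intro tendsto_diff tendsto_const LIMSEQ_Suc[OF lim_const_over_n])
    then show "(\<lambda>n. M - 1 / real (Suc n)) \<longlonglongrightarrow> M" by simp
    have "M - 1 / real (Suc n) \<le> m S" for n using Q[of n] mmono[OF QS[of n]] by linarith
    then show "\<forall>\<^sub>F n in sequentially. M - 1 / real (Suc n) \<le> m S" by simp
  qed simp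
  have all: "\<eta> \<in> V S" for \<eta>
  proof -
    define S' where "S' k = (case k of 0 \<Rightarrow> \<eta> | Suc i \<Rightarrow> S i)" for k
    have sub: "V S \<subseteq> V S'"
    proof (rule Vmono)
      show "\<exists>j. S i = S' j" for i by (rule exI[of _ "Suc i"]) (simp add: S'_def)
    qed
    have "Re (\<tau> (p S' - p S)) = 0"
      using leM[of S'] mS mmono[OF sub] pA by (simp add: m_def)
    then have "\<tau> (adj (p S' - p S) o\<^sub>L (p S' - p S)) = 0"
      using tr_adj_self(2)[of "p S' - p S"] pdiff[OF sub] pA by (simp add: complex_eq_iff)
    then have "p S' - p S = 0" using pA by (intro tr_faithful) auto
    moreover have "\<eta> \<in> V S'" using VS[OF idc, of S' 0] by (simp add: S'_def)
    ultimately show ?thesis using p(3)[of S \<eta>] p(4)[of \<eta> S'] by simp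
  qed
  have "x = 0" if x: "x \<in> A" "\<forall>i. blinfun_apply x (S i) = 0" for x
  proof (rule blinfun_eqI)
    fix \<eta>
    have "blinfun_apply x g = 0" if "g \<in> G S" for g
    proof -
      obtain w i where w: "w \<in> commutant A" "g = blinfun_apply w (S i)" using \<open>g \<in> G S\<close> by (auto simp: G_def)
      have "x (w (S i)) = w (x (S i))" using commute_commutant[OF x(1) w(1)] by (metis blinfun_apply_blinfun_compose)
      then show ?thesis using x(2) w by simp
    qed
    then show "blinfun_apply x \<eta> = blinfun_apply 0 \<eta>"
      using closed_cspan_kernel[of x "G S" \<eta>] x(1) all[of \<eta>] by (simp add: V_def)
  qed
  then show ?thesis by blast
qed

text \<open>Rescaling the vectors does not affect separation, and summability makes the sum of their
  vector functionals a normal functional.\<close>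

lemma separating_summable_sequence:
  "\<exists>\<xi> :: nat \<Rightarrow> 'a. summable (\<lambda>i. (norm (\<xi> i))\<^sup>2) \<and> (\<forall>x\<in>A. (\<forall>i. blinfun_apply x (\<xi> i) = 0) \<longrightarrow> x = 0)"
proof -
  obtain \<xi> :: "nat \<Rightarrow> 'a" where \<xi>: "\<And>x. x \<in> A \<Longrightarrow> (\<And>i. blinfun_apply x (\<xi> i) = 0) \<Longrightarrow> x = 0"
    using separating_sequence by blast
  define \<zeta> where "\<zeta> i = ((1/2) ^ i / (1 + norm (\<xi> i))) *\<^sub>R \<xi> i" for i
  have pos: "0 < 1 + norm (\<xi> i)" for i by (simp add: add_pos_nonneg)
  have "norm ((norm (\<zeta> i))\<^sup>2) \<le> (1/4) ^ i" for i
  proof -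
    have "norm (\<zeta> i) \<le> (1/2) ^ i"
    proof -
      have "norm (\<zeta> i) = (1/2) ^ i * (norm (\<xi> i) / (1 + norm (\<xi> i)))"
        unfolding \<zeta>_def using pos[of i] by simp
      also have "\<dots> \<le> (1/2) ^ i * 1" using pos[of i] by (intro mult_left_mono) auto
      finally show ?thesis by simp
    qed
    then have "(norm (\<zeta> i))\<^sup>2 \<le> ((1/2) ^ i)\<^sup>2" by (intro power_mono) auto
    also have "((1/2) ^ i)\<^sup>2 = ((1/4) ^ i :: real)" by (simp add: power2_eq_square flip: power_mult_distrib)
    finally show ?thesis by simp
  qed
  then have "summable (\<lambda>i. (norm (\<zeta> i))\<^sup>2)"
    by (intro summable_comparison_test'[OF summable_geometric[of "1/4 :: real"]]) auto
  moreover have "x = 0" if "x \<in> A" "\<forall>i. blinfun_apply x (\<zeta> i) = 0" for x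
  proof (rule \<xi>[OF that(1)])
    fix i
    show "blinfun_apply x (\<xi> i) = 0"
      using that(2)[rule_format, of i] pos[of i] by (auto simp: \<zeta>_def blinfun.bilinear_simps)
  qed
  ultimately show ?thesis by blast
qed

text \<open>The series is faithful on positive elements because the vectors separate A, so the trace
  is absolutely continuous with respect to it.\<close>

lemma vector_series_tendsto_norm2:
  assumes s: "summable (\<lambda>i. (norm (\<xi> i))\<^sup>2)"
    and sep: "\<And>x. x \<in> A \<Longrightarrow> (\<And>i. blinfun_apply x (\<xi> i) = 0) \<Longrightarrow> x = 0"
    and X: "\<forall>\<^sub>F j in F. X j \<in> A \<and> positive_op (X j) \<and> op_le (X j) (K *\<^sub>R id_blinfun)"
    and lim: "((\<lambda>j. \<Sum>i. Re (cinner (blinfun_apply (X j) (\<xi> i)) (\<xi> i))) \<longlongrightarrow> 0) F"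
  shows "((\<lambda>j. Re (\<tau> (X j))) \<longlongrightarrow> 0) F"
proof (rule normal_positive_tendsto[OF normal_positive_vector_series[OF s] _ normal_positive_trace X lim])
  fix x assume x: "x \<in> A" "positive_op x" and 0: "(\<Sum>i. Re (cinner (blinfun_apply x (\<xi> i)) (\<xi> i))) = 0"
  have bd: "norm (Re (cinner (blinfun_apply x (\<xi> i)) (\<xi> i))) \<le> norm x * (norm (\<xi> i))\<^sup>2" for i
    using op_le_Re[OF self_adjoint_le_norm(1)[of x "norm x"], of "\<xi> i"] x positive_op_adj[OF x(2)] positive_op_Re[OF x(2)]
    by (simp add: blinfun.bilinear_simps cinner_scaleR_left cinner_self)
  have sm: "summable (\<lambda>i. Re (cinner (blinfun_apply x (\<xi> i)) (\<xi> i)))"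
    by (rule summable_comparison_test'[OF summable_mult[OF s, of "norm x"]]) (rule bd)
  have "Re (cinner (blinfun_apply x (\<xi> i)) (\<xi> i)) = 0" for i
    using suminf_eq_zero_iff[OF sm] positive_op_Re[OF x(2)] 0 by simp
  then have "(norm (blinfun_apply x (\<xi> i)))\<^sup>2 \<le> 0" for i
    using norm_apply_positive_op[OF x(2) self_adjoint_le_norm(1)[of x "norm x"], of "\<xi> i"] x positive_op_adj[OF x(2)]
    by simp
  then show "x = 0" using sep[OF x(1)] by simp
qed

text \<open>The converse of \<open>norm2_tendsto_strong\<close> for sequences: strong convergence
  makes the vector series tend to 0 by dominated summation, and the trace follows.\<close>

lemma strong_tendsto_norm2:
  assumes X: "\<And>n. X n \<in> A" "\<And>n. norm (X n) \<le> K" and lim: "\<And>\<xi>. (\<lambda>n. blinfun_apply (X n) \<xi>) \<longlonglongrightarrow> 0"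
  shows "(\<lambda>n. norm2 \<tau> (X n)) \<longlonglongrightarrow> 0"
proof -
  obtain \<xi> :: "nat \<Rightarrow> 'a" where s: "summable (\<lambda>i. (norm (\<xi> i))\<^sup>2)"
    and sep: "\<And>x. x \<in> A \<Longrightarrow> (\<And>i. blinfun_apply x (\<xi> i) = 0) \<Longrightarrow> x = 0"
    using separating_summable_sequence by blast
  have K: "0 \<le> K" using X(2)[of 0] norm_ge_zero order_trans by blast
  have q: "Re (cinner (blinfun_apply (adj (X n) o\<^sub>L X n) \<eta>) \<eta>) = (norm (X n \<eta>))\<^sup>2" for n \<eta>
    by (simp only: norm_adj_compose_self[OF bounded[OF X(1)]] Re_complex_of_real)
  have "(\<lambda>n. \<Sum>i. Re (cinner (blinfun_apply (adj (X n) o\<^sub>L X n) (\<xi> i)) (\<xi> i))) \<longlonglongrightarrow> (\<Sum>i. 0)"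
    unfolding q
  proof (rule tannerys_theorem[THEN conjunct2, THEN conjunct2])
    show "(\<lambda>n. (norm (X n (\<xi> i)))\<^sup>2) \<longlonglongrightarrow> 0" for i
      using tendsto_power[OF tendsto_norm[OF lim], of "\<xi> i" 2] by simp
    have "norm ((norm (X n (\<xi> i)))\<^sup>2) \<le> K\<^sup>2 * (norm (\<xi> i))\<^sup>2" for i n
      using power_mono[OF norm_blinfun_le[OF X(2)], of n "\<xi> i" 2] by (simp add: power_mult_distrib)
    then show "\<forall>\<^sub>F (i, n) in at_top \<times>\<^sub>F sequentially. norm ((norm (X n (\<xi> i)))\<^sup>2) \<le> K\<^sup>2 * (norm (\<xi> i))\<^sup>2"
      by (intro always_eventually) auto
    show "summable (\<lambda>i. K\<^sup>2 * (norm (\<xi> i))\<^sup>2)" by (rule summable_mult[OF s])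
  qed simp
  then have "(\<lambda>n. Re (\<tau> (adj (X n) o\<^sub>L X n))) \<longlonglongrightarrow> 0"
    by (intro vector_series_tendsto_norm2[OF s sep, where K = "K\<^sup>2"])
      (use X in \<open>auto intro!: always_eventually adj_self_le\<close>)
  then have "(\<lambda>n. sqrt (Re (\<tau> (adj (X n) o\<^sub>L X n)))) \<longlonglongrightarrow> sqrt 0" by (intro tendsto_intros)
  then show ?thesis by (simp add: norm2_def)
qed

end

section \<open>Comparison of two traces, and minimising sequences in the trace norm\<close>

context tracial_algebra
begin

lemma norm2_sq_add_scaleR:
  assumes "u \<in> A" "w \<in> A"
  shows "(norm2 \<tau> (u + r *\<^sub>R w))\<^sup>2 = (norm2 \<tau> u)\<^sup>2 + 2 * r * Re (\<tau> (adj w o\<^sub>L u)) + r\<^sup>2 * (norm2 \<tau> w)\<^sup>2"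
proof -
  have "u + r *\<^sub>R w = scale_op (of_real r) w + u" by (simp add: scale_op_of_real add.commute)
  then have "(norm2 \<tau> (u + r *\<^sub>R w))\<^sup>2
      = Re (\<tau> (adj (scale_op (of_real r) w + u) o\<^sub>L (scale_op (of_real r) w + u)))"
    using assms by (simp only: norm2_sq closed_simps)
  then show ?thesis
    unfolding tr_form_expand[OF assms(2,1)] tr_form_hermitian[OF assms(2,1)]
    using assms by (simp add: norm2_sq)
qed

text \<open>Averages of suitably chosen members of a \<open>\<tau>\<close>-weakly null bounded family are small in
  \<open>\<tau>\<close>-norm (Banach and Saks), and the two trace norms are comparable on bounded sets.\<close>

lemma weakly_null_transfer:
  assumes t1: "tracial_algebra A \<tau>'"
    and V: "\<forall>\<^sub>F i in F. V i \<in> A \<and> norm (V i) \<le> K"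
    and lim: "\<And>a. a \<in> A \<Longrightarrow> ((\<lambda>i. \<tau> (a o\<^sub>L V i)) \<longlongrightarrow> 0) F" and c: "c \<in> A"
  shows "((\<lambda>i. \<tau>' (c o\<^sub>L V i)) \<longlongrightarrow> 0) F"
proof (rule ccontr)
  interpret t1: tracial_algebra A \<tau>' by (rule t1)
  define f where "f x = \<tau>' (c o\<^sub>L x)" for x
  have f_add: "f (x + y) = f x + f y" if "x \<in> A" "y \<in> A" for x y
    using that c by (simp add: f_def blinfun_compose_simps)
  have f_sc: "f (r *\<^sub>R x) = r *\<^sub>R f x" if "x \<in> A" for r x
    using that c by (simp add: f_def blinfun_compose_simps scaleR_conv_of_real)
  assume "\<not> ?thesis"
  then obtain e where e: "0 < e" "\<exists>\<^sub>F i in F. e \<le> cmod (f (V i))"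
    unfolding tendsto_iff by (auto simp: f_def frequently_def not_le)
  \<comment> \<open>If |f (V i)| >= e, one of its multiples by 1, -1, \<i>, -\<i> has real part at
    least e/2. Fixing a factor u that occurs frequently lets the real parts add up without
    cancellation.\<close>
  have "cmod z < e" if z: "\<And>u. u \<in> {1, -1, \<i>, -\<i>} \<Longrightarrow> Re (u * z) < e / 2" for z
  proof -
    have "\<bar>Re z\<bar> < e / 2" "\<bar>Im z\<bar> < e / 2"
      using z[of 1] z[of "-1"] z[of "\<i>"] z[of "-\<i>"] by (auto simp: abs_less_iff)
    then show ?thesis using cmod_le[of z] by linarith
  qed
  then have "\<exists>\<^sub>F i in F. \<exists>u\<in>{1, -1, \<i>, -\<i>}. e / 2 \<le> Re (u * f (V i))"
    using e(2) by (elim frequently_elim1) (meson not_le)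
  then have "(\<exists>\<^sub>F i in F. e / 2 \<le> Re (1 * f (V i))) \<or> (\<exists>\<^sub>F i in F. e / 2 \<le> Re (- 1 * f (V i)))
    \<or> (\<exists>\<^sub>F i in F. e / 2 \<le> Re (\<i> * f (V i))) \<or> (\<exists>\<^sub>F i in F. e / 2 \<le> Re (- \<i> * f (V i)))"
    by (simp only: frequently_disj_iff bex_simps not_frequently_False simp_thms)
  then obtain u where u: "\<exists>\<^sub>F i in F. e / 2 \<le> Re (u * f (V i))" by blast
  \<comment> \<open>Each new summand V i is picked with |\<tau>(adj(s) V i)| < 1, so it raises the
    squared trace norm of s by at most its own square plus 2. The squared norm of a sum of k terms
    thus grows linearly, and that of the average decays like C/k.\<close>
  define C where "C = 2 + K\<^sup>2 * (norm2 \<tau> id_blinfun)\<^sup>2"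
  have ex: "\<exists>s\<in>A. norm s \<le> real k * K \<and> (norm2 \<tau> s)\<^sup>2 \<le> real k * C \<and> real k * (e / 2) \<le> Re (u * f s)" for k
  proof (induction k)
    case 0
    have "f 0 = 0" using f_sc[of 0 0] by simp
    then show ?case by (intro bexI[of _ 0]) auto
  next
    case (Suc k)
    then obtain s where s: "s \<in> A" "norm s \<le> real k * K" "(norm2 \<tau> s)\<^sup>2 \<le> real k * C"
      "real k * (e / 2) \<le> Re (u * f s)" by blast
    have "\<forall>\<^sub>F i in F. dist (\<tau> (adj s o\<^sub>L V i)) 0 < 1"
      by (rule tendstoD[OF lim]) (use s in auto)
    then have "\<forall>\<^sub>F i in F. (V i \<in> A \<and> norm (V i) \<le> K) \<and> cmod (\<tau> (adj s o\<^sub>L V i)) < 1"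
      using V by eventually_elim simp
    from frequently_eventually_conj[OF u this] obtain i where
      i: "V i \<in> A" "norm (V i) \<le> K" "cmod (\<tau> (adj s o\<^sub>L V i)) < 1" "e / 2 \<le> Re (u * f (V i))"
      using frequently_ex by blast
    have "norm2 \<tau> (V i) \<le> K * norm2 \<tau> id_blinfun"
      using norm2_le_norm[OF i(1)] i(2) norm2_nonneg[of id_blinfun] by (meson closed_simps(1) mult_right_mono order_trans)
    then have "(norm2 \<tau> (V i))\<^sup>2 \<le> K\<^sup>2 * (norm2 \<tau> id_blinfun)\<^sup>2"
      using power_mono[of "norm2 \<tau> (V i)" "K * norm2 \<tau> id_blinfun" 2] i(1) by (simp add: power_mult_distrib)
    moreover have "Re (\<tau> (adj s o\<^sub>L V i)) \<le> 1" using i(3) complex_Re_le_cmod[of "\<tau> (adj s o\<^sub>L V i)"] by linarith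
    ultimately have "(norm2 \<tau> (V i + 1 *\<^sub>R s))\<^sup>2 \<le> real (Suc k) * C"
      using s(3) unfolding norm2_sq_add_scaleR[OF i(1) s(1)] by (simp add: C_def algebra_simps)
    moreover have "norm (V i + s) \<le> real (Suc k) * K"
      using norm_triangle_ineq[of "V i" s] s(2) i(2) by (simp add: algebra_simps)
    moreover have "real (Suc k) * (e / 2) \<le> Re (u * f (V i + s))"
    proof -
      have "real (Suc k) * (e / 2) = real k * (e / 2) + e / 2" by (simp add: algebra_simps)
      then show ?thesis using s(4) i(4) f_add[OF i(1) s(1)] by (simp add: distrib_left)
    qed
    ultimately show ?case using s(1) i(1) by (intro bexI[of _ "V i + s"]) auto
  qed
  obtain s where s: "s k \<in> A" "norm (s k) \<le> real k * K" "(norm2 \<tau> (s k))\<^sup>2 \<le> real k * C"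
      "real k * (e / 2) \<le> Re (u * f (s k))" for k
    using ex by metis
  define x where "x k = (1 / real (Suc k)) *\<^sub>R s (Suc k)" for k
  have xA: "x k \<in> A" for k using s(1) by (simp add: x_def)
  have xn: "norm (x k) \<le> K" for k
    using s(2)[of "Suc k"] by (simp add: x_def field_simps)
  have x2: "(norm2 \<tau> (x k))\<^sup>2 \<le> C / real (Suc k)" for k
  proof -
    have "(norm2 \<tau> (x k))\<^sup>2 = (norm2 \<tau> (s (Suc k)))\<^sup>2 / (real (Suc k))\<^sup>2"
      unfolding x_def norm2_scaleR[OF s(1)] by (simp add: power_mult_distrib power_divide)
    also have "\<dots> \<le> real (Suc k) * C / (real (Suc k))\<^sup>2"
      by (intro divide_right_mono s(3)) simp
    finally show ?thesis by (simp add: power2_eq_square)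
  qed
  have "(\<lambda>k. (norm2 \<tau> (x k))\<^sup>2) \<longlonglongrightarrow> 0"
    by (rule tendsto_sandwich[OF _ _ tendsto_const LIMSEQ_Suc[OF lim_const_over_n[of C]]])
      (use x2 in auto)
  then have "(\<lambda>k. sqrt ((norm2 \<tau> (x k))\<^sup>2)) \<longlonglongrightarrow> sqrt 0" by (intro tendsto_intros)
  then have "(\<lambda>k. norm2 \<tau> (x k)) \<longlonglongrightarrow> 0" using xA by simp
  then have "(\<lambda>k. Re (\<tau>' (adj (x k) o\<^sub>L x k))) \<longlonglongrightarrow> 0"
    by (intro norm2_tendsto_normal_positive[where K = K] t1.normal_positive_trace) (use xA xn in auto)
  then have "(\<lambda>k. sqrt (Re (\<tau>' (adj (x k) o\<^sub>L x k)))) \<longlonglongrightarrow> sqrt 0" by (intro tendsto_intros)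
  then have "(\<lambda>k. norm2 \<tau>' c * norm2 \<tau>' (x k)) \<longlonglongrightarrow> norm2 \<tau>' c * 0"
    unfolding norm2_def[of \<tau>' "x _"] by (intro tendsto_mult tendsto_const) simp
  then have "(\<lambda>k. f (x k)) \<longlonglongrightarrow> 0"
    by (intro Lim_null_comparison[of "\<lambda>k. f (x k)"]) (use t1.tr_cauchy_schwarz[OF c xA] in \<open>auto simp: f_def\<close>)
  from tendsto_Re[OF tendsto_mult_left[OF this, of u]]
  have "(\<lambda>k. Re (u * f (x k))) \<longlonglongrightarrow> 0" by simp
  moreover have "e / 2 \<le> Re (u * f (x k))" for k
  proof -
    have "Re (u * f (x k)) = Re (u * f (s (Suc k))) / real (Suc k)"
      unfolding x_def f_sc[OF s(1)] by simp
    moreover have "e / 2 \<le> Re (u * f (s (Suc k))) / real (Suc k)"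
      using s(4)[of "Suc k"] by (subst pos_le_divide_eq) (simp_all only: of_nat_0_less_iff zero_less_Suc mult.commute)
    ultimately show ?thesis by simp
  qed
  ultimately have "e / 2 \<le> 0" by (intro tendsto_lowerbound[of _ 0 sequentially]) auto
  then show False using e by simp
qed

lemma tr_parallelogram:
  assumes "u \<in> A" "v \<in> A"
  shows "(norm2 \<tau> (u + v))\<^sup>2 + (norm2 \<tau> (u - v))\<^sup>2 = 2 * (norm2 \<tau> u)\<^sup>2 + 2 * (norm2 \<tau> v)\<^sup>2"
  using norm2_sq_add_scaleR[OF assms, of 1] norm2_sq_add_scaleR[OF assms, of "-1"] by simp

text \<open>A need not be complete in the trace norm, so a sequence is produced rather than a
  minimiser.\<close>

lemma norm2_minimising_sequence:
  assumes S: "S \<noteq> {}" "S \<subseteq> A" and mid: "\<And>x y. x \<in> S \<Longrightarrow> y \<in> S \<Longrightarrow> (1/2) *\<^sub>R (x + y) \<in> S" and a: "a \<in> A"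
  obtains X where "\<And>n. X n \<in> S"
    "\<And>n y. y \<in> S \<Longrightarrow> (norm2 \<tau> (a - X n))\<^sup>2 \<le> (norm2 \<tau> (a - y))\<^sup>2 + 1 / real (Suc n)"
    "\<And>m n. (norm2 \<tau> (X m - X n))\<^sup>2 \<le> 2 / real (Suc m) + 2 / real (Suc n)"
proof -
  let ?q = "\<lambda>x. (norm2 \<tau> x)\<^sup>2"
  have par: "4 * ?q (a - (1/2) *\<^sub>R (x + y)) + ?q (x - y) = 2 * ?q (a - x) + 2 * ?q (a - y)"
    if "x \<in> S" "y \<in> S" for x y
  proof -
    have A: "x \<in> A" "y \<in> A" using that S by auto
    have 1: "(a - x) + (a - y) = 2 *\<^sub>R (a - (1/2) *\<^sub>R (x + y))"
      by (simp add: scaleR_diff_right scaleR_2)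
    have 2: "(a - x) - (a - y) = (-1) *\<^sub>R (x - y)" by simp
    have "?q (2 *\<^sub>R (a - (1/2) *\<^sub>R (x + y))) = 4 * ?q (a - (1/2) *\<^sub>R (x + y))"
      using norm2_scaleR[of "a - (1/2) *\<^sub>R (x + y)" 2] A a by (simp add: power_mult_distrib)
    moreover have "?q ((-1) *\<^sub>R (x - y)) = ?q (x - y)"
      using norm2_scaleR[of "x - y" "-1"] A by simp
    ultimately show ?thesis
      using tr_parallelogram[of "a - x" "a - y"] A a unfolding 1 2 by simp
  qed
  show thesis
  proof (rule minimising_sequence[of S ?q a, OF S(1) mid _ par])
    fix X assume "\<And>n. X n \<in> S" "\<And>n y. y \<in> S \<Longrightarrow> ?q (a - X n) \<le> ?q (a - y) + 1 / real (Suc n)"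
      "\<And>m n. ?q (X m - X n) \<le> 2 / real (Suc m) + 2 / real (Suc n)"
    then show thesis by (rule that)
  qed (assumption | rule zero_le_power2)+
qed

end

section \<open>Existence of the trace-preserving conditional expectation\<close>

locale tracial_subalgebra = tracial_algebra A \<tau> + sub: vn_algebra B
  for A :: "'a::complex_hilbert_space op set" and \<tau> and B +
  assumes subset: "B \<subseteq> A"
begin

lemma sub_mem [simp]: "b \<in> B \<Longrightarrow> b \<in> A"
  using subset by blast

text \<open>A convex part of B that is complete in the trace norm, so that nearest points exist in
  it.\<close>

definition contractions :: "'a op set" where
  "contractions = {s \<in> B. positive_op s \<and> op_le s id_blinfun}"

lemma contractionsD:
  assumes "s \<in> contractions"
  shows "s \<in> B" "positive_op s" "op_le s id_blinfun" "adj s = s" "norm s \<le> 1" "norm2 \<tau> s \<le> norm2 \<tau> id_blinfun"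
proof -
  show s: "s \<in> B" "positive_op s" "op_le s id_blinfun" "adj s = s"
    using assms positive_op_adj by (auto simp: contractions_def)
  show n: "norm s \<le> 1" using norm_le_of_op_le[of s 1] s by simp
  show "norm2 \<tau> s \<le> norm2 \<tau> id_blinfun"
    using norm2_le_norm[of s] mult_right_mono[OF n, of "norm2 \<tau> id_blinfun"] s by simp
qed

lemma contractions_convex:
  assumes "s \<in> contractions" "t \<in> contractions" "0 \<le> r" "r \<le> 1"
  shows "(1 - r) *\<^sub>R t + r *\<^sub>R s \<in> contractions"
proof -
  have "id_blinfun - ((1 - r) *\<^sub>R t + r *\<^sub>R s) = (1 - r) *\<^sub>R (id_blinfun - t) + r *\<^sub>R (id_blinfun - s)"
    by (simp add: algebra_simps)
  moreover have "positive_op \<dots>"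
    using contractionsD(3)[OF assms(1)] contractionsD(3)[OF assms(2)] assms(3,4) by (simp add: op_le_def)
  ultimately show ?thesis
    using contractionsD(1,2)[OF assms(1)] contractionsD(1,2)[OF assms(2)] assms(3,4)
    by (simp add: contractions_def op_le_def)
qed

text \<open>On bounded sets a Cauchy sequence for the trace norm is strongly Cauchy; its strong
  limit stays among the contractions, and strong convergence gives back convergence in the trace
  norm. The Cauchy rate is the one that \<open>norm2_minimising_sequence\<close> delivers.\<close>

lemma contractions_complete:
  assumes t: "\<And>n. t n \<in> contractions"
    and cauchy: "\<And>m n. (norm2 \<tau> (t m - t n))\<^sup>2 \<le> 2 / real (Suc m) + 2 / real (Suc n)"
  shows "\<exists>s\<in>contractions. (\<lambda>n. norm2 \<tau> (t n - s)) \<longlonglongrightarrow> 0"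
proof -
  note tD = contractionsD[OF t]
  have lim: "((\<lambda>p. norm2 \<tau> (t (fst p) - t (snd p))) \<longlongrightarrow> 0) (sequentially \<times>\<^sub>F sequentially)"
  proof -
    have l: "((\<lambda>p. sqrt (2 / real (Suc (fst p)) + 2 / real (Suc (snd p)))) \<longlongrightarrow> sqrt (0 + 0)) (sequentially \<times>\<^sub>F sequentially)"
      using filterlim_compose[OF LIMSEQ_Suc[OF lim_const_over_n] filterlim_fst]
        filterlim_compose[OF LIMSEQ_Suc[OF lim_const_over_n] filterlim_snd]
      by (intro tendsto_real_sqrt tendsto_add)
    show ?thesis
    proof (rule tendsto_sandwich[OF _ _ tendsto_const l[unfolded add_0 real_sqrt_zero]])
      have "norm2 \<tau> (t m - t n) \<le> sqrt (2 / real (Suc m) + 2 / real (Suc n))" for m n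
        using real_sqrt_le_mono[OF cauchy[of m n]] tD(1) by simp
      then show "\<forall>\<^sub>F p in sequentially \<times>\<^sub>F sequentially. norm2 \<tau> (t (fst p) - t (snd p))
          \<le> sqrt (2 / real (Suc (fst p)) + 2 / real (Suc (snd p)))" by simp
    qed (use tD(1) in simp)
  qed
  have d2: "norm (t m - t n) \<le> 2" for m n
    using norm_triangle_ineq4[of "t m" "t n"] tD(5)[of m] tD(5)[of n] by linarith
  have "Cauchy (\<lambda>n. t n \<xi>)" for \<xi>
  proof -
    have "((\<lambda>p. (t (fst p) - t (snd p)) \<xi>) \<longlongrightarrow> 0) (sequentially \<times>\<^sub>F sequentially)"
      by (rule norm2_tendsto_strong[OF _ lim, where K = 2]) (use tD(1) d2 in auto)
    then have "\<forall>e>0. \<forall>\<^sub>F p in sequentially \<times>\<^sub>F sequentially. norm (t (fst p) \<xi> - t (snd p) \<xi>) < e"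
      by (simp add: tendsto_iff blinfun.bilinear_simps)
    then show ?thesis
      unfolding eventually_prod_sequentially by (intro CauchyI) (auto, meson)
  qed
  then obtain l where l: "\<And>\<xi>. (\<lambda>n. t n \<xi>) \<longlonglongrightarrow> l \<xi>"
    unfolding Cauchy_convergent_iff convergent_def by metis
  have "\<exists>T\<in>bounded_ops. \<forall>x y. (\<lambda>n. cinner (t n x) y) \<longlonglongrightarrow> cinner (blinfun_apply T x) y"
  proof (rule weak_limit_op)
    show "\<forall>\<^sub>F n in sequentially. t n \<in> bounded_ops \<and> norm (t n) \<le> 1" using tD(1,5) by simp
    show "\<exists>k. (\<lambda>n. cinner (t n x) y) \<longlonglongrightarrow> k" for x y
      using cinner.tendsto[OF l tendsto_const] by blast
  qed simp
  then obtain s where s: "s \<in> bounded_ops" "\<And>x y. (\<lambda>n. cinner (t n x) y) \<longlonglongrightarrow> cinner (blinfun_apply s x) y" by blast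
  have "s \<xi> = l \<xi>" for \<xi>
    by (rule cinner_ext) (rule LIMSEQ_unique[OF s(2) cinner.tendsto[OF l tendsto_const]])
  then have ts: "(\<lambda>n. t n \<xi>) \<longlonglongrightarrow> s \<xi>" for \<xi> using l by simp
  have sB: "s \<in> B" by (rule sub.strong_limit_closed[OF tD(1) s(1) ts])
  have sc: "s \<in> contractions"
    using op_le_limit[OF ts tD(2) tD(3) s(1)] sB by (simp add: contractions_def)
  have "(\<lambda>n. norm2 \<tau> (t n - s)) \<longlonglongrightarrow> 0"
  proof (rule strong_tendsto_norm2[where K = 2])
    show "t n - s \<in> A" for n using tD(1) sB by simp
    show "norm (t n - s) \<le> 2" for n
      using norm_triangle_ineq4[of "t n" s] tD(5)[of n] contractionsD(5)[OF sc] by linarith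
    show "(\<lambda>n. (t n - s) \<xi>) \<longlonglongrightarrow> 0" for \<xi>
      using LIM_zero[OF ts] by (simp add: blinfun.bilinear_simps)
  qed
  then show ?thesis using sc by blast
qed

text \<open>With \<open>Q = (1 + |b|)\<inverse>\<close>, the contraction \<open>s = (1 + bQ)/2\<close> approximates the spectral projection of \<open>b\<close>
  for the positive half line, and \<open>(b + |b| + 1)/2\<close> dominates both \<open>0\<close> and \<open>b\<close>.\<close>

lemma support_bound_one:
  assumes b: "b \<in> B" "adj b = b" and x: "x \<in> A" "positive_op x" "op_le x id_blinfun"
  shows "\<exists>s\<in>contractions. Re (\<tau> (x o\<^sub>L b)) \<le> Re (\<tau> (s o\<^sub>L b)) + Re (\<tau> id_blinfun)"
proof -
  have "positive_op (b o\<^sub>L b)" using positive_op_adj_self[of b] b by simp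
  then obtain m where m: "m \<in> B" "positive_op m" "m o\<^sub>L m = b o\<^sub>L b"
    and mcomm: "\<And>R. R \<in> bounded_ops \<Longrightarrow> R o\<^sub>L (b o\<^sub>L b) = (b o\<^sub>L b) o\<^sub>L R \<Longrightarrow> R o\<^sub>L m = m o\<^sub>L R"
    using sub.sqrt_closed[of "b o\<^sub>L b"] b by blast
  have bm: "b o\<^sub>L m = m o\<^sub>L b" using mcomm[of b] b by (simp add: blinfun_compose_assoc)
  define Q where "Q = resolv m"
  have Q: "Q \<in> B" "positive_op Q" "op_le Q id_blinfun" unfolding Q_def using m by auto
  have bQ: "b o\<^sub>L Q = Q o\<^sub>L b" unfolding Q_def by (rule resolv_commute[OF m(2) bm])
  have mQ: "m o\<^sub>L Q = id_blinfun - Q" unfolding Q_def using resolv_compl(1)[OF m(2)] by simp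
  have Qm: "Q o\<^sub>L m = id_blinfun - Q" unfolding Q_def using resolv_compl(2)[OF m(2)] by simp
  have Qs: "adj Q = Q" by (rule positive_op_adj[OF Q(2)])
  \<comment> \<open>k is b/(1 + |b|), a bounded substitute for the sign of b; adj(k) k = (1 - Q)^2
    shows that it is a contraction.\<close>
  define k where "k = b o\<^sub>L Q"
  have k: "k \<in> B" "adj k = k" using b Q Qs by (simp_all add: k_def bQ)
  have kk: "adj k o\<^sub>L k = adj (id_blinfun - Q) o\<^sub>L (id_blinfun - Q)"
  proof -
    have "adj k o\<^sub>L k = (Q o\<^sub>L b) o\<^sub>L (b o\<^sub>L Q)" using b Q Qs by (simp add: k_def)
    also have "\<dots> = Q o\<^sub>L ((m o\<^sub>L m) o\<^sub>L Q)" by (simp add: m(3) blinfun_compose_assoc)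
    also have "\<dots> = (Q o\<^sub>L m) o\<^sub>L (m o\<^sub>L Q)" by (simp only: blinfun_compose_assoc)
    also have "\<dots> = adj (id_blinfun - Q) o\<^sub>L (id_blinfun - Q)" using Q Qs by (simp add: mQ Qm)
    finally show ?thesis .
  qed
  have "norm (id_blinfun - Q) \<le> 1"
    by (rule norm_le_of_op_le) (use Q in \<open>auto simp: op_le_def\<close>)
  then have "op_le (adj k o\<^sub>L k) (1\<^sup>2 *\<^sub>R id_blinfun)"
    unfolding kk by (intro adj_self_le) (use Q in auto)
  then have kn: "norm k \<le> 1" by (intro norm_le_of_adj_self_le[of k 1]) (use k in auto)
  have kpm: "positive_op (id_blinfun - k)" "positive_op (id_blinfun + k)"
    using self_adjoint_le_norm[of k 1] k kn by (simp_all add: op_le_def add.commute)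
  define s where "s = (1/2) *\<^sub>R (id_blinfun + k)"
  have "id_blinfun - s = (1/2) *\<^sub>R (id_blinfun - k)"
    unfolding s_def by (rule blinfun_eqI) (simp add: blinfun.bilinear_simps algebra_simps flip: scaleR_add_left)
  then have s: "s \<in> contractions"
    using k kpm by (simp add: contractions_def op_le_def) (simp add: s_def k kpm)
  let ?P = "id_blinfun + m"
  have P: "positive_op ?P" using m by simp
  have Pk: "?P o\<^sub>L k = b" "k o\<^sub>L ?P = b"
  proof -
    have "?P o\<^sub>L k = (?P o\<^sub>L Q) o\<^sub>L b" by (simp add: k_def bQ blinfun_compose_assoc)
    also have "?P o\<^sub>L Q = id_blinfun" by (simp add: blinfun_compose_simps mQ)
    finally show 1: "?P o\<^sub>L k = b" by (simp add: blinfun_compose_simps)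
    have "k o\<^sub>L ?P = b o\<^sub>L (Q o\<^sub>L ?P)" by (simp only: k_def blinfun_compose_assoc)
    also have "Q o\<^sub>L ?P = id_blinfun" by (simp add: blinfun_compose_simps Qm)
    finally show "k o\<^sub>L ?P = b" by (simp add: blinfun_compose_simps)
  qed
  have "positive_op ((id_blinfun - k) o\<^sub>L ?P)"
    by (rule positive_op_compose[OF kpm(1) P]) (simp only: blinfun_compose_simps(3,4,7,8) Pk)
  then have c1: "positive_op (?P - b)" by (simp only: blinfun_compose_simps(3,7) Pk)
  have "positive_op ((id_blinfun + k) o\<^sub>L ?P)"
  proof (rule positive_op_compose[OF kpm(2) P])
    have "(id_blinfun + k) o\<^sub>L ?P = ?P + b" by (simp only: blinfun_compose_simps(1)[of id_blinfun k] blinfun_compose_simps(7) Pk)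
    moreover have "?P o\<^sub>L (id_blinfun + k) = ?P + b" by (simp only: blinfun_compose_simps(2)[of _ id_blinfun k] blinfun_compose_simps(8) Pk)
    ultimately show "(id_blinfun + k) o\<^sub>L ?P = ?P o\<^sub>L (id_blinfun + k)" by simp
  qed
  then have c2: "positive_op (?P + b)"
    by (simp only: blinfun_compose_simps(1)[of id_blinfun k] blinfun_compose_simps(7) Pk)
  have A: "b \<in> A" "m \<in> A" "Q \<in> A" "k \<in> A" "?P \<in> A" using b m Q k by auto
  \<comment> \<open>Adding the two inequalities gives 2 \<tau>(x b) <= \<tau>(1 + |b|) + \<tau>(b),
    and \<tau>(s b) falls short of half the right side by at most \<tau>(1).\<close>
  have 1: "0 \<le> Re (\<tau> (x o\<^sub>L (?P - b)))"
    by (rule tr_product_positive[OF x(1,2) _ c1]) (use A in auto)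
  have 2: "0 \<le> Re (\<tau> ((id_blinfun - x) o\<^sub>L (?P + b)))"
    by (rule tr_product_positive[OF _ positive_op_diff[OF x(3)] _ c2]) (use A x in auto)
  have e1: "Re (\<tau> (x o\<^sub>L (?P - b))) = Re (\<tau> (x o\<^sub>L ?P)) - Re (\<tau> (x o\<^sub>L b))"
    using A x by (simp only: blinfun_compose_simps(4)) simp
  have e2: "Re (\<tau> ((id_blinfun - x) o\<^sub>L (?P + b))) = Re (\<tau> ?P) + Re (\<tau> b) - Re (\<tau> (x o\<^sub>L ?P)) - Re (\<tau> (x o\<^sub>L b))"
    using A x by (simp only: blinfun_compose_simps(2,3,7)) (simp add: blinfun_compose_simps(7))
  have kb: "k o\<^sub>L b = m - (id_blinfun - Q)"
  proof -
    have "k o\<^sub>L b = (Q o\<^sub>L m) o\<^sub>L m" by (simp add: k_def bQ m(3) blinfun_compose_assoc)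
    then show ?thesis by (simp only: Qm blinfun_compose_simps(3,7))
  qed
  have e3: "Re (\<tau> (s o\<^sub>L b)) = (Re (\<tau> b) + Re (\<tau> m) - Re (\<tau> id_blinfun) + Re (\<tau> Q)) / 2"
    using A unfolding s_def by (simp add: blinfun_compose_simps(1,5,7) kb)
  have e4: "Re (\<tau> ?P) = Re (\<tau> id_blinfun) + Re (\<tau> m)" using A by simp
  have e5: "0 \<le> Re (\<tau> Q)" using tr_positive(1) A Q by blast
  have "2 * Re (\<tau> (x o\<^sub>L b)) \<le> Re (\<tau> ?P) + Re (\<tau> b)" using 1 2 unfolding e1 e2 by linarith
  then have "Re (\<tau> (x o\<^sub>L b)) \<le> Re (\<tau> (s o\<^sub>L b)) + Re (\<tau> id_blinfun)" unfolding e3 e4 using e5 by argo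
  then show ?thesis using s by blast
qed

text \<open>The error \<tau>(1) does not depend on b, so applying the estimate to b/r and scaling
  back reduces it to r \<tau>(1).\<close>

lemma support_bound:
  assumes b: "b \<in> B" "adj b = b" and x: "x \<in> A" "positive_op x" "op_le x id_blinfun" and e: "0 < e"
  shows "\<exists>s\<in>contractions. Re (\<tau> (x o\<^sub>L b)) \<le> Re (\<tau> (s o\<^sub>L b)) + e"
proof -
  define r where "r = e / (1 + Re (\<tau> id_blinfun))"
  have t1: "0 \<le> Re (\<tau> id_blinfun)" by (rule tr_positive) auto
  then have r: "0 < r" "r * Re (\<tau> id_blinfun) \<le> e" unfolding r_def using e by (auto simp: field_simps)
  obtain s where s: "s \<in> contractions"
    "Re (\<tau> (x o\<^sub>L ((1/r) *\<^sub>R b))) \<le> Re (\<tau> (s o\<^sub>L ((1/r) *\<^sub>R b))) + Re (\<tau> id_blinfun)"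
    using support_bound_one[of "(1/r) *\<^sub>R b" x] b x by auto
  then have "Re (\<tau> (x o\<^sub>L b)) / r \<le> Re (\<tau> (s o\<^sub>L b)) / r + Re (\<tau> id_blinfun)"
    using b x contractionsD(1)[OF s(1)] by (simp add: blinfun_compose_simps(6))
  then have "Re (\<tau> (x o\<^sub>L b)) \<le> Re (\<tau> (s o\<^sub>L b)) + r * Re (\<tau> id_blinfun)"
    using r(1) by (simp add: field_simps)
  then show ?thesis using s(1) r(2) by (intro bexI[of _ s]) auto
qed

text \<open>The variational inequality of a nearest point in a convex set: moving from t towards s
  by a fraction r does not decrease the distance to x, and r is made small.\<close>

lemma contraction_nearest:
  assumes x: "x \<in> A"
  obtains t where "t \<in> contractions"
    "\<And>s. s \<in> contractions \<Longrightarrow> Re (\<tau> ((x - t) o\<^sub>L s)) \<le> Re (\<tau> ((x - t) o\<^sub>L t))"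
proof -
  have "0 \<in> contractions" by (simp add: contractions_def)
  moreover have "(1/2) *\<^sub>R (y + z) \<in> contractions" if "y \<in> contractions" "z \<in> contractions" for y z
    using contractions_convex[OF that, of "1/2"] by (simp add: scaleR_add_right add.commute)
  ultimately obtain X where X: "\<And>n. X n \<in> contractions"
    "\<And>n y. y \<in> contractions \<Longrightarrow> (norm2 \<tau> (x - X n))\<^sup>2 \<le> (norm2 \<tau> (x - y))\<^sup>2 + 1 / real (Suc n)"
    "\<And>m n. (norm2 \<tau> (X m - X n))\<^sup>2 \<le> 2 / real (Suc m) + 2 / real (Suc n)"
    using norm2_minimising_sequence[of contractions x] x by (metis contractionsD(1) empty_iff sub_mem subsetI)
  obtain t where t: "t \<in> contractions" "(\<lambda>n. norm2 \<tau> (X n - t)) \<longlonglongrightarrow> 0"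
    using contractions_complete[of X] X by blast
  have tA: "t \<in> A" "X n \<in> A" for n using contractionsD(1) t X by auto
  have min: "(norm2 \<tau> (x - t))\<^sup>2 \<le> (norm2 \<tau> (x - y))\<^sup>2" if y: "y \<in> contractions" for y
  proof -
    have yA: "y \<in> A" using contractionsD(1) y by auto
    have "norm2 \<tau> (x - t) \<le> sqrt ((norm2 \<tau> (x - y))\<^sup>2 + 1 / real (Suc n)) + norm2 \<tau> (X n - t)" for n
    proof -
      have "norm2 \<tau> (x - t) \<le> norm2 \<tau> (x - X n) + norm2 \<tau> (X n - t)"
        using norm2_triangle[of "x - X n" "X n - t"] x tA by simp
      moreover have "norm2 \<tau> (x - X n) \<le> sqrt ((norm2 \<tau> (x - y))\<^sup>2 + 1 / real (Suc n))"
        using X(2)[OF y, of n] by (rule real_le_rsqrt)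
      ultimately show ?thesis by simp
    qed
    moreover have "(\<lambda>n. sqrt ((norm2 \<tau> (x - y))\<^sup>2 + 1 / real (Suc n)) + norm2 \<tau> (X n - t))
      \<longlonglongrightarrow> sqrt ((norm2 \<tau> (x - y))\<^sup>2 + 0) + 0"
      by (intro tendsto_add tendsto_real_sqrt tendsto_const t LIMSEQ_Suc[OF lim_const_over_n])
    ultimately have "norm2 \<tau> (x - t) \<le> sqrt ((norm2 \<tau> (x - y))\<^sup>2 + 0) + 0"
      by (intro LIMSEQ_le_const[where X = "\<lambda>n. sqrt ((norm2 \<tau> (x - y))\<^sup>2 + 1 / real (Suc n)) + norm2 \<tau> (X n - t)"]) auto
    then show ?thesis using x yA tA by (intro power_mono) auto
  qed
  show thesis
  proof (rule that[OF t(1)])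
    fix s assume s: "s \<in> contractions"
    have sA: "s \<in> A" using contractionsD(1)[OF s] by simp
    let ?w = "s - t"
    have ws: "adj ?w = ?w" using contractionsD(4) s t sA tA by simp
    define g where "g = Re (\<tau> (?w o\<^sub>L (x - t)))"
    have le: "2 * g \<le> r * (norm2 \<tau> ?w)\<^sup>2" if r: "0 < r" "r \<le> 1" for r
    proof -
      have "(norm2 \<tau> (x - t))\<^sup>2 \<le> (norm2 \<tau> (x - ((1 - r) *\<^sub>R t + r *\<^sub>R s)))\<^sup>2"
        by (rule min, rule contractions_convex[OF s t(1)]) (use r in auto)
      also have "x - ((1 - r) *\<^sub>R t + r *\<^sub>R s) = (x - t) + (- r) *\<^sub>R ?w" by (simp add: algebra_simps)
      also have "(norm2 \<tau> ((x - t) + (- r) *\<^sub>R ?w))\<^sup>2 = (norm2 \<tau> (x - t))\<^sup>2 - 2 * r * g + r\<^sup>2 * (norm2 \<tau> ?w)\<^sup>2"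
        using norm2_sq_add_scaleR[of "x - t" ?w "-r"] x tA sA unfolding ws g_def by simp
      finally have "r * (2 * g) \<le> r * (r * (norm2 \<tau> ?w)\<^sup>2)" by (simp add: power2_eq_square ac_simps)
      then show ?thesis using r by simp
    qed
    have "g \<le> 0"
    proof (rule ccontr)
      assume "\<not> g \<le> 0"
      then have g: "0 < g" by simp
      define N where "N = (norm2 \<tau> ?w)\<^sup>2"
      have N: "0 \<le> N" by (simp add: N_def)
      \<comment> \<open>This r makes r N at most g, against 2 g <= r N.\<close>
      have "2 * g \<le> min 1 (g / (N + 1)) * N"
        unfolding N_def by (rule le) (use g N in \<open>auto simp: N_def intro!: divide_pos_pos add_nonneg_pos\<close>)
      also have "\<dots> \<le> g / (N + 1) * N" using N by (intro mult_right_mono) auto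
      also have "\<dots> \<le> g" using g N by (simp add: field_simps)
      finally show False using g by simp
    qed
    moreover have "\<tau> (?w o\<^sub>L (x - t)) = \<tau> ((x - t) o\<^sub>L s) - \<tau> ((x - t) o\<^sub>L t)"
      using tr_comm[of ?w "x - t"] x tA sA by (simp add: blinfun_compose_simps(4)[of "x - t"])
    ultimately show "Re (\<tau> ((x - t) o\<^sub>L s)) \<le> Re (\<tau> ((x - t) o\<^sub>L t))" by (simp add: g_def)
  qed
qed

text \<open>B need not be complete in the trace norm, so y = x - t has a priori no projection onto
  B. It is replaced by the X n, nearly nearest to y among the self-adjoint elements, and these tend
  to 0: up to errors of order d n, the squared norm of X n is \<tau>(y X n) = \<tau>(x X n) -
  \<tau>(t X n); \<open>support_bound\<close> gives \<tau>(x X n) <= \<tau>(s X n) with a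
  contraction s, and \<tau>(s X n) is nearly \<tau>(y s) <= \<tau>(y t), which is nearly \<tau>(t X
  n).\<close>

lemma contraction_nearest_annihilates:
  assumes x: "x \<in> A" "positive_op x" "op_le x id_blinfun" and t: "t \<in> contractions"
    and near: "\<And>s. s \<in> contractions \<Longrightarrow> Re (\<tau> ((x - t) o\<^sub>L s)) \<le> Re (\<tau> ((x - t) o\<^sub>L t))"
    and c: "c \<in> B" "adj c = c"
  shows "Re (\<tau> ((x - t) o\<^sub>L c)) = 0"
proof -
  define y where "y = x - t"
  define S where "S = {b \<in> B. adj b = b}"
  have tA: "t \<in> A" using contractionsD(1)[OF t] by simp
  have yA: "y \<in> A" using x tA by (simp add: y_def)
  have "S \<noteq> {}" "S \<subseteq> A" unfolding S_def by (auto intro: exI[of _ 0])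
  moreover have "(1/2) *\<^sub>R (a + b) \<in> S" if "a \<in> S" "b \<in> S" for a b using that by (simp add: S_def)
  ultimately obtain X where X: "\<And>n. X n \<in> S"
    "\<And>n b. b \<in> S \<Longrightarrow> (norm2 \<tau> (y - X n))\<^sup>2 \<le> (norm2 \<tau> (y - b))\<^sup>2 + 1 / real (Suc n)"
    using norm2_minimising_sequence[of S y] yA by (metis (no_types, lifting))
  have XB: "X n \<in> B" "adj (X n) = X n" "X n \<in> A" for n using X(1)[of n] by (auto simp: S_def)
  define d where "d n = sqrt (1 / real (Suc n))" for n
  have d: "0 < d n" "d n \<le> 1" "(d n)\<^sup>2 = 1 / real (Suc n)" for n
    by (auto simp: d_def)
  have dlim: "d \<longlonglongrightarrow> 0"
    unfolding d_def using tendsto_real_sqrt[OF LIMSEQ_Suc[OF lim_const_over_n[of 1]]] by simp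
  \<comment> \<open>g/q is the optimal step from X n in the direction b; near-minimality of X n
    bounds the gain g^2/q by (d n)^2.\<close>
  have near_orth: "\<bar>Re (\<tau> ((y - X n) o\<^sub>L b))\<bar> \<le> d n * norm2 \<tau> b" if b: "b \<in> B" "adj b = b" for b n
  proof (cases "norm2 \<tau> b = 0")
    case True
    then have "b = 0" using norm2_eq_0[of b] b by simp
    then show ?thesis by (simp add: blinfun_compose_simps)
  next
    case False
    define q where "q = (norm2 \<tau> b)\<^sup>2"
    define g where "g = Re (\<tau> ((y - X n) o\<^sub>L b))"
    have q: "0 < q" using False by (simp add: q_def)
    have bA: "b \<in> A" using b by simp
    have "X n + (g / q) *\<^sub>R b \<in> S" using XB b by (simp add: S_def)
    from X(2)[OF this, of n]
    have "(norm2 \<tau> (y - X n))\<^sup>2 \<le> (norm2 \<tau> ((y - X n) + (- (g / q)) *\<^sub>R b))\<^sup>2 + (d n)\<^sup>2"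
      by (simp add: d(3) diff_diff_eq)
    also have "(norm2 \<tau> ((y - X n) + (- (g / q)) *\<^sub>R b))\<^sup>2 = (norm2 \<tau> (y - X n))\<^sup>2 - 2 * (g / q) * g + (g / q)\<^sup>2 * q"
      using norm2_sq_add_scaleR[of "y - X n" b "- (g / q)"] yA XB(3)[of n] bA b(2) tr_comm[of b "y - X n"]
      by (simp add: g_def q_def)
    finally have "g\<^sup>2 / q \<le> (d n)\<^sup>2" using q by (simp add: power2_eq_square field_simps)
    then have "g\<^sup>2 \<le> (d n * norm2 \<tau> b)\<^sup>2" using q by (simp add: divide_le_eq power_mult_distrib q_def)
    then show ?thesis
      using d(1)[of n] bA by (simp add: g_def abs_le_square_iff[symmetric])
  qed
  \<comment> \<open>Collects the coefficients of d n: the first summand bounds the trace norm of X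
    n, the 1 is the error from \<open>support_bound\<close>, and the last summand accounts for the
    two contractions s and t.\<close>
  define K where "K = 2 * (norm2 \<tau> y + 1) + 1 + 2 * norm2 \<tau> id_blinfun"
  have Xb: "norm2 \<tau> (X n) \<le> 2 * (norm2 \<tau> y + 1)" for n
  proof -
    have "0 \<in> S" by (simp add: S_def)
    from X(2)[OF this, of n] have "(norm2 \<tau> (y - X n))\<^sup>2 \<le> (norm2 \<tau> y)\<^sup>2 + (d n)\<^sup>2"
      by (simp add: d(3))
    also have "\<dots> \<le> (norm2 \<tau> y)\<^sup>2 + 1" using d[of n] by (simp add: power_le_one)
    also have "\<dots> \<le> (norm2 \<tau> y + 1)\<^sup>2" using norm2_nonneg[OF yA] by (simp add: power2_sum)
    finally have "norm2 \<tau> (y - X n) \<le> norm2 \<tau> y + 1"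
      using norm2_nonneg[OF yA] by (simp add: power2_le_iff_abs_le)
    moreover have "norm2 \<tau> (X n) \<le> norm2 \<tau> y + norm2 \<tau> (y - X n)"
      using norm2_triangle[of y "(-1) *\<^sub>R (y - X n)"] norm2_scaleR[of "y - X n" "-1"] yA XB(3)[of n] by simp
    ultimately have "norm2 \<tau> (X n) \<le> norm2 \<tau> y + (norm2 \<tau> y + 1)"
      by (meson add_left_mono order_trans)
    then show ?thesis by simp
  qed
  have X2: "(norm2 \<tau> (X n))\<^sup>2 \<le> d n * K" for n
  proof -
    obtain s where s: "s \<in> contractions" "Re (\<tau> (x o\<^sub>L X n)) \<le> Re (\<tau> (s o\<^sub>L X n)) + d n"
      using support_bound[OF XB(1,2) x d(1)] by blast
    have sA: "s \<in> A" using contractionsD(1)[OF s(1)] by simp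
    have split: "Re (\<tau> (y o\<^sub>L w)) = Re (\<tau> ((y - X n) o\<^sub>L w)) + Re (\<tau> (X n o\<^sub>L w))" if "w \<in> A" for w
      using that yA XB(3)[of n] by (simp add: blinfun_compose_simps(3)[of y])
    have comm: "\<tau> (X n o\<^sub>L w) = \<tau> (w o\<^sub>L X n)" if "w \<in> A" for w
      using that XB(3) tr_comm by blast
    have near_orth_contraction: "Re (\<tau> ((y - X n) o\<^sub>L w)) \<le> d n * norm2 \<tau> id_blinfun
      \<and> - Re (\<tau> ((y - X n) o\<^sub>L w)) \<le> d n * norm2 \<tau> id_blinfun" if w: "w \<in> contractions" for w
    proof -
      have "d n * norm2 \<tau> w \<le> d n * norm2 \<tau> id_blinfun"
        using d(1)[of n] by (intro mult_left_mono contractionsD(6)[OF w]) simp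
      then show ?thesis using near_orth[OF contractionsD(1,4)[OF w], of n] by linarith
    qed
    have i: "Re (\<tau> (s o\<^sub>L X n)) \<le> Re (\<tau> (y o\<^sub>L s)) + d n * norm2 \<tau> id_blinfun"
      using split[OF sA] near_orth_contraction[OF s(1)] unfolding comm[OF sA] by linarith
    have ii: "Re (\<tau> (y o\<^sub>L t)) \<le> Re (\<tau> (t o\<^sub>L X n)) + d n * norm2 \<tau> id_blinfun"
      using split[OF tA] near_orth_contraction[OF t] unfolding comm[OF tA] by linarith
    have iii: "Re (\<tau> (y o\<^sub>L s)) \<le> Re (\<tau> (y o\<^sub>L t))" using near[OF s(1)] by (simp add: y_def)
    have iv: "Re (\<tau> (y o\<^sub>L X n)) = Re (\<tau> (x o\<^sub>L X n)) - Re (\<tau> (t o\<^sub>L X n))"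
      using x tA XB(3)[of n] by (simp add: y_def blinfun_compose_simps(3))
    have v: "(norm2 \<tau> (X n))\<^sup>2 = Re (\<tau> (X n o\<^sub>L X n))" using norm2_sq[of "X n"] XB(2,3)[of n] by simp
    have vi: "- Re (\<tau> ((y - X n) o\<^sub>L X n)) \<le> d n * norm2 \<tau> (X n)"
      using near_orth[OF XB(1,2), of n n] by (simp add: abs_le_iff)
    have vii: "d n * norm2 \<tau> (X n) \<le> d n * (2 * (norm2 \<tau> y + 1))"
      using Xb[of n] d(1)[of n] by (intro mult_left_mono) auto
    have "(norm2 \<tau> (X n))\<^sup>2 \<le> d n * (2 * (norm2 \<tau> y + 1)) + d n + 2 * (d n * norm2 \<tau> id_blinfun)"
      using split[OF XB(3)[of n]] s(2) i ii iii iv v vi vii by linarith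
    then show ?thesis unfolding K_def by (simp only: distrib_left mult_1_right mult.left_commute[of "d n" 2])
  qed
  have Xlim: "(\<lambda>n. norm2 \<tau> (X n)) \<longlonglongrightarrow> 0"
  proof -
    have "(\<lambda>n. d n * K) \<longlonglongrightarrow> 0 * K" by (intro tendsto_intros dlim)
    then have dK: "(\<lambda>n. d n * K) \<longlonglongrightarrow> 0" by simp
    have "(\<lambda>n. (norm2 \<tau> (X n))\<^sup>2) \<longlonglongrightarrow> 0"
      by (rule tendsto_sandwich[OF _ _ tendsto_const dK]) (use X2 in auto)
    then have "(\<lambda>n. sqrt ((norm2 \<tau> (X n))\<^sup>2)) \<longlonglongrightarrow> sqrt 0" by (intro tendsto_intros)
    then show ?thesis using XB(3) by simp
  qed
  have cA: "c \<in> A" using c by simp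
  have "\<bar>Re (\<tau> (y o\<^sub>L c))\<bar> \<le> (d n + norm2 \<tau> (X n)) * norm2 \<tau> c" for n
  proof -
    have "Re (\<tau> (y o\<^sub>L c)) = Re (\<tau> ((y - X n) o\<^sub>L c)) + Re (\<tau> (X n o\<^sub>L c))"
      using cA yA XB(3)[of n] by (simp add: blinfun_compose_simps(3)[of y])
    moreover have "\<bar>Re (\<tau> (X n o\<^sub>L c))\<bar> \<le> norm2 \<tau> (X n) * norm2 \<tau> c"
      using abs_Re_le_cmod tr_cauchy_schwarz[OF XB(3)[of n] cA] order_trans by blast
    ultimately show ?thesis using near_orth[OF c, of n] by (simp add: distrib_right)
  qed
  moreover have "(\<lambda>n. (d n + norm2 \<tau> (X n)) * norm2 \<tau> c) \<longlonglongrightarrow> (0 + 0) * norm2 \<tau> c"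
    by (intro tendsto_intros dlim Xlim)
  ultimately have "\<bar>Re (\<tau> (y o\<^sub>L c))\<bar> \<le> (0 + 0) * norm2 \<tau> c"
    by (intro LIMSEQ_le_const[where X = "\<lambda>n. (d n + norm2 \<tau> (X n)) * norm2 \<tau> c"]) auto
  then show ?thesis by (simp add: y_def)
qed

text \<open>The characterisation by traces against B. It is visibly linear and, by faithfulness,
  determines e, so the expectation can be assembled from the parts of x.\<close>

definition is_expectation_of :: "'a op \<Rightarrow> 'a op \<Rightarrow> bool" where
  "is_expectation_of e x \<longleftrightarrow> e \<in> B \<and> (\<forall>b\<in>B. \<tau> (e o\<^sub>L b) = \<tau> (x o\<^sub>L b))"

lemma is_expectation_of_unique:
  assumes "is_expectation_of e x" "is_expectation_of e' x" shows "e = e'"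
proof -
  have B: "e \<in> B" "e' \<in> B" using assms by (auto simp: is_expectation_of_def)
  let ?b = "adj (e - e')"
  have "?b \<in> B" using B by simp
  then have "\<tau> (e o\<^sub>L ?b) = \<tau> (e' o\<^sub>L ?b)" using assms by (simp only: is_expectation_of_def)
  moreover have "\<tau> ((e - e') o\<^sub>L ?b) = \<tau> (e o\<^sub>L ?b) - \<tau> (e' o\<^sub>L ?b)"
    using B by (subst blinfun_compose_simps(3)) (simp del: adj_diff)
  ultimately have "\<tau> ((e - e') o\<^sub>L ?b) = 0" by simp
  then have "\<tau> (?b o\<^sub>L (e - e')) = 0" using tr_comm[of "e - e'" ?b] B by simp
  then have "e - e' = 0" by (intro tr_faithful) (use B in auto)
  then show ?thesis by simp
qed

lemma is_expectation_of_add: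
  "x \<in> A \<Longrightarrow> y \<in> A \<Longrightarrow> is_expectation_of e x \<Longrightarrow> is_expectation_of f y \<Longrightarrow> is_expectation_of (e + f) (x + y)"
  by (simp add: is_expectation_of_def blinfun_compose_simps)

lemma is_expectation_of_scale:
  "x \<in> A \<Longrightarrow> is_expectation_of e x \<Longrightarrow> is_expectation_of (scale_op c e) (scale_op c x)"
  by (simp add: is_expectation_of_def scale_op_compose)

lemma tr_self_adjoint_real:
  assumes "x \<in> A" "adj x = x" "y \<in> A" "adj y = y"
  shows "Im (\<tau> (x o\<^sub>L y)) = 0"
proof -
  have "cnj (\<tau> (x o\<^sub>L y)) = \<tau> (x o\<^sub>L y)"
    using tr_adj[of "x o\<^sub>L y"] tr_comm[of y x] assms by simp
  then show ?thesis by (simp add: complex_eq_iff)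
qed

lemma self_adjoint_decomposition:
  assumes x: "x \<in> (bounded_ops :: 'a op set)"
  shows "x = (1/2) *\<^sub>R (x + adj x) + scale_op \<i> (scale_op (- \<i> / 2) (x - adj x))"
    "adj ((1/2) *\<^sub>R (x + adj x)) = (1/2) *\<^sub>R (x + adj x)"
    "adj (scale_op (- \<i> / 2) (x - adj x)) = scale_op (- \<i> / 2) (x - adj x)"
proof -
  show "adj ((1/2) *\<^sub>R (x + adj x)) = (1/2) *\<^sub>R (x + adj x)"
    using x by (simp add: add.commute)
  show "adj (scale_op (- \<i> / 2) (x - adj x)) = scale_op (- \<i> / 2) (x - adj x)"
    using x by (intro blinfun_eqI) (simp add: blinfun.bilinear_simps scaleC.diff_right scaleC.minus_left)
  show "x = (1/2) *\<^sub>R (x + adj x) + scale_op \<i> (scale_op (- \<i> / 2) (x - adj x))"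
  proof (rule blinfun_eqI)
    fix \<xi>
    have i: "\<i> *\<^sub>C (\<i> / 2) *\<^sub>C v = - ((1/2) *\<^sub>R v)" for v :: 'a
      using scaleC_of_real[of "-(1/2)" v] by (simp add: scaleC_scaleC)
    define f where "f = (1/2) *\<^sub>R blinfun_apply x \<xi>"
    have x: "x \<xi> = f + f" unfolding f_def scaleR_add_left[symmetric] by simp
    show "x \<xi> = ((1/2) *\<^sub>R (x + adj x) + scale_op \<i> (scale_op (- \<i> / 2) (x - adj x))) \<xi>"
      by (simp add: blinfun.bilinear_simps scaleC.diff_right scaleC.minus_left scaleC.minus_right i
          scaleR_add_right f_def[symmetric]) (simp add: x)
  qed
qed

text \<open>The residue x - t of the nearest contraction t annihilates the self-adjoint elements of
  B, and these span B. Finding the expectation among the contractions is what later yields its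
  positivity.\<close>

lemma is_expectation_of_exists_contraction:
  assumes x: "x \<in> A" "positive_op x" "op_le x id_blinfun"
  shows "\<exists>e\<in>contractions. is_expectation_of e x"
proof -
  obtain t where t: "t \<in> contractions"
    "\<And>s. s \<in> contractions \<Longrightarrow> Re (\<tau> ((x - t) o\<^sub>L s)) \<le> Re (\<tau> ((x - t) o\<^sub>L t))"
    using contraction_nearest[OF x(1)] by blast
  have tA: "t \<in> A" using contractionsD(1)[OF t(1)] by simp
  have 0: "\<tau> ((x - t) o\<^sub>L c) = 0" if c: "c \<in> B" "adj c = c" for c
  proof -
    have "adj (x - t) = x - t" using contractionsD(4)[OF t(1)] x tA positive_op_adj[OF x(2)] by simp
    then have "Im (\<tau> ((x - t) o\<^sub>L c)) = 0"
      by (intro tr_self_adjoint_real) (use x tA c in auto)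
    then show ?thesis using contraction_nearest_annihilates[OF x t c] by (simp add: complex_eq_iff)
  qed
  have "\<tau> (t o\<^sub>L b) = \<tau> (x o\<^sub>L b)" if b: "b \<in> B" for b
  proof -
    define h where "h = (1/2) *\<^sub>R (b + adj b)"
    define k where "k = scale_op (- \<i> / 2) (b - adj b)"
    have bb: "b \<in> bounded_ops" using b by simp
    note dec = self_adjoint_decomposition[OF bb, folded h_def k_def]
    have hk: "h \<in> B" "k \<in> B" using b by (auto simp: h_def k_def)
    have xt: "x - t \<in> A" using x tA by simp
    have "\<tau> ((x - t) o\<^sub>L (h + scale_op \<i> k)) = \<tau> ((x - t) o\<^sub>L h) + \<i> * \<tau> ((x - t) o\<^sub>L k)"
      using hk xt by (simp only: blinfun_compose_simps(2) scale_op_compose(2)[OF bounded[OF xt]] tr_add tr_scale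
        closed_simps sub_mem)
    also have "\<dots> = 0" using 0[OF hk(1) dec(2)] 0[OF hk(2) dec(3)] by simp
    finally have "\<tau> ((x - t) o\<^sub>L b) = 0" using dec(1) by simp
    then show ?thesis using x tA b by (simp add: blinfun_compose_simps(3))
  qed
  then show ?thesis using t(1) contractionsD(1)[OF t(1)] unfolding is_expectation_of_def by blast
qed

lemma is_expectation_of_exists_positive:
  assumes x: "x \<in> A" "positive_op x"
  shows "\<exists>e. positive_op e \<and> is_expectation_of e x"
proof -
  define c where "c = 1 / (1 + norm x)"
  have c: "0 < c" "c * norm x \<le> 1"
    unfolding c_def by (simp_all add: add_pos_nonneg field_simps)
  have "op_le (c *\<^sub>R x) id_blinfun"
    using self_adjoint_le_norm(1)[of "c *\<^sub>R x" 1] x c positive_op_adj[of x] by simp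
  then obtain e where e: "e \<in> contractions" "is_expectation_of e (c *\<^sub>R x)"
    using is_expectation_of_exists_contraction[of "c *\<^sub>R x"] x c by auto
  have "is_expectation_of (scale_op (of_real (1 / c)) e) (scale_op (of_real (1 / c)) (c *\<^sub>R x))"
    by (rule is_expectation_of_scale) (use x e in auto)
  then have "is_expectation_of ((1 / c) *\<^sub>R e) x" using c by (simp add: scale_op_of_real del: of_real_divide)
  then show ?thesis using contractionsD(2)[OF e(1)] c by (intro exI[of _ "(1 / c) *\<^sub>R e"]) auto
qed

lemma is_expectation_of_exists_self_adjoint:
  assumes x: "x \<in> A" "adj x = x"
  shows "\<exists>e. is_expectation_of e x"
proof -
  have "positive_op (x + norm x *\<^sub>R id_blinfun)"
    using self_adjoint_le_norm(2)[of x "norm x"] x by (simp add: op_le_def)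
  then obtain e where "is_expectation_of e (x + norm x *\<^sub>R id_blinfun)"
    using is_expectation_of_exists_positive[of "x + norm x *\<^sub>R id_blinfun"] x by auto
  moreover have "is_expectation_of (scale_op (of_real (- norm x)) id_blinfun) (scale_op (of_real (- norm x)) id_blinfun)"
    by (simp add: is_expectation_of_def)
  ultimately have "is_expectation_of (e + scale_op (of_real (- norm x)) id_blinfun)
      ((x + norm x *\<^sub>R id_blinfun) + scale_op (of_real (- norm x)) id_blinfun)"
    by (intro is_expectation_of_add) (use x in auto)
  also have "(x + norm x *\<^sub>R id_blinfun) + scale_op (of_real (- norm x)) id_blinfun = x"
    unfolding scale_op_of_real by simp
  finally show ?thesis by blast
qed

lemma is_expectation_of_exists:
  assumes x: "x \<in> A" shows "\<exists>e. is_expectation_of e x"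
proof -
  let ?h = "(1/2) *\<^sub>R (x + adj x)" and ?k = "scale_op (- \<i> / 2) (x - adj x)"
  note dec = self_adjoint_decomposition[OF bounded[OF x]]
  have A: "?h \<in> A" "?k \<in> A" using x by auto
  obtain e f where "is_expectation_of e ?h" "is_expectation_of f ?k"
    using is_expectation_of_exists_self_adjoint[OF A(1) dec(2)] is_expectation_of_exists_self_adjoint[OF A(2) dec(3)] by blast
  then have "is_expectation_of (e + scale_op \<i> f) (?h + scale_op \<i> ?k)"
    using A by (intro is_expectation_of_add is_expectation_of_scale) auto
  then show ?thesis using dec(1) by metis
qed

text \<open>\<open>cond_exp_onto\<close> is a choice and is meaningful because such a map exists.
  Positivity is inherited from the construction; linearity and the bimodule property follow from
  uniqueness.\<close>

theorem trace_preserving_expectation_exists: "\<exists>E. trace_preserving_expectation \<tau> B A E"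
proof -
  define E where "E x = (SOME e. is_expectation_of e x)" for x
  have E: "is_expectation_of (E x) x" if "x \<in> A" for x
    unfolding E_def using is_expectation_of_exists[OF that] by (rule someI_ex)
  have eq: "E x = e" if "x \<in> A" "is_expectation_of e x" for x e
    using is_expectation_of_unique[OF E[OF that(1)] that(2)] .
  have EB: "E x \<in> B" "b \<in> B \<Longrightarrow> \<tau> (E x o\<^sub>L b) = \<tau> (x o\<^sub>L b)" if "x \<in> A" for x b
    using E[OF that] by (auto simp: is_expectation_of_def)
  have "trace_preserving_expectation \<tau> B A E"
    unfolding trace_preserving_expectation_def
  proof (intro conjI ballI allI impI)
    show "E a \<in> B" if "a \<in> A" for a using EB that by blast
    show "E b = b" if "b \<in> B" for b by (rule eq) (use that in \<open>auto simp: is_expectation_of_def\<close>)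
    show "E (x + y) = E x + E y" if "x \<in> A" "y \<in> A" for x y
      by (rule eq) (use that E in \<open>auto intro: is_expectation_of_add\<close>)
    show "E (scale_op c x) = scale_op c (E x)" if "x \<in> A" for c x
      by (rule eq) (use that E in \<open>auto intro: is_expectation_of_scale\<close>)
    show "positive_op (E x)" if "x \<in> A" "positive_op x" for x
      using is_expectation_of_exists_positive[OF that] eq[OF that(1)] by blast
    show "E (b o\<^sub>L x o\<^sub>L b') = b o\<^sub>L E x o\<^sub>L b'" if "x \<in> A" "b \<in> B" "b' \<in> B" for x b b'
    proof (rule eq)
      have "\<tau> (b o\<^sub>L E x o\<^sub>L b' o\<^sub>L c) = \<tau> (b o\<^sub>L x o\<^sub>L b' o\<^sub>L c)" if c: "c \<in> B" for c
      proof -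
        have "\<tau> (b o\<^sub>L E x o\<^sub>L b' o\<^sub>L c) = \<tau> (E x o\<^sub>L (b' o\<^sub>L c o\<^sub>L b))"
          using tr_comm[of b "E x o\<^sub>L (b' o\<^sub>L c)"] \<open>b \<in> B\<close> \<open>b' \<in> B\<close> c EB(1)[OF \<open>x \<in> A\<close>] by (simp add: blinfun_compose_assoc)
        also have "\<dots> = \<tau> (x o\<^sub>L (b' o\<^sub>L c o\<^sub>L b))"
          by (rule EB(2)[OF \<open>x \<in> A\<close>]) (use \<open>b \<in> B\<close> \<open>b' \<in> B\<close> c in auto)
        also have "\<dots> = \<tau> (b o\<^sub>L x o\<^sub>L b' o\<^sub>L c)"
          using tr_comm[of b "x o\<^sub>L (b' o\<^sub>L c)"] \<open>b \<in> B\<close> \<open>b' \<in> B\<close> c \<open>x \<in> A\<close> by (simp add: blinfun_compose_assoc)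
        finally show ?thesis .
      qed
      then show "is_expectation_of (b o\<^sub>L E x o\<^sub>L b') (b o\<^sub>L x o\<^sub>L b')"
        using that EB(1) by (auto simp: is_expectation_of_def)
    qed (use that in auto)
    show "\<tau> (E x) = \<tau> x" if "x \<in> A" for x
      using EB(2)[OF that, of id_blinfun] by (simp add: blinfun_compose_simps)
  qed
  then show ?thesis by blast
qed

section \<open>Calculus of the conditional expectation\<close>

abbreviation E where "E \<equiv> cond_exp_onto \<tau> B A"

lemma expectation: "trace_preserving_expectation \<tau> B A E"
  unfolding cond_exp_onto_def using trace_preserving_expectation_exists by (rule someI_ex)

lemma expectation_closed [simp]: "x \<in> A \<Longrightarrow> E x \<in> B"
  and expectation_id: "b \<in> B \<Longrightarrow> E b = b"
  and expectation_add: "x \<in> A \<Longrightarrow> y \<in> A \<Longrightarrow> E (x + y) = E x + E y"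
  and expectation_scale: "x \<in> A \<Longrightarrow> E (scale_op c x) = scale_op c (E x)"
  and expectation_positive: "x \<in> A \<Longrightarrow> positive_op x \<Longrightarrow> positive_op (E x)"
  and expectation_bimodule: "x \<in> A \<Longrightarrow> b \<in> B \<Longrightarrow> b' \<in> B \<Longrightarrow> E (b o\<^sub>L x o\<^sub>L b') = b o\<^sub>L E x o\<^sub>L b'"
  and expectation_trace: "x \<in> A \<Longrightarrow> \<tau> (E x) = \<tau> x"
  using expectation by (auto simp: trace_preserving_expectation_def)

lemma expectation_left: "x \<in> A \<Longrightarrow> b \<in> B \<Longrightarrow> E (b o\<^sub>L x) = b o\<^sub>L E x"
  and expectation_right: "x \<in> A \<Longrightarrow> b \<in> B \<Longrightarrow> E (x o\<^sub>L b) = E x o\<^sub>L b"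
  using expectation_bimodule[of x b id_blinfun] expectation_bimodule[of x id_blinfun b]
  by (simp_all add: blinfun_compose_simps)

lemma expectation_scaleR: "x \<in> A \<Longrightarrow> E (r *\<^sub>R x) = r *\<^sub>R E x"
  using expectation_scale[of x "of_real r"] by (simp add: scale_op_of_real)

lemma expectation_diff: "x \<in> A \<Longrightarrow> y \<in> A \<Longrightarrow> E (x - y) = E x - E y"
  using expectation_add[of x "(-1) *\<^sub>R y"] expectation_scaleR[of y "-1"] by simp

lemma expectation_is: "x \<in> A \<Longrightarrow> is_expectation_of (E x) x"
  unfolding is_expectation_of_def
  by (metis expectation_closed expectation_right expectation_trace closed_simps(8) sub_mem)

lemma expectation_eqI:
  assumes "x \<in> A" "e \<in> B" "\<And>b. b \<in> B \<Longrightarrow> \<tau> (e o\<^sub>L b) = \<tau> (x o\<^sub>L b)"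
  shows "E x = e"
  by (rule is_expectation_of_unique[OF expectation_is]) (use assms in \<open>auto simp: is_expectation_of_def\<close>)

lemma expectation_trace_right: "x \<in> A \<Longrightarrow> b \<in> B \<Longrightarrow> \<tau> (E x o\<^sub>L b) = \<tau> (x o\<^sub>L b)"
  using expectation_is by (simp add: is_expectation_of_def)

lemma expectation_trace_left: "x \<in> A \<Longrightarrow> b \<in> B \<Longrightarrow> \<tau> (b o\<^sub>L E x) = \<tau> (b o\<^sub>L x)"
  using expectation_trace_right[of x b] tr_comm[of b x] tr_comm[of b "E x"] by simp

lemma expectation_adj: "x \<in> A \<Longrightarrow> E (adj x) = adj (E x)"
proof (rule expectation_eqI)
  assume x: "x \<in> A"
  show "\<tau> (adj (E x) o\<^sub>L b) = \<tau> (adj x o\<^sub>L b)" if b: "b \<in> B" for b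
    using tr_adj[of "adj b o\<^sub>L E x"] tr_adj[of "adj b o\<^sub>L x"] expectation_trace_left[OF x, of "adj b"] x b by simp
qed auto

lemma expectation_norm2_le:
  assumes x: "x \<in> A" shows "norm2 \<tau> (E x) \<le> norm2 \<tau> x"
proof (cases "norm2 \<tau> (E x) = 0")
  case False
  have "(norm2 \<tau> (E x))\<^sup>2 = Re (\<tau> (adj (E x) o\<^sub>L x))"
    using expectation_trace_left[OF x, of "adj (E x)"] x by (simp add: norm2_sq)
  also have "\<dots> \<le> cmod (\<tau> (adj (E x) o\<^sub>L x))" by (rule complex_Re_le_cmod)
  also have "\<dots> \<le> norm2 \<tau> (adj (E x)) * norm2 \<tau> x"
    by (rule tr_cauchy_schwarz) (use x in auto)
  also have "norm2 \<tau> (adj (E x)) = norm2 \<tau> (E x)" by (rule norm2_adj) (use x in auto)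
  finally have "norm2 \<tau> (E x) * norm2 \<tau> (E x) \<le> norm2 \<tau> (E x) * norm2 \<tau> x"
    by (simp add: power2_eq_square)
  moreover have "0 < norm2 \<tau> (E x)" using False x by (simp add: less_le)
  ultimately show ?thesis by (rule mult_left_le_imp_le)
qed (use x in auto)

text \<open>For self-adjoint y with ||y|| <= c, positivity gives 0 <= E y + c <= 2 c and hence ||E
  y|| <= 3 c; the two self-adjoint parts of x double this. The crude constant 6 is harmless where
  uniform boundedness is the aim.\<close>

lemma expectation_norm_le:
  assumes x: "x \<in> A" shows "norm (E x) \<le> 6 * norm x"
proof -
  have sa: "norm (E y) \<le> 3 * c" if y: "y \<in> A" "adj y = y" "norm y \<le> c" for y c
  proof -
    have c: "0 \<le> c" using y(3) norm_ge_zero order_trans by blast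
    note le = self_adjoint_le_norm[of y c]
    have "positive_op (y + c *\<^sub>R id_blinfun)" "positive_op (c *\<^sub>R id_blinfun - y)"
      using le y by (simp_all add: op_le_def)
    then have "positive_op (E y + c *\<^sub>R id_blinfun)" "positive_op (c *\<^sub>R id_blinfun - E y)"
      using expectation_positive[of "y + c *\<^sub>R id_blinfun"] expectation_positive[of "c *\<^sub>R id_blinfun - y"] y(1)
      by (simp_all add: expectation_add expectation_diff expectation_id)
    then have "norm (E y + c *\<^sub>R id_blinfun) \<le> 2 * c"
    proof (intro norm_le_of_op_le)
      have "(2 * c) *\<^sub>R id_blinfun - (E y + c *\<^sub>R id_blinfun) = c *\<^sub>R id_blinfun - E y"
        by (simp only: mult_2 scaleR_add_left) simp
      then show "op_le (E y + c *\<^sub>R id_blinfun) ((2 * c) *\<^sub>R id_blinfun)"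
        using \<open>positive_op (c *\<^sub>R id_blinfun - E y)\<close> by (simp only: op_le_def)
    qed (use c in auto)
    moreover have "norm (c *\<^sub>R (id_blinfun :: 'a op)) \<le> c"
      using mult_left_mono[OF norm_blinfun_id_le c] c by simp
    ultimately show ?thesis
      using norm_triangle_ineq4[of "E y + c *\<^sub>R id_blinfun" "c *\<^sub>R id_blinfun"] by simp
  qed
  let ?h = "(1/2) *\<^sub>R (x + adj x)" and ?k = "scale_op (- \<i> / 2) (x - adj x)"
  note dec = self_adjoint_decomposition[OF bounded[OF x]]
  have A: "?h \<in> A" "?k \<in> A" using x by auto
  have nsc: "norm (scale_op c T) \<le> cmod c * norm T" for c and T :: "'a op"
    by (rule norm_blinfun_bound) (simp_all add: norm_scaleC norm_blinfun mult.assoc mult_left_mono)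
  have na: "norm (adj x) = norm x" by (rule norm_adj[OF bounded[OF x]])
  have "norm ?h \<le> norm x" using norm_triangle_ineq[of x "adj x"] na by simp
  moreover have "norm ?k \<le> norm x"
    using nsc[of "- \<i> / 2" "x - adj x"] norm_triangle_ineq4[of x "adj x"] na by (simp add: norm_divide)
  ultimately have "norm (E ?h) \<le> 3 * norm x" "norm (E ?k) \<le> 3 * norm x"
    using sa[OF A(1) dec(2)] sa[OF A(2) dec(3)] by auto
  moreover have "E x = E ?h + scale_op \<i> (E ?k)"
    using A by (subst dec(1)) (simp only: expectation_add expectation_scale closed_simps)
  ultimately show ?thesis
    using norm_triangle_ineq[of "E ?h" "scale_op \<i> (E ?k)"] nsc[of \<i> "E ?k"] by simp
qed

end

section \<open>Operators on square-summable functions\<close>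

lemma Rep_ell2_simps [simp]:
  "Rep_ell2 (x + y) s = Rep_ell2 x s + Rep_ell2 y s" "Rep_ell2 (x - y) s = Rep_ell2 x s - Rep_ell2 y s"
  "Rep_ell2 (c *\<^sub>C x) s = c *\<^sub>C Rep_ell2 x s" "Rep_ell2 (r *\<^sub>R x) s = r *\<^sub>R Rep_ell2 x s"
  "Rep_ell2 0 s = 0"
  by (simp_all add: plus_ell2.rep_eq minus_ell2.rep_eq scaleC_ell2.rep_eq scaleR_ell2.rep_eq zero_ell2.rep_eq)

lemma ell2_eqI: "(\<And>s. Rep_ell2 x s = Rep_ell2 y s) \<Longrightarrow> x = y"
  by (metis Rep_ell2_inject ext)

lemma norm_Rep_ell2_le: "norm (Rep_ell2 x s) \<le> norm x"
  using L2_set_le_norm_ell2[of "{s}" x] by simp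

lemma tendsto_Rep_ell2: "(X \<longlongrightarrow> x) F \<Longrightarrow> ((\<lambda>i. Rep_ell2 (X i) s) \<longlongrightarrow> Rep_ell2 x s) F"
proof -
  assume "(X \<longlongrightarrow> x) F"
  then have "((\<lambda>i. norm (X i - x)) \<longlongrightarrow> 0) F" by (simp add: LIM_zero tendsto_norm_zero)
  moreover have "norm (Rep_ell2 (X i) s - Rep_ell2 x s) \<le> norm (X i - x)" for i
    using norm_Rep_ell2_le[of "X i - x" s] by simp
  ultimately have "((\<lambda>i. Rep_ell2 (X i) s - Rep_ell2 x s) \<longlongrightarrow> 0) F"
    by (intro Lim_null_comparison[of "\<lambda>i. Rep_ell2 (X i) s - Rep_ell2 x s" "\<lambda>i. norm (X i - x)"]) auto
  then show ?thesis by (rule LIM_zero_cancel)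
qed

lemma norm_ell2_has_sum: "((\<lambda>s. (norm (Rep_ell2 x s))\<^sup>2) has_sum (norm x)\<^sup>2) UNIV"
proof -
  have "(norm x)\<^sup>2 = (\<Sum>\<^sub>\<infinity>s. (norm (Rep_ell2 x s))\<^sup>2)"
    by (simp add: norm_ell2.rep_eq infsum_nonneg)
  then show ?thesis using Rep_ell2[of x] by (simp add: has_sum_infsum)
qed

text \<open>One pattern for the operators on the crossed product space: \<pi>(a) with f the
  identity, u_g with weights 1, and among the operators commuting with these the constant diagonals
  and the weighted right translations.\<close>

definition weighted_comp :: "('g \<Rightarrow> 'g) \<Rightarrow> ('g \<Rightarrow> 'h::complex_hilbert_space op) \<Rightarrow> ('g, 'h) ell2 op" where
  "weighted_comp f T = Blinfun (\<lambda>\<xi>. Abs_ell2 (\<lambda>s. blinfun_apply (T s) (Rep_ell2 \<xi> (f s))))"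

locale bounded_weights =
  fixes f :: "'g \<Rightarrow> 'g" and T :: "'g \<Rightarrow> 'h::complex_hilbert_space op" and K :: real
  assumes inj: "inj f" and T_bounded: "\<And>s. T s \<in> bounded_ops" and K: "\<And>s. norm (T s) \<le> K"
begin

lemma L2_bound:
  assumes F: "finite F"
  shows "L2_set (\<lambda>s. norm (blinfun_apply (T s) (Rep_ell2 \<xi> (f s)))) F \<le> norm \<xi> * K"
proof -
  have K0: "0 \<le> K" using K norm_ge_zero order_trans by blast
  have "L2_set (\<lambda>s. norm (blinfun_apply (T s) (Rep_ell2 \<xi> (f s)))) F \<le> L2_set (\<lambda>s. K * norm (Rep_ell2 \<xi> (f s))) F"
    by (intro L2_set_mono norm_blinfun_le K) auto
  also have "\<dots> = K * L2_set (\<lambda>s. norm (Rep_ell2 \<xi> (f s))) F" using K0 by (simp add: L2_set_right_distrib)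
  also have "L2_set (\<lambda>s. norm (Rep_ell2 \<xi> (f s))) F = L2_set (\<lambda>s. norm (Rep_ell2 \<xi> s)) (f ` F)"
    unfolding L2_set_def using inj by (subst sum.reindex) (auto intro: inj_on_subset)
  also have "K * \<dots> \<le> K * norm \<xi>"
    using F K0 by (intro mult_left_mono L2_set_le_norm_ell2) auto
  finally show ?thesis by (simp add: mult.commute)
qed

lemma Rep_Abs:
  "Rep_ell2 (Abs_ell2 (\<lambda>s. blinfun_apply (T s) (Rep_ell2 \<xi> (f s)))) s = blinfun_apply (T s) (Rep_ell2 \<xi> (f s))"
  using L2_bound ell2_iff_bound[of "\<lambda>s. blinfun_apply (T s) (Rep_ell2 \<xi> (f s))"] by (subst Abs_ell2_inverse) auto

lemma
  shows weighted_comp_bounded_ops [simp]: "weighted_comp f T \<in> bounded_ops"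
    and Rep_weighted_comp [simp]: "Rep_ell2 (blinfun_apply (weighted_comp f T) \<xi>) s = blinfun_apply (T s) (Rep_ell2 \<xi> (f s))"
proof -
  let ?W = "\<lambda>\<xi>. Abs_ell2 (\<lambda>s. blinfun_apply (T s) (Rep_ell2 \<xi> (f s)))"
  have 1: "?W (x + y) = ?W x + ?W y" for x y 
    by (rule ell2_eqI, simp only: Rep_Abs Rep_ell2_simps(1)[of "?W x"]) (simp add: blinfun.bilinear_simps)
  have 2: "?W (c *\<^sub>C x) = c *\<^sub>C ?W x" for c x
    by (rule ell2_eqI, simp only: Rep_Abs Rep_ell2_simps(3)[of c "?W x"]) (simp add: bounded_ops_scaleC[OF T_bounded])
  have 3: "norm (?W x) \<le> norm x * K" for x
    by (rule norm_ell2_le) (use L2_bound in \<open>simp add: Rep_Abs\<close>)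
  note W = bounded_ops_of_linear[of ?W, OF 1 2 3]
  show "weighted_comp f T \<in> bounded_ops" unfolding weighted_comp_def by (rule W(1))
  show "Rep_ell2 (blinfun_apply (weighted_comp f T) \<xi>) s = blinfun_apply (T s) (Rep_ell2 \<xi> (f s))"
    unfolding weighted_comp_def W(2) by (rule Rep_Abs)
qed

end

definition single :: "'g \<Rightarrow> 'h \<Rightarrow> ('g, 'h::complex_hilbert_space) ell2" where
  "single s \<eta> = Abs_ell2 (\<lambda>t. if t = s then \<eta> else 0)"

lemma Rep_single [simp]: "Rep_ell2 (single s \<eta>) t = (if t = s then \<eta> else 0)"
proof -
  have "(\<lambda>t. (norm (if t = s then \<eta> else 0))\<^sup>2) summable_on UNIV"
    by (rule summable_on_cong_neutral[THEN iffD1, OF _ _ _ summable_on_finite[of "{s}" "\<lambda>_. (norm \<eta>)\<^sup>2"]]) auto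
  then show ?thesis unfolding single_def by (subst Abs_ell2_inverse) auto
qed

lemma single_linear:
  "single s (x + y) = single s x + single s y" "single s (c *\<^sub>C x) = c *\<^sub>C single s x" "single s 0 = 0"
  by (auto intro!: ell2_eqI simp: scaleC.zero_right)

lemma cinner_single: "cinner \<xi> (single s \<eta>) = cinner (Rep_ell2 \<xi> s) \<eta>"
proof -
  have "cinner \<xi> (single s \<eta>) = infsum (\<lambda>t. cinner (Rep_ell2 \<xi> t) (Rep_ell2 (single s \<eta>) t)) {s}"
    unfolding cinner_ell2.rep_eq by (rule infsum_cong_neutral) auto
  then show ?thesis by simp
qed

lemma cinner_single_left: "cinner (single s \<eta>) \<xi> = cinner \<eta> (Rep_ell2 \<xi> s)"
  by (metis cinner_commute cinner_single)

lemma norm_single [simp]: "norm (single s \<eta>) = norm \<eta>"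
proof -
  have "(norm (single s \<eta>))\<^sup>2 = (norm \<eta>)\<^sup>2"
    using Re_cinner_self[of "single s \<eta>"] by (simp add: cinner_single Re_cinner_self)
  then show ?thesis by (simp add: power2_eq_iff_nonneg)
qed

definition entry :: "('g, 'h::complex_hilbert_space) ell2 op \<Rightarrow> 'g \<Rightarrow> 'g \<Rightarrow> 'h op" where
  "entry x s t = Blinfun (\<lambda>\<eta>. Rep_ell2 (blinfun_apply x (single t \<eta>)) s)"

lemma
  assumes x: "x \<in> bounded_ops"
  shows entry_bounded_ops [simp]: "entry x s t \<in> bounded_ops"
    and entry_apply: "blinfun_apply (entry x s t) \<eta> = Rep_ell2 (blinfun_apply x (single t \<eta>)) s"
    and norm_entry_le: "norm (entry x s t) \<le> norm x"
proof -
  have 1: "norm (Rep_ell2 (blinfun_apply x (single t \<eta>)) s) \<le> norm \<eta> * norm x" for \<eta>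
    using norm_Rep_ell2_le[of "blinfun_apply x (single t \<eta>)" s] norm_blinfun[of x "single t \<eta>"]
    by (simp add: mult.commute)
  note W = bounded_ops_of_linear[of "\<lambda>\<eta>. Rep_ell2 (blinfun_apply x (single t \<eta>)) s", OF _ _ 1]
  show "entry x s t \<in> bounded_ops" unfolding entry_def
    by (rule W(1)) (simp_all add: single_linear blinfun.bilinear_simps bounded_ops_scaleC[OF x])
  show 2: "blinfun_apply (entry x s t) \<eta> = Rep_ell2 (blinfun_apply x (single t \<eta>)) s" for \<eta> unfolding entry_def
    by (subst W(2)) (simp_all add: single_linear blinfun.bilinear_simps bounded_ops_scaleC[OF x])
  show "norm (entry x s t) \<le> norm x"
    by (rule norm_blinfun_bound) (use 1 2 in \<open>simp_all add: mult.commute\<close>)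
qed

lemma cinner_entry:
  "x \<in> bounded_ops \<Longrightarrow> cinner (blinfun_apply (entry x s t) \<eta>) \<zeta> = cinner (blinfun_apply x (single t \<eta>)) (single s \<zeta>)"
  by (simp add: entry_apply cinner_single)

lemma entry_add: "x \<in> bounded_ops \<Longrightarrow> y \<in> bounded_ops \<Longrightarrow> entry (x + y) s t = entry x s t + entry y s t"
  and entry_diff: "x \<in> bounded_ops \<Longrightarrow> y \<in> bounded_ops \<Longrightarrow> entry (x - y) s t = entry x s t - entry y s t"
  and entry_scale_op: "x \<in> bounded_ops \<Longrightarrow> entry (scale_op c x) s t = scale_op c (entry x s t)"
  by (auto intro!: blinfun_eqI simp: entry_apply blinfun.bilinear_simps)

lemma entry_adj:
  assumes x: "x \<in> bounded_ops" shows "entry (adj x) s t = adj (entry x t s)"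
proof -
  have "adj (entry x t s) = entry (adj x) s t"
    by (rule adj_eqI[OF entry_bounded_ops[OF x]])
      (simp add: cinner_entry[OF x] cinner_adj_right[OF x] entry_apply[OF adj_bounded_ops[OF x]] cinner_single_left)
  then show ?thesis by simp
qed

lemma entry_zero [simp]: "entry 0 s t = 0"
  by (rule blinfun_eqI) (simp add: entry_apply)

lemma entry_id: "entry id_blinfun s t = (if s = t then id_blinfun else 0)"
  by (rule blinfun_eqI) (simp add: entry_apply)

text \<open>The difference kills every vector \<open>single t \<eta>\<close>; pairing with these
  shows that its adjoint vanishes coordinatewise.\<close>

lemma op_eq_entries:
  assumes x: "x \<in> bounded_ops" and y: "y \<in> bounded_ops" and e: "\<And>s t. entry x s t = entry y s t"
  shows "x = y"
proof -
  let ?d = "x - y"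
  have d: "?d \<in> bounded_ops" using x y by simp
  have "blinfun_apply (adj ?d) \<xi> = 0" for \<xi>
  proof (rule ell2_eqI)
    fix t
    have z: "blinfun_apply ?d (single t \<eta>) = 0" for \<eta>
    proof (rule ell2_eqI)
      fix s
      have "Rep_ell2 (blinfun_apply x (single t \<eta>)) s = Rep_ell2 (blinfun_apply y (single t \<eta>)) s"
        using e[of s t] entry_apply[OF x, of s t \<eta>] entry_apply[OF y, of s t \<eta>] by simp
      then show "Rep_ell2 (blinfun_apply ?d (single t \<eta>)) s = Rep_ell2 0 s" by (simp add: blinfun.bilinear_simps)
    qed
    have "cinner (Rep_ell2 (blinfun_apply (adj ?d) \<xi>) t) \<eta> = 0" for \<eta>
      using cinner_adj_left[OF d, of \<xi> "single t \<eta>"] by (simp add: z cinner_single)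
    then show "Rep_ell2 (blinfun_apply (adj ?d) \<xi>) t = Rep_ell2 0 t"
      using cinner_ext[of "Rep_ell2 (blinfun_apply (adj ?d) \<xi>) t" 0] by simp
  qed
  then have "adj ?d = 0" by (intro blinfun_eqI) simp
  then have "adj (adj ?d) = 0" by (simp only: adj_zero)
  then have "?d = 0" using d by (simp only: adj_adj)
  then show ?thesis by simp
qed

context bounded_weights
begin

lemma entry_weighted_comp_left:
  "x \<in> bounded_ops \<Longrightarrow> entry (weighted_comp f T o\<^sub>L x) s t = T s o\<^sub>L entry x (f s) t"
  by (rule blinfun_eqI) (simp add: entry_apply)

lemma weighted_comp_single:
  "blinfun_apply (weighted_comp f T) (single (f t) \<eta>) = single t (blinfun_apply (T t) \<eta>)"
  using inj by (intro ell2_eqI) (auto simp: inj_def)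

lemma entry_weighted_comp_right:
  "x \<in> bounded_ops \<Longrightarrow> entry (x o\<^sub>L weighted_comp f T) s (f t) = entry x s t o\<^sub>L T t"
  by (rule blinfun_eqI) (simp add: entry_apply weighted_comp_single)

lemma entry_weighted_comp: "entry (weighted_comp f T) s t = (if f s = t then T s else 0)"
  by (rule blinfun_eqI) (simp add: entry_apply)

end

lemma adj_diagonal:
  assumes "bounded_weights id T K"
  shows "adj (weighted_comp id T) = weighted_comp id (\<lambda>s. adj (T s))"
proof -
  interpret T: bounded_weights id T K by (rule assms)
  interpret T': bounded_weights id "\<lambda>s. adj (T s)" K
    by unfold_locales (use T.T_bounded T.K in \<open>auto simp: norm_adj\<close>)
  show ?thesis
    by (rule op_eq_entries)
      (auto simp: entry_adj T.entry_weighted_comp T'.entry_weighted_comp)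
qed

section \<open>Intertwiners of an automorphism\<close>

context tracial_algebra
begin

text \<open>From a (1 + adj(a) a) = (1 + a adj(a)) a by inverting on both sides.\<close>

lemma resolv_push_through:
  assumes a: "a \<in> A"
  shows "resolv (a o\<^sub>L adj a) o\<^sub>L a = a o\<^sub>L resolv (adj a o\<^sub>L a)"
proof -
  have p: "positive_op (adj a o\<^sub>L a)" "positive_op (a o\<^sub>L adj a)"
    using positive_op_adj_self[of a] positive_op_adj_self[of "adj a"] a by auto
  let ?r = "resolv (adj a o\<^sub>L a)" and ?q = "resolv (a o\<^sub>L adj a)"
  have "?q o\<^sub>L a = ?q o\<^sub>L (a o\<^sub>L ((id_blinfun + (adj a o\<^sub>L a)) o\<^sub>L ?r))"
    by (simp only: resolv_right[OF p(1)] blinfun_compose_simps(8))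
  also have "a o\<^sub>L ((id_blinfun + (adj a o\<^sub>L a)) o\<^sub>L ?r) = (id_blinfun + (a o\<^sub>L adj a)) o\<^sub>L (a o\<^sub>L ?r)"
    by (simp add: blinfun_compose_simps blinfun_compose_assoc)
  also have "?q o\<^sub>L \<dots> = a o\<^sub>L ?r"
    by (simp add: blinfun_compose_assoc[symmetric] resolv_left[OF p(2)] blinfun_compose_simps(7))
  finally show ?thesis .
qed

text \<open>The projection onto the closure of \<open>{(\<sigma>(a)\<eta>, a\<xi>\<^sub>0, a\<xi>\<^sub>1, \<dots>)}\<close> commutes with the operators
  \<open>\<sigma>(a) \<oplus> a \<oplus> a \<oplus> \<dots>\<close>, so its off-diagonal entries are intertwiners. If \<open>b\<close> kills them all and \<open>\<eta>\<close> is in the range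
  of \<open>b\<^sup>*\<close>, then \<open>(\<eta>, 0, 0, \<dots>)\<close> lies in that closure: there are \<open>a\<^sub>n\<close> with \<open>\<sigma>(a\<^sub>n)\<eta> \<longlonglongrightarrow> \<eta>\<close> and
  \<open>a\<^sub>n\<xi>\<^sub>i \<longlonglongrightarrow> 0\<close>. The \<open>a\<^sub>n\<close> need not be bounded, which is repaired by multiplying with
  \<open>q\<^sub>n = (1 + a\<^sub>na\<^sub>n\<^sup>*)\<inverse>\<close>, because \<open>\<tau>(1 - q\<^sub>n) = \<tau>(1 - (1 + a\<^sub>n\<^sup>*a\<^sub>n)\<inverse>)\<close> tends to \<open>0\<close>.\<close>

lemma intertwiners_separate:
  assumes iso: "star_isomorphism A A \<sigma>" and b: "b \<in> A"
    and kills: "\<And>V. V \<in> bounded_ops \<Longrightarrow> (\<And>a. a \<in> A \<Longrightarrow> V o\<^sub>L a = \<sigma> a o\<^sub>L V) \<Longrightarrow> b o\<^sub>L V = 0"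
  shows "b = 0"
proof (rule ccontr)
  interpret \<sigma>: vn_isomorphism A A \<sigma>
    by unfold_locales (rule iso)
  assume "b \<noteq> 0"
  then have "adj b \<noteq> 0" using b by (metis adj_adj adj_zero bounded)
  then obtain \<eta>0 where \<eta>0: "blinfun_apply (adj b) \<eta>0 \<noteq> 0" by (metis blinfun_eqI zero_blinfun.rep_eq)
  define \<eta> where "\<eta> = blinfun_apply (adj b) \<eta>0"
  obtain \<xi> :: "nat \<Rightarrow> 'a" where sm: "summable (\<lambda>i. (norm (\<xi> i))\<^sup>2)"
    and sep: "\<And>x. x \<in> A \<Longrightarrow> (\<And>i. blinfun_apply x (\<xi> i) = 0) \<Longrightarrow> x = 0"
    using separating_summable_sequence by blast
  \<comment> \<open>Coordinate 0 carries \<sigma>(a) and all later ones a; accordingly the indices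
    of \<xi> are shifted by one in the vector \<open>v\<close> below.\<close>
  define w where "w a i = (case i of 0 \<Rightarrow> \<sigma> a | Suc j \<Rightarrow> a)" for a and i :: nat
  have w_simps [simp]: "w a 0 = \<sigma> a" "w a (Suc i) = a" for a i by (simp_all add: w_def)
  have bw: "bounded_weights id (w a) (norm a)" if a: "a \<in> A" for a
  proof
    show "w a s \<in> bounded_ops" "norm (w a s) \<le> norm a" for s
      using a \<sigma>.norm_le[OF a] by (cases s; simp)+
  qed simp
  define G where "G a = weighted_comp id (w a)" for a
  have G_bounded: "G a \<in> bounded_ops" if "a \<in> A" for a
    unfolding G_def using bounded_weights.weighted_comp_bounded_ops[OF bw[OF that]] .
  have Rep_G: "Rep_ell2 (blinfun_apply (G a) \<zeta>) s = blinfun_apply (w a s) (Rep_ell2 \<zeta> s)" if "a \<in> A" for a \<zeta> s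
    unfolding G_def using bounded_weights.Rep_weighted_comp[OF bw[OF that]] by simp
  have w_lin: "w (a + c) s = w a s + w c s" "w (scale_op z a) s = scale_op z (w a s)" "w (a o\<^sub>L c) s = w a s o\<^sub>L w c s"
    "w (adj a) s = adj (w a s)"
    if "a \<in> A" "c \<in> A" for a c z s
    using that by (cases s; simp)+
  have G_adj: "adj (G a) = G (adj a)" if a: "a \<in> A" for a
  proof -
    have "(\<lambda>s. adj (w a s)) = w (adj a)" using w_lin(4)[OF a a] by auto
    then show ?thesis unfolding G_def adj_diagonal[OF bw[OF a]] by simp
  qed
  define v where "v i = (case i of 0 \<Rightarrow> \<eta> | Suc j \<Rightarrow> \<xi> j)" for i
  have "summable (\<lambda>i. norm ((norm (v i))\<^sup>2))"
    using sm by (subst summable_Suc_iff[symmetric]) (simp add: v_def)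
  then have "(\<lambda>i. (norm (v i))\<^sup>2) summable_on UNIV" by (rule norm_summable_imp_summable_on)
  then obtain \<Xi> where \<Xi>: "Rep_ell2 \<Xi> = v" using Abs_ell2_inverse by blast
  have \<Xi>s: "Rep_ell2 \<Xi> 0 = \<eta>" "Rep_ell2 \<Xi> (Suc i) = \<xi> i" for i by (simp_all add: \<Xi> v_def)
  define S where "S = (\<lambda>a. blinfun_apply (G a) \<Xi>) ` A"
  have GS: "blinfun_apply (G a) z \<in> S" if a: "a \<in> A" and z: "z \<in> S" for a z
  proof -
    obtain c where c: "c \<in> A" "z = blinfun_apply (G c) \<Xi>" using z by (auto simp: S_def)
    have "blinfun_apply (G a) z = blinfun_apply (G (a o\<^sub>L c)) \<Xi>"
      by (rule ell2_eqI) (simp add: c Rep_G a w_lin(3))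
    then show ?thesis using a c by (auto simp: S_def)
  qed
  have csS: "csubspace S"
    unfolding csubspace_def
  proof (intro conjI ballI allI)
    have "blinfun_apply (G 0) \<Xi> = 0"
      using w_lin(2)[of 0 0 0] by (intro ell2_eqI) (simp add: Rep_G, case_tac s; simp)
    then show "0 \<in> S" by (metis S_def closed_simps(2) imageI)
    fix x y c assume "x \<in> S" "y \<in> S"
    then obtain a a' where a: "a \<in> A" "x = blinfun_apply (G a) \<Xi>" "a' \<in> A" "y = blinfun_apply (G a') \<Xi>"
      by (auto simp: S_def)
    have "x + y = blinfun_apply (G (a + a')) \<Xi>"
      by (rule ell2_eqI) (simp add: a Rep_G w_lin(1) blinfun.bilinear_simps)
    then show "x + y \<in> S" using a by (auto simp: S_def)
    have "c *\<^sub>C x = blinfun_apply (G (scale_op c a)) \<Xi>"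
      by (rule ell2_eqI) (simp add: a Rep_G w_lin(2)[OF a(1) a(1)])
    then show "c *\<^sub>C x \<in> S" using a by (auto simp: S_def)
  qed
  have csV: "csubspace (closure S)"
    unfolding csubspace_def
  proof (intro conjI ballI allI)
    show "0 \<in> closure S" using csS closure_subset unfolding csubspace_def by blast
    fix x y c assume "x \<in> closure S" "y \<in> closure S"
    then obtain X Y where XY: "\<And>n. X n \<in> S" "X \<longlonglongrightarrow> x" "\<And>n. Y n \<in> S" "Y \<longlonglongrightarrow> y"
      unfolding closure_sequential by blast
    have "X n + Y n \<in> S" "c *\<^sub>C X n \<in> S" for n using csS XY unfolding csubspace_def by blast+
    moreover have "(\<lambda>n. X n + Y n) \<longlonglongrightarrow> x + y" "(\<lambda>n. c *\<^sub>C X n) \<longlonglongrightarrow> c *\<^sub>C x"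
      by (intro tendsto_add XY scaleC.tendsto tendsto_const)+
    ultimately show "x + y \<in> closure S" "c *\<^sub>C x \<in> closure S"
      unfolding closure_sequential by (intro exI[of _ "\<lambda>n. X n + Y n"] exI[of _ "\<lambda>n. c *\<^sub>C X n"]; simp)+
  qed
  have GV: "blinfun_apply (G a) z \<in> closure S" if a: "a \<in> A" and z: "z \<in> closure S" for a z
  proof -
    obtain Z where Z: "\<And>n. Z n \<in> S" "Z \<longlonglongrightarrow> z" using z unfolding closure_sequential by blast
    have "(\<lambda>n. blinfun_apply (G a) (Z n)) \<longlonglongrightarrow> blinfun_apply (G a) z"
      by (intro blinfun.tendsto tendsto_const Z)
    then show ?thesis using GS[OF a Z(1)] unfolding closure_sequential
      by (intro exI[of _ "\<lambda>n. blinfun_apply (G a) (Z n)"]) simp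
  qed
  obtain P where P: "P \<in> bounded_ops" "positive_op P" "P o\<^sub>L P = P" "\<And>x. blinfun_apply P x \<in> closure S"
    "\<And>x. x \<in> closure S \<Longrightarrow> blinfun_apply P x = x"
    using projection_exists[OF csV closed_closure] by blast
  have PG: "P o\<^sub>L G a = G a o\<^sub>L P" if a: "a \<in> A" for a
    by (rule projection_commute[OF P(2,4,5) G_bounded[OF a] GV[OF a]])
      (use GV[OF adj_closed[OF a]] G_adj[OF a] in auto)
  have entry_G: "entry (G a o\<^sub>L P) s t = w a s o\<^sub>L entry P s t" "entry (P o\<^sub>L G a) s t = entry P s t o\<^sub>L w a t"
    if a: "a \<in> A" for a s t
    using bounded_weights.entry_weighted_comp_left[OF bw[OF a] P(1), of s t]
      bounded_weights.entry_weighted_comp_right[OF bw[OF a] P(1), of s t] unfolding G_def by simp_all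
  have b0: "b o\<^sub>L entry P 0 (Suc i) = 0" for i
  proof (rule kills)
    show "entry P 0 (Suc i) o\<^sub>L a = \<sigma> a o\<^sub>L entry P 0 (Suc i)" if a: "a \<in> A" for a
      using entry_G[OF a, of 0 "Suc i"] PG[OF a] by simp
  qed (use P in simp)
  let ?s = "single 0 \<eta> :: (nat, 'a) ell2"
  \<comment> \<open>The entries of P in column 0 below the first are adjoints of intertwiners that b
    kills from the left, so they vanish on the range of adj b, which contains \<eta>.\<close>
  have Ps: "blinfun_apply P ?s = single 0 (blinfun_apply (entry P 0 0) \<eta>)"
  proof (rule ell2_eqI)
    fix k
    have "blinfun_apply (entry P (Suc i) 0) \<eta> = 0" for i
    proof -
      have "adj (entry P 0 (Suc i)) = entry P (Suc i) 0"
        using entry_adj[OF P(1), of "Suc i" 0] positive_op_adj[OF P(2)] by simp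
      moreover have "adj (b o\<^sub>L entry P 0 (Suc i)) = 0" by (simp only: b0 adj_zero)
      ultimately have "entry P (Suc i) 0 o\<^sub>L adj b = 0" using b P(1) by simp
      then show ?thesis unfolding \<eta>_def by (metis blinfun_apply_blinfun_compose zero_blinfun.rep_eq)
    qed
    then show "Rep_ell2 (blinfun_apply P ?s) k = Rep_ell2 (single 0 (blinfun_apply (entry P 0 0) \<eta>)) k"
      by (cases k) (simp_all add: entry_apply[OF P(1), symmetric])
  qed
  have "\<Xi> \<in> closure S"
  proof -
    have "blinfun_apply (G id_blinfun) \<Xi> = \<Xi>"
      by (rule ell2_eqI) (simp add: Rep_G, case_tac s; simp)
    then have "\<Xi> \<in> S" unfolding S_def by (metis closed_simps(1) imageI)
    then show ?thesis using closure_subset by blast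
  qed
  then have "blinfun_apply P \<Xi> = \<Xi>" by (rule P(5))
  then have "cinner (blinfun_apply P ?s) \<Xi> = cinner ?s \<Xi>"
    using cinner_adj_right[OF P(1), of ?s \<Xi>] positive_op_adj[OF P(2)] by simp
  then have Q: "cinner (blinfun_apply (entry P 0 0) \<eta>) \<eta> = cinner \<eta> \<eta>"
    unfolding Ps by (simp add: cinner_single_left \<Xi>s)
  \<comment> \<open>P fixes \<Xi> and maps ?s into coordinate 0, where \<Xi> has the entry \<eta>;
    so <P ?s, ?s> = <P ?s, \<Xi>> = <?s, \<Xi>> = <?s, ?s>, and for a projection this means P ?s =
    ?s.\<close>
  have "(norm (blinfun_apply P ?s - ?s))\<^sup>2 = 0"
  proof -
    have 1: "cinner (blinfun_apply P ?s) ?s = cinner \<eta> \<eta>" unfolding Ps by (simp add: cinner_single_left Q)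
    have "cinner (blinfun_apply P ?s) (blinfun_apply P ?s) = cinner (blinfun_apply P (blinfun_apply P ?s)) ?s"
      using cinner_adj_left[OF P(1), of "blinfun_apply P ?s" ?s] positive_op_adj[OF P(2)] by simp
    also have "blinfun_apply P (blinfun_apply P ?s) = blinfun_apply P ?s"
      using P(3) by (metis blinfun_apply_blinfun_compose)
    finally have 2: "cinner (blinfun_apply P ?s) (blinfun_apply P ?s) = cinner \<eta> \<eta>" by (simp add: 1)
    have 3: "cinner ?s (blinfun_apply P ?s) = cinner \<eta> \<eta>" using 1 by (metis cinner_commute)
    have 4: "cinner ?s ?s = cinner \<eta> \<eta>" by (simp add: cinner_single_left)
    have "complex_of_real ((norm (blinfun_apply P ?s - ?s))\<^sup>2) = 0"
      unfolding cinner_self[symmetric] by (simp add: cinner.diff_left cinner.diff_right 1 2 3 4)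
    then show ?thesis by simp
  qed
  then have "?s \<in> closure S" using P(4)[of ?s] by simp
  then obtain Z where Z: "\<And>n. Z n \<in> S" "Z \<longlonglongrightarrow> ?s" unfolding closure_sequential by blast
  have "\<exists>c. c \<in> A \<and> Z n = blinfun_apply (G c) \<Xi>" for n using Z(1)[of n] by (auto simp: S_def)
  then obtain a where a: "\<And>n. a n \<in> A" "\<And>n. Z n = blinfun_apply (G (a n)) \<Xi>" by metis
  have lim_eta: "(\<lambda>n. \<sigma> (a n) \<eta>) \<longlonglongrightarrow> \<eta>"
    using tendsto_Rep_ell2[OF Z(2), of 0] by (simp add: a Rep_G \<Xi>s)
  define d where "d n = (norm (Z n - ?s))\<^sup>2" for n
  have dlim: "d \<longlonglongrightarrow> 0"
    unfolding d_def using tendsto_power[OF tendsto_norm_zero[OF LIM_zero[OF Z(2)]], of 2] by simp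
  have axi: "(\<Sum>i<k. (norm (a n (\<xi> i)))\<^sup>2) \<le> d n" for n k
  proof -
    have "(\<Sum>i<k. (norm (a n (\<xi> i)))\<^sup>2) = (\<Sum>i\<in>Suc ` {..<k}. (norm (Rep_ell2 (Z n - ?s) i))\<^sup>2)"
      by (subst sum.reindex) (auto simp: a Rep_G \<Xi>s)
    also have "\<dots> = (L2_set (\<lambda>i. norm (Rep_ell2 (Z n - ?s) i)) (Suc ` {..<k}))\<^sup>2"
      unfolding L2_set_def by (simp add: sum_nonneg)
    also have "\<dots> \<le> d n" unfolding d_def by (intro power_mono L2_set_le_norm_ell2) (auto simp: L2_set_def sum_nonneg)
    finally show ?thesis .
  qed
  define r where "r n = resolv (adj (a n) o\<^sub>L a n)" for n
  define q where "q n = resolv (a n o\<^sub>L adj (a n))" for n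
  have pos: "positive_op (adj (a n) o\<^sub>L a n)" "positive_op (a n o\<^sub>L adj (a n))" for n
    using positive_op_adj_self[of "a n"] positive_op_adj_self[of "adj (a n)"] a by auto
  have rq: "r n \<in> A" "positive_op (r n)" "op_le (r n) id_blinfun" "q n \<in> A" "positive_op (q n)" "op_le (q n) id_blinfun" for n
    unfolding r_def q_def using a pos by auto
  have push: "q n o\<^sub>L a n = a n o\<^sub>L r n" for n unfolding q_def r_def by (rule resolv_push_through[OF a(1)])
  define y where "y n = id_blinfun - r n" for n
  have yr: "y n = (adj (a n) o\<^sub>L a n) o\<^sub>L r n" "op_le (y n) (adj (a n) o\<^sub>L a n)" for n
    unfolding y_def r_def using resolv_compl(1)[OF pos(1)] compl_resolv_le[OF pos(1)] by simp_all
  have y: "y n \<in> A" "positive_op (y n)" "op_le (y n) id_blinfun" for n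
    unfolding y_def using rq by (auto simp: op_le_def)
  \<comment> \<open>As y n <= adj(a) a, its vector functionals at the \<xi>_i are dominated by ||a
    \<xi>_i||^2, which sum to at most d n.\<close>
  have tau_y: "(\<lambda>n. Re (\<tau> (y n))) \<longlonglongrightarrow> 0"
  proof (rule vector_series_tendsto_norm2[OF sm sep, where K = 1])
    show "(\<lambda>n. \<Sum>i. Re (cinner (blinfun_apply (y n) (\<xi> i)) (\<xi> i))) \<longlonglongrightarrow> 0"
    proof (rule tendsto_sandwich[OF _ _ tendsto_const dlim])
      have le: "Re (cinner (blinfun_apply (y n) (\<xi> i)) (\<xi> i)) \<le> (norm (a n (\<xi> i)))\<^sup>2" for n i
        using op_le_Re[OF yr(2)[of n], of "\<xi> i"] norm_adj_compose_self[OF bounded[OF a(1)[of n]], of "\<xi> i"] by simp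
      have nn: "0 \<le> Re (cinner (blinfun_apply (y n) (\<xi> i)) (\<xi> i))" for n i by (rule positive_op_Re[OF y(2)])
      have part: "(\<Sum>i<k. Re (cinner (blinfun_apply (y n) (\<xi> i)) (\<xi> i))) \<le> d n" for n k
        by (rule order_trans[OF sum_mono axi[where k = k and n = n]]) (rule le)
      have s: "summable (\<lambda>i. Re (cinner (blinfun_apply (y n) (\<xi> i)) (\<xi> i)))" for n
        by (rule summableI_nonneg_bounded[OF nn part])
      have "(\<Sum>i. Re (cinner (blinfun_apply (y n) (\<xi> i)) (\<xi> i))) \<le> d n" for n
        by (rule suminf_le_const[OF s part])
      then show "\<forall>\<^sub>F n in sequentially. (\<Sum>i. Re (cinner (blinfun_apply (y n) (\<xi> i)) (\<xi> i))) \<le> d n" by simp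
      show "\<forall>\<^sub>F n in sequentially. 0 \<le> (\<Sum>i. Re (cinner (blinfun_apply (y n) (\<xi> i)) (\<xi> i)))"
        using suminf_nonneg[OF s nn] by simp
    qed
  qed (use y in auto)
  \<comment> \<open>Cyclicity of the trace, since 1 - q n = a adj(a) q and y n = adj(a) q a.\<close>
  have tau_q: "\<tau> (id_blinfun - q n) = \<tau> (y n)" for n
  proof -
    have "id_blinfun - q n = a n o\<^sub>L (adj (a n) o\<^sub>L q n)"
      unfolding q_def using resolv_compl(1)[OF pos(2)] by (simp add: blinfun_compose_assoc)
    also have "\<tau> \<dots> = \<tau> ((adj (a n) o\<^sub>L q n) o\<^sub>L a n)" by (rule tr_comm) (use a rq in auto)
    also have "(adj (a n) o\<^sub>L q n) o\<^sub>L a n = y n" by (simp add: yr(1) push blinfun_compose_assoc)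
    finally show ?thesis .
  qed
  define \<phi> where "\<phi> x = Re (cinner (blinfun_apply (\<sigma> x) \<eta>) \<eta>)" for x
  have \<phi>: "normal_positive A \<phi>" unfolding \<phi>_def by (rule \<sigma>.normal_positive_compose[OF normal_positive_vector])
  note to_\<phi> = normal_positive_tendsto[OF normal_positive_trace trace_faithful_positive \<phi>, where K = 1]
  have "(\<lambda>n. \<phi> (id_blinfun - q n)) \<longlonglongrightarrow> 0"
    by (rule to_\<phi>) (use rq tau_q tau_y in \<open>auto simp: op_le_def\<close>)
  then have q1: "(\<lambda>n. blinfun_apply (\<sigma> (q n)) \<eta>) \<longlonglongrightarrow> \<eta>"
  proof -
    assume l: "(\<lambda>n. \<phi> (id_blinfun - q n)) \<longlonglongrightarrow> 0"
    have "(norm (blinfun_apply (\<sigma> (id_blinfun - q n)) \<eta>))\<^sup>2 \<le> 1 * \<phi> (id_blinfun - q n)" for n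
      unfolding \<phi>_def
    proof (rule norm_apply_positive_op)
      show "positive_op (\<sigma> (id_blinfun - q n))" using rq[of n] by (subst \<sigma>.positive_iff) (auto simp: op_le_def)
      show "op_le (\<sigma> (id_blinfun - q n)) (1 *\<^sub>R id_blinfun)"
        using rq[of n] \<sigma>.positive_iff[of "q n"] by (simp add: op_le_def)
    qed
    then have "(\<lambda>n. (norm (blinfun_apply (\<sigma> (id_blinfun - q n)) \<eta>))\<^sup>2) \<longlonglongrightarrow> 0"
      by (intro tendsto_sandwich[OF _ _ tendsto_const l]) auto
    then have "(\<lambda>n. sqrt ((norm (blinfun_apply (\<sigma> (id_blinfun - q n)) \<eta>))\<^sup>2)) \<longlonglongrightarrow> sqrt 0" by (intro tendsto_intros)
    then have "(\<lambda>n. blinfun_apply (\<sigma> (id_blinfun - q n)) \<eta>) \<longlonglongrightarrow> 0" by (simp add: tendsto_norm_zero_iff)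
    then have "(\<lambda>n. \<eta> - blinfun_apply (\<sigma> (id_blinfun - q n)) \<eta>) \<longlonglongrightarrow> \<eta> - 0" by (intro tendsto_intros)
    then show ?thesis using rq by (simp add: blinfun.bilinear_simps)
  qed
  define x where "x n = adj (q n o\<^sub>L a n) o\<^sub>L (q n o\<^sub>L a n)" for n
  \<comment> \<open>y n - x n = adj(a) q (1 - q) a, and q (1 - q) is positive.\<close>
  have x_le: "op_le (x n) (y n)" for n
  proof -
    have qs: "adj (q n) = q n" using positive_op_adj rq by blast
    have "positive_op (q n o\<^sub>L (id_blinfun - q n))"
      by (rule positive_op_compose) (use rq[of n] in \<open>auto simp: op_le_def blinfun_compose_simps\<close>)
    from positive_op_conj[OF this, of "a n"]
    have "positive_op (adj (a n) o\<^sub>L (q n o\<^sub>L (id_blinfun - q n)) o\<^sub>L a n)" using a by simp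
    also have "adj (a n) o\<^sub>L (q n o\<^sub>L (id_blinfun - q n)) o\<^sub>L a n = y n - x n"
      using a(1)[of n] rq[of n] qs by (simp add: x_def yr(1) push[symmetric] blinfun_compose_simps blinfun_compose_assoc)
    finally show ?thesis by (simp add: op_le_def)
  qed
  have xA: "x n \<in> A" "positive_op (x n)" "op_le (x n) id_blinfun" for n
  proof -
    have qa: "q n o\<^sub>L a n \<in> A" using a rq by auto
    show "x n \<in> A" unfolding x_def by (rule closed_simps(8)[OF adj_closed[OF qa] qa])
    show "positive_op (x n)" unfolding x_def by (rule positive_op_adj_self[OF bounded[OF qa]])
    show "op_le (x n) id_blinfun" by (rule op_le_trans[OF x_le y(3)])
  qed
  have "(\<lambda>n. Re (\<tau> (x n))) \<longlonglongrightarrow> 0"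
  proof (rule tendsto_sandwich[OF _ _ tendsto_const tau_y])
    show "\<forall>\<^sub>F n in sequentially. 0 \<le> Re (\<tau> (x n))" using tr_positive(1) xA by simp
    show "\<forall>\<^sub>F n in sequentially. Re (\<tau> (x n)) \<le> Re (\<tau> (y n))" using tr_mono xA y x_le by simp
  qed
  then have "(\<lambda>n. \<phi> (x n)) \<longlonglongrightarrow> 0"
    by (intro to_\<phi>) (use xA in auto)
  moreover have "\<phi> (x n) = (norm (blinfun_apply (\<sigma> (q n)) (blinfun_apply (\<sigma> (a n)) \<eta>)))\<^sup>2" for n
  proof -
    have qa: "q n o\<^sub>L a n \<in> A" using a rq by auto
    have "\<sigma> (x n) = adj (\<sigma> (q n o\<^sub>L a n)) o\<^sub>L \<sigma> (q n o\<^sub>L a n)"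
      unfolding x_def using qa by (simp only: \<sigma>.mult \<sigma>.adjoint adj_closed)
    then show ?thesis
      unfolding \<phi>_def using norm_adj_compose_self[OF bounded[OF \<sigma>.closed[OF qa]], of \<eta>] a rq by simp
  qed
  ultimately have "(\<lambda>n. (norm (blinfun_apply (\<sigma> (q n)) (blinfun_apply (\<sigma> (a n)) \<eta>)))\<^sup>2) \<longlonglongrightarrow> 0" by simp
  then have "(\<lambda>n. sqrt ((norm (blinfun_apply (\<sigma> (q n)) (blinfun_apply (\<sigma> (a n)) \<eta>)))\<^sup>2)) \<longlonglongrightarrow> sqrt 0"
    by (intro tendsto_intros)
  then have l1: "(\<lambda>n. blinfun_apply (\<sigma> (q n)) (blinfun_apply (\<sigma> (a n)) \<eta>)) \<longlonglongrightarrow> 0" by (simp add: tendsto_norm_zero_iff)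
  have l2: "(\<lambda>n. blinfun_apply (\<sigma> (q n)) (blinfun_apply (\<sigma> (a n)) \<eta> - \<eta>)) \<longlonglongrightarrow> 0"
  proof (rule Lim_null_comparison)
    have "norm (q n) \<le> 1" for n using norm_le_of_op_le[of "q n" 1] rq by simp
    then have "norm (\<sigma> (q n)) \<le> 1" for n using \<sigma>.norm_le[OF rq(4)] order_trans by blast
    then show "\<forall>\<^sub>F n in sequentially. norm (blinfun_apply (\<sigma> (q n)) (blinfun_apply (\<sigma> (a n)) \<eta> - \<eta>))
        \<le> norm (blinfun_apply (\<sigma> (a n)) \<eta> - \<eta>)"
      using norm_blinfun_le[of _ 1] by (intro always_eventually) fastforce
    show "(\<lambda>n. norm (blinfun_apply (\<sigma> (a n)) \<eta> - \<eta>)) \<longlonglongrightarrow> 0" by (rule tendsto_norm_zero[OF LIM_zero[OF lim_eta]])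
  qed
  \<comment> \<open>A difference of two null sequences, whereas \<open>q1\<close> gives the limit
    \<eta>.\<close>
  have "(\<lambda>n. blinfun_apply (\<sigma> (q n)) \<eta>) \<longlonglongrightarrow> 0"
    using tendsto_diff[OF l1 l2] by (simp add: blinfun.bilinear_simps)
  then have "\<eta> = 0" using q1 LIMSEQ_unique by blast
  then show False using \<eta>0 by (simp add: \<eta>_def)
qed

end

lemma (in tracial_algebra) trace_supremum:
  assumes "S \<noteq> {}" "\<And>x. x \<in> S \<Longrightarrow> x \<in> A" "\<And>x. x \<in> S \<Longrightarrow> positive_op x"
    and "\<And>x y. x \<in> S \<Longrightarrow> y \<in> S \<Longrightarrow> \<exists>z\<in>S. op_le x z \<and> op_le y z"
    and "s \<in> A" "\<And>x. x \<in> S \<Longrightarrow> op_le x s" "\<And>u. u \<in> A \<Longrightarrow> (\<And>x. x \<in> S \<Longrightarrow> op_le x u) \<Longrightarrow> op_le s u"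
  shows "Re (\<tau> s) = (SUP x\<in>S. Re (\<tau> x))"
proof -
  have "normal_on A \<tau>" using trace unfolding faithful_normal_trace_def by blast
  then show ?thesis
    by (intro mp[OF spec[OF spec[OF iffD1[OF normal_on_def]]]] conjI ballI impI) (use assms in auto)
qed

section \<open>Crossed products\<close>

lemma neg_add_eq_iff: "- g + x = t \<longleftrightarrow> x = g + (t::'g::group_add)"
  by (metis add.assoc add.left_inverse add.right_inverse add_0)

lemma bounded_weights_translation: "bounded_weights (\<lambda>s. - g + s) (\<lambda>_. id_blinfun :: 'h::complex_hilbert_space op) 1"
  for g :: "'g::group_add"
  by unfold_locales (auto simp: inj_def norm_blinfun_id_le)

lemma group_unitary_eq: "group_unitary g = weighted_comp (\<lambda>s. - g + s) (\<lambda>_. id_blinfun)"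
  by (simp add: group_unitary_def weighted_comp_def)

lemma group_unitary_bounded_ops [simp]:
  "group_unitary g \<in> (bounded_ops :: ('g::group_add, 'h::complex_hilbert_space) ell2 op set)"
  unfolding group_unitary_eq by (rule bounded_weights.weighted_comp_bounded_ops[OF bounded_weights_translation])

lemma entry_group_unitary:
  "entry (group_unitary g :: ('g::group_add, 'h::complex_hilbert_space) ell2 op) s t = (if s = g + t then id_blinfun else 0)"
  unfolding group_unitary_eq bounded_weights.entry_weighted_comp[OF bounded_weights_translation] neg_add_eq_iff ..

lemma entry_group_unitary_left:
  assumes "x \<in> bounded_ops" shows "entry (group_unitary g o\<^sub>L x) s t = entry x (- g + s) t"
  unfolding group_unitary_eq bounded_weights.entry_weighted_comp_left[OF bounded_weights_translation assms]
  by (simp add: blinfun_compose_simps)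

lemma group_unitary_simps:
  "group_unitary g o\<^sub>L group_unitary h = (group_unitary (g + h) :: ('g::group_add, 'h::complex_hilbert_space) ell2 op)"
  "group_unitary 0 = (id_blinfun :: ('g, 'h) ell2 op)"
  "adj (group_unitary g) = (group_unitary (- g) :: ('g, 'h) ell2 op)"
proof -
  show "group_unitary g o\<^sub>L group_unitary h = (group_unitary (g + h) :: ('g, 'h) ell2 op)"
  proof (rule op_eq_entries)
    fix s t
    have "- g + s = h + t \<longleftrightarrow> s = g + h + t" by (simp add: neg_add_eq_iff add.assoc)
    then show "entry (group_unitary g o\<^sub>L group_unitary h) s t = entry (group_unitary (g + h) :: ('g, 'h) ell2 op) s t"
      by (simp add: entry_group_unitary_left entry_group_unitary)
  qed auto
  show "group_unitary 0 = (id_blinfun :: ('g, 'h) ell2 op)"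
    by (rule op_eq_entries) (auto simp: entry_group_unitary entry_id)
  show "adj (group_unitary g) = (group_unitary (- g) :: ('g, 'h) ell2 op)"
  proof (rule op_eq_entries)
    fix s t
    have "t = g + s \<longleftrightarrow> s = - g + t" using neg_add_eq_iff[of g t s] by auto
    then show "entry (adj (group_unitary g)) s t = entry (group_unitary (- g) :: ('g, 'h) ell2 op) s t"
      by (simp add: entry_adj entry_group_unitary)
  qed auto
qed

lemma norm_group_unitary: "norm (group_unitary g :: ('g::group_add, 'h::complex_hilbert_space) ell2 op) \<le> 1"
proof (rule norm_le_of_adj_self_le)
  show "op_le (adj (group_unitary g) o\<^sub>L group_unitary g) (1\<^sup>2 *\<^sub>R (id_blinfun :: ('g, 'h) ell2 op))"
    by (simp add: group_unitary_simps)
qed auto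

lemma bounded_weights_const: "w \<in> bounded_ops \<Longrightarrow> inj f \<Longrightarrow> bounded_weights f (\<lambda>_. w) (norm w)"
  by unfold_locales auto

text \<open>A nonzero v gives rank-one operators z -> <z, v> x; commuting with them forces T x = (<T
  v, v> / <v, v>) x for every x.\<close>

lemma commutant_bounded_ops_scalar:
  assumes T: "(T :: 'h::complex_hilbert_space op) \<in> bounded_ops" and comm: "\<And>S. S \<in> bounded_ops \<Longrightarrow> T o\<^sub>L S = S o\<^sub>L T"
  shows "\<exists>c. T = scale_op c id_blinfun"
proof (cases "\<exists>v::'h. v \<noteq> 0")
  case False
  then have "T = scale_op 0 id_blinfun" by (intro blinfun_eqI) (metis)
  then show ?thesis by blast
next
  case True
  then obtain v :: 'h where v: "v \<noteq> 0" by blast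
  have "T x = scale_op (cinner (T v) v / cinner v v) id_blinfun x" for x
  proof -
    let ?R = "Blinfun (\<lambda>z. cinner z v *\<^sub>C x)"
    have "norm (cinner z v *\<^sub>C x) \<le> norm z * (norm v * norm x)" for z
      using mult_right_mono[OF cinner_cauchy_schwarz[of z v] norm_ge_zero[of x]] by (simp add: norm_scaleC ac_simps)
    note R = bounded_ops_of_linear[of "\<lambda>z. cinner z v *\<^sub>C x", OF _ _ this]
    have R': "?R \<in> bounded_ops" "blinfun_apply ?R = (\<lambda>z. cinner z v *\<^sub>C x)"
      by (rule R; simp add: cinner_add_left scaleC_add_left cinner_scaleC_left scaleC_scaleC)+
    have "T (?R v) = ?R (T v)" using comm[OF R'(1)] by (metis blinfun_apply_blinfun_compose)
    then have "cinner v v *\<^sub>C T x = cinner (T v) v *\<^sub>C x"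
      by (simp add: R'(2) bounded_ops_scaleC[OF T])
    then have "(1 / cinner v v) *\<^sub>C cinner v v *\<^sub>C T x = (1 / cinner v v) *\<^sub>C cinner (T v) v *\<^sub>C x" by simp
    moreover have "cinner v v \<noteq> 0" using v by (simp add: cinner_self)
    ultimately show ?thesis by (simp add: scaleC_scaleC)
  qed
  then show ?thesis by (intro exI blinfun_eqI)
qed

text \<open>Constant diagonal operators with arbitrary w commute with all translations, so every
  entry of x commutes with every bounded operator.\<close>

lemma group_vna_entry_scalar:
  assumes x: "x \<in> (group_vna :: ('g::group_add, 'h::complex_hilbert_space) ell2 op set)"
  shows "\<exists>c. entry x s t = scale_op c id_blinfun"
proof (rule commutant_bounded_ops_scalar)
  have "x \<in> commutant (commutant (range group_unitary))"
    using x unfolding group_vna_def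
    by (rule subsetD[OF hull_subset_bicommutant, rotated 2]) (auto simp: group_unitary_simps)
  then have xb: "x \<in> bounded_ops" and xc: "\<And>W. W \<in> commutant (range group_unitary) \<Longrightarrow> x o\<^sub>L W = W o\<^sub>L x"
    by (auto simp: commutant_def)
  show "entry x s t \<in> bounded_ops" using xb by simp
  fix w :: "'h op" assume w: "w \<in> bounded_ops"
  interpret W: bounded_weights "id :: 'g \<Rightarrow> 'g" "\<lambda>_. w" "norm w"
    by (rule bounded_weights_const[OF w]) simp
  let ?W = "weighted_comp (id :: 'g \<Rightarrow> 'g) (\<lambda>_. w)"
  have "?W o\<^sub>L group_unitary g = group_unitary g o\<^sub>L ?W" for g
    by (rule op_eq_entries)
      (auto simp: W.entry_weighted_comp_left W.entry_weighted_comp entry_group_unitary_left entry_group_unitary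
        blinfun_compose_simps add.assoc[symmetric])
  then have "?W \<in> commutant (range group_unitary)" by (auto simp: commutant_def)
  then have "entry (x o\<^sub>L ?W) s (id t) = entry (?W o\<^sub>L x) s t" using xc by simp
  then show "entry x s t o\<^sub>L w = w o\<^sub>L entry x s t"
    using W.entry_weighted_comp_right[OF xb] W.entry_weighted_comp_left[OF xb] by simp
qed

section \<open>Matrix entries of the elements of a crossed product\<close>

locale tp_extension =
  fixes \<sigma> :: "'g::{group_add,countable} \<Rightarrow> 'h::complex_hilbert_space op \<Rightarrow> 'h op" and B A \<tau>
  assumes ext: "trace_preserving_extension \<sigma> B A \<tau>"

sublocale tp_extension \<subseteq> tracial_subalgebra A \<tau> B
  using ext by unfold_locales (auto simp: trace_preserving_extension_def extension_def)

context tp_extension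
begin

lemma act_iso: "vn_isomorphism A A (\<sigma> g)"
  using ext by unfold_locales (auto simp: trace_preserving_extension_def extension_def group_action_def)

lemmas act_simps [simp] =
  vn_isomorphism.add[OF act_iso] vn_isomorphism.mult[OF act_iso] vn_isomorphism.scale[OF act_iso]
  vn_isomorphism.adjoint[OF act_iso] vn_isomorphism.closed[OF act_iso] vn_isomorphism.scaleR[OF act_iso]
  vn_isomorphism.zero[OF act_iso] vn_isomorphism.diff[OF act_iso] vn_isomorphism.one[OF act_iso]

lemma act_norm_le: "a \<in> A \<Longrightarrow> norm (\<sigma> g a) \<le> norm a"
  by (rule vn_isomorphism.norm_le[OF act_iso])

lemma act_group: "a \<in> A \<Longrightarrow> \<sigma> 0 a = a" "a \<in> A \<Longrightarrow> \<sigma> (g + h) a = \<sigma> g (\<sigma> h a)"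
  using ext by (auto simp: trace_preserving_extension_def extension_def group_action_def)

lemma act_inverse: "a \<in> A \<Longrightarrow> \<sigma> g (\<sigma> (- g) a) = a" "a \<in> A \<Longrightarrow> \<sigma> (- g) (\<sigma> g a) = a"
  using act_group(2)[of a g "- g"] act_group(2)[of a "- g" g] by (simp_all add: act_group(1))

lemma act_sub [simp]: "b \<in> B \<Longrightarrow> \<sigma> g b \<in> B"
proof -
  assume "b \<in> B"
  moreover have "\<sigma> g ` B = B" using ext by (simp add: trace_preserving_extension_def extension_def)
  ultimately show ?thesis by blast
qed

lemma act_trace [simp]: "a \<in> A \<Longrightarrow> \<tau> (\<sigma> g a) = \<tau> a"
  using ext by (simp add: trace_preserving_extension_def)

lemma act_norm2: "a \<in> A \<Longrightarrow> norm2 \<tau> (\<sigma> g a) = norm2 \<tau> a"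
proof -
  assume a: "a \<in> A"
  have "adj (\<sigma> g a) o\<^sub>L \<sigma> g a = \<sigma> g (adj a o\<^sub>L a)" using a by simp
  then show ?thesis using a by (simp only: norm2_def act_trace closed_simps adj_closed)
qed

lemma act_expectation: "a \<in> A \<Longrightarrow> E (\<sigma> g a) = \<sigma> g (E a)"
proof (rule expectation_eqI)
  assume a: "a \<in> A"
  show "\<tau> (\<sigma> g (E a) o\<^sub>L b) = \<tau> (\<sigma> g a o\<^sub>L b)" if b: "b \<in> B" for b
  proof -
    have "\<sigma> g (E a) o\<^sub>L b = \<sigma> g (E a o\<^sub>L \<sigma> (- g) b)" "\<sigma> g a o\<^sub>L b = \<sigma> g (a o\<^sub>L \<sigma> (- g) b)"
      using a b by (simp_all add: act_inverse)
    moreover have "\<tau> (\<sigma> g (E a o\<^sub>L \<sigma> (- g) b)) = \<tau> (E a o\<^sub>L \<sigma> (- g) b)"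
      "\<tau> (\<sigma> g (a o\<^sub>L \<sigma> (- g) b)) = \<tau> (a o\<^sub>L \<sigma> (- g) b)"
      using a b by (auto intro!: act_trace simp del: act_simps)
    ultimately show ?thesis using expectation_trace_right[OF a, of "\<sigma> (- g) b"] b by simp
  qed
qed auto

lemma bounded_weights_embed: "a \<in> A \<Longrightarrow> bounded_weights id (\<lambda>s. \<sigma> (- s) a) (norm a)"
  by unfold_locales (auto intro: act_norm_le)

lemma crossed_embed_eq: "crossed_embed \<sigma> a = weighted_comp id (\<lambda>s. \<sigma> (- s) a)"
  by (simp add: crossed_embed_def weighted_comp_def)

lemma crossed_embed_bounded_ops [simp]: "a \<in> A \<Longrightarrow> crossed_embed \<sigma> a \<in> bounded_ops"
  unfolding crossed_embed_eq by (rule bounded_weights.weighted_comp_bounded_ops[OF bounded_weights_embed])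

lemma entry_crossed_embed: "a \<in> A \<Longrightarrow> entry (crossed_embed \<sigma> a) s t = (if s = t then \<sigma> (- s) a else 0)"
  unfolding crossed_embed_eq by (simp add: bounded_weights.entry_weighted_comp[OF bounded_weights_embed])

lemma entry_crossed_embed_left:
  "a \<in> A \<Longrightarrow> x \<in> bounded_ops \<Longrightarrow> entry (crossed_embed \<sigma> a o\<^sub>L x) s t = \<sigma> (- s) a o\<^sub>L entry x s t"
  unfolding crossed_embed_eq by (simp add: bounded_weights.entry_weighted_comp_left[OF bounded_weights_embed])

lemma entry_crossed_embed_right:
  "a \<in> A \<Longrightarrow> x \<in> bounded_ops \<Longrightarrow> entry (x o\<^sub>L crossed_embed \<sigma> a) s t = entry x s t o\<^sub>L \<sigma> (- t) a"
  using bounded_weights.entry_weighted_comp_right[OF bounded_weights_embed, of a x s t]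
  unfolding crossed_embed_eq by simp

lemma crossed_embed_mult:
  "a \<in> A \<Longrightarrow> b \<in> A \<Longrightarrow> crossed_embed \<sigma> a o\<^sub>L crossed_embed \<sigma> b = crossed_embed \<sigma> (a o\<^sub>L b)"
  by (rule op_eq_entries) (auto simp: entry_crossed_embed_left entry_crossed_embed blinfun_compose_simps)

lemma crossed_embed_adj: "a \<in> A \<Longrightarrow> adj (crossed_embed \<sigma> a) = crossed_embed \<sigma> (adj a)"
  by (rule op_eq_entries) (auto simp: entry_adj entry_crossed_embed)

lemma group_unitary_crossed_embed:
  assumes "a \<in> A"
  shows "group_unitary g o\<^sub>L crossed_embed \<sigma> a = crossed_embed \<sigma> (\<sigma> g a) o\<^sub>L group_unitary g"
proof (rule op_eq_entries)
  fix s t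
  have "\<sigma> (- (g + t)) (\<sigma> g a) = \<sigma> (- t) a"
    using act_group(2)[OF assms, of "- (g + t)" g] by (simp add: minus_add add.assoc)
  then show "entry (group_unitary g o\<^sub>L crossed_embed \<sigma> a) s t = entry (crossed_embed \<sigma> (\<sigma> g a) o\<^sub>L group_unitary g) s t"
    using assms by (simp add: entry_group_unitary_left entry_crossed_embed entry_crossed_embed_left
        entry_group_unitary neg_add_eq_iff blinfun_compose_simps)
qed (use assms in auto)

abbreviation generators where
  "generators C \<equiv> crossed_embed \<sigma> ` C \<union> (range group_unitary :: ('g, 'h) ell2 op set)"

lemma generators_props:
  assumes "C \<subseteq> A" "\<And>c. c \<in> C \<Longrightarrow> adj c \<in> C"
  shows "generators C \<subseteq> bounded_ops" "x \<in> generators C \<Longrightarrow> adj x \<in> generators C"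
proof -
  show "generators C \<subseteq> bounded_ops" using assms(1) by auto
  show "adj x \<in> generators C" if "x \<in> generators C"
    using that
  proof
    assume "x \<in> crossed_embed \<sigma> ` C"
    then obtain c where c: "c \<in> C" "x = crossed_embed \<sigma> c" by blast
    then have "adj x = crossed_embed \<sigma> (adj c)" using assms(1) by (auto simp: crossed_embed_adj)
    then show ?thesis using assms(2)[OF c(1)] by blast
  qed (auto simp: group_unitary_simps)
qed

lemma crossed_product_vna: "C \<subseteq> A \<Longrightarrow> von_neumann_algebra (crossed_product \<sigma> C)"
  unfolding crossed_product_def by (rule von_neumann_algebra_hull) auto

lemma generators_mem:
  "c \<in> C \<Longrightarrow> crossed_embed \<sigma> c \<in> crossed_product \<sigma> C"
  "group_unitary g \<in> crossed_product \<sigma> C"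
  using hull_subset[of "generators C" von_neumann_algebra] unfolding crossed_product_def by auto

lemma crossed_product_commute:
  assumes C: "C \<subseteq> A" "\<And>c. c \<in> C \<Longrightarrow> adj c \<in> C" and x: "x \<in> crossed_product \<sigma> C"
    and W: "W \<in> bounded_ops" "\<And>c. c \<in> C \<Longrightarrow> W o\<^sub>L crossed_embed \<sigma> c = crossed_embed \<sigma> c o\<^sub>L W"
      "\<And>g. W o\<^sub>L group_unitary g = group_unitary g o\<^sub>L W"
  shows "x o\<^sub>L W = W o\<^sub>L x"
proof -
  have "x \<in> commutant (commutant (generators C))"
    using hull_subset_bicommutant[OF generators_props[OF C]] x unfolding crossed_product_def by blast
  moreover have "W \<in> commutant (generators C)" using W by (auto simp: commutant_def)
  ultimately show ?thesis by (rule commutantD)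
qed

text \<open>Constant diagonal operators with w in the commutant of C commute with the translations
  and, C being invariant, with every \<pi>(c); comparing entries puts those of x into the
  bicommutant of C.\<close>

lemma crossed_product_entry_mem:
  assumes C: "vn_algebra C" "C \<subseteq> A" "\<And>g c. c \<in> C \<Longrightarrow> \<sigma> g c \<in> C" and x: "x \<in> crossed_product \<sigma> C"
  shows "entry x s t \<in> C"
proof -
  interpret C: vn_algebra C by (rule C)
  have xb: "x \<in> bounded_ops" using crossed_product_vna[OF C(2)] x by (auto simp: von_neumann_algebra_def)
  have "entry x s t o\<^sub>L w = w o\<^sub>L entry x s t" if w: "w \<in> commutant C" for w
  proof -
    interpret W: bounded_weights "id :: 'g \<Rightarrow> 'g" "\<lambda>_. w" "norm w"
      by (rule bounded_weights_const[OF commutant_bounded_ops[OF w]]) simp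
    let ?W = "weighted_comp (id :: 'g \<Rightarrow> 'g) (\<lambda>_. w)"
    have "x o\<^sub>L ?W = ?W o\<^sub>L x"
    proof (rule crossed_product_commute[OF C(2) C.adj_closed x W.weighted_comp_bounded_ops])
      show "?W o\<^sub>L group_unitary g = group_unitary g o\<^sub>L ?W" for g
        by (rule op_eq_entries)
          (auto simp: W.entry_weighted_comp_left W.entry_weighted_comp entry_group_unitary_left entry_group_unitary
            blinfun_compose_simps add.assoc[symmetric])
      show "?W o\<^sub>L crossed_embed \<sigma> c = crossed_embed \<sigma> c o\<^sub>L ?W" if c: "c \<in> C" for c
      proof (rule op_eq_entries)
        fix s t
        have cA: "c \<in> A" using c C(2) by blast
        have "w o\<^sub>L \<sigma> (- t) c = \<sigma> (- t) c o\<^sub>L w" using commutantD[OF w C(3)[OF c]] .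
        then show "entry (?W o\<^sub>L crossed_embed \<sigma> c) s t = entry (crossed_embed \<sigma> c o\<^sub>L ?W) s t"
          using cA by (simp add: W.entry_weighted_comp_left W.entry_weighted_comp entry_crossed_embed
            entry_crossed_embed_left blinfun_compose_simps)
      qed (use c C(2) in auto)
    qed
    then have "entry (x o\<^sub>L ?W) s (id t) = entry (?W o\<^sub>L x) s t" by simp
    then show ?thesis
      using W.entry_weighted_comp_right[OF xb] W.entry_weighted_comp_left[OF xb] by simp
  qed
  then show ?thesis using xb by (simp add: C.mem_iff)
qed

abbreviation M where "M \<equiv> crossed_product \<sigma> A"
abbreviation N where "N \<equiv> crossed_product \<sigma> B"

lemma entry_mem [simp]: "x \<in> M \<Longrightarrow> entry x s t \<in> A" "x \<in> N \<Longrightarrow> entry x s t \<in> B"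
  using crossed_product_entry_mem[OF vn_algebra_axioms order_refl]
    crossed_product_entry_mem[OF sub.vn_algebra_axioms subset] by simp_all

lemma N_subset_M: "N \<subseteq> M" and group_vna_subset_N: "(group_vna :: ('g, 'h) ell2 op set) \<subseteq> N"
  unfolding crossed_product_def group_vna_def using subset by (auto intro!: hull_mono)

lemma M_bounded_ops [simp]: "x \<in> M \<Longrightarrow> x \<in> bounded_ops"
  using crossed_product_vna[of A] by (auto simp: von_neumann_algebra_def)

text \<open>If V a = \<sigma>_r(a) V for all a, then right translation by r with weight V commutes
  with the generators. Comparing entries gives Y V = V X = \<sigma>_r(X) V, and such V separate A. A
  unitary implementing \<sigma>_r on H would be one such V, but none need exist.\<close>

lemma covariance:
  assumes x: "x \<in> M" shows "\<sigma> r (entry x (s + r) (t + r)) = entry x s t"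
proof -
  let ?X = "entry x (s + r) (t + r)" and ?Y = "entry x s t"
  have XY: "?X \<in> A" "?Y \<in> A" using x by auto
  have "?Y - \<sigma> r ?X = 0"
  proof (rule intertwiners_separate[of "\<sigma> r"])
    show "star_isomorphism A A (\<sigma> r)" using act_iso by (simp add: vn_isomorphism_def vn_isomorphism_axioms_def)
    fix V :: "'h op" assume V: "V \<in> bounded_ops" "\<And>a. a \<in> A \<Longrightarrow> V o\<^sub>L a = \<sigma> r a o\<^sub>L V"
    interpret T: bounded_weights "\<lambda>s. s + r" "\<lambda>_. V" "norm V"
      by (rule bounded_weights_const[OF V(1)]) (simp add: inj_def)
    let ?T = "weighted_comp (\<lambda>s. s + r) (\<lambda>_. V)"
    have "x o\<^sub>L ?T = ?T o\<^sub>L x"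
    proof (rule crossed_product_commute[OF _ _ x T.weighted_comp_bounded_ops])
      show "?T o\<^sub>L group_unitary g = group_unitary g o\<^sub>L ?T" for g
        by (rule op_eq_entries)
          (auto simp: T.entry_weighted_comp_left T.entry_weighted_comp entry_group_unitary_left entry_group_unitary
            blinfun_compose_simps add.assoc neg_add_eq_iff)
      show "?T o\<^sub>L crossed_embed \<sigma> a = crossed_embed \<sigma> a o\<^sub>L ?T" if a: "a \<in> A" for a
      proof (rule op_eq_entries)
        fix s t
        have "\<sigma> (- (s + r)) a = \<sigma> (- r) (\<sigma> (- s) a)"
          using act_group(2)[OF a, of "- r" "- s"] by (simp add: minus_add)
        then have "V o\<^sub>L \<sigma> (- (s + r)) a = \<sigma> (- s) a o\<^sub>L V"
          using V(2)[of "\<sigma> (- r) (\<sigma> (- s) a)"] a by (simp add: act_inverse)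
        then show "entry (?T o\<^sub>L crossed_embed \<sigma> a) s t = entry (crossed_embed \<sigma> a o\<^sub>L ?T) s t"
          using a by (auto simp: T.entry_weighted_comp_left T.entry_weighted_comp entry_crossed_embed
            entry_crossed_embed_left blinfun_compose_simps)
      qed (use a in auto)
    qed auto
    then have "entry (x o\<^sub>L ?T) s (t + r) = entry (?T o\<^sub>L x) s (t + r)" by simp
    then have "?Y o\<^sub>L V = V o\<^sub>L ?X"
      using T.entry_weighted_comp_right[of x s t] T.entry_weighted_comp_left[of x s "t + r"] x by simp
    then show "(?Y - \<sigma> r ?X) o\<^sub>L V = 0" using V(2)[OF XY(1)] by (simp add: blinfun_compose_simps)
  qed (use XY in auto)
  then show ?thesis by simp
qed

lemma covariance': "x \<in> M \<Longrightarrow> \<sigma> (- s) (entry x 0 (- s)) = entry x s 0"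
  using covariance[of x "- s" s 0] by simp

lemma entry_translate: "x \<in> M \<Longrightarrow> entry x s t = \<sigma> (- t) (entry x (s - t) 0)"
  using covariance[of x t "s - t" 0] act_inverse(2)[of "entry x s t" t] by simp

section \<open>The canonical trace of the crossed product\<close>

definition tr :: "('g, 'h) ell2 op \<Rightarrow> complex" where
  "tr x = \<tau> (entry x 0 0)"

lemma entry_adj_self:
  assumes "x \<in> M"
  shows "cinner (blinfun_apply (entry (adj x o\<^sub>L x) t t) \<eta>) \<eta> = of_real ((norm (blinfun_apply x (single t \<eta>)))\<^sup>2)"
  using norm_adj_compose_self[OF M_bounded_ops[OF assms], of "single t \<eta>"] assms by (subst cinner_entry) auto

text \<open>The entry y of adj(x) x at (0, 0) is the least upper bound of the sums of adj(e s) (e s)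
  over finite sets of s, where e s runs through column 0. These sums form a directed family, so
  normality of \<tau> turns the supremum into the sum of the traces.\<close>

lemma parseval:
  assumes x: "x \<in> M"
  shows "((\<lambda>s. (norm2 \<tau> (entry x s 0))\<^sup>2) has_sum Re (tr (adj x o\<^sub>L x))) UNIV"
proof -
  interpret M: vn_algebra M by unfold_locales (rule crossed_product_vna[OF order_refl])
  define e where "e s = entry x s 0" for s
  have eA: "e s \<in> A" for s using x by (simp add: e_def)
  define p where "p F = (\<Sum>s\<in>F. adj (e s) o\<^sub>L e s)" for F
  define y where "y = entry (adj x o\<^sub>L x) 0 0"
  have pA: "p F \<in> A" "positive_op (p F)" for F
    unfolding p_def using eA by (auto intro!: sum_closed positive_op_sum)
  have yA: "y \<in> A" unfolding y_def using x by simp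
  have yq: "cinner (blinfun_apply y \<eta>) \<eta> = of_real ((norm (blinfun_apply x (single 0 \<eta>)))\<^sup>2)" for \<eta>
    unfolding y_def by (rule entry_adj_self[OF x])
  have y: "positive_op y" using yA yq by (auto simp: positive_op_iff)
  have hs: "((\<lambda>s. (norm (blinfun_apply (e s) \<eta>))\<^sup>2) has_sum Re (cinner (blinfun_apply y \<eta>) \<eta>)) UNIV" for \<eta>
    using norm_ell2_has_sum[of "blinfun_apply x (single 0 \<eta>)"] x by (simp add: yq e_def entry_apply)
  have pq: "Re (cinner (blinfun_apply (p F) \<eta>) \<eta>) = (\<Sum>s\<in>F. (norm (blinfun_apply (e s) \<eta>))\<^sup>2)" for F \<eta>
    unfolding p_def
    by (simp add: blinfun.sum_left cinner.sum_left norm_adj_compose_self[OF bounded[OF eA], unfolded blinfun_apply_blinfun_compose])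
  have le: "op_le (p F) y" if "finite F" for F
    by (rule op_leI) (use pA yA y positive_op_adj finite_sum_le_has_sum[OF hs that] in \<open>auto simp: pq\<close>)
  have mono: "op_le (p F) (p G)" if "finite G" "F \<subseteq> G" for F G
    by (rule op_leI) (use pA positive_op_adj that in \<open>auto simp: pq intro!: sum_mono2\<close>)
  have sup: "Re (\<tau> y) = (SUP z\<in>p ` {F. finite F \<and> F \<subseteq> UNIV}. Re (\<tau> z))"
  proof (rule trace_supremum)
    show "\<exists>w\<in>p ` {F. finite F \<and> F \<subseteq> UNIV}. op_le z w \<and> op_le z' w"
      if zz: "z \<in> p ` {F. finite F \<and> F \<subseteq> UNIV}" "z' \<in> p ` {F. finite F \<and> F \<subseteq> UNIV}" for z z'
    proof -
      obtain F G where FG: "finite F" "finite G" "z = p F" "z' = p G" using zz by auto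
      then show ?thesis using mono[of "F \<union> G" F] mono[of "F \<union> G" G] by (intro bexI[of _ "p (F \<union> G)"]) auto
    qed
    show "op_le y u" if u: "u \<in> A" "\<And>z. z \<in> p ` {F. finite F \<and> F \<subseteq> UNIV} \<Longrightarrow> op_le z u" for u
    proof -
      have "op_le (p {}) u" using u(2) by blast
      then have up: "positive_op u" by (simp add: p_def)
      show ?thesis
      proof (rule op_leI)
        show "Re (cinner (blinfun_apply y \<eta>) \<eta>) \<le> Re (cinner (blinfun_apply u \<eta>) \<eta>)" for \<eta>
        proof (rule has_sum_le_finite_sums[OF hs])
          fix F :: "'g set" assume "finite F"
          then have "op_le (p F) u" using u(2) by blast
          from op_le_Re[OF this] show "(\<Sum>s\<in>F. (norm (blinfun_apply (e s) \<eta>))\<^sup>2) \<le> Re (cinner (blinfun_apply u \<eta>) \<eta>)"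
            by (simp only: pq)
        qed
      qed (use y up positive_op_adj in auto)
    qed
  qed (use pA yA le in auto)
  have tp: "Re (\<tau> (p F)) = (\<Sum>s\<in>F. (norm2 \<tau> (e s))\<^sup>2)" for F
    unfolding p_def using normal_positive_sum[OF normal_positive_trace, of F "\<lambda>s. adj (e s) o\<^sub>L e s"] eA by (simp add: norm2_sq)
  have "((\<lambda>s. (norm2 \<tau> (e s))\<^sup>2) has_sum (SUP F\<in>{F. finite F \<and> F \<subseteq> UNIV}. \<Sum>s\<in>F. (norm2 \<tau> (e s))\<^sup>2)) UNIV"
  proof (rule nonneg_bdd_above_has_sum)
    have "(\<Sum>s\<in>F. (norm2 \<tau> (e s))\<^sup>2) \<le> Re (\<tau> y)" if "finite F" for F
      using tr_mono[OF pA(1) yA le[OF that]] by (simp add: tp)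
    then show "bdd_above (sum (\<lambda>s. (norm2 \<tau> (e s))\<^sup>2) ` {F. F \<subseteq> UNIV \<and> finite F})"
      by (auto intro!: bdd_aboveI[of _ "Re (\<tau> y)"])
  qed simp
  then show ?thesis unfolding tr_def y_def[symmetric] e_def[symmetric] sup by (simp add: image_image tp)
qed

text \<open>By Parseval both sides are sums over column 0, of x and of adj x. The entry of adj x at
  (-s, 0) is the adjoint of x_{0,-s}, which the trace-preserving \<sigma>_{-s} carries to x_{s,0};
  so the sums agree after s -> -s.\<close>

lemma tr_commutes_square:
  assumes x: "x \<in> M" shows "tr (adj x o\<^sub>L x) = tr (x o\<^sub>L adj x)"
proof -
  interpret M: vn_algebra M by unfold_locales (rule crossed_product_vna[OF order_refl])
  have real: "Im (tr (adj z o\<^sub>L z)) = 0" if z: "z \<in> M" for z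
  proof -
    have "positive_op (entry (adj z o\<^sub>L z) 0 0)" using z entry_adj_self[OF z] by (auto simp: positive_op_iff)
    then show ?thesis unfolding tr_def using tr_positive(2) z by simp
  qed
  have "norm2 \<tau> (entry (adj x) (- s) 0) = norm2 \<tau> (entry x s 0)" for s
  proof -
    have "norm2 \<tau> (entry (adj x) (- s) 0) = norm2 \<tau> (entry x 0 (- s))"
      using x by (simp add: entry_adj norm2_adj)
    also have "\<dots> = norm2 \<tau> (entry x s 0)"
      unfolding covariance'[OF x, symmetric] by (rule act_norm2[symmetric]) (use x in simp)
    finally show ?thesis .
  qed
  then have "((\<lambda>s. (norm2 \<tau> (entry (adj x) (- s) 0))\<^sup>2) has_sum Re (tr (adj x o\<^sub>L x))) UNIV"
    using parseval[OF x] by simp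
  moreover have "bij_betw (\<lambda>s::'g. - s) UNIV UNIV" by (rule bij_betw_byWitness[of _ "\<lambda>s. - s"]) auto
  ultimately have "((\<lambda>s. (norm2 \<tau> (entry (adj x) s 0))\<^sup>2) has_sum Re (tr (adj x o\<^sub>L x))) UNIV"
    by (subst has_sum_reindex_bij_betw[symmetric]) auto
  moreover have "((\<lambda>s. (norm2 \<tau> (entry (adj x) s 0))\<^sup>2) has_sum Re (tr (x o\<^sub>L adj x))) UNIV"
    using parseval[of "adj x"] x by simp
  ultimately have "Re (tr (adj x o\<^sub>L x)) = Re (tr (x o\<^sub>L adj x))" by (rule has_sum_unique)
  moreover have "Im (tr (x o\<^sub>L adj x)) = 0" using real[of "adj x"] x by simp
  ultimately show ?thesis using real[OF x] by (simp add: complex_eq_iff)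
qed

end

context vn_isomorphism
begin

text \<open>Positivity and order pass through \<theta> in both directions, so a least upper bound in
  A is mapped to a least upper bound in A'.\<close>

lemma trace_pullback:
  assumes t: "faithful_normal_trace A' t"
  shows "faithful_normal_trace A (\<lambda>x. t (\<theta> x))"
proof -
  interpret t: tracial_algebra A' t by unfold_locales (rule t)
  show ?thesis
    unfolding faithful_normal_trace_def linear_functional_on_def normal_on_def
  proof (intro conjI ballI allI impI)
    show "t (\<theta> (x + y)) = t (\<theta> x) + t (\<theta> y)" if "x \<in> A" "y \<in> A" for x y using that by simp
    show "t (\<theta> (scale_op c x)) = c * t (\<theta> x)" if "x \<in> A" for c x using that by simp
    show "t (\<theta> x) \<in> \<real>\<^sub>\<ge>\<^sub>0" if "x \<in> A" "positive_op x" for x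
      using t.tr_positive[of "\<theta> x"] that by (simp add: complex_nonneg_Reals_iff positive_iff)
    show "t (\<theta> (x o\<^sub>L y)) = t (\<theta> (y o\<^sub>L x))" if "x \<in> A" "y \<in> A" for x y
      using t.tr_comm[of "\<theta> x" "\<theta> y"] that by simp
    show "x = 0" if "x \<in> A" "t (\<theta> (adj x o\<^sub>L x)) = 0" for x
      using t.tr_faithful[of "\<theta> x"] that inject[of x 0] by simp
    fix S s
    assume *: "S \<noteq> {} \<and> (\<forall>x\<in>S. x \<in> A \<and> positive_op x)
        \<and> (\<forall>x\<in>S. \<forall>y\<in>S. \<exists>z\<in>S. op_le x z \<and> op_le y z)
        \<and> s \<in> A \<and> (\<forall>x\<in>S. op_le x s) \<and> (\<forall>u\<in>A. (\<forall>x\<in>S. op_le x u) \<longrightarrow> op_le s u)"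
    have "Re (t (\<theta> s)) = (SUP x\<in>\<theta> ` S. Re (t x))"
    proof (rule t.trace_supremum)
      show "\<exists>z\<in>\<theta> ` S. op_le x z \<and> op_le y z" if xy: "x \<in> \<theta> ` S" "y \<in> \<theta> ` S" for x y
      proof -
        obtain x' y' where x': "x' \<in> S" "y' \<in> S" "x = \<theta> x'" "y = \<theta> y'" using xy by blast
        then obtain z where "z \<in> S" "op_le x' z" "op_le y' z" using * by blast
        then show ?thesis using x' * op_le_iff by (intro bexI[of _ "\<theta> z"]) auto
      qed
      show "op_le (\<theta> s) u" if u: "u \<in> A'" "\<And>x. x \<in> \<theta> ` S \<Longrightarrow> op_le x u" for u
      proof -
        obtain v where v: "v \<in> A" "u = \<theta> v" using surjE[OF u(1)] by blast
        have "op_le x v" if "x \<in> S" for x using u(2)[of "\<theta> x"] v * that op_le_iff by auto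
        then have "op_le s v" using * v(1) by blast
        then show ?thesis using v * op_le_iff by auto
      qed
    qed (use * op_le_iff positive_iff in auto)
    then show "Re (t (\<theta> s)) = (SUP x\<in>S. Re (t (\<theta> x)))" by (simp add: image_image)
  qed
qed

end

lemma positive_entry: "positive_op x \<Longrightarrow> positive_op (entry x s s)"
  by (auto simp: positive_op_iff cinner_entry)

context tp_extension
begin

lemma vn_algebra_M: "vn_algebra M"
  by unfold_locales (rule crossed_product_vna[OF order_refl])

lemma tr_linear:
  assumes "x \<in> M" "y \<in> M"
  shows "tr (x + y) = tr x + tr y" "tr (scale_op c x) = c * tr x"
  using assms by (simp_all add: tr_def entry_add entry_scale_op)

text \<open>Polarisation of \<open>tr_commutes_square\<close> at y + c z, for c = 1 and c =
  \<i>.\<close>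

lemma tr_crossed_comm:
  assumes x: "x \<in> M" and y: "y \<in> M" shows "tr (x o\<^sub>L y) = tr (y o\<^sub>L x)"
proof -
  interpret M: vn_algebra M by (rule vn_algebra_M)
  define z where "z = adj x"
  have z: "z \<in> M" using x by (simp add: z_def)
  have yz: "y \<in> bounded_ops" "z \<in> bounded_ops" using y z by auto
  define d where "d u v = tr (adj v o\<^sub>L u) - tr (u o\<^sub>L adj v)" for u v
  have "cnj c * d y z + c * d z y = 0" for c
  proof -
    let ?w = "y + scale_op c z"
    have "adj ?w o\<^sub>L ?w = ((adj y o\<^sub>L y) + scale_op c (adj y o\<^sub>L z)) + (scale_op (cnj c) (adj z o\<^sub>L y) + scale_op (cnj c * c) (adj z o\<^sub>L z))"
      using yz by (intro blinfun_eqI)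
        (simp add: blinfun.bilinear_simps bounded_ops_scaleC[OF adj_bounded_ops] scaleC_add_right scaleC_scaleC ac_simps)
    then have 1: "tr (adj ?w o\<^sub>L ?w) = tr (adj y o\<^sub>L y) + c * tr (adj y o\<^sub>L z) + (cnj c * tr (adj z o\<^sub>L y) + cnj c * c * tr (adj z o\<^sub>L z))"
      using y z by (simp only: tr_linear M.closed_simps M.adj_closed)
    have "?w o\<^sub>L adj ?w = ((y o\<^sub>L adj y) + scale_op c (z o\<^sub>L adj y)) + (scale_op (cnj c) (y o\<^sub>L adj z) + scale_op (cnj c * c) (z o\<^sub>L adj z))"
      using yz by (intro blinfun_eqI)
        (simp add: blinfun.bilinear_simps bounded_ops_scaleC scaleC_add_right scaleC_scaleC ac_simps)
    then have 2: "tr (?w o\<^sub>L adj ?w) = tr (y o\<^sub>L adj y) + c * tr (z o\<^sub>L adj y) + (cnj c * tr (y o\<^sub>L adj z) + cnj c * c * tr (z o\<^sub>L adj z))"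
      using y z by (simp only: tr_linear M.closed_simps M.adj_closed)
    have "tr (adj ?w o\<^sub>L ?w) = tr (?w o\<^sub>L adj ?w)" by (rule tr_commutes_square) (use y z in auto)
    then show ?thesis
      unfolding 1 2 d_def tr_commutes_square[OF y] tr_commutes_square[OF z] by (simp add: algebra_simps)
  qed
  from this[of 1] this[of \<i>] have "d y z + d z y = 0" "- \<i> * d y z + \<i> * d z y = 0" by simp_all
  then have "d y z = 0" by (simp add: complex_eq_iff)
  then show ?thesis using x by (simp add: d_def z_def)
qed

text \<open>Parseval makes column 0 vanish, and covariance the other columns.\<close>

lemma tr_crossed_faithful:
  assumes x: "x \<in> M" and 0: "tr (adj x o\<^sub>L x) = 0" shows "x = 0"
proof -
  have hs: "((\<lambda>s. (norm2 \<tau> (entry x s 0))\<^sup>2) has_sum 0) UNIV" using parseval[OF x] 0 by simp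
  have "entry x s 0 = 0" for s
  proof -
    have "(\<Sum>s\<in>{s}. (norm2 \<tau> (entry x s 0))\<^sup>2) \<le> 0" by (rule finite_sum_le_has_sum[OF hs]) auto
    then show ?thesis using norm2_eq_0[of "entry x s 0"] x by simp
  qed
  then have "entry x s t = entry 0 s t" for s t unfolding entry_translate[OF x, of s t] by simp
  then show ?thesis using x by (intro op_eq_entries) auto
qed

text \<open>A directed supremum in M has the pointwise supremum as its quadratic form. This
  restricts to vectors supported at 0, so passing to the entry at (0, 0) preserves suprema and
  normality of \<tau> applies.\<close>

lemma tr_crossed_normal: "normal_on M tr"
  unfolding normal_on_def
proof (intro allI impI)
  interpret M: vn_algebra M by (rule vn_algebra_M)
  fix S s
  assume *: "S \<noteq> {} \<and> (\<forall>x\<in>S. x \<in> M \<and> positive_op x)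
      \<and> (\<forall>x\<in>S. \<forall>y\<in>S. \<exists>z\<in>S. op_le x z \<and> op_le y z)
      \<and> s \<in> M \<and> (\<forall>x\<in>S. op_le x s) \<and> (\<forall>u\<in>M. (\<forall>x\<in>S. op_le x u) \<longrightarrow> op_le s u)"
  obtain s' where s': "s' \<in> M" "positive_op s'" "\<forall>x\<in>S. op_le x s'"
    "\<And>\<xi>. Re (cinner (blinfun_apply s' \<xi>) \<xi>) = (SUP x\<in>S. Re (cinner (blinfun_apply x \<xi>) \<xi>))"
  proof -
    have "\<exists>s'\<in>M. positive_op s' \<and> (\<forall>x\<in>S. op_le x s')
      \<and> (\<forall>\<xi>. Re (cinner (blinfun_apply s' \<xi>) \<xi>) = (SUP x\<in>S. Re (cinner (blinfun_apply x \<xi>) \<xi>)))"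
      by (rule M.directed_supremum[of S s]) (use * in blast)+
    then show thesis using that by blast
  qed
  have sM: "s \<in> M" using * by blast
  have SM: "x \<in> M" "positive_op x" "op_le x s" if "x \<in> S" for x using * that by blast+
  have S0: "S \<noteq> {}" using * by blast
  obtain x0 where x0: "x0 \<in> S" using * by blast
  have spos: "positive_op s" using x0 * positive_op_mono by blast
  have "op_le s s'" using * s' by blast
  moreover have "op_le s' s"
  proof (rule op_leI)
    show "Re (cinner (blinfun_apply s' \<xi>) \<xi>) \<le> Re (cinner (blinfun_apply s \<xi>) \<xi>)" for \<xi>
      unfolding s'(4) by (rule cSUP_least[OF S0]) (rule op_le_Re[OF SM(3)])
  qed (use s' spos positive_op_adj in auto)
  ultimately have ss: "s = s'" by (rule op_le_antisym)
  have mono: "op_le (entry x 0 0) (entry y 0 0)" if "x \<in> M" "y \<in> M" "op_le x y" for x y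
    using positive_entry[of "y - x" 0] that by (simp add: op_le_def entry_diff)
  have "Re (\<tau> (entry s 0 0)) = (SUP z\<in>(\<lambda>x. entry x 0 0) ` S. Re (\<tau> z))"
  proof (rule trace_supremum)
    show "\<exists>z\<in>(\<lambda>x. entry x 0 0) ` S. op_le x z \<and> op_le y z"
      if xy: "x \<in> (\<lambda>x. entry x 0 0) ` S" "y \<in> (\<lambda>x. entry x 0 0) ` S" for x y
    proof -
      obtain x' y' where x': "x' \<in> S" "y' \<in> S" "x = entry x' 0 0" "y = entry y' 0 0" using xy by blast
      then obtain z where z: "z \<in> S" "op_le x' z" "op_le y' z" using * by blast
      then show ?thesis
        using mono[OF SM(1)[OF x'(1)] SM(1)[OF z(1)]] mono[OF SM(1)[OF x'(2)] SM(1)[OF z(1)]] x' by blast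
    qed
    show "op_le (entry s 0 0) u" if u: "u \<in> A" "\<And>x. x \<in> (\<lambda>x. entry x 0 0) ` S \<Longrightarrow> op_le x u" for u
    proof -
      have "positive_op (entry x0 0 0)" by (rule positive_entry[OF SM(2)[OF x0]])
      then have up: "positive_op u" using u(2)[of "entry x0 0 0"] x0 positive_op_mono by blast
      show ?thesis
      proof (rule op_leI)
        fix \<eta>
        have "Re (cinner (blinfun_apply (entry s 0 0) \<eta>) \<eta>) = (SUP x\<in>S. Re (cinner (blinfun_apply x (single 0 \<eta>)) (single 0 \<eta>)))"
          using s'(4)[of "single 0 \<eta>"] sM ss by (simp add: cinner_entry)
        also have "\<dots> \<le> Re (cinner (blinfun_apply u \<eta>) \<eta>)"
        proof (rule cSUP_least)
          fix x assume x: "x \<in> S"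
          then show "Re (cinner (blinfun_apply x (single 0 \<eta>)) (single 0 \<eta>)) \<le> Re (cinner (blinfun_apply u \<eta>) \<eta>)"
            using op_le_Re[OF u(2)[of "entry x 0 0"], of \<eta>] SM(1)[OF x] by (simp add: cinner_entry)
        qed (rule S0)
        finally show "Re (cinner (blinfun_apply (entry s 0 0) \<eta>) \<eta>) \<le> Re (cinner (blinfun_apply u \<eta>) \<eta>)" .
      qed (use positive_op_adj[OF positive_entry[OF spos]] sM up positive_op_adj[OF up] in auto)
    qed
  qed (use S0 sM in \<open>auto intro: SM positive_entry mono entry_mem(1)\<close>)
  then show "Re (tr s) = (SUP x\<in>S. Re (tr x))" by (simp add: tr_def image_image)
qed

lemma tr_faithful_normal_trace: "faithful_normal_trace M tr"
proof -
  have "tr x \<in> \<real>\<^sub>\<ge>\<^sub>0" if "x \<in> M" "positive_op x" for x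
    using tr_positive[of "entry x 0 0"] positive_entry[OF that(2)] that(1)
    by (simp add: tr_def complex_nonneg_Reals_iff)
  then show ?thesis
    unfolding faithful_normal_trace_def linear_functional_on_def
    using tr_linear tr_crossed_comm tr_crossed_faithful tr_crossed_normal by blast
qed

end

section \<open>Fourier coefficients and the conditional expectation of the crossed product\<close>

sublocale tp_extension \<subseteq> cp: tracial_subalgebra M tr N
  using tr_faithful_normal_trace crossed_product_vna[of A] crossed_product_vna[of B] subset N_subset_M
  by unfold_locales auto

context tp_extension
begin

lemma group_vna_closed [simp]: "w \<in> group_vna \<Longrightarrow> w \<in> N" "w \<in> group_vna \<Longrightarrow> w \<in> M"
  using group_vna_subset_N N_subset_M by blast+

lemma group_unitary_group_vna: "group_unitary g \<in> (group_vna :: ('g, 'h) ell2 op set)"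
  unfolding group_vna_def using hull_subset[of "range group_unitary" von_neumann_algebra] by blast

lemma vn_algebra_group_vna: "vn_algebra (group_vna :: ('g, 'h) ell2 op set)"
  unfolding group_vna_def by unfold_locales (rule von_neumann_algebra_hull, auto)

lemma group_unitary_mem [simp]: "group_unitary g \<in> M" "group_unitary g \<in> N"
  by (rule generators_mem)+

lemma crossed_embed_mem [simp]: "a \<in> A \<Longrightarrow> crossed_embed \<sigma> a \<in> M" "b \<in> B \<Longrightarrow> crossed_embed \<sigma> b \<in> N"
  by (rule generators_mem; simp)+

lemma norm_crossed_embed_le:
  assumes a: "a \<in> A" shows "norm (crossed_embed \<sigma> a) \<le> norm a"
proof (rule norm_blinfun_bound)
  fix \<xi> :: "('g, 'h) ell2"
  interpret W: bounded_weights "id :: 'g \<Rightarrow> 'g" "\<lambda>s. \<sigma> (- s) a" "norm a" by (rule bounded_weights_embed[OF a])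
  show "norm (blinfun_apply (crossed_embed \<sigma> a) \<xi>) \<le> norm a * norm \<xi>"
    unfolding crossed_embed_eq
    by (rule norm_ell2_le) (use W.L2_bound in \<open>simp add: mult.commute\<close>)
qed simp

lemma norm2_cp_has_sum:
  assumes x: "x \<in> M" shows "((\<lambda>s. (norm2 \<tau> (entry x s 0))\<^sup>2) has_sum (norm2 tr x)\<^sup>2) UNIV"
  using parseval[OF x] by (simp only: cp.norm2_sq[OF x])

lemma entry_column:
  assumes x: "x \<in> M" shows "entry x s 0 = entry (group_unitary (- s) o\<^sub>L x) 0 0"
  using entry_group_unitary_left[of x "- s" 0 0] x by simp

text \<open>As tr(y \<pi>(b)) = \<tau>(y_{00} b), the entry at (0, 0) of the expectation onto N has
  the characterising property of an expectation onto B.\<close>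

lemma entry_expectation_0: assumes x: "x \<in> M" shows "entry (cp.E x) 0 0 = E (entry x 0 0)"
proof (rule expectation_eqI[symmetric])
  show "\<tau> (entry (cp.E x) 0 0 o\<^sub>L b) = \<tau> (entry x 0 0 o\<^sub>L b)" if b: "b \<in> B" for b
  proof -
    have "tr (y o\<^sub>L crossed_embed \<sigma> b) = \<tau> (entry y 0 0 o\<^sub>L b)" if "y \<in> M" for y
      using that b by (simp add: tr_def entry_crossed_embed_right act_group)
    then show ?thesis
      using cp.expectation_trace_right[OF x, of "crossed_embed \<sigma> b"] x b by simp
  qed
qed (use x in auto)

lemma entry_expectation: assumes x: "x \<in> M" shows "entry (cp.E x) s 0 = E (entry x s 0)"
proof -
  have "entry (cp.E x) s 0 = entry (cp.E (group_unitary (- s) o\<^sub>L x)) 0 0"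
    using x by (subst entry_column) (simp_all add: cp.expectation_left)
  also have "\<dots> = E (entry (group_unitary (- s) o\<^sub>L x) 0 0)" using x by (intro entry_expectation_0) auto
  also have "\<dots> = E (entry x s 0)" unfolding entry_column[OF x, of s] ..
  finally show ?thesis .
qed

text \<open>tr(x u_g) = \<tau>(x_{-g,0}), and the entries in column 0 have square summable trace
  norms. Applied to \<Lambda>, this makes the group unitaries a bounded weakly null family.\<close>

lemma tr_group_unitary_tendsto_0:
  assumes x: "x \<in> M" shows "((\<lambda>g. tr (x o\<^sub>L group_unitary g)) \<longlongrightarrow> 0) cofinite"
proof -
  have "((\<lambda>s. (norm2 \<tau> (entry x s 0))\<^sup>2) \<longlongrightarrow> 0) cofinite"
  proof (rule tendstoI)
    fix e :: real assume e: "0 < e"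
    have sm: "(\<lambda>s. (norm2 \<tau> (entry x s 0))\<^sup>2) summable_on UNIV" using norm2_cp_has_sum[OF x] by (auto simp: summable_on_def)
    have "finite {s. e \<le> (norm2 \<tau> (entry x s 0))\<^sup>2}"
    proof (rule ccontr)
      assume inf: "infinite {s. e \<le> (norm2 \<tau> (entry x s 0))\<^sup>2}"
      obtain k :: nat where k: "(norm2 tr x)\<^sup>2 < real k * e" using reals_Archimedean3[OF e] by blast
      obtain F where F: "F \<subseteq> {s. e \<le> (norm2 \<tau> (entry x s 0))\<^sup>2}" "finite F" "card F = k"
        using infinite_arbitrarily_large[OF inf] by blast
      have "real k * e \<le> (\<Sum>s\<in>F. (norm2 \<tau> (entry x s 0))\<^sup>2)"
        using sum_mono[of F "\<lambda>_. e" "\<lambda>s. (norm2 \<tau> (entry x s 0))\<^sup>2"] F by auto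
      also have "\<dots> \<le> (norm2 tr x)\<^sup>2" by (rule finite_sum_le_has_sum[OF norm2_cp_has_sum[OF x]]) (use F in auto)
      finally show False using k by simp
    qed
    then show "\<forall>\<^sub>F s in cofinite. dist ((norm2 \<tau> (entry x s 0))\<^sup>2) 0 < e"
      by (simp add: eventually_cofinite not_less)
  qed
  then have "((\<lambda>s. sqrt ((norm2 \<tau> (entry x s 0))\<^sup>2)) \<longlongrightarrow> sqrt 0) cofinite" by (intro tendsto_intros)
  then have "((\<lambda>s. norm2 \<tau> (entry x s 0)) \<longlongrightarrow> 0) cofinite" using x by simp
  moreover have "filterlim (\<lambda>g::'g. - g) cofinite cofinite"
    unfolding filterlim_def le_filter_def eventually_filtermap eventually_cofinite
  proof (intro allI impI)
    fix P :: "'g \<Rightarrow> bool" assume "finite {x. \<not> P x}"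
    then have "finite (uminus ` {x. \<not> P x})" by simp
    moreover have "{x. \<not> P (- x)} \<subseteq> uminus ` {x. \<not> P x}" by (auto intro: image_eqI[of _ _ "- _"])
    ultimately show "finite {x. \<not> P (- x)}" by (rule rev_finite_subset)
  qed
  ultimately have "((\<lambda>g. norm2 \<tau> (entry x (- g) 0)) \<longlongrightarrow> 0) cofinite" by (rule filterlim_compose)
  then have l: "((\<lambda>g. norm2 \<tau> (entry x (- g) 0) * norm2 \<tau> id_blinfun) \<longlongrightarrow> 0 * norm2 \<tau> id_blinfun) cofinite" by (intro tendsto_intros)
  show ?thesis
  proof (rule Lim_null_comparison)
    have "tr (x o\<^sub>L group_unitary g) = \<tau> (entry x (- g) 0)" for g
      using cp.tr_comm[of x "group_unitary g"] entry_column[OF x, of "- g"] x by (simp add: tr_def)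
    then show "\<forall>\<^sub>F g in cofinite. norm (tr (x o\<^sub>L group_unitary g)) \<le> norm2 \<tau> (entry x (- g) 0) * norm2 \<tau> id_blinfun"
      using tr_le_norm2[of "entry x (- _) 0"] x by (intro always_eventually) auto
    show "((\<lambda>g. norm2 \<tau> (entry x (- g) 0) * norm2 \<tau> id_blinfun) \<longlongrightarrow> 0) cofinite" using l by simp
  qed
qed

text \<open>Truncation of the Fourier series: the term \<pi>(a g) u_g with a g = \<sigma>_g(x_{g,0})
  reproduces the entry x_{g,0}, and by Parseval the squared norm of the remainder is the tail of the
  series. The approximation holds in the trace norm, without control of operator norms.\<close>

lemma finite_fourier_approximation:
  assumes x: "x \<in> M" and Ex: "cp.E x = 0" and e: "0 < e"
  shows "\<exists>F a. finite F \<and> (\<forall>g. a g \<in> A \<and> E (a g) = 0)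
    \<and> norm2 tr (x - (\<Sum>g\<in>F. crossed_embed \<sigma> (a g) o\<^sub>L group_unitary g)) < e"
proof -
  define f where "f s = (norm2 \<tau> (entry x s 0))\<^sup>2" for s
  have hs: "(f has_sum (norm2 tr x)\<^sup>2) UNIV" unfolding f_def by (rule norm2_cp_has_sum[OF x])
  then have "(sum f \<longlongrightarrow> (norm2 tr x)\<^sup>2) (finite_subsets_at_top UNIV)" by (simp add: has_sum_def)
  then have "\<forall>\<^sub>F F in finite_subsets_at_top UNIV. dist (sum f F) ((norm2 tr x)\<^sup>2) < e\<^sup>2"
    using e by (intro tendstoD) auto
  then obtain F where F: "finite F" "dist (sum f F) ((norm2 tr x)\<^sup>2) < e\<^sup>2"
    unfolding eventually_finite_subsets_at_top by blast
  define a where "a g = \<sigma> g (entry x g 0)" for g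
  have aA: "a g \<in> A" for g using x by (simp add: a_def)
  have E0: "E (entry x s 0) = 0" for s using entry_expectation[OF x, of s] Ex by simp
  have Ea: "E (a g) = 0" for g using act_expectation[of "entry x g 0" g] x E0[of g] by (simp add: a_def)
  define p where "p g = crossed_embed \<sigma> (a g) o\<^sub>L group_unitary g" for g
  have pM: "p g \<in> M" for g using aA by (simp add: p_def)
  have pe: "entry (p g) s 0 = (if s = g then entry x g 0 else 0)" for g s
    using aA x act_inverse(2)[of "entry x g 0" g]
    by (auto simp: p_def entry_crossed_embed_left entry_group_unitary blinfun_compose_simps a_def)
  define z where "z = x - sum p F"
  have sM: "sum p G \<in> M" for G by (rule cp.sum_closed) (rule pM)
  have zM: "z \<in> M" using x sM by (simp add: z_def)
  have se: "entry (sum p G) s 0 = (\<Sum>g\<in>G. entry (p g) s 0)" for G s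
    by (induction G rule: infinite_finite_induct)
      (simp_all add: entry_add pM sM)
  have ze: "entry z s 0 = (if s \<in> F then 0 else entry x s 0)" for s
    using F(1) unfolding z_def entry_diff[OF M_bounded_ops[OF x] M_bounded_ops[OF sM]] se pe by simp
  have "((\<lambda>s. (norm2 \<tau> (entry z s 0))\<^sup>2) has_sum (norm2 tr z)\<^sup>2) UNIV" by (rule norm2_cp_has_sum[OF zM])
  moreover have "((\<lambda>s. (norm2 \<tau> (entry z s 0))\<^sup>2) has_sum (norm2 tr x)\<^sup>2 - sum f F) UNIV"
  proof -
    have "(f has_sum (norm2 tr x)\<^sup>2 - sum f F) (UNIV - F)"
      by (rule has_sum_Diff[OF hs has_sum_finite[OF F(1)]]) simp
    moreover have "(f has_sum v) (UNIV - F) \<longleftrightarrow> ((\<lambda>s. (norm2 \<tau> (entry z s 0))\<^sup>2) has_sum v) UNIV" for v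
      by (rule has_sum_cong_neutral) (auto simp: ze f_def)
    ultimately show ?thesis by simp
  qed
  ultimately have "(norm2 tr z)\<^sup>2 = (norm2 tr x)\<^sup>2 - sum f F" by (rule has_sum_unique)
  then have "(norm2 tr z)\<^sup>2 < e\<^sup>2" using F(2) by (simp add: dist_real_def)
  then have "norm2 tr z < e" using e by (simp add: power2_less_imp_less)
  then show ?thesis using F(1) aA Ea unfolding z_def p_def by blast
qed

end

section \<open>Mixing\<close>

context tp_extension
begin

lemma norm2_tr_id: "norm2 tr id_blinfun = norm2 \<tau> id_blinfun"
  by (simp add: norm2_def tr_def entry_id blinfun_compose_simps)

text \<open>If \<open>w\<close> has Fourier coefficients \<open>c\<^sub>s\<close>, then \<open>E(aw b)\<close> has the coefficients \<open>c\<^sub>s E(a \<sigma>\<^sub>s(b))\<close>.\<close>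

lemma mixing_elementary:
  assumes a: "a \<in> A" and b: "b \<in> A"
    and mix: "((\<lambda>g. norm2 \<tau> (E (a o\<^sub>L \<sigma> g b))) \<longlongrightarrow> 0) cofinite"
    and w: "\<forall>\<^sub>F i in F. w i \<in> group_vna \<and> norm (w i) \<le> K"
    and null: "\<And>x. x \<in> M \<Longrightarrow> ((\<lambda>i. tr (x o\<^sub>L w i)) \<longlongrightarrow> 0) F"
  shows "((\<lambda>i. norm2 tr (cp.E (crossed_embed \<sigma> a o\<^sub>L w i o\<^sub>L crossed_embed \<sigma> b))) \<longlongrightarrow> 0) F"
proof (cases "norm2 \<tau> id_blinfun = 0")
  \<comment> \<open>Traces are not normalised and H may be zero; excluding this case allows division
    by \<open>n1\<close> below.\<close>
  case True
  have zero: "norm2 tr z = 0" if "z \<in> M" for z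
    using cp.norm2_le_norm[OF that] cp.norm2_nonneg[OF that] by (simp add: norm2_tr_id True)
  show ?thesis
  proof (rule tendsto_eventually)
    show "\<forall>\<^sub>F i in F. norm2 tr (cp.E (crossed_embed \<sigma> a o\<^sub>L w i o\<^sub>L crossed_embed \<sigma> b)) = 0"
      using w by eventually_elim (use a b in \<open>auto intro!: zero\<close>)
  qed
next
  case False
  define n1 where "n1 = (norm2 \<tau> id_blinfun)\<^sup>2"
  have n1: "0 < n1" using False by (simp add: n1_def)
  have t1: "cmod (\<tau> id_blinfun) = n1"
    using tr_adj_self_eq[of id_blinfun] by (simp add: n1_def blinfun_compose_simps norm_power)
  define c where "c i s = (SOME c. entry (w i) s 0 = scale_op c id_blinfun)" for i s
  have c: "entry (w i) s 0 = scale_op (c i s) id_blinfun" if "w i \<in> group_vna" for i s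
    unfolding c_def using group_vna_entry_scalar[OF that] by (rule someI_ex)
  define k where "k i = cp.E (crossed_embed \<sigma> a o\<^sub>L w i o\<^sub>L crossed_embed \<sigma> b)" for i
  define f where "f s = (norm2 \<tau> (E (a o\<^sub>L \<sigma> s b)))\<^sup>2" for s
  define C where "C = norm a * norm2 \<tau> b"
  have f: "0 \<le> f s" "f s \<le> C\<^sup>2" for s
  proof -
    have "norm2 \<tau> (E (a o\<^sub>L \<sigma> s b)) \<le> norm2 \<tau> (a o\<^sub>L \<sigma> s b)" by (rule expectation_norm2_le) (use a b in auto)
    also have "\<dots> \<le> norm a * norm2 \<tau> (\<sigma> s b)" by (rule norm2_compose_left) (use a b in auto)
    finally have "norm2 \<tau> (E (a o\<^sub>L \<sigma> s b)) \<le> C" using b by (simp add: C_def act_norm2)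
    then show "f s \<le> C\<^sup>2" unfolding f_def using a b by (intro power_mono) auto
  qed (simp add: f_def)
  have k_sum: "((\<lambda>s. (cmod (c i s))\<^sup>2 * f s) has_sum (norm2 tr (k i))\<^sup>2) UNIV"
    and w_sum: "((\<lambda>s. (cmod (c i s))\<^sup>2 * n1) has_sum (norm2 tr (w i))\<^sup>2) UNIV"
    if wi: "w i \<in> group_vna" for i
  proof -
    have x: "crossed_embed \<sigma> a o\<^sub>L w i o\<^sub>L crossed_embed \<sigma> b \<in> M" using a b wi by simp
    have "norm2 \<tau> (entry (k i) s 0) = cmod (c i s) * norm2 \<tau> (E (a o\<^sub>L \<sigma> s b))" for s
    proof -
      have "entry (crossed_embed \<sigma> a o\<^sub>L w i o\<^sub>L crossed_embed \<sigma> b) s 0 = \<sigma> (- s) a o\<^sub>L entry (w i) s 0 o\<^sub>L b"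
        using a b wi by (simp add: entry_crossed_embed_right entry_crossed_embed_left act_group(1))
      also have "\<dots> = scale_op (c i s) (\<sigma> (- s) a o\<^sub>L b)"
        unfolding c[OF wi] using a by (simp add: scale_op_compose blinfun_compose_simps)
      also have "\<sigma> (- s) a o\<^sub>L b = \<sigma> (- s) (a o\<^sub>L \<sigma> s b)" using a b by (simp add: act_inverse)
      finally have "entry (k i) s 0 = scale_op (c i s) (\<sigma> (- s) (E (a o\<^sub>L \<sigma> s b)))"
        unfolding k_def entry_expectation[OF x] using a b by (simp add: expectation_scale act_expectation del: act_simps(2))
      then show ?thesis using a b by (simp add: norm2_scale act_norm2)
    qed
    then show "((\<lambda>s. (cmod (c i s))\<^sup>2 * f s) has_sum (norm2 tr (k i))\<^sup>2) UNIV"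
      using norm2_cp_has_sum[of "k i"] x by (simp add: k_def f_def power_mult_distrib)
    show "((\<lambda>s. (cmod (c i s))\<^sup>2 * n1) has_sum (norm2 tr (w i))\<^sup>2) UNIV"
      using norm2_cp_has_sum[of "w i"] wi by (simp add: c[OF wi] norm2_scale power_mult_distrib n1_def)
  qed
  \<comment> \<open>The coefficient is read off from tr(u_{-s} w_i) = c_s \<tau>(1), so it tends to
    0 for each single s.\<close>
  have c_lim: "((\<lambda>i. (cmod (c i s))\<^sup>2) \<longlongrightarrow> 0) F" for s
  proof -
    have "((\<lambda>i. (cmod (tr (group_unitary (- s) o\<^sub>L w i)) / n1)\<^sup>2) \<longlongrightarrow> (0 / n1)\<^sup>2) F"
      by (intro tendsto_intros tendsto_norm_zero null) (use n1 in auto)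
    then have l: "((\<lambda>i. (cmod (tr (group_unitary (- s) o\<^sub>L w i)) / n1)\<^sup>2) \<longlongrightarrow> 0) F" by simp
    show ?thesis
    proof (rule Lim_transform_eventually[OF l])
      show "\<forall>\<^sub>F i in F. (cmod (tr (group_unitary (- s) o\<^sub>L w i)) / n1)\<^sup>2 = (cmod (c i s))\<^sup>2"
        using w
      proof eventually_elim
        case (elim i)
        then have "entry (group_unitary (- s) o\<^sub>L w i) 0 0 = scale_op (c i s) id_blinfun"
          using entry_column[of "w i" s, symmetric] c[of i s] by simp
        then have "tr (group_unitary (- s) o\<^sub>L w i) = c i s * \<tau> id_blinfun" by (simp add: tr_def)
        then show ?case using n1 by (simp add: norm_mult t1)
      qed
    qed
  qed
  have "((\<lambda>i. (norm2 tr (k i))\<^sup>2) \<longlongrightarrow> 0) F"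
  proof (rule tendstoI)
    fix \<epsilon> :: real assume \<epsilon>: "0 < \<epsilon>"
    define e where "e = \<epsilon> / (2 * (K\<^sup>2 + 1))"
    have e: "0 < e" "e * K\<^sup>2 \<le> \<epsilon> / 2"
    proof -
      have K1: "0 < K\<^sup>2 + 1" by (simp add: add_nonneg_pos)
      then show "0 < e" using \<epsilon> by (simp add: e_def)
      have "e * K\<^sup>2 \<le> e * (K\<^sup>2 + 1)" using \<open>0 < e\<close> by simp
      also have "\<dots> = \<epsilon> / 2" using K1 by (simp add: e_def field_simps)
      finally show "e * K\<^sup>2 \<le> \<epsilon> / 2" .
    qed
    \<comment> \<open>Mixing leaves finitely many s with f s >= e, and there the coefficients tend
      to 0. The others contribute at most e times the sum of |c_s|^2, which is bounded by
      K^2.\<close>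
    define S where "S = {s. e \<le> f s}"
    have "((\<lambda>s. f s) \<longlongrightarrow> 0) cofinite" unfolding f_def using tendsto_power[OF mix, of 2] by simp
    then have "\<forall>\<^sub>F s in cofinite. dist (f s) 0 < e" using e by (intro tendstoD) auto
    then have finS: "finite S" unfolding S_def eventually_cofinite using f by (simp add: not_less)
    have "((\<lambda>i. \<Sum>s\<in>S. (cmod (c i s))\<^sup>2 * C\<^sup>2) \<longlongrightarrow> (\<Sum>s\<in>S. 0 * C\<^sup>2)) F"
      by (intro tendsto_intros c_lim)
    then have "\<forall>\<^sub>F i in F. dist (\<Sum>s\<in>S. (cmod (c i s))\<^sup>2 * C\<^sup>2) 0 < \<epsilon> / 2"
      using \<epsilon> by (intro tendstoD) auto
    then show "\<forall>\<^sub>F i in F. dist ((norm2 tr (k i))\<^sup>2) 0 < \<epsilon>"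
      using w
    proof eventually_elim
      case (elim i)
      then have wi: "w i \<in> group_vna" "norm (w i) \<le> K" by auto
      have s1: "((\<lambda>s. if s \<in> S then (cmod (c i s))\<^sup>2 * C\<^sup>2 else 0) has_sum (\<Sum>s\<in>S. (cmod (c i s))\<^sup>2 * C\<^sup>2)) UNIV"
        using has_sum_finite[OF finS, of "\<lambda>s. (cmod (c i s))\<^sup>2 * C\<^sup>2"]
        by (rule has_sum_cong_neutral[THEN iffD1, rotated -1]) auto
      have s2: "((\<lambda>s. (cmod (c i s))\<^sup>2 * n1 * (e / n1)) has_sum (norm2 tr (w i))\<^sup>2 * (e / n1)) UNIV"
        by (rule has_sum_cmult_left[OF w_sum[OF wi(1)]])
      have "(norm2 tr (k i))\<^sup>2 \<le> (\<Sum>s\<in>S. (cmod (c i s))\<^sup>2 * C\<^sup>2) + (norm2 tr (w i))\<^sup>2 * (e / n1)"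
      proof (rule has_sum_mono[OF k_sum[OF wi(1)] has_sum_add[OF s1 s2]])
        fix s
        show "(cmod (c i s))\<^sup>2 * f s \<le> (if s \<in> S then (cmod (c i s))\<^sup>2 * C\<^sup>2 else 0) + (cmod (c i s))\<^sup>2 * n1 * (e / n1)"
        proof (cases "s \<in> S")
          case True
          have "(cmod (c i s))\<^sup>2 * f s \<le> (cmod (c i s))\<^sup>2 * C\<^sup>2" using f(2)[of s] by (intro mult_left_mono) auto
          moreover have "0 \<le> (cmod (c i s))\<^sup>2 * n1 * (e / n1)" using n1 e by simp
          ultimately show ?thesis using True by (simp only: if_True)
        next
          case False
          then show ?thesis using n1 by (simp add: S_def not_le mult_left_mono)
        qed
      qed
      moreover have "(norm2 tr (w i))\<^sup>2 * (e / n1) \<le> e * K\<^sup>2"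
      proof -
        have "norm2 tr (w i) \<le> norm (w i) * norm2 \<tau> id_blinfun"
          using cp.norm2_le_norm[of "w i"] wi by (simp add: norm2_tr_id)
        also have "\<dots> \<le> K * norm2 \<tau> id_blinfun" using wi by (intro mult_right_mono) auto
        finally have "(norm2 tr (w i))\<^sup>2 \<le> (K * norm2 \<tau> id_blinfun)\<^sup>2" using wi by (intro power_mono) auto
        then have "(norm2 tr (w i))\<^sup>2 * (e / n1) \<le> (K\<^sup>2 * n1) * (e / n1)"
          using n1 e by (intro mult_right_mono) (auto simp: power_mult_distrib n1_def)
        then show ?thesis using n1 by (simp add: mult.commute)
      qed
      ultimately show ?case using elim e by (simp add: dist_real_def)
    qed
  qed
  then have "((\<lambda>i. sqrt ((norm2 tr (k i))\<^sup>2)) \<longlongrightarrow> sqrt 0) F" by (intro tendsto_intros)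
  then have l: "((\<lambda>i. sqrt ((norm2 tr (k i))\<^sup>2)) \<longlongrightarrow> 0) F" by simp
  have "((\<lambda>i. norm2 tr (k i)) \<longlongrightarrow> 0) F"
  proof (rule Lim_transform_eventually[OF l])
    show "\<forall>\<^sub>F i in F. sqrt ((norm2 tr (k i))\<^sup>2) = norm2 tr (k i)"
      using w by eventually_elim (use a b in \<open>simp add: k_def\<close>)
  qed
  then show ?thesis by (simp add: k_def)
qed

text \<open>Approximation is available in the trace norm only, so x w y is perturbed in one factor
  at a time while the other keeps a fixed operator norm: x is approximated with y elementary, and
  the result extends to arbitrary y with x fixed.\<close>

lemma mixing_bimodule:
  assumes mix: "\<And>a b. a \<in> A \<Longrightarrow> b \<in> A \<Longrightarrow> E a = 0 \<Longrightarrow> E b = 0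
      \<Longrightarrow> ((\<lambda>g. norm2 \<tau> (E (a o\<^sub>L \<sigma> g b))) \<longlongrightarrow> 0) cofinite"
    and w: "\<forall>\<^sub>F i in F. w i \<in> group_vna \<and> norm (w i) \<le> K"
    and null: "\<And>x. x \<in> M \<Longrightarrow> ((\<lambda>i. tr (x o\<^sub>L w i)) \<longlongrightarrow> 0) F"
    and x: "x \<in> M" "cp.E x = 0" and y: "y \<in> M" "cp.E y = 0"
  shows "((\<lambda>i. norm2 tr (cp.E (x o\<^sub>L w i o\<^sub>L y))) \<longlongrightarrow> 0) F"
proof -
  define good where "good x y \<longleftrightarrow> ((\<lambda>i. norm2 tr (cp.E (x o\<^sub>L w i o\<^sub>L y))) \<longlongrightarrow> 0) F" for x y
  have wM: "\<forall>\<^sub>F i in F. w i \<in> M \<and> norm (w i) \<le> K" using w by eventually_elim simp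
  have E0: "cp.E 0 = 0" using cp.expectation_id[of 0] by simp
  \<comment> \<open>The inner unitaries are absorbed into w: the family u_g w u_h stays bounded in
    L(\<Gamma>) and is weakly null by cyclicity of the trace.\<close>
  have elem: "good (crossed_embed \<sigma> a o\<^sub>L group_unitary g) (group_unitary h o\<^sub>L crossed_embed \<sigma> b)"
    if ab: "a \<in> A" "b \<in> A" "E a = 0" "E b = 0" for a b g h
  proof -
    let ?w = "\<lambda>i. group_unitary g o\<^sub>L w i o\<^sub>L group_unitary h"
    interpret L: vn_algebra "group_vna :: ('g, 'h) ell2 op set" by (rule vn_algebra_group_vna)
    have "((\<lambda>i. norm2 tr (cp.E (crossed_embed \<sigma> a o\<^sub>L ?w i o\<^sub>L crossed_embed \<sigma> b))) \<longlongrightarrow> 0) F"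
    proof (rule mixing_elementary[OF ab(1,2) mix[OF ab]])
      show "\<forall>\<^sub>F i in F. ?w i \<in> group_vna \<and> norm (?w i) \<le> K"
        using w
      proof eventually_elim
        case (elim i)
        have "norm (?w i) \<le> norm (group_unitary g o\<^sub>L w i) * norm (group_unitary h :: ('g, 'h) ell2 op)"
          by (rule norm_blinfun_compose)
        also have "\<dots> \<le> norm (group_unitary g o\<^sub>L w i) * 1" by (intro mult_left_mono norm_group_unitary) auto
        also have "\<dots> \<le> norm (group_unitary g :: ('g, 'h) ell2 op) * norm (w i)" by (simp add: norm_blinfun_compose)
        also have "\<dots> \<le> 1 * norm (w i)" by (intro mult_right_mono norm_group_unitary) auto
        finally show ?case using elim group_unitary_group_vna by simp
      qed
      fix z assume z: "z \<in> M"
      have "((\<lambda>i. tr ((group_unitary h o\<^sub>L z o\<^sub>L group_unitary g) o\<^sub>L w i)) \<longlongrightarrow> 0) F"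
        by (rule null) (use z in simp)
      moreover have "\<forall>\<^sub>F i in F. tr ((group_unitary h o\<^sub>L z o\<^sub>L group_unitary g) o\<^sub>L w i) = tr (z o\<^sub>L ?w i)"
        using wM
      proof eventually_elim
        case (elim i)
        then show ?case
          using cp.tr_comm[of "group_unitary h" "z o\<^sub>L group_unitary g o\<^sub>L w i"] z by (simp add: blinfun_compose_assoc)
      qed
      ultimately show "((\<lambda>i. tr (z o\<^sub>L ?w i)) \<longlongrightarrow> 0) F" by (rule Lim_transform_eventually)
    qed
    then show ?thesis by (simp add: good_def blinfun_compose_assoc)
  qed
  have add_left: "good (x + x') y" if "x \<in> M" "x' \<in> M" "y \<in> M" "good x y" "good x' y" for x x' y
    unfolding good_def
  proof (rule Lim_null_comparison)
    show "\<forall>\<^sub>F i in F. norm (norm2 tr (cp.E ((x + x') o\<^sub>L w i o\<^sub>L y)))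
      \<le> norm2 tr (cp.E (x o\<^sub>L w i o\<^sub>L y)) + norm2 tr (cp.E (x' o\<^sub>L w i o\<^sub>L y))"
      using wM
    proof eventually_elim
      case (elim i)
      have "cp.E ((x + x') o\<^sub>L w i o\<^sub>L y) = cp.E (x o\<^sub>L w i o\<^sub>L y) + cp.E (x' o\<^sub>L w i o\<^sub>L y)"
        using that elim by (simp add: blinfun_compose_simps(1)[of x] blinfun_compose_simps(1)[of "x o\<^sub>L w i"] cp.expectation_add)
      then show ?case
        using cp.norm2_triangle[of "cp.E (x o\<^sub>L w i o\<^sub>L y)" "cp.E (x' o\<^sub>L w i o\<^sub>L y)"] that elim by simp
    qed
    show "((\<lambda>i. norm2 tr (cp.E (x o\<^sub>L w i o\<^sub>L y)) + norm2 tr (cp.E (x' o\<^sub>L w i o\<^sub>L y))) \<longlongrightarrow> 0) F"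
      using tendsto_add[OF that(4,5)[unfolded good_def]] by simp
  qed
  have add_right: "good x (y + y')" if "x \<in> M" "y \<in> M" "y' \<in> M" "good x y" "good x y'" for x y y'
    unfolding good_def
  proof (rule Lim_null_comparison)
    show "\<forall>\<^sub>F i in F. norm (norm2 tr (cp.E (x o\<^sub>L w i o\<^sub>L (y + y'))))
      \<le> norm2 tr (cp.E (x o\<^sub>L w i o\<^sub>L y)) + norm2 tr (cp.E (x o\<^sub>L w i o\<^sub>L y'))"
      using wM
    proof eventually_elim
      case (elim i)
      have "cp.E (x o\<^sub>L w i o\<^sub>L (y + y')) = cp.E (x o\<^sub>L w i o\<^sub>L y) + cp.E (x o\<^sub>L w i o\<^sub>L y')"
        using that elim by (simp add: blinfun_compose_simps(2)[of _ y] cp.expectation_add)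
      then show ?case
        using cp.norm2_triangle[of "cp.E (x o\<^sub>L w i o\<^sub>L y)" "cp.E (x o\<^sub>L w i o\<^sub>L y')"] that elim by simp
    qed
    show "((\<lambda>i. norm2 tr (cp.E (x o\<^sub>L w i o\<^sub>L y)) + norm2 tr (cp.E (x o\<^sub>L w i o\<^sub>L y'))) \<longlongrightarrow> 0) F"
      using tendsto_add[OF that(4,5)[unfolded good_def]] by simp
  qed
  have zero: "good 0 y" "good x 0" for x y
    by (simp_all add: good_def E0 blinfun_compose_simps)
  have sum_left: "good (sum p G) y" if "\<And>g. p g \<in> M" "y \<in> M" "\<And>g. good (p g) y" for p y and G :: "'g set"
    by (induction G rule: infinite_finite_induct)
      (simp_all add: zero add_left[OF that(1) cp.sum_closed[OF that(1)] that(2,3)])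
  have sum_right: "good x (sum p G)" if "\<And>g. p g \<in> M" "x \<in> M" "\<And>g. good x (p g)" for p x and G :: "'g set"
    by (induction G rule: infinite_finite_induct)
      (simp_all add: zero add_right[OF that(2,1) cp.sum_closed[OF that(1)] that(3)])
  have K: "\<forall>\<^sub>F i in F. w i \<in> M \<and> norm (w i) \<le> \<bar>K\<bar>" using wM by eventually_elim auto
  \<comment> \<open>R is a Lipschitz constant of the product, for the trace norm, in the factor that
    is varied.\<close>
  have approx: "good x y"
    if xy: "x \<in> M" "y \<in> M" and R: "0 \<le> R"
      and ex: "\<And>e. 0 < e \<Longrightarrow> \<exists>x' y'. x' \<in> M \<and> y' \<in> M \<and> good x' y'
        \<and> (\<forall>i. w i \<in> M \<and> norm (w i) \<le> \<bar>K\<bar> \<longrightarrow> norm2 tr ((x o\<^sub>L w i o\<^sub>L y) - (x' o\<^sub>L w i o\<^sub>L y')) \<le> R * e)"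
    for x y R
    unfolding good_def
  proof (rule tendstoI)
    fix \<epsilon> :: real assume \<epsilon>: "0 < \<epsilon>"
    define e where "e = \<epsilon> / (2 * (R + 1))"
    have e: "0 < e" using \<epsilon> R by (simp add: e_def)
    have Re: "R * e < \<epsilon>/2" unfolding e_def using \<epsilon> R by (simp add: field_simps)
    obtain x' y' where x': "x' \<in> M" "y' \<in> M" "good x' y'"
      "\<And>i. w i \<in> M \<Longrightarrow> norm (w i) \<le> \<bar>K\<bar> \<Longrightarrow> norm2 tr ((x o\<^sub>L w i o\<^sub>L y) - (x' o\<^sub>L w i o\<^sub>L y')) \<le> R * e"
      using ex[OF e] by blast
    have "\<forall>\<^sub>F i in F. dist (norm2 tr (cp.E (x' o\<^sub>L w i o\<^sub>L y'))) 0 < \<epsilon> / 2"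
      using x'(3) \<epsilon> unfolding good_def by (intro tendstoD) auto
    then show "\<forall>\<^sub>F i in F. dist (norm2 tr (cp.E (x o\<^sub>L w i o\<^sub>L y))) 0 < \<epsilon>"
      using K
    proof eventually_elim
      case (elim i)
      let ?u = "x o\<^sub>L w i o\<^sub>L y" and ?v = "x' o\<^sub>L w i o\<^sub>L y'"
      have uv: "?u \<in> M" "?v \<in> M" using xy x' elim by auto
      have "norm2 tr (cp.E ?u) \<le> norm2 tr (cp.E (?u - ?v)) + norm2 tr (cp.E ?v)"
        using cp.norm2_triangle[of "cp.E (?u - ?v)" "cp.E ?v"] uv by (simp add: cp.expectation_diff)
      also have "norm2 tr (cp.E (?u - ?v)) \<le> norm2 tr (?u - ?v)" using uv by (intro cp.expectation_norm2_le) auto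
      also have "\<dots> \<le> R * e" using x'(4) elim by blast
      finally show ?case using elim Re uv by (simp add: dist_real_def)
    qed
  qed
  have left: "good x (group_unitary h o\<^sub>L crossed_embed \<sigma> b)"
    if x: "x \<in> M" "cp.E x = 0" and b: "b \<in> A" "E b = 0" for x h b
  proof -
    let ?y = "group_unitary h o\<^sub>L crossed_embed \<sigma> b"
    have yM: "?y \<in> M" using b by simp
    show ?thesis
    proof (rule approx[OF x(1) yM, of "\<bar>K\<bar> * norm ?y"])
      fix e :: real assume "0 < e"
      then obtain G a where G: "finite G" "\<And>g. a g \<in> A \<and> E (a g) = 0"
        "norm2 tr (x - (\<Sum>g\<in>G. crossed_embed \<sigma> (a g) o\<^sub>L group_unitary g)) < e"
        using finite_fourier_approximation[OF x] by blast
      let ?x = "\<Sum>g\<in>G. crossed_embed \<sigma> (a g) o\<^sub>L group_unitary g"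
      have x'M: "?x \<in> M" by (rule cp.sum_closed) (use G in auto)
      have g: "good ?x ?y" by (rule sum_left) (use G(2) b yM elem in auto)
      have le: "norm2 tr ((x o\<^sub>L v o\<^sub>L ?y) - (?x o\<^sub>L v o\<^sub>L ?y)) \<le> \<bar>K\<bar> * norm ?y * e" if v: "v \<in> M" "norm v \<le> \<bar>K\<bar>" for v
      proof -
        have "(x o\<^sub>L v o\<^sub>L ?y) - (?x o\<^sub>L v o\<^sub>L ?y) = (x - ?x) o\<^sub>L v o\<^sub>L ?y"
          by (simp only: blinfun_compose_simps(3))
        moreover have "norm2 tr ((x - ?x) o\<^sub>L v o\<^sub>L ?y) \<le> norm2 tr ((x - ?x) o\<^sub>L v) * norm ?y"
          by (rule cp.norm2_compose_right) (use x x'M v yM in auto)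
        moreover have "norm2 tr ((x - ?x) o\<^sub>L v) * norm ?y \<le> (norm2 tr (x - ?x) * norm v) * norm ?y"
          by (intro mult_right_mono cp.norm2_compose_right) (use x x'M v in auto)
        moreover have "(norm2 tr (x - ?x) * norm v) * norm ?y \<le> (e * \<bar>K\<bar>) * norm ?y"
          by (intro mult_right_mono mult_mono) (use G(3) v \<open>0 < e\<close> in auto)
        ultimately show ?thesis by (simp add: ac_simps)
      qed
      then show "\<exists>x' y'. x' \<in> M \<and> y' \<in> M \<and> good x' y'
        \<and> (\<forall>i. w i \<in> M \<and> norm (w i) \<le> \<bar>K\<bar> \<longrightarrow> norm2 tr ((x o\<^sub>L w i o\<^sub>L ?y) - (x' o\<^sub>L w i o\<^sub>L y')) \<le> \<bar>K\<bar> * norm ?y * e)"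
        using x'M yM g by blast
    qed simp
  qed
  have "good x y"
  proof (rule approx[OF x(1) y(1), of "norm x * \<bar>K\<bar>"])
    fix e :: real assume e: "0 < e"
    \<comment> \<open>Approximating adj y and taking adjoints puts each unitary to the left of
      \<pi>(b), the form in which \<open>elem\<close> absorbs it into w.\<close>
    have "cp.E (adj y) = 0" using cp.expectation_adj[OF y(1)] y(2) by simp
    from finite_fourier_approximation[OF cp.adj_closed[OF y(1)] this e]
    obtain G a where G: "finite G" "\<And>g. a g \<in> A \<and> E (a g) = 0"
      "norm2 tr (adj y - (\<Sum>g\<in>G. crossed_embed \<sigma> (a g) o\<^sub>L group_unitary g)) < e"
      by blast
    let ?z = "\<Sum>g\<in>G. crossed_embed \<sigma> (a g) o\<^sub>L group_unitary g"
    let ?p = "\<lambda>g. group_unitary (- g) o\<^sub>L crossed_embed \<sigma> (adj (a g))"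
    let ?y = "sum ?p G"
    have aA: "a g \<in> A" "E (a g) = 0" for g using G(2) by auto
    have pM: "?p g \<in> M" for g using aA by simp
    have zM: "?z \<in> M" by (rule cp.sum_closed) (use aA in auto)
    have y'M: "?y \<in> M" by (rule cp.sum_closed) (rule pM)
    have adj_p: "adj (?p g) = crossed_embed \<sigma> (a g) o\<^sub>L group_unitary g" for g
      using aA by (simp add: group_unitary_simps crossed_embed_adj)
    have adj_sum: "adj (sum ?p H) = (\<Sum>g\<in>H. crossed_embed \<sigma> (a g) o\<^sub>L group_unitary g)" for H
    proof (induction H rule: infinite_finite_induct)
      case (insert g H)
      have "sum ?p H \<in> M" by (rule cp.sum_closed) (rule pM)
      then show ?case using insert pM[of g] by (simp add: adj_p[symmetric] del: adj_compose)
    qed simp_all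
    have g: "good x ?y"
      by (rule sum_right[OF pM x(1)]) (rule left[OF x], use aA in \<open>auto simp: expectation_adj\<close>)
    have yy: "norm2 tr (y - ?y) < e"
      using G(3) cp.norm2_adj[of "y - ?y"] y(1) y'M by (simp add: adj_sum)
    have le: "norm2 tr ((x o\<^sub>L v o\<^sub>L y) - (x o\<^sub>L v o\<^sub>L ?y)) \<le> norm x * \<bar>K\<bar> * e" if v: "v \<in> M" "norm v \<le> \<bar>K\<bar>" for v
    proof -
      have "(x o\<^sub>L v o\<^sub>L y) - (x o\<^sub>L v o\<^sub>L ?y) = (x o\<^sub>L v) o\<^sub>L (y - ?y)"
        by (simp only: blinfun_compose_simps(4))
      moreover have "norm2 tr ((x o\<^sub>L v) o\<^sub>L (y - ?y)) \<le> norm (x o\<^sub>L v) * norm2 tr (y - ?y)"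
        by (rule cp.norm2_compose_left) (use x y y'M v in auto)
      moreover have "norm (x o\<^sub>L v) * norm2 tr (y - ?y) \<le> (norm x * \<bar>K\<bar>) * e"
      proof (rule mult_mono)
        show "norm (x o\<^sub>L v) \<le> norm x * \<bar>K\<bar>"
          using norm_blinfun_compose[of x v] mult_left_mono[OF v(2) norm_ge_zero[of x]] by linarith
      qed (use yy y(1) y'M in auto)
      ultimately show ?thesis by simp
    qed
    then show "\<exists>x' y'. x' \<in> M \<and> y' \<in> M \<and> good x' y'
        \<and> (\<forall>i. w i \<in> M \<and> norm (w i) \<le> \<bar>K\<bar> \<longrightarrow> norm2 tr ((x o\<^sub>L w i o\<^sub>L y) - (x' o\<^sub>L w i o\<^sub>L y')) \<le> norm x * \<bar>K\<bar> * e)"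
      using x(1) y'M g by blast
  qed simp
  then show ?thesis by (simp add: good_def)
qed

end

section \<open>Transfer of mixing along the isomorphism\<close>

theorem theorem2p8:
  fixes \<sigma> :: "'g::{group_add,countable} \<Rightarrow> 'h::complex_hilbert_space op \<Rightarrow> 'h op"
    and \<alpha> :: "'l::{group_add,countable} \<Rightarrow> 'k::complex_hilbert_space op \<Rightarrow> 'k op"
    and A B :: "'h op set" and C D :: "'k op set"
    and \<tau> :: "'h op \<Rightarrow> complex" and \<tau>' :: "'k op \<Rightarrow> complex"
  assumes "mixing_extension \<sigma> B A \<tau>"
    and "trace_preserving_extension \<alpha> D C \<tau>'"
    and "\<exists>\<theta> :: ('g, 'h) ell2 op \<Rightarrow> ('l, 'k) ell2 op.
           star_isomorphism (crossed_product \<sigma> A) (crossed_product \<alpha> C) \<theta>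
           \<and> \<theta> ` crossed_product \<sigma> B = crossed_product \<alpha> D
           \<and> \<theta> ` group_vna = group_vna"
  shows "mixing_extension \<alpha> D C \<tau>'"
proof -
  interpret G: tp_extension \<sigma> B A \<tau>
    by unfold_locales (use assms(1) in \<open>simp add: mixing_extension_def\<close>)
  interpret H: tp_extension \<alpha> D C \<tau>'
    by unfold_locales (rule assms(2))
  obtain \<theta> :: "('g, 'h) ell2 op \<Rightarrow> ('l, 'k) ell2 op" where iso: "star_isomorphism G.M H.M \<theta>"
    and \<theta>N: "\<theta> ` G.N = H.N" and \<theta>L: "\<theta> ` group_vna = group_vna"
    using assms(3) by blast
  interpret \<theta>: vn_isomorphism G.M H.M \<theta>
    by unfold_locales (rule iso)
  define \<tau>1 where "\<tau>1 x = H.tr (\<theta> x)" for x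
  interpret T: tracial_algebra G.M \<tau>1
    by unfold_locales (use \<theta>.trace_pullback[OF H.tr_faithful_normal_trace] in \<open>simp add: \<tau>1_def[abs_def]\<close>)
  let ?i = "inv_into G.M \<theta>"
  have inv_N: "?i z \<in> G.N" if z: "z \<in> H.N" for z
  proof -
    obtain y where y: "y \<in> G.N" "z = \<theta> y" using z \<theta>N by blast
    then show ?thesis using \<theta>.inv_simps(3)[of y] G.N_subset_M by auto
  qed
  have inv_L: "?i z \<in> group_vna" if z: "z \<in> group_vna" for z
  proof -
    obtain y where y: "y \<in> group_vna" "z = \<theta> y" using z \<theta>L by blast
    then show ?thesis using \<theta>.inv_simps(3)[of y] by auto
  qed
  have inv_norm: "norm (?i z) \<le> norm z" if "z \<in> H.M" for z
    using vn_isomorphism.norm_le[OF \<theta>.inv_iso that] .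
  define w where "w l = ?i (group_unitary l)" for l
  have \<theta>w: "\<theta> (w l) = group_unitary l" for l unfolding w_def by (rule \<theta>.inv_simps(2)) simp
  have w: "w l \<in> group_vna" "w l \<in> G.M" "w l \<in> G.N" "norm (w l) \<le> 1" for l
  proof -
    show "w l \<in> group_vna" unfolding w_def by (rule inv_L[OF H.group_unitary_group_vna])
    then show "w l \<in> G.M" "w l \<in> G.N" by simp_all
    show "norm (w l) \<le> 1"
      unfolding w_def using inv_norm[of "group_unitary l"] norm_group_unitary[of l, where 'h = 'k] order_trans by auto
  qed
  have null1: "((\<lambda>l. \<tau>1 (x o\<^sub>L w l)) \<longlongrightarrow> 0) cofinite" if x: "x \<in> G.M" for x
    using H.tr_group_unitary_tendsto_0[OF \<theta>.closed[OF x]] x w(2) by (simp add: \<tau>1_def \<theta>w)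
  \<comment> \<open>The unitaries u_l are weakly null for the trace of C \<rtimes> \<Lambda>, hence
    their preimages for \<tau>_1. Mixing of \<Gamma> speaks of \<open>G.tr\<close>, so the transfer
    runs from \<tau>_1 to \<open>G.tr\<close> here and back at the end.\<close>
  have null: "((\<lambda>l. G.tr (x o\<^sub>L w l)) \<longlongrightarrow> 0) cofinite" if x: "x \<in> G.M" for x
    by (rule T.weakly_null_transfer[OF G.cp.tracial_algebra_axioms _ null1 x, where K = 1]) (use w in auto)
  have mix: "((\<lambda>g. norm2 \<tau> (G.E (a o\<^sub>L \<sigma> g b))) \<longlongrightarrow> 0) cofinite"
    if "a \<in> A" "b \<in> A" "G.E a = 0" "G.E b = 0" for a b
    using assms(1) that by (simp add: mixing_extension_def orthocomplement_in_def)
  have "((\<lambda>l. norm2 \<tau>' (H.E (t o\<^sub>L \<alpha> l z))) \<longlongrightarrow> 0) cofinite"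
    if t: "t \<in> C" "H.E t = 0" and z: "z \<in> C" for t z
  proof -
    define d where "d l = H.E (t o\<^sub>L \<alpha> l z)" for l
    have d: "d l \<in> D" for l unfolding d_def using t z by simp
    \<comment> \<open>The factor 6 is the bound from \<open>expectation_norm_le\<close>.\<close>
    define R where "R = 6 * (norm t * norm z)"
    have dR: "norm (d l) \<le> R" for l
    proof -
      have "norm (t o\<^sub>L \<alpha> l z) \<le> norm t * norm z"
        using norm_blinfun_compose[of t "\<alpha> l z"] mult_left_mono[OF H.act_norm_le[OF z] norm_ge_zero[of t]]
        by (rule order_trans)
      then show ?thesis unfolding d_def R_def using H.expectation_norm_le[of "t o\<^sub>L \<alpha> l z"] t z by simp
    qed
    define x where "x = ?i (crossed_embed \<alpha> t)"
    define y where "y = ?i (crossed_embed \<alpha> z)"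
    \<comment> \<open>Chosen so that the pairing with x (w l) y reproduces the squared norm of d l;
      u_{-l} cancels the u_l that remains after z has been moved across it. These elements lie in N
      because d l is in D, and they are bounded because the d l are.\<close>
    define b where "b l = ?i (group_unitary (- l) o\<^sub>L crossed_embed \<alpha> (adj (d l)))" for l
    have xM: "x \<in> G.M" "\<theta> x = crossed_embed \<alpha> t" unfolding x_def using t by simp_all
    have yM: "y \<in> G.M" "\<theta> y = crossed_embed \<alpha> z" unfolding y_def using z by simp_all
    have cd: "group_unitary (- l) o\<^sub>L crossed_embed \<alpha> (adj (d l)) \<in> H.N" for l using d by simp
    have bN: "b l \<in> G.N" "b l \<in> G.M" "\<theta> (b l) = group_unitary (- l) o\<^sub>L crossed_embed \<alpha> (adj (d l))" for l
    proof -
      show "b l \<in> G.N" unfolding b_def by (rule inv_N[OF cd])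
      then show "b l \<in> G.M" using G.N_subset_M by blast
      show "\<theta> (b l) = group_unitary (- l) o\<^sub>L crossed_embed \<alpha> (adj (d l))"
        unfolding b_def by (rule \<theta>.inv_simps(2)) (use cd H.N_subset_M in blast)
    qed
    have bR: "norm (b l) \<le> R" for l
    proof -
      have "norm (b l) \<le> norm (group_unitary (- l) o\<^sub>L crossed_embed \<alpha> (adj (d l)))"
        unfolding b_def by (rule inv_norm) (use cd H.N_subset_M in blast)
      also have "\<dots> \<le> norm (group_unitary (- l) :: ('l, 'k) ell2 op) * norm (crossed_embed \<alpha> (adj (d l)))"
        by (rule norm_blinfun_compose)
      also have "\<dots> \<le> 1 * norm (crossed_embed \<alpha> (adj (d l)))"
        by (intro mult_right_mono norm_group_unitary) auto
      also have "norm (crossed_embed \<alpha> (adj (d l))) \<le> norm (adj (d l))"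
        by (rule H.norm_crossed_embed_le) (use d in auto)
      also have "norm (adj (d l)) = norm (d l)" by (rule norm_adj) (use d in auto)
      finally show ?thesis using dR[of l] by simp
    qed
    have key: "\<tau>1 (b l o\<^sub>L x o\<^sub>L w l o\<^sub>L y) = of_real ((norm2 \<tau>' (d l))\<^sup>2)" for l
    proof -
      let ?u = "group_unitary l :: ('l, 'k) ell2 op" and ?v = "group_unitary (- l) :: ('l, 'k) ell2 op"
      let ?p = "crossed_embed \<alpha>"
      have dC: "d l \<in> C" "adj (d l) \<in> C" using d by auto
      have uz: "?u o\<^sub>L ?p z = ?p (\<alpha> l z) o\<^sub>L ?u" by (rule H.group_unitary_crossed_embed[OF z])
      have "\<tau>1 (b l o\<^sub>L x o\<^sub>L w l o\<^sub>L y) = H.tr (?v o\<^sub>L (?p (adj (d l)) o\<^sub>L (?p t o\<^sub>L (?u o\<^sub>L ?p z))))"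
        unfolding \<tau>1_def using bN xM yM w(2) by (simp add: \<theta>w blinfun_compose_assoc)
      also have "\<dots> = H.tr ((?p (adj (d l)) o\<^sub>L (?p t o\<^sub>L (?p (\<alpha> l z) o\<^sub>L ?u))) o\<^sub>L ?v)"
        unfolding uz by (rule H.cp.tr_comm) (use dC t z in auto)
      also have "(?p (adj (d l)) o\<^sub>L (?p t o\<^sub>L (?p (\<alpha> l z) o\<^sub>L ?u))) o\<^sub>L ?v = ?p (adj (d l) o\<^sub>L (t o\<^sub>L \<alpha> l z))"
        using dC t z by (simp add: blinfun_compose_assoc group_unitary_simps blinfun_compose_simps H.crossed_embed_mult)
      also have "H.tr \<dots> = \<tau>' (adj (d l) o\<^sub>L (t o\<^sub>L \<alpha> l z))"
        using dC t z by (simp add: H.tr_def H.entry_crossed_embed H.act_group(1) del: H.act_simps(2))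
      also have "\<dots> = \<tau>' (adj (d l) o\<^sub>L d l)"
        using H.expectation_trace_left[of "t o\<^sub>L \<alpha> l z" "adj (d l)"] t z d by (simp add: d_def)
      also have "\<dots> = of_real ((norm2 \<tau>' (d l))\<^sup>2)" by (rule H.tr_adj_self_eq[OF dC(1)])
      finally show ?thesis .
    qed
    \<comment> \<open>For \<tau>_1 the element x is orthogonal to N, although it need not be for
      \<open>G.tr\<close>: the pairing only sees the entry of \<theta>(n) at (0, 0), which lies in
      D.\<close>
    have annihilate: "\<tau>1 (n o\<^sub>L x) = 0" if n: "n \<in> G.N" for n
    proof -
      have nM: "n \<in> G.M" using n G.N_subset_M by blast
      have nH: "\<theta> n \<in> H.N" using n \<theta>N by blast
      have e: "entry (\<theta> n) 0 0 \<in> D" using nH by simp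
      have "\<tau>1 (n o\<^sub>L x) = H.tr (\<theta> n o\<^sub>L crossed_embed \<alpha> t)" using nM xM by (simp add: \<tau>1_def)
      also have "\<dots> = \<tau>' (entry (\<theta> n) 0 0 o\<^sub>L t)"
        using t nM by (simp add: H.tr_def H.entry_crossed_embed_right H.act_group(1))
      also have "\<dots> = \<tau>' (entry (\<theta> n) 0 0 o\<^sub>L H.E t)" using H.expectation_trace_left[OF t(1) e] by simp
      finally show ?thesis by (simp add: t(2) blinfun_compose_simps)
    qed
    define y0 where "y0 = y - G.cp.E y"
    have EyN: "G.cp.E y \<in> G.N" using yM by simp
    have y0: "y0 \<in> G.M" "G.cp.E y0 = 0"
      unfolding y0_def using yM EyN by (simp_all add: G.cp.expectation_diff G.cp.expectation_id)
    define v where "v l = x o\<^sub>L w l o\<^sub>L y0 o\<^sub>L b l" for l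
    have vM: "v l \<in> G.M" for l unfolding v_def using xM w(2) y0 bN by simp
    have vn: "norm (v l) \<le> norm x * norm y0 * R" for l
    proof -
      have "norm (v l) \<le> ((norm x * norm (w l)) * norm y0) * norm (b l)"
        unfolding v_def
        by (intro order_trans[OF norm_blinfun_compose] mult_right_mono norm_ge_zero order_refl)
      also have "\<dots> \<le> ((norm x * 1) * norm y0) * R"
        by (intro mult_mono mult_left_mono mult_right_mono w(4) bR) auto
      finally show ?thesis by simp
    qed
    have vnull: "((\<lambda>l. G.tr (a o\<^sub>L v l)) \<longlongrightarrow> 0) cofinite" if a: "a \<in> G.M" for a
    proof -
      \<comment> \<open>Mixing asks for both outer factors in the kernel of the expectation for
        \<open>G.tr\<close>. Replacing a x by x0 does not change the expectation of the product, as
        E(E(a x) w y0) = E(a x) w E(y0) = 0.\<close>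
      define x0 where "x0 = (a o\<^sub>L x) - G.cp.E (a o\<^sub>L x)"
      have axM: "a o\<^sub>L x \<in> G.M" using a xM by simp
      have EN: "G.cp.E (a o\<^sub>L x) \<in> G.N" using axM by simp
      have x0: "x0 \<in> G.M" "G.cp.E x0 = 0"
        unfolding x0_def using axM EN by (simp_all add: G.cp.expectation_diff G.cp.expectation_id)
      have lim: "((\<lambda>l. norm2 G.tr (G.cp.E (x0 o\<^sub>L w l o\<^sub>L y0))) \<longlongrightarrow> 0) cofinite"
        by (rule G.mixing_bimodule[OF mix _ null x0 y0, where K = 1]) (use w in auto)
      have bound: "cmod (G.tr (a o\<^sub>L v l)) \<le> norm2 G.tr (G.cp.E (x0 o\<^sub>L w l o\<^sub>L y0)) * (R * norm2 G.tr id_blinfun)" for l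
      proof -
        have wl: "w l \<in> G.M" "w l \<in> G.N" by (rule w)+
        have "G.cp.E (a o\<^sub>L x) o\<^sub>L w l \<in> G.N" using EN wl(2) by (rule G.cp.sub.closed_simps)
        then have E1: "G.cp.E (G.cp.E (a o\<^sub>L x) o\<^sub>L w l o\<^sub>L y0) = 0"
          using G.cp.expectation_left[OF y0(1)] y0(2) by (simp add: blinfun_compose_simps)
        have "a o\<^sub>L x o\<^sub>L w l o\<^sub>L y0 = (x0 o\<^sub>L w l o\<^sub>L y0) + (G.cp.E (a o\<^sub>L x) o\<^sub>L w l o\<^sub>L y0)"
          unfolding x0_def by (simp add: blinfun_compose_simps(1)[symmetric])
        then have "G.cp.E (a o\<^sub>L x o\<^sub>L w l o\<^sub>L y0) = G.cp.E (x0 o\<^sub>L w l o\<^sub>L y0)"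
          using E1 x0 wl y0 EN by (simp add: G.cp.expectation_add)
        moreover have "G.tr (a o\<^sub>L v l) = G.tr (G.cp.E (a o\<^sub>L x o\<^sub>L w l o\<^sub>L y0) o\<^sub>L b l)"
          using G.cp.expectation_trace_right[of "a o\<^sub>L x o\<^sub>L w l o\<^sub>L y0" "b l"] a xM wl y0 bN
          by (simp add: v_def blinfun_compose_assoc)
        ultimately have "cmod (G.tr (a o\<^sub>L v l)) \<le> norm2 G.tr (G.cp.E (x0 o\<^sub>L w l o\<^sub>L y0)) * norm2 G.tr (b l)"
          using G.cp.tr_cauchy_schwarz[of "G.cp.E (x0 o\<^sub>L w l o\<^sub>L y0)" "b l"] x0 wl y0 bN by simp
        also have "\<dots> \<le> norm2 G.tr (G.cp.E (x0 o\<^sub>L w l o\<^sub>L y0)) * (R * norm2 G.tr id_blinfun)"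
        proof (intro mult_left_mono)
          have "norm2 G.tr (b l) \<le> norm (b l) * norm2 G.tr id_blinfun" by (rule G.cp.norm2_le_norm[OF bN(2)])
          also have "\<dots> \<le> R * norm2 G.tr id_blinfun" by (intro mult_right_mono bR) auto
          finally show "norm2 G.tr (b l) \<le> R * norm2 G.tr id_blinfun" .
        qed (use x0 wl y0 in simp)
        finally show ?thesis .
      qed
      have lim': "((\<lambda>l. norm2 G.tr (G.cp.E (x0 o\<^sub>L w l o\<^sub>L y0)) * (R * norm2 G.tr id_blinfun)) \<longlongrightarrow> 0) cofinite"
        using tendsto_mult_right[OF lim, of "R * norm2 G.tr id_blinfun"] by (simp only: mult_zero_left)
      show ?thesis by (rule Lim_null_comparison[OF always_eventually lim']) (rule allI, rule bound)
    qed
    have "((\<lambda>l. \<tau>1 (id_blinfun o\<^sub>L v l)) \<longlongrightarrow> 0) cofinite"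
      by (rule G.cp.weakly_null_transfer[OF T.tracial_algebra_axioms _ vnull, where K = "norm x * norm y0 * R"])
        (use vM vn in auto)
    moreover have "\<tau>1 (id_blinfun o\<^sub>L v l) = of_real ((norm2 \<tau>' (d l))\<^sup>2)" for l
    proof -
      have wl: "w l \<in> G.M" "w l \<in> G.N" by (rule w)+
      have "\<tau>1 (b l o\<^sub>L x o\<^sub>L w l o\<^sub>L G.cp.E y) = \<tau>1 ((w l o\<^sub>L G.cp.E y o\<^sub>L b l) o\<^sub>L x)"
        using T.tr_comm[of "b l o\<^sub>L x" "w l o\<^sub>L G.cp.E y"] bN xM wl yM by (simp add: blinfun_compose_assoc)
      also have "\<dots> = 0" by (rule annihilate) (use wl EyN bN in simp)
      finally have 0: "\<tau>1 (b l o\<^sub>L x o\<^sub>L w l o\<^sub>L G.cp.E y) = 0" .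
      have "\<tau>1 (id_blinfun o\<^sub>L v l) = \<tau>1 (b l o\<^sub>L (x o\<^sub>L w l o\<^sub>L y0))"
        using T.tr_comm[of "x o\<^sub>L w l o\<^sub>L y0" "b l"] bN xM wl y0 by (simp add: v_def blinfun_compose_simps)
      also have "b l o\<^sub>L (x o\<^sub>L w l o\<^sub>L y0) = (b l o\<^sub>L x o\<^sub>L w l o\<^sub>L y) - (b l o\<^sub>L x o\<^sub>L w l o\<^sub>L G.cp.E y)"
        unfolding y0_def by (simp add: blinfun_compose_simps(4)[symmetric] blinfun_compose_assoc)
      also have "\<tau>1 \<dots> = \<tau>1 (b l o\<^sub>L x o\<^sub>L w l o\<^sub>L y)"
        using bN xM wl yM 0 by simp
      finally show ?thesis by (simp only: key)
    qed
    ultimately have "((\<lambda>l. complex_of_real ((norm2 \<tau>' (d l))\<^sup>2)) \<longlongrightarrow> 0) cofinite" by simp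
    from tendsto_Re[OF this] have "((\<lambda>l. (norm2 \<tau>' (d l))\<^sup>2) \<longlongrightarrow> 0) cofinite"
      by (simp del: of_real_power)
    then have "((\<lambda>l. sqrt ((norm2 \<tau>' (d l))\<^sup>2)) \<longlongrightarrow> sqrt 0) cofinite" by (intro tendsto_intros)
    then show ?thesis using d by (simp add: d_def)
  qed
  then show ?thesis
    using assms(2) by (auto simp: mixing_extension_def orthocomplement_in_def)
qed

end
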